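(* Let $d\ge2$. There exist, for each $e>0$, a constant $C_1=C_1(e)<\infty$ depending only on $e$, and a function $F_1\colon[0,\infty)^3\to[0,\infty)$, for which the following holds for all $e>0$ and $T>0$. Given $\pi_1,\pi_2\in\mathscr P_e$ with bounded entropy, i.e. $H_e(\pi_i|M_e)<+\infty$ for $i=1,2$, and given $\kappa\ge C_1(e)$, there exists a path $(\boldsymbol\pi,\boldsymbol Q)\in\mathscr S_{e,T}$ such that $\boldsymbol\pi_0=\pi_1$, $\boldsymbol\pi_T=\pi_2$, and $$J_{e,T}(\boldsymbol\pi,\boldsymbol Q)\le F_1(e,T,\kappa)+H_e(\pi_2|M_e),\qquad\boldsymbol Q(1)=\kappa.$$ The function $F_1$ may be chosen such that, for fixed $e,\kappa$ and for all $0<T_0<T_1<\infty$, $$\sup_{T_0\le T\le T_1}F_1(e,T,\kappa)<\infty.$$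
   Context: Fix an integer $d\ge2$; $e\in(0,\infty)$. $d\omega$ is the Haar (rotation invariant) measure on the unit sphere $\mathbb S_{d-1}\subset\mathbb R^d$. The collision kernel is $B(v-v_*,\omega)=\frac12|(v-v_* )\cdot\omega|$. Given $v,v_*\in\mathbb R^d$, $\omega\in\mathbb S_{d-1}$, the post-collisional velocities are $v'=v+(\omega\cdot(v_*-v))\omega$, $v_*'=v_*-(\omega\cdot(v_*-v))\omega$. Write $\zeta_0(v)=|v|^2/2$, $\zeta(v)=v$. $\mathscr P_e$ is the set of probability measures $\pi$ on $\mathbb R^d$ with $\pi(\zeta_0)\le e$ and $\pi(\zeta)=0$, with the weak topology. $M_e$ is the Maxwellian (centred isotropic Gaussian) on $\mathbb R^d$ with $M_e(\zeta_0)=e$. For $\pi\in\mathscr P_e$ with density $f$, $H_e(\pi|M_e)=\int f\log f\,dv+\frac d2\big(\log\frac{4\pi e}{d}+1\big)$ (where the $\pi$ inside the logarithm is the number $3.14\ldots$), and $H_e(\pi|M_e)=+\infty$ if $\pi$ has no density. For $T>0$: $D([0,T];\mathscr P_e)$ is the Skorokhod space of càdlàg paths; $\mathscr M_T$ is the set of finite measures $\boldsymbol Q$ on $[0,T]\times\mathbb R^{2d}\times\mathbb R^{2d}$ with $\boldsymbol Q(dt;dv,dv_*,dv',dv_*')=\boldsymbol Q(dt;dv_*,dv,dv',dv_*')=\boldsymbol Q(dt;dv,dv_*,dv_*',dv')$. $\mathscr S_{e,T}$ is the set of pairs $(\boldsymbol\pi,\boldsymbol Q)\in D([0,T];\mathscr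 P_e)\times\mathscr M_T$ satisfying, for every $\phi\in C^1_b([0,T]\times\mathbb R^d)$, the balance equation $$\pi_T(\phi_T)-\pi_0(\phi_0)-\int_0^T dt\,\pi_t(\partial_t\phi_t)-\int\boldsymbol Q(dt;dv,dv_*,dv',dv_*')\,\bar\nabla\phi_t(v,v_*,v',v_*')=0,$$ where in this equation $\pi_t=\boldsymbol\pi_t$ and $\bar\nabla\phi(v,v_*,v',v_*')=\phi(v')+\phi(v_*')-\phi(v)-\phi(v_* )$. Let $r(v,v_*;\cdot)$ be the measure on $\mathbb R^{2d}$ which is the image of $B(v-v_*,\omega)\,d\omega$ under $\omega\mapsto(v',v_*')$, and set $\boldsymbol Q^{\boldsymbol\pi}(dt;dv,dv_*,dv',dv_*')=\frac12dt\,\boldsymbol\pi_t(dv)\boldsymbol\pi_t(dv_* )\,r(v,v_*;dv',dv_*')$. The dynamical rate function $J_{e,T}\colon\mathscr S_{e,T}\to[0,\infty]$ is $$J_{e,T}(\boldsymbol\pi,\boldsymbol Q)=\int d\boldsymbol Q^{\boldsymbol\pi}\Big[\frac{d\boldsymbol Q}{d\boldsymbol Q^{\boldsymbol\pi}}\log\frac{d\boldsymbol Q}{d\boldsymbol Q^{\boldsymbol\pi}}-\Big(\frac{d\boldsymbol Q}{d\boldsymbol Q^{\boldsymbol\pi}}-1\Big)\Big]$$ if $\boldsymbol\pi\in C([0,T];\mathscr P_e)$ and $\boldsymbol Q\ll\boldsymbol Q^{\boldsymbol\pi}$, and $+\infty$ otherwise. $\boldsymbol Q(1)$ is the total mass of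 $\boldsymbol Q$. *)

theory Defs
  imports "HOL-Probability.Probability"
begin

section \<open>Velocity distributions\<close>

text \<open>The velocity space is \<open>real ^ 'n\<close>, so that \<open>d = CARD('n)\<close>.\<close>

definition vel_distributions :: "real \<Rightarrow> (real ^ 'n::finite) measure set" where
  "vel_distributions e = {\<pi>. prob_space \<pi> \<and> sets \<pi> = sets borel \<and>
     (\<integral>\<^sup>+v. ennreal ((norm v)\<^sup>2 / 2) \<partial>\<pi>) \<le> ennreal e \<and> (\<integral>v. v \<partial>\<pi>) = 0}"

definition weak_topology :: "real \<Rightarrow> (real ^ 'n::finite) measure topology" where
  "weak_topology e = topology_generated_by
     {{\<pi> \<in> vel_distributions e. (\<integral>v. f v \<partial>\<pi>) \<in> U} | f U.
        continuous_on UNIV f \<and> bounded (range f) \<and> open (U :: real set)}"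

text \<open>
  This is the relative entropy with respect to the Maxwellian of mean energy \<open>e\<close>, except that the
  energy of \<open>\<pi>\<close> is replaced by \<open>e\<close>.  The integral of \<open>f log f\<close> is taken as the difference of the
  integrals of its positive and negative parts; the latter is finite for \<open>\<pi>\<close> in
  \<open>vel_distributions e\<close>, while the former may be infinite.  Recall \<open>0 * ln 0 = 0\<close>.
\<close>

definition rel_entropy :: "real \<Rightarrow> (real ^ 'n::finite) measure \<Rightarrow> ereal" where
  "rel_entropy e \<pi> =
     (if absolutely_continuous lborel \<pi> then
        (let f = (\<lambda>v. enn2real (RN_deriv lborel \<pi> v)); d = real CARD('n) in
          enn2ereal (\<integral>\<^sup>+v. ennreal (f v * ln (f v)) \<partial>lborel)
          - enn2ereal (\<integral>\<^sup>+v. ennreal (- (f v * ln (f v))) \<partial>lborel)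
          + ereal (d / 2 * (ln (4 * pi * e / d) + 1)))
      else \<infinity>)"

section \<open>Collisions\<close>

text \<open>
  The Haar measure on the unit sphere is determined by rotation invariance up to a positive factor.
  No normalisation is fixed; statements are made for every such measure.
\<close>

definition sphere_haar :: "(real ^ 'n::finite) measure \<Rightarrow> bool" where
  "sphere_haar \<sigma> \<longleftrightarrow>
     sets \<sigma> = sets (restrict_space borel (sphere 0 1)) \<and> finite_measure \<sigma> \<and>
     emeasure \<sigma> (space \<sigma>) \<noteq> 0 \<and>
     (\<forall>A :: real ^ 'n ^ 'n. rotation_matrix A \<longrightarrow> distr \<sigma> \<sigma> (\<lambda>\<omega>. A *v \<omega>) = \<sigma>)"

definition cross_section :: "real ^ 'n::finite \<Rightarrow> real ^ 'n \<Rightarrow> real" where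
  "cross_section w \<omega> = \<bar>w \<bullet> \<omega>\<bar> / 2"

definition post_collision ::
    "real ^ 'n::finite \<Rightarrow> real ^ 'n \<Rightarrow> real ^ 'n \<Rightarrow> (real ^ 'n) \<times> (real ^ 'n)" where
  "post_collision v v\<^sub>s \<omega> = (v + (\<omega> \<bullet> (v\<^sub>s - v)) *\<^sub>R \<omega>, v\<^sub>s - (\<omega> \<bullet> (v\<^sub>s - v)) *\<^sub>R \<omega>)"

definition collision_kernel ::
    "(real ^ 'n::finite) measure \<Rightarrow> real ^ 'n \<Rightarrow> real ^ 'n \<Rightarrow> ((real ^ 'n) \<times> (real ^ 'n)) measure" where
  "collision_kernel \<sigma> v v\<^sub>s =
     distr (density \<sigma> (\<lambda>\<omega>. ennreal (cross_section (v - v\<^sub>s) \<omega>))) borel (post_collision v v\<^sub>s)"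

section \<open>Paths and collision measures\<close>

text \<open>Elements are \<open>(t, (v, v\<^sub>s), (v', v\<^sub>s'))\<close>.\<close>

type_synonym 'n event =
  "real \<times> ((real ^ 'n) \<times> (real ^ 'n)) \<times> ((real ^ 'n) \<times> (real ^ 'n))"

definition event_space :: "real \<Rightarrow> 'n::finite event measure" where
  "event_space T = restrict_space borel ({0..T} \<times> UNIV)"

text \<open>A path on \<open>[0,T]\<close> is a function on all of \<open>real\<close> whose values outside \<open>[0,T]\<close> are irrelevant.\<close>

definition cadlag_paths :: "real \<Rightarrow> real \<Rightarrow> (real \<Rightarrow> (real ^ 'n::finite) measure) set" where
  "cadlag_paths e T = {\<pi>.
     (\<forall>t\<in>{0..T}. \<pi> t \<in> vel_distributions e) \<and>
     (\<forall>t\<in>{0..<T}. limitin (weak_topology e) \<pi> (\<pi> t) (at_right t)) \<and>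
     (\<forall>t\<in>{0<..T}. \<exists>l. limitin (weak_topology e) \<pi> l (at_left t))}"

definition continuous_paths :: "real \<Rightarrow> real \<Rightarrow> (real \<Rightarrow> (real ^ 'n::finite) measure) set" where
  "continuous_paths e T = {\<pi>. continuous_map (top_of_set {0..T}) (weak_topology e) \<pi>}"

definition collision_measures :: "real \<Rightarrow> 'n::finite event measure set" where
  "collision_measures T = {Q. finite_measure Q \<and> sets Q = sets (event_space T) \<and>
     distr Q Q (\<lambda>(t, (v, v\<^sub>s), p). (t, (v\<^sub>s, v), p)) = Q \<and>
     distr Q Q (\<lambda>(t, p, (v', v\<^sub>s')). (t, p, (v\<^sub>s', v'))) = Q}"

text \<open>Derivatives at \<open>t = 0\<close> and \<open>t = T\<close> are one-sided in time.\<close>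

definition C1b :: "real \<Rightarrow> (real \<times> (real ^ 'n::finite) \<Rightarrow> real) set" where
  "C1b T = {\<phi>. bounded (\<phi> ` ({0..T} \<times> UNIV)) \<and>
     (\<exists>D :: real \<times> (real ^ 'n) \<Rightarrow> (real \<times> (real ^ 'n)) \<Rightarrow>\<^sub>L real.
        (\<forall>p \<in> {0..T} \<times> UNIV. (\<phi> has_derivative blinfun_apply (D p)) (at p within {0..T} \<times> UNIV)) \<and>
        continuous_on ({0..T} \<times> UNIV) D \<and> bounded (D ` ({0..T} \<times> UNIV)))}"

definition time_deriv ::
    "real \<Rightarrow> (real \<times> (real ^ 'n::finite) \<Rightarrow> real) \<Rightarrow> real \<Rightarrow> real ^ 'n \<Rightarrow> real" where
  "time_deriv T \<phi> t v = vector_derivative (\<lambda>s. \<phi> (s, v)) (at t within {0..T})"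

definition collision_gradient ::
    "(real ^ 'n::finite \<Rightarrow> real) \<Rightarrow> (real ^ 'n) \<times> (real ^ 'n) \<Rightarrow> (real ^ 'n) \<times> (real ^ 'n) \<Rightarrow> real" where
  "collision_gradient \<phi> = (\<lambda>(v, v\<^sub>s) (v', v\<^sub>s'). \<phi> v' + \<phi> v\<^sub>s' - \<phi> v - \<phi> v\<^sub>s)"

definition balanced_pairs ::
    "real \<Rightarrow> real \<Rightarrow> ((real \<Rightarrow> (real ^ 'n::finite) measure) \<times> 'n event measure) set" where
  "balanced_pairs e T = {(\<pi>, Q). \<pi> \<in> cadlag_paths e T \<and> Q \<in> collision_measures T \<and>
     (\<forall>\<phi> \<in> C1b T.
        (\<integral>v. \<phi> (T, v) \<partial>\<pi> T) - (\<integral>v. \<phi> (0, v) \<partial>\<pi> 0)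
        - (LINT t:{0..T}|lborel. (\<integral>v. time_deriv T \<phi> t v \<partial>\<pi> t))
        - (\<integral>(t, p, p'). collision_gradient (\<lambda>v. \<phi> (t, v)) p p' \<partial>Q) = 0)}"

section \<open>The dynamical rate function\<close>

text \<open>
  The measure \<open>(1/2) dt \<pi>\<^sub>t(dv) \<pi>\<^sub>t(dv\<^sub>s) r(v,v\<^sub>s;dv',dv\<^sub>s')\<close>, given through its values on measurable sets as
  an iterated integral.  For cadlag \<open>\<pi>\<close> the integrands are measurable, so this set function is
  countably additive and \<open>measure_of\<close> does not fall back to the zero measure.
\<close>

definition typical_collisions ::
    "(real ^ 'n::finite) measure \<Rightarrow> real \<Rightarrow> (real \<Rightarrow> (real ^ 'n) measure) \<Rightarrow> 'n event measure" where
  "typical_collisions \<sigma> T \<pi> =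
     measure_of (space (event_space T :: 'n event measure)) (sets (event_space T))
       (\<lambda>A. \<integral>\<^sup>+t\<in>{0..T}. (\<integral>\<^sup>+v. (\<integral>\<^sup>+v\<^sub>s.
          emeasure (collision_kernel \<sigma> v v\<^sub>s) {p'. (t, (v, v\<^sub>s), p') \<in> A} / 2 \<partial>\<pi> t) \<partial>\<pi> t) \<partial>lborel)"

definition rate_function ::
    "(real ^ 'n::finite) measure \<Rightarrow> real \<Rightarrow> real \<Rightarrow>
       (real \<Rightarrow> (real ^ 'n) measure) \<Rightarrow> 'n event measure \<Rightarrow> ennreal" where
  "rate_function \<sigma> e T \<pi> Q =
     (let Q\<pi> = typical_collisions \<sigma> T \<pi>; \<rho> = (\<lambda>x. enn2real (RN_deriv Q\<pi> Q x)) in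
      if \<pi> \<in> continuous_paths e T \<and> absolutely_continuous Q\<pi> Q
      then \<integral>\<^sup>+x. ennreal (\<rho> x * ln (\<rho> x) - (\<rho> x - 1)) \<partial>Q\<pi>
      else \<infinity>)"

end

theory Submission imports Defs begin

text \<open>
 Let \<open>N\<close> be a bounded density with power tails and energy at most \<open>e\<close>.  Any velocity density \<open>f\<close> with
 energy at most \<open>e\<close> is carried to \<open>N\<close> by a static collision measure: collide the particles at velocity
 \<open>v\<close> with ghost partners, so that \<open>(v, v + R(a + b))\<close> goes to \<open>(v + R a, v + R b)\<close>, where \<open>(a, b)\<close> is a Gaussian
 pair weighted on orthogonal vectors.  One such step replaces \<open>f - N\<close> by a convolution-type average
 \<open>T\<^sub>R (f - N)\<close>; the ghost partners are compensated within the step.  Iterating at scales \<open>R = \<Lambda>\<^sup>k\<close> the error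
 decays geometrically because it has zero mass, and the sum of all steps is a collision measure
 whose density is, up to a bounded multiple of the collision rate, linear in \<open>f\<close>.

 The path is the polynomial interpolation \<open>\<pi>\<^sub>t = a f\<^sub>1 + b f\<^sub>2 + c N\<close> with \<open>a + b + c = 1\<close>, driven by the static
 measure of \<open>f\<^sub>1\<close> at rate \<open>- a'\<close> and the time reversal of that of \<open>f\<^sub>2\<close> at rate \<open>b'\<close>; the exponents are chosen such
 that the rates are dominated by powers of \<open>a, b, c\<close> and the logarithms are integrable in time.  A
 balanced waste measure, the static measure of \<open>N\<close> itself, adjusts the total mass to \<open>\<kappa>\<close>.  In the cost the
 outgoing density \<open>f\<^sub>2\<close> enters only through \<open>x ln x\<close>, and convexity yields exactly its entropy.
\<close>

text \<open>The obstacle: the reference collision rate is quadratic in the current density, while f1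
  and f2 have finite entropy only and may vanish on large sets. The reservoir N, present at all
  intermediate times, supplies the partner. A flux linear in f1 is compared with the part f1 * N of
  the reference rate, so f1 cancels in the logarithm and no entropy of the initial state enters the
  bound. Power tails make - ln N grow logarithmically: partners at distance \<Lambda> ^ k cost a
  multiple of k, which the halving of the error at every scale outweighs. The weight of the Gaussian
  pair is |a| |b|. Orthogonal pairs under delta (a . b) da db give the leg a the density 1 / |a|, so
  these factors make each leg exactly Gaussian; they also keep the weight below a multiple of the
  collision rate, which is |a|. The kernel of a step, two legs minus the ghost partner, has mass one
  but is signed. Densities of collisions must be nonnegative, so the positive part of the error is
  processed forward in time and the negative part backward.\<close>

abbreviation (input) lebesgue_integral_nn :: "('a::euclidean_space \<Rightarrow> ennreal) \<Rightarrow> ennreal" (binder "LI " 10) where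
 "lebesgue_integral_nn f \<equiv> nn_integral lborel f"
abbreviation (input) lebesgue_integral_ennreal :: "('a::euclidean_space \<Rightarrow> real) \<Rightarrow> ennreal" (binder "LE " 10) where
 "lebesgue_integral_ennreal f \<equiv> nn_integral lborel (\<lambda>x. ennreal (f x))"
abbreviation (input) lebesgue_integral_real :: "('a::euclidean_space \<Rightarrow> 'b::{banach,second_countable_topology}) \<Rightarrow> 'b" (binder "BI " 10) where
 "lebesgue_integral_real f \<equiv> integral\<^sup>L lborel f"
abbreviation (input) borel_funs :: "('a::topological_space \<Rightarrow> 'b::topological_space) set" where
 "borel_funs \<equiv> borel_measurable borel"

type_synonym 'n vels = "(real ^ 'n) \<times> (real ^ 'n)"

section \<open>Lebesgue measure and collisions\<close>

lemma nn_integral_lborel_translate: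
 fixes f :: "'a::euclidean_space \<Rightarrow> ennreal"
 assumes [measurable]: "f \<in> borel_funs"
 shows "(LI x. f (t + x)) = (LI x. f x)"
proof -
 have "(LI x. f x) = (\<integral>\<^sup>+x. f x \<partial>distr lborel borel ((+) t))"
  by (simp add: lborel_distr_plus)
 also have "... = (LI x. f (t + x))"
  by (subst nn_integral_distr) auto
 finally show ?thesis by simp
qed

lemma nn_integral_lborel_scale:
 fixes f :: "'a::euclidean_space \<Rightarrow> ennreal"
 assumes [measurable]: "f \<in> borel_funs" and c: "c \<noteq> 0"
 shows "(LI x. f x) = ennreal (\<bar>c\<bar> ^ DIM('a)) * (LI x. f (c *\<^sub>R x))"
 by (subst lborel_affine[OF c, of 0])
  (simp add: nn_integral_density nn_integral_distr nn_integral_cmult ennreal_power)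

lemma nn_integral_lborel_uminus:
 fixes f :: "'a::euclidean_space \<Rightarrow> ennreal"
 assumes "f \<in> borel_funs"
 shows "(LI x. f (- x)) = (LI x. f x)"
 using nn_integral_lborel_scale[OF assms, of "-1"] by simp

lemma emeasure_lborel_ball_pos:
 fixes c :: "'a::euclidean_space"
 assumes "0 < r"
 shows "0 < emeasure lborel (ball c r)"
 using content_ball_pos[OF assms, of c] emeasure_lborel_ball_finite[of c r]
 by (simp add: measure_def enn2real_positive_iff)

lemma ennreal_mult_right_cancel:
 fixes a b c :: ennreal
 assumes "a * c = b * c" "c \<noteq> 0" "c \<noteq> top"
 shows "a = b"
proof -
 have "a * c / c = b * c / c" using assms(1) by simp
 then show ?thesis using assms(2,3) by (simp add: ennreal_mult_divide_eq)
qed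

lemma nn_integral_swap:
 assumes "sigma_finite_measure M" "sigma_finite_measure N"
  and "(\<lambda>(x, y). F x y) \<in> borel_measurable (M \<Otimes>\<^sub>M N)"
 shows "(\<integral>\<^sup>+x. \<integral>\<^sup>+y. F x y \<partial>N \<partial>M) = (\<integral>\<^sup>+y. \<integral>\<^sup>+x. F x y \<partial>M \<partial>N)"
proof -
 interpret pair_sigma_finite M N using assms by (simp add: pair_sigma_finite_def)
 show ?thesis using Fubini'[OF assms(3)] by simp
qed

lemmas nn_integral_lborel_swap = nn_integral_swap[OF sigma_finite_lborel sigma_finite_lborel]

text \<open>Comparing the image measure with Lebesgue measure by convolving with the unit ball, which is
 invariant; this is the uniqueness proof for Haar measure.\<close>

lemma nn_integral_lborel_orthogonal:
 fixes f :: "'a::euclidean_space \<Rightarrow> 'a"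
 assumes f: "orthogonal_transformation f" and [measurable]: "F \<in> borel_funs"
 shows "(LI x. F (f x)) = (LI x. F x)"
proof -
 have lf: "linear f" using f by (rule orthogonal_transformation_linear)
 have [measurable]: "f \<in> borel_funs"
  using lf by (simp add: borel_measurable_continuous_onI linear_continuous_on linear_conv_bounded_linear)
 obtain g where g: "\<And>x. f (g x) = x"
  using f by (metis bij_inv_eq_iff orthogonal_transformation_bij)
 define B :: "'a \<Rightarrow> ennreal" where "B = indicator (ball 0 1)"
 have [measurable]: "B \<in> borel_funs" unfolding B_def by (intro borel_measurable_indicator) simp
 have Bm: "B (- x) = B x" and Bf: "B (f x) = B x" for x
  using f by (auto simp: B_def indicator_def orthogonal_transformation_norm)
 have V: "(LI y. B y) = emeasure lborel (ball (0::'a) 1)" by (simp add: B_def)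
 have "(LI x. F (f x)) * (LI y. B y) = (LI x. (LI y. F (f x) * B y))"
  by (simp add: nn_integral_cmult nn_integral_multc)
 also have "... = (LI x. (LI y. F (f x) * B (- f x + y)))"
 proof (rule nn_integral_cong)
  fix x
  show "(LI y. F (f x) * B y) = (LI y. F (f x) * B (- f x + y))"
   by (rule nn_integral_lborel_translate[of "\<lambda>y. F (f x) * B y", symmetric]) simp
 qed
 also have "... = (LI y. (LI x. F (f x) * B (- f x + y)))"
  by (rule nn_integral_lborel_swap) simp
 also have "... = (LI y. (LI x. F (f x + y) * B (f x)))"
 proof (rule nn_integral_cong)
  fix y
  show "(LI x. F (f x) * B (- f x + y)) = (LI x. F (f x + y) * B (f x))"
   using nn_integral_lborel_translate[of "\<lambda>x. F (f x) * B (- f x + y)" "g y"]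
   by (simp add: linear_add[OF lf] g add.commute Bm)
 qed
 also have "... = (LI x. (LI y. F (f x + y) * B (f x)))"
  by (rule nn_integral_lborel_swap) simp
 also have "... = (LI x. F x) * (LI y. B y)"
  by (simp add: nn_integral_multc nn_integral_cmult nn_integral_lborel_translate Bf)
 finally have "(LI x. F (f x)) * emeasure lborel (ball (0::'a) 1)
   = (LI x. F x) * emeasure lborel (ball (0::'a) 1)" unfolding V .
 moreover have "emeasure lborel (ball (0::'a) 1) \<noteq> 0"
  using emeasure_lborel_ball_pos[of 1 "0::'a"] by (metis less_irrefl zero_less_one)
 moreover have "emeasure lborel (ball (0::'a) 1) \<noteq> top"
  using emeasure_lborel_ball_finite[of "0::'a" 1] by (metis infinity_ennreal_def less_irrefl)
 ultimately show ?thesis by (rule ennreal_mult_right_cancel)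
qed

text \<open>Exchanging the component of \<open>z\<close> along \<open>w\<close> with an independent real variable replaces a
 decomposition of Lebesgue measure along the line spanned by \<open>w\<close> and its orthogonal complement.\<close>

lemma nn_integral_exchange_component:
 fixes F :: "real \<times> 'a::euclidean_space \<Rightarrow> ennreal"
 assumes [measurable]: "F \<in> borel_funs" and w: "norm w = 1"
 shows "(LI z. (LI r. F (w \<bullet> z, z - (w \<bullet> z) *\<^sub>R w + r *\<^sub>R w)))
   = (LI z. (LI r. F (r, z)))"
proof -
 have ww: "w \<bullet> w = 1" using w by (simp add: norm_eq_1)
 have [measurable]: "F \<in> borel_measurable (borel \<Otimes>\<^sub>M borel)" by (simp add: borel_prod)
 have "(LI z. (LI r. F (w \<bullet> z, z - (w \<bullet> z) *\<^sub>R w + r *\<^sub>R w)))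
   = (LI z. (LI r. F (w \<bullet> z, z + r *\<^sub>R w)))"
 proof (rule nn_integral_cong)
  fix z
  show "(LI r. F (w \<bullet> z, z - (w \<bullet> z) *\<^sub>R w + r *\<^sub>R w)) = (LI r. F (w \<bullet> z, z + r *\<^sub>R w))"
   using nn_integral_lborel_translate[of "\<lambda>r. F (w \<bullet> z, z + r *\<^sub>R w)" "- (w \<bullet> z)"]
   by (simp add: algebra_simps)
 qed
 also have "... = (LI r. (LI z. F (w \<bullet> z, z + r *\<^sub>R w)))"
  by (rule nn_integral_lborel_swap) simp
 also have "... = (LI r. (LI z. F (w \<bullet> z - r, z)))"
 proof (rule nn_integral_cong)
  fix r
  show "(LI z. F (w \<bullet> z, z + r *\<^sub>R w)) = (LI z. F (w \<bullet> z - r, z))"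
   using nn_integral_lborel_translate[of "\<lambda>z. F (w \<bullet> z - r, z)" "r *\<^sub>R w"]
   by (simp add: inner_add_right ww add.commute)
 qed
 also have "... = (LI z. (LI r. F (w \<bullet> z - r, z)))"
  by (rule nn_integral_lborel_swap) simp
 also have "... = (LI z. (LI r. F (r, z)))"
 proof (rule nn_integral_cong)
  fix z
  show "(LI r. F (w \<bullet> z - r, z)) = (LI r. F (r, z))"
   using nn_integral_real_affine[of "\<lambda>r. F (r, z)" "-1" "w \<bullet> z"] by simp
 qed
 finally show ?thesis .
qed

lemma orthogonal_transformation_reflect:
 fixes w :: "'a::euclidean_space"
 assumes w: "norm w = 1"
 shows "orthogonal_transformation (\<lambda>z. z - (2 * (w \<bullet> z)) *\<^sub>R w)"
proof -
 have ww: "w \<bullet> w = 1" using w by (simp add: norm_eq_1)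
 show ?thesis unfolding orthogonal_transformation_def
  by (auto intro!: linearI simp: algebra_simps inner_commute ww)
qed

text \<open>In the variables v and z = u - v a collision shifts v by (w . z) w and reflects the
  relative velocity z in the hyperplane orthogonal to w. Both maps preserve Lebesgue
  measure.\<close>

lemma nn_integral_post_collision:
 fixes F :: "(real ^ 'n::finite) \<times> (real ^ 'n) \<Rightarrow> ennreal"
 assumes [measurable]: "F \<in> borel_funs" and w: "norm w = 1"
 shows "(LI v. (LI u. F (post_collision v u w))) = (LI v. (LI u. F (v, u)))"
proof -
 have ww: "w \<bullet> w = 1" using w by (simp add: norm_eq_1)
 have [measurable]: "F \<in> borel_measurable (borel \<Otimes>\<^sub>M borel)" by (simp add: borel_prod)
 have "(LI v. (LI u. F (post_collision v u w)))
   = (LI v. (LI z. F (v + (w \<bullet> z) *\<^sub>R w, v + z - (w \<bullet> z) *\<^sub>R w)))"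
 proof (rule nn_integral_cong)
  fix v
  show "(LI u. F (post_collision v u w)) = (LI z. F (v + (w \<bullet> z) *\<^sub>R w, v + z - (w \<bullet> z) *\<^sub>R w))"
   using nn_integral_lborel_translate[of "\<lambda>u. F (post_collision v u w)" v]
   by (simp add: post_collision_def)
 qed
 also have "... = (LI z. (LI v. F (v + (w \<bullet> z) *\<^sub>R w, v + z - (w \<bullet> z) *\<^sub>R w)))"
  by (rule nn_integral_lborel_swap) simp
 also have "... = (LI z. (LI v. F (v, v + (z - (2 * (w \<bullet> z)) *\<^sub>R w))))"
 proof (rule nn_integral_cong)
  fix z
  show "(LI v. F (v + (w \<bullet> z) *\<^sub>R w, v + z - (w \<bullet> z) *\<^sub>R w)) = (LI v. F (v, v + (z - (2 * (w \<bullet> z)) *\<^sub>R w)))"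
  proof -
   have e: "(w \<bullet> z) *\<^sub>R w + v + (z - (2 * (w \<bullet> z)) *\<^sub>R w) = v + z - (w \<bullet> z) *\<^sub>R w" for v
    unfolding mult_2 scaleR_left_distrib by (simp only: diff_diff_eq[symmetric] add_diff_eq) simp
   have "(LI v. F (v + (w \<bullet> z) *\<^sub>R w, v + z - (w \<bullet> z) *\<^sub>R w)) = (LI v. F ((w \<bullet> z) *\<^sub>R w + v, (w \<bullet> z) *\<^sub>R w + v + (z - (2 * (w \<bullet> z)) *\<^sub>R w)))"
    unfolding e by (simp only: add.commute)
   also have "... = (LI v. F (v, v + (z - (2 * (w \<bullet> z)) *\<^sub>R w)))"
    by (rule nn_integral_lborel_translate[where f="\<lambda>v. F (v, v + (z - (2 * (w \<bullet> z)) *\<^sub>R w))"]) simp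
   finally show ?thesis .
  qed
 qed
 also have "... = (LI v. (LI z. F (v, v + (z - (2 * (w \<bullet> z)) *\<^sub>R w))))"
  by (rule nn_integral_lborel_swap) simp
 also have "... = (LI v. (LI z. F (v, v + z)))"
  by (intro nn_integral_cong nn_integral_lborel_orthogonal[OF orthogonal_transformation_reflect[OF w], where F="\<lambda>z. F (_, _ + z)"]) simp
 also have "... = (LI v. (LI u. F (v, u)))"
  by (intro nn_integral_cong nn_integral_lborel_translate[where f="\<lambda>z. F (_, z)"]) simp
 finally show ?thesis .
qed

text \<open>The invariant measure is carried over to a Borel measure on the whole space that is
  concentrated on the sphere. Measurability is then always with respect to \<open>borel\<close>, and
  the restriction to unit vectors becomes an almost-everywhere statement.\<close>

locale haar_sphere =
 fixes s :: "(real ^ 'n::finite) measure"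
 assumes card2: "2 \<le> CARD('n)"
  and sets_s[measurable_cong, simp]: "sets s = sets borel"
  and finite_s: "emeasure s UNIV < \<infinity>"
  and pos_s: "emeasure s UNIV \<noteq> 0"
  and sphere_s: "AE w in s. norm w = 1"
  and rot_s: "\<And>A :: real ^ 'n ^ 'n. rotation_matrix A \<Longrightarrow> distr s borel (\<lambda>w. A *v w) = s"
begin

text \<open>The exponent d - 2 is the one that makes the two orthogonal parts of z exchangeable: if
  a is the part of z along w and b the rest, polar coordinates turn this weight times dw dz into a
  constant times delta (a . b) da db.\<close>

abbreviation (input) jac :: "real ^ 'n \<Rightarrow> real ^ 'n \<Rightarrow> real" where "jac x y \<equiv> \<bar>x \<bullet> y\<bar> ^ (CARD('n) - 2)"
abbreviation (input) sphere_integral :: "(real ^ 'n \<Rightarrow> ennreal) \<Rightarrow> ennreal" (binder "SI " 10) where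
 "sphere_integral f \<equiv> nn_integral s f"

lemma space_s[simp]: "space s = UNIV"
 using sets_eq_imp_space_eq[OF sets_s] by simp

sublocale s: finite_measure s
 by standard (use finite_s in simp)

sublocale sl: pair_sigma_finite s "lborel :: (real ^ 'n) measure" ..
sublocale sr: pair_sigma_finite s "lborel :: real measure" ..

lemma nn_integral_s_rot:
 assumes A: "rotation_matrix A" and [measurable]: "f \<in> borel_funs"
 shows "(SI w. f (A *v w)) = (SI w. f w)"
proof -
 have [measurable]: "(\<lambda>w. A *v w) \<in> borel_funs"
  by (intro borel_measurable_continuous_onI matrix_vector_mult_linear_continuous_on)
 have "(SI w. f w) = (\<integral>\<^sup>+w. f w \<partial>distr s borel (\<lambda>w. A *v w))"
  by (simp add: rot_s[OF A])
 also have "... = (SI w. f (A *v w))" by (subst nn_integral_distr) auto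
 finally show ?thesis by simp
qed

text \<open>The invariance of s is assumed for proper rotations, determinant one. They act
  transitively on spheres from dimension two on, which is where \<open>card2\<close> enters.\<close>

lemma rotation_to:
 fixes x y :: "real ^ 'n"
 assumes "norm x = norm y"
 obtains A where "rotation_matrix A" "A *v x = y" "orthogonal_transformation (\<lambda>z. A *v z)"
proof -
 obtain f where f: "orthogonal_transformation f" "det (matrix f) = 1" "f x = y"
  using rotation_exists[OF card2 assms] by blast
 have "rotation_matrix (matrix f)"
  using f by (simp add: rotation_matrix_def orthogonal_transformation_matrix)
 moreover have "matrix f *v z = f z" for z
  using f(1) by (simp add: matrix_works orthogonal_transformation_linear)
 ultimately show thesis using that f by (metis (no_types, lifting) ext)
qed

lemma nn_integral_s_inner:
 fixes x y :: "real ^ 'n"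
 assumes [measurable]: "f \<in> borel_funs" and "norm x = norm y"
 shows "(SI w. f (w \<bullet> x)) = (SI w. f (w \<bullet> y))"
proof -
 obtain A where A: "rotation_matrix A" "A *v x = y" "orthogonal_transformation (\<lambda>z. A *v z)"
  using rotation_to[OF assms(2)] .
 have "(SI w. f (w \<bullet> y)) = (SI w. f ((A *v w) \<bullet> y))"
  by (subst nn_integral_s_rot[OF A(1), of "\<lambda>w. f (w \<bullet> y)"]) auto
 also have "... = (SI w. f (w \<bullet> x))"
  using A(2,3) by (metis orthogonal_transformation_def)
 finally show ?thesis by simp
qed

end

lemma measurable_fst_borel[measurable]:
 "fst \<in> borel_measurable (borel :: ('a::topological_space \<times> 'b::topological_space) measure)"
 by (intro borel_measurable_continuous_onI continuous_intros)

lemma measurable_snd_borel[measurable]: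
 "snd \<in> borel_measurable (borel :: ('a::topological_space \<times> 'b::topological_space) measure)"
 by (intro borel_measurable_continuous_onI continuous_intros)

section \<open>Polar decomposition by an arbitrary rotation invariant measure\<close>

definition near :: "real \<Rightarrow> 'a::metric_space \<Rightarrow> 'a \<Rightarrow> ennreal" where
 "near \<rho> x y = (if dist x y < \<rho> then 1 else 0)"

lemma near_measurable[measurable]:
 fixes f g :: "'b \<Rightarrow> 'a::{second_countable_topology, metric_space}"
 assumes [measurable]: "f \<in> borel_measurable M" "g \<in> borel_measurable M"
 shows "(\<lambda>x. near \<rho> (f x) (g x)) \<in> borel_measurable M"
 unfolding near_def by measurable

lemma nn_integral_near:
 fixes x :: "'a::euclidean_space"
 shows "(LI y. near \<rho> x y) = emeasure lborel (ball (0::'a) \<rho>)"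
proof -
 have "(LI y. near \<rho> x y) = (LI y. near \<rho> x (x + y))"
  by (rule nn_integral_lborel_translate[symmetric, of "\<lambda>y. near \<rho> x y"]) simp
 also have "(\<lambda>y. near \<rho> x (x + y)) = indicator (ball 0 \<rho>)"
  by (auto simp: near_def indicator_def dist_norm fun_eq_iff)
 finally show ?thesis by simp
qed

context haar_sphere begin

definition dir_measure :: "('n vels) measure" where
 "dir_measure = s \<Otimes>\<^sub>M lborel"

lemma sets_dir_measure[simp, measurable_cong]: "sets dir_measure = sets borel"
proof -
 have "sets dir_measure = sets (borel \<Otimes>\<^sub>M (borel :: (real ^ 'n) measure))"
  unfolding dir_measure_def by (rule sets_pair_measure_cong) simp_all
 then show ?thesis by (simp only: borel_prod)
qed

lemma sigma_finite_dir: "sigma_finite_measure dir_measure"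
 unfolding dir_measure_def by (rule sigma_finite_pair_measure) unfold_locales

lemma nn_integral_dir:
 assumes [measurable]: "G \<in> borel_funs"
 shows "(\<integral>\<^sup>+p. G p \<partial>dir_measure) = (SI w. (LI y. G (w, y)))"
proof -
 have "G \<in> borel_measurable (s \<Otimes>\<^sub>M lborel)"
  using assms sets_dir_measure measurable_cong_sets unfolding dir_measure_def by blast
 then show ?thesis unfolding dir_measure_def by (simp add: lborel.nn_integral_fst)
qed

lemma AE_dir: "AE p in dir_measure. norm (fst p) = 1"
 unfolding dir_measure_def
proof (rule sl.AE_pair_measure)
 have "{p \<in> space dir_measure. norm (fst p) = 1} \<in> sets dir_measure" by measurable
 then show "{p \<in> space (s \<Otimes>\<^sub>M lborel). norm (fst p) = 1} \<in> sets (s \<Otimes>\<^sub>M (lborel :: (real ^ 'n) measure))"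
  by (simp only: dir_measure_def)
qed (use sphere_s in auto)

text \<open>The direction is drawn from s and the length from Lebesgue measure. That the image is
  again a multiple of Lebesgue measure, shown in \<open>distr_radial\<close>, is the polar
  decomposition with nothing known of s beyond its invariance.\<close>

definition radial :: "'n vels \<Rightarrow> real ^ 'n" where
 "radial p = norm (snd p) *\<^sub>R fst p"

lemma radial_measurable[measurable]: "radial \<in> borel_funs"
 unfolding radial_def by (intro borel_measurable_continuous_onI continuous_intros)

definition rad_ball :: "real \<Rightarrow> real ^ 'n \<Rightarrow> ennreal" where
 "rad_ball \<rho> x = (\<integral>\<^sup>+p. near \<rho> x (radial p) \<partial>dir_measure)"

lemma rad_ball_measurable[measurable]: "rad_ball \<rho> \<in> borel_funs"
 unfolding rad_ball_def
 by (rule sigma_finite_measure.borel_measurable_nn_integral[OF sigma_finite_dir]) measurable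

lemma rad_ball_rotation:
 assumes "norm x = norm y"
 shows "rad_ball \<rho> x = rad_ball \<rho> y"
proof -
 obtain A where A: "rotation_matrix A" "A *v x = y" "orthogonal_transformation (\<lambda>z. A *v z)"
  using rotation_to[OF assms] .
 have *: "rad_ball \<rho> z = (SI w. (LI (u :: real ^ 'n). near \<rho> z (norm u *\<^sub>R w)))" for z
  unfolding rad_ball_def by (subst nn_integral_dir) (simp_all add: radial_def)
 have "rad_ball \<rho> y = (SI w. (LI (u :: real ^ 'n). near \<rho> y (norm u *\<^sub>R (A *v w))))"
  unfolding * by (rule nn_integral_s_rot[OF A(1), symmetric]) measurable
 also have "... = rad_ball \<rho> x"
 proof -
  have "dist y (norm u *\<^sub>R (A *v w)) = dist x (norm u *\<^sub>R w)" for u :: "real ^ 'n" and w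
  proof -
   have "dist y (norm u *\<^sub>R (A *v w)) = norm (A *v (x - norm u *\<^sub>R w))"
    by (simp add: dist_norm A(2)[symmetric] matrix_vector_mult_diff_distrib matrix_vector_mult_scaleR)
   then show ?thesis using A(3) by (simp add: dist_norm orthogonal_transformation_norm)
  qed
  then show ?thesis unfolding * near_def by simp
 qed
 finally show ?thesis by simp
qed

lemma norm_ball_integral_rotation:
 fixes w w' :: "real ^ 'n"
 assumes "norm w = norm w'" and [measurable]: "p \<in> borel_funs"
 shows "(LI x. p (norm x) * near \<rho> x w)
   = (LI x. p (norm x) * near \<rho> x w')"
proof -
 obtain A where A: "rotation_matrix A" "A *v w = w'" "orthogonal_transformation (\<lambda>z. A *v z)"
  using rotation_to[OF assms(1)] .
 have "dist (A *v x) w' = dist x w" for x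
 proof -
  have "dist (A *v x) w' = norm (A *v (x - w))"
   by (simp add: dist_norm A(2)[symmetric] matrix_vector_mult_diff_distrib)
  then show ?thesis using A(3) by (simp add: dist_norm orthogonal_transformation_norm)
 qed
 moreover have "norm (A *v x) = norm x" for x
  using A(3) by (simp add: orthogonal_transformation_norm)
 moreover have "(LI x. p (norm (A *v x)) * near \<rho> (A *v x) w')
  = (LI x. p (norm x) * near \<rho> x w')"
  by (rule nn_integral_lborel_orthogonal[OF A(3)]) measurable
 ultimately show ?thesis by (simp add: near_def)
qed

text \<open>Against a radial weight every direction can be rotated onto that of the second
  component, after which only the total mass of s is left. As \<open>rad_ball\<close> is itself
  radial, its averages against radial weights determine it almost everywhere.\<close>

lemma rad_ball_radial_average:
 assumes [measurable]: "p \<in> borel_funs"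
 shows "(LI x. p (norm x) * rad_ball \<rho> x)
  = emeasure s UNIV * emeasure lborel (ball (0::real ^ 'n) \<rho>) * (LI x. p (norm (x :: real ^ 'n)))"
proof -
 have "(LI x. p (norm x) * rad_ball \<rho> x) = (LI x. \<integral>\<^sup>+q. p (norm (x :: real ^ 'n)) * near \<rho> x (radial q) \<partial>dir_measure)"
  unfolding rad_ball_def
  by (intro nn_integral_cong, subst nn_integral_cmult) auto
 also have "... = (\<integral>\<^sup>+q. (LI x. p (norm (x :: real ^ 'n)) * near \<rho> x (radial q)) \<partial>dir_measure)"
  by (rule nn_integral_swap[OF sigma_finite_lborel sigma_finite_dir]) measurable
 also have "... = (\<integral>\<^sup>+q. (LI x. p (norm (x :: real ^ 'n)) * near \<rho> x (snd q)) \<partial>dir_measure)"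
  using AE_dir by (intro nn_integral_cong_AE) (auto simp: radial_def intro!: norm_ball_integral_rotation)
 also have "... = (SI w. (LI y. (LI x. p (norm (x :: real ^ 'n)) * near \<rho> x y)))"
  by (subst nn_integral_dir) simp_all
 also have "... = emeasure s UNIV * (LI y. (LI x. p (norm (x :: real ^ 'n)) * near \<rho> x y))"
  by (simp add: mult.commute)
 also have "(LI y. (LI x. p (norm (x :: real ^ 'n)) * near \<rho> x y)) = (LI x. (LI y. p (norm (x :: real ^ 'n)) * near \<rho> x y))"
  by (rule nn_integral_lborel_swap) measurable
 also have "... = (LI x. p (norm (x :: real ^ 'n)) * emeasure lborel (ball (0::real ^ 'n) \<rho>))"
 proof (rule nn_integral_cong)
  fix x
  have "(LI y. p (norm (x :: real ^ 'n)) * near \<rho> x y) = p (norm x) * (LI y. near \<rho> x y)"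
   by (subst nn_integral_cmult[symmetric]) auto
  then show "(LI y. p (norm (x :: real ^ 'n)) * near \<rho> x y) = p (norm x) * emeasure lborel (ball (0::real ^ 'n) \<rho>)"
   by (simp add: nn_integral_near)
 qed
 finally show ?thesis by (simp add: nn_integral_multc mult_ac)
qed

text \<open>The set where \<open>rad_ball\<close> exceeds the constant is invariant under rotations.
  Its indicator is therefore an admissible radial weight in \<open>rad_ball_radial_average\<close>,
  and the integral of the excess vanishes.\<close>

lemma rad_ball_le:
 "AE x in lborel. rad_ball \<rho> x \<le> emeasure s UNIV * emeasure lborel (ball (0::real ^ 'n) \<rho>)"
proof -
 define c where "c = emeasure s UNIV * emeasure lborel (ball (0::real ^ 'n) \<rho>)"
 have c: "c < top" using finite_s emeasure_lborel_ball_finite[of "0::real ^ 'n" \<rho>] by (simp add: c_def ennreal_mult_less_top)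
 obtain e :: "real ^ 'n" where e: "norm e = 1" using vector_choose_size[of 1] by auto
 have "AE x in lborel. norm x < real M \<longrightarrow> rad_ball \<rho> x \<le> c" for M :: nat
 proof -
  \<comment> \<open>The excess set is read off along the ray through e, which makes p a function of
    the norm. The cut at M keeps both integrals finite, so that they can be subtracted.\<close>
  define p :: "real \<Rightarrow> ennreal" where "p = indicator {r. \<bar>r\<bar> < real M \<and> rad_ball \<rho> (r *\<^sub>R e) > c}"
  have [measurable]: "p \<in> borel_funs" unfolding p_def by (intro borel_measurable_indicator) measurable
  have pn: "p (norm x) = indicator {x. norm x < M \<and> rad_ball \<rho> x > c} x" for x
   using rad_ball_rotation[of "norm x *\<^sub>R e" x] e by (auto simp: p_def indicator_def)
  have fin: "(LI x. p (norm (x :: real ^ 'n))) < top"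
  proof -
   have "(LI x. p (norm (x :: real ^ 'n))) \<le> (LI x. indicator (ball (0 :: real ^ 'n) M) x)"
    by (intro nn_integral_mono) (auto simp: p_def indicator_def)
   then show ?thesis using emeasure_lborel_ball_finite[of "0::real ^ 'n" M] by (auto simp: less_top[symmetric] top_unique)
  qed
  have "(LI x. p (norm x) * rad_ball \<rho> x - p (norm x) * c)
   = (LI x. p (norm x) * rad_ball \<rho> x) - (LI x. p (norm (x :: real ^ 'n)) * c)"
  proof (rule nn_integral_diff)
   show "(LI x. p (norm (x :: real ^ 'n)) * c) \<noteq> \<infinity>"
    using fin c by (auto simp: nn_integral_multc ennreal_mult_eq_top_iff)
  qed (auto simp: pn indicator_def)
  also have "(LI x. p (norm (x :: real ^ 'n)) * c) = (LI x. p (norm x) * rad_ball \<rho> x)"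
   by (simp only: rad_ball_radial_average[OF \<open>p \<in> borel_funs\<close>] c_def[symmetric])
    (subst nn_integral_multc, simp_all add: mult.commute)
  also have "(LI x. p (norm x) * rad_ball \<rho> x) - (LI x. p (norm x) * rad_ball \<rho> x) = 0"
  proof (rule ennreal_diff_self)
   show "(LI x. p (norm x) * rad_ball \<rho> x) \<noteq> top"
    unfolding rad_ball_radial_average[OF \<open>p \<in> borel_funs\<close>] c_def[symmetric]
    using fin c by (auto simp: ennreal_mult_eq_top_iff)
  qed
  finally have "AE x in lborel. p (norm x) * rad_ball \<rho> x - p (norm x) * c = 0"
   by (subst (asm) nn_integral_0_iff_AE) measurable
  then show ?thesis
  proof (rule AE_mp, intro AE_I2 impI)
   fix x assume *: "p (norm x) * rad_ball \<rho> x - p (norm x) * c = 0" and x: "norm x < M"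
   show "rad_ball \<rho> x \<le> c"
   proof (rule ccontr)
    assume n: "\<not> rad_ball \<rho> x \<le> c"
    then have "rad_ball \<rho> x - c = 0" using * x by (simp add: pn)
    then show False using n c by (simp add: diff_eq_0_iff_ennreal less_top)
   qed
  qed
 qed
 then have "AE x in lborel. \<forall>M::nat. norm x < real M \<longrightarrow> rad_ball \<rho> x \<le> c"
  unfolding AE_all_countable by blast
 then show ?thesis unfolding c_def[symmetric]
  by eventually_elim (use reals_Archimedean2 in blast)
qed

text \<open>J n w is the share of the ball of radius 1 / Suc n around w that lies in U. On an open
  set it is eventually 1, so Fatou's lemma transfers the bound for balls to U.\<close>

lemma emeasure_radial_open:
 assumes "open U"
 shows "(\<integral>\<^sup>+p. indicator U (radial p) \<partial>dir_measure) \<le> emeasure s UNIV * emeasure lborel U"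
proof -
 have [measurable]: "U \<in> sets borel" using assms by simp
 define V where "V n = emeasure lborel (ball (0::real ^ 'n) (1 / Suc n))" for n
 have V: "V n \<noteq> 0" "V n \<noteq> top" for n
  using emeasure_lborel_ball_pos[of "1 / Suc n" "0::real ^ 'n"] emeasure_lborel_ball_finite[of "0::real ^ 'n" "1 / Suc n"]
  by (auto simp: V_def less_top)
 define J where "J n w = (LI x. indicator U x * near (1 / Suc n) x w) / V n" for n w
 have [measurable]: "J n \<in> borel_funs" for n
  unfolding J_def by measurable
 have lim: "indicator U w \<le> liminf (\<lambda>n. J n w)" for w
 proof (cases "w \<in> U")
  case True
  then obtain r where r: "r > 0" "ball w r \<subseteq> U" using \<open>open U\<close> open_contains_ball by blast
  obtain m where m: "1 / Suc m < r" using r(1) nat_approx_posE by blast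
  have "J n w = 1" if "n \<ge> m" for n
  proof -
   have "1 / Suc n \<le> 1 / Suc m" using that by (simp add: frac_le)
   then have "(LI x. indicator U x * near (1 / Suc n) x w) = (LI x. near (1 / Suc n) w x)"
    using r m by (intro nn_integral_cong) (auto simp: near_def indicator_def dist_commute)
   then show ?thesis unfolding J_def using V[of n] by (simp add: nn_integral_near V_def divide_eq_1_ennreal)
  qed
  then have "eventually (\<lambda>n. 1 \<le> J n w) sequentially"
   unfolding eventually_sequentially by (intro exI[of _ m]) simp
  then have "1 \<le> liminf (\<lambda>n. J n w)" by (rule Liminf_bounded)
  then show ?thesis using True by simp
 qed simp
 have "(\<integral>\<^sup>+p. indicator U (radial p) \<partial>dir_measure) \<le> (\<integral>\<^sup>+p. liminf (\<lambda>n. J n (radial p)) \<partial>dir_measure)"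
  by (intro nn_integral_mono lim)
 also have "... \<le> liminf (\<lambda>n. \<integral>\<^sup>+p. J n (radial p) \<partial>dir_measure)"
  by (rule nn_integral_liminf) measurable
 also have "... \<le> emeasure s UNIV * emeasure lborel U"
 proof -
  have "(\<integral>\<^sup>+p. J n (radial p) \<partial>dir_measure) \<le> emeasure s UNIV * emeasure lborel U" for n
  proof -
   have "(\<integral>\<^sup>+p. J n (radial p) \<partial>dir_measure) = (\<integral>\<^sup>+p. (LI x. indicator U x * near (1 / Suc n) x (radial p)) \<partial>dir_measure) / V n"
    unfolding J_def by (rule nn_integral_divide) measurable
   also have "(\<integral>\<^sup>+p. (LI x. indicator U x * near (1 / Suc n) x (radial p)) \<partial>dir_measure)
    = (LI x. \<integral>\<^sup>+p. indicator U x * near (1 / Suc n) x (radial p) \<partial>dir_measure)"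
    by (rule nn_integral_swap[OF sigma_finite_dir sigma_finite_lborel]) measurable
   also have "... = (LI x. indicator U x * rad_ball (1 / Suc n) x)"
    unfolding rad_ball_def
    by (intro nn_integral_cong, subst nn_integral_cmult) auto
   also have "... \<le> (LI x. indicator U x * (emeasure s UNIV * V n))"
   proof (intro nn_integral_mono_AE)
    show "AE x in lborel. indicator U x * rad_ball (1 / Suc n) x \<le> indicator U x * (emeasure s UNIV * V n)"
     using rad_ball_le[of "1 / Suc n"] unfolding V_def by eventually_elim (rule mult_left_mono, auto)
   qed
   also have "... = emeasure s UNIV * emeasure lborel U * V n"
    by (subst nn_integral_multc) (simp_all add: mult_ac)
   finally have "(\<integral>\<^sup>+p. J n (radial p) \<partial>dir_measure) \<le> emeasure s UNIV * emeasure lborel U * V n / V n"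
    by (simp add: divide_right_mono_ennreal)
   then show ?thesis using V[of n] by (simp add: ennreal_mult_divide_eq)
  qed
  then show ?thesis by (intro Liminf_le) auto
 qed
 finally show ?thesis .
qed

lemma emeasure_radial_le:
 assumes [measurable]: "A \<in> sets borel"
 shows "(\<integral>\<^sup>+p. indicator A (radial p) \<partial>dir_measure) \<le> emeasure s UNIV * emeasure lborel A"
proof (cases "emeasure lborel A = top")
 case True
 then show ?thesis using pos_s by (simp add: ennreal_mult_top)
next
 case False
 have sfin: "emeasure s UNIV < top" using finite_s by simp
 show ?thesis
 proof (rule ennreal_le_epsilon)
  fix e :: real assume e: "0 < e"
  define s1 where "s1 = enn2real (emeasure s UNIV)"
  have s1: "emeasure s UNIV = ennreal s1" "s1 > 0"
   using sfin pos_s by (auto simp: s1_def enn2real_positive_iff less_top[symmetric] zero_less_iff_neq_zero)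
  obtain U where U: "open U" "A \<subseteq> U" "emeasure lborel (U - A) < ennreal (e / s1)"
   using outer_regular_lborel[OF assms, of "e / s1"] e s1(2) by auto
  have [measurable]: "U \<in> sets borel" using U(1) by simp
  have "(\<integral>\<^sup>+p. indicator A (radial p) \<partial>dir_measure) \<le> (\<integral>\<^sup>+p. indicator U (radial p) \<partial>dir_measure)"
   using U(2) by (intro nn_integral_mono) (auto simp: indicator_def)
  also have "... \<le> emeasure s UNIV * emeasure lborel U"
   by (rule emeasure_radial_open[OF U(1)])
  also have "emeasure lborel U = emeasure lborel A + emeasure lborel (U - A)"
   using U(2) by (subst plus_emeasure) (auto intro!: arg_cong[where f="emeasure lborel"])
  also have "emeasure s UNIV * (emeasure lborel A + emeasure lborel (U - A))
   \<le> emeasure s UNIV * emeasure lborel A + ennreal s1 * ennreal (e / s1)"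
   unfolding distrib_left s1(1) using U(3) by (intro add_left_mono mult_left_mono) auto
  also have "ennreal s1 * ennreal (e / s1) = ennreal e"
   using s1 e by (simp flip: ennreal_mult)
  finally show "(\<integral>\<^sup>+p. indicator A (radial p) \<partial>dir_measure) \<le> emeasure s UNIV * emeasure lborel A + ennreal e" .
 qed
qed

text \<open>One inequality is known for all Borel sets. On balls around the origin both measures
  agree, because \<open>radial\<close> keeps the length of the Lebesgue variable when w is a unit
  vector; a deficit on A inside such a ball would have to be made up on the complement of A, which
  the inequality forbids.\<close>

lemma distr_radial: "distr dir_measure borel radial = density lborel (\<lambda>_. emeasure s UNIV)"
proof (rule measure_eqI)
 show "sets (distr dir_measure borel radial) = sets (density lborel (\<lambda>_. emeasure s UNIV))" by simp
 fix A assume "A \<in> sets (distr dir_measure borel radial)"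
 then have A[measurable]: "A \<in> sets borel" by simp
 let ?N = "distr dir_measure borel radial" and ?L = "density lborel (\<lambda>_. emeasure s UNIV) :: (real ^ 'n) measure"
 have N: "emeasure ?N B = (\<integral>\<^sup>+p. indicator B (radial p) \<partial>dir_measure)" if [measurable]: "B \<in> sets borel" for B
  by (subst nn_integral_indicator[symmetric], simp, subst nn_integral_distr) simp_all
 have L: "emeasure ?L B = emeasure s UNIV * emeasure lborel B" if [measurable]: "B \<in> sets borel" for B
  by (subst emeasure_density) (simp_all add: nn_integral_cmult_indicator)
 have le: "emeasure ?N B \<le> emeasure ?L B" if "B \<in> sets borel" for B
  unfolding N[OF that] L[OF that] by (rule emeasure_radial_le[OF that])
 define K where "K m = ball (0 :: real ^ 'n) (real m)" for m
 have [measurable]: "K m \<in> sets borel" for m by (simp add: K_def)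
 have Kfin: "emeasure ?L (K m) < top" for m
  using finite_s emeasure_lborel_ball_finite[of "0::real ^ 'n" "real m"]
  by (simp add: L ennreal_mult_less_top) (simp add: K_def)
 have Keq: "emeasure ?N (K m) = emeasure ?L (K m)" for m
 proof -
  have "emeasure ?N (K m) = (\<integral>\<^sup>+p. indicator (K m) (snd p) \<partial>dir_measure)"
   unfolding N[OF \<open>K m \<in> sets borel\<close>]
   using AE_dir by (intro nn_integral_cong_AE) (auto simp: K_def radial_def indicator_def)
  also have "... = emeasure s UNIV * emeasure lborel (K m)"
   by (subst nn_integral_dir) (simp_all add: mult.commute)
  finally show ?thesis by (simp add: L)
 qed
 have eq: "emeasure ?N (A \<inter> K m) = emeasure ?L (A \<inter> K m)" for m
 proof (rule antisym)
  show "emeasure ?N (A \<inter> K m) \<le> emeasure ?L (A \<inter> K m)" by (rule le) simp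
  have split: "emeasure M (K m) = emeasure M (A \<inter> K m) + emeasure M (K m - A)" if "sets M = sets borel" for M
   using that by (subst plus_emeasure) (auto intro!: arg_cong[where f="emeasure M"])
  have "emeasure ?L (A \<inter> K m) + emeasure ?L (K m - A) = emeasure ?N (A \<inter> K m) + emeasure ?N (K m - A)"
   using split[of ?N] split[of ?L] Keq[of m] by simp
  also have "... \<le> emeasure ?N (A \<inter> K m) + emeasure ?L (K m - A)"
   by (intro add_left_mono le) simp
  finally have *: "emeasure ?L (K m - A) + emeasure ?L (A \<inter> K m) \<le> emeasure ?L (K m - A) + emeasure ?N (A \<inter> K m)"
   by (simp add: add.commute)
  have "emeasure ?L (K m - A) \<le> emeasure ?L (K m)" by (intro emeasure_mono) auto
  then have "emeasure ?L (K m - A) \<noteq> \<infinity>" using Kfin[of m] by (auto simp: top_unique)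
  then show "emeasure ?L (A \<inter> K m) \<le> emeasure ?N (A \<inter> K m)"
   using * by (simp only: ennreal_add_left_cancel_le) auto
 qed
 have U: "(\<Union>m. A \<inter> K m) = A" unfolding K_def using reals_Archimedean2 by (auto simp: dist_norm)
 then have UU: "A \<inter> \<Union> (range K) = A" by auto
 have inc: "incseq (\<lambda>m. A \<inter> K m)" unfolding K_def by (auto simp: incseq_def)
 have "emeasure ?N A = (SUP m. emeasure ?N (A \<inter> K m))"
  using SUP_emeasure_incseq[of "\<lambda>m. A \<inter> K m" ?N] inc by (simp add: UU image_subset_iff)
 also have "... = emeasure ?L A"
  unfolding eq using SUP_emeasure_incseq[of "\<lambda>m. A \<inter> K m" ?L] inc by (simp add: UU image_subset_iff)
 finally show "emeasure ?N A = emeasure ?L A" .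
qed

lemma nn_integral_radial_average:
 assumes [measurable]: "F \<in> borel_funs"
 shows "(SI w. (LI x. F (norm (x :: real ^ 'n) *\<^sub>R w))) = emeasure s UNIV * (LI x. F x)"
proof -
 have "(SI w. (LI x. F (norm (x :: real ^ 'n) *\<^sub>R w))) = (\<integral>\<^sup>+p. F (radial p) \<partial>dir_measure)"
  by (subst nn_integral_dir) (simp_all add: radial_def)
 also have "... = (\<integral>\<^sup>+x. F x \<partial>distr dir_measure borel radial)"
  by (rule nn_integral_distr[symmetric]) simp_all
 also have "... = emeasure s UNIV * (LI x. F x)"
  unfolding distr_radial by (simp add: nn_integral_density nn_integral_cmult)
 finally show ?thesis .
qed

end

section \<open>The radial law of Lebesgue measure\<close>

lemma distr_norm_lborel:
 "distr lborel borel (norm :: 'a::euclidean_space \<Rightarrow> real) =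
  density lborel (\<lambda>r. ennreal (DIM('a) * measure lborel (ball (0::'a) 1) * r ^ (DIM('a) - 1)) * indicator {0..} r)" (is "?N = ?L")
proof (rule measure_eqI_generator_eq[where \<Omega>=UNIV and E="range (lessThan :: real \<Rightarrow> _)" and A="\<lambda>i::nat. {..<real i}"])
 let ?V = "measure lborel (ball (0::'a) 1)"
 have eq: "emeasure ?N {..<r} = emeasure ?L {..<r}" and fin: "emeasure ?N {..<r} < top" for r :: real
 proof -
  have sc: "emeasure lborel (ball (0::'a) r) = ennreal (?V * r ^ DIM('a))" if "r \<ge> 0"
  proof -
   have "emeasure lborel (ball (0::'a) r) \<noteq> top"
    using emeasure_lborel_ball_finite[of "0::'a" r] by auto
   then show ?thesis using content_ball_conv_unit_ball[of r "0::'a"] that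
    by (simp add: emeasure_eq_ennreal_measure mult.commute)
  qed
  have "norm -` {..<r} = ball (0::'a) r" by auto
  then have N: "emeasure ?N {..<r} = emeasure lborel (ball (0::'a) r)" by (subst emeasure_distr) auto
  then show "emeasure ?N {..<r} < top" using emeasure_lborel_ball_finite[of "0::'a" r] by simp
  show "emeasure ?N {..<r} = emeasure ?L {..<r}"
  proof (cases "r \<ge> 0")
   case True
   have "emeasure ?L {..<r} = (LI x. ennreal (DIM('a) * ?V * x ^ (DIM('a) - 1)) * indicator {0..r} x)"
    by (subst emeasure_density, simp, simp, rule nn_integral_cong_AE, rule AE_mp[OF AE_lborel_singleton[of r]], rule AE_I2)
     (auto simp: indicator_def)
   also have "... = ennreal (?V * r ^ DIM('a) - ?V * 0 ^ DIM('a))"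
   proof (rule nn_integral_has_integral_lebesgue')
    show "((\<lambda>x. DIM('a) * ?V * x ^ (DIM('a) - 1)) has_integral ?V * r ^ DIM('a) - ?V * 0 ^ DIM('a)) {0..r}"
     using True
     by (intro fundamental_theorem_of_calculus)
      (auto intro!: derivative_eq_intros simp: has_real_derivative_iff_has_vector_derivative[symmetric])
   qed (use True in auto)
   finally show ?thesis using sc[OF True] N by (simp add: zero_power[OF DIM_positive])
  next
   case False
   have "emeasure ?L {..<r} = (LI (x::real). 0)"
   proof -
    have "(LI x. (ennreal (DIM('a) * ?V * x ^ (DIM('a) - 1)) * indicator {0..} x) * indicator {..<r} x) = (LI (x::real). 0)"
     by (rule nn_integral_cong) (use False in \<open>auto simp: indicator_def\<close>)
    then show ?thesis by (subst emeasure_density) simp_all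
   qed
   moreover have b: "ball (0::'a) r = {}" using False by (simp add: ball_eq_empty)
   ultimately show ?thesis unfolding N b by simp
  qed
 qed
 show "emeasure ?N X = emeasure ?L X" if "X \<in> range lessThan" for X using that eq by auto
 show "emeasure ?N {..<real i} \<noteq> \<infinity>" for i using fin[of i] by auto
 show "sets ?N = sigma_sets UNIV (range lessThan)" "sets ?L = sigma_sets UNIV (range lessThan)"
  by (simp_all add: borel_Iio)
 show "(\<Union>i::nat. {..<real i}) = UNIV" using reals_Archimedean2 by auto
 have "{..<a} \<inter> {..<b} = {..<min a b}" for a b :: real by auto
 then show "Int_stable (range (lessThan :: real \<Rightarrow> _))" by (auto simp: Int_stable_def)
qed auto

lemma nn_integral_real_halves:
 fixes f :: "real \<Rightarrow> ennreal"
 assumes [measurable]: "f \<in> borel_funs"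
 shows "(LI r. (f r + f (- r)) * indicator {0..} r) = (LI r. f r)"
proof -
 have "(LI r. (f r + f (- r)) * indicator {0..} r)
  = (LI r. f r * indicator {0..} r) + (LI r. f (- r) * indicator {0..} r)"
  unfolding distrib_right by (rule nn_integral_add) measurable
 also have "(LI r. f (- r) * indicator {0..} r) = (LI r. f r * indicator {..0} r)"
 proof -
  have "(LI r. f (- r) * indicator {0..} r) = (LI r. f (- r) * indicator {..0} (- r))"
   by (intro nn_integral_cong) (auto simp: indicator_def)
  also have "... = (LI r. f r * indicator {..0} r)"
   by (rule nn_integral_lborel_uminus[of "\<lambda>r. f r * indicator {..0} r"]) simp
  finally show ?thesis .
 qed
 also have "(LI r. f r * indicator {0..} r) + (LI r. f r * indicator {..0} r)
  = (LI r. f r * indicator {0..} r + f r * indicator {..0} r)"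
  by (rule nn_integral_add[symmetric]) measurable
 also have "... = (LI r. f r)"
  by (rule nn_integral_cong_AE, rule AE_mp[OF AE_lborel_singleton[of 0]], rule AE_I2) (auto simp: indicator_def)
 finally show ?thesis .
qed

lemma nn_integral_lborel_norm:
 assumes [measurable]: "g \<in> borel_funs"
 shows "(LI x. g (norm (x :: 'a::euclidean_space))) =
  (LI r. ennreal (DIM('a) * measure lborel (ball (0::'a) 1) * r ^ (DIM('a) - 1)) * indicator {0..} r * g r)"
proof -
 have "(LI x. g (norm (x :: 'a))) = (\<integral>\<^sup>+r. g r \<partial>distr lborel borel (norm :: 'a \<Rightarrow> real))"
  by (rule nn_integral_distr[symmetric]) simp_all
 also have "... = (LI r. ennreal (DIM('a) * measure lborel (ball (0::'a) 1) * r ^ (DIM('a) - 1)) * indicator {0..} r * g r)"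
  unfolding distr_norm_lborel by (rule nn_integral_density) simp_all
 finally show ?thesis .
qed

section \<open>Polar coordinates and orthogonal decompositions\<close>

context haar_sphere begin

text \<open>The radius runs over the whole line, since w . z takes either sign in a collision; every
  point is then met from both w and - w, which explains the factor 2 in the constant. Only its
  existence and positivity are recorded because s is not normalised.\<close>

lemma polar:
 "\<exists>c>0. \<forall>F \<in> borel_funs. (SI w. (LI r. ennreal (\<bar>r\<bar> ^ (CARD('n) - 1)) * F (r *\<^sub>R w)))
  = ennreal c * (LI x. F x)"
proof -
 define k where "k = real CARD('n) * measure lborel (ball (0::real ^ 'n) 1)"
 define s1 where "s1 = enn2real (emeasure s UNIV)"
 have s1: "emeasure s UNIV = ennreal s1" "s1 > 0"
  using finite_s pos_s by (auto simp: s1_def enn2real_positive_iff less_top[symmetric] zero_less_iff_neq_zero)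
 have k: "k > 0" using card2 by (auto simp: k_def intro!: mult_pos_pos content_ball_pos)
 have "ennreal k * (SI w. (LI r. ennreal (\<bar>r\<bar> ^ (CARD('n) - 1)) * F (r *\<^sub>R w)))
  = ennreal (s1 * 2) * (LI x. F x)" if [measurable]: "F \<in> borel_funs" for F :: "real ^ 'n \<Rightarrow> ennreal"
 proof -
  have inner: "(LI x. F (norm (x :: real ^ 'n) *\<^sub>R w) + F (- (norm x *\<^sub>R w)))
   = ennreal k * (LI r. ennreal (\<bar>r\<bar> ^ (CARD('n) - 1)) * F (r *\<^sub>R w))" for w
  proof -
   let ?h = "\<lambda>r. ennreal (k * \<bar>r\<bar> ^ (CARD('n) - 1)) * F (r *\<^sub>R w)"
   have "(LI x. F (norm (x :: real ^ 'n) *\<^sub>R w) + F (- (norm x *\<^sub>R w)))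
    = (LI r. ennreal (k * r ^ (CARD('n) - 1)) * indicator {0..} r * (F (r *\<^sub>R w) + F (- (r *\<^sub>R w))))"
    using nn_integral_lborel_norm[where 'a="real ^ 'n", of "\<lambda>r. F (r *\<^sub>R w) + F (- (r *\<^sub>R w))"] by (simp add: k_def)
   also have "... = (LI r. (?h r + ?h (- r)) * indicator {0..} r)"
   proof (rule nn_integral_cong)
    fix r :: real
    show "ennreal (k * r ^ (CARD('n) - 1)) * indicator {0..} r * (F (r *\<^sub>R w) + F (- (r *\<^sub>R w))) = (?h r + ?h (- r)) * indicator {0..} r"
     by (cases "r \<ge> 0") (simp_all add: distrib_left)
   qed
   also have "... = (LI r. ?h r)"
    by (rule nn_integral_real_halves[of ?h]) simp
   also have "... = (LI r. ennreal k * (ennreal (\<bar>r\<bar> ^ (CARD('n) - 1)) * F (r *\<^sub>R w)))"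
    using k by (intro nn_integral_cong) (simp add: ennreal_mult mult.assoc)
   also have "... = ennreal k * (LI r. ennreal (\<bar>r\<bar> ^ (CARD('n) - 1)) * F (r *\<^sub>R w))"
    by (rule nn_integral_cmult) simp
   finally show ?thesis .
  qed
  have "ennreal k * (SI w. (LI r. ennreal (\<bar>r\<bar> ^ (CARD('n) - 1)) * F (r *\<^sub>R w)))
   = (SI w. (LI x. F (norm (x :: real ^ 'n) *\<^sub>R w) + F (- (norm x *\<^sub>R w))))"
   unfolding inner by (rule nn_integral_cmult[symmetric]) measurable
  also have "... = emeasure s UNIV * (LI x. F x + F (- x))"
   by (rule nn_integral_radial_average[of "\<lambda>x. F x + F (- x)"]) measurable
  also have "(LI x. F x + F (- x)) = 2 * (LI x. F x)"
   by (simp add: nn_integral_add nn_integral_lborel_uminus mult_2)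
  finally show ?thesis using s1 by (simp add: ennreal_mult mult_ac)
 qed
 note * = this
 show ?thesis
 proof (intro exI[of _ "s1 * 2 / k"] conjI ballI)
  show "0 < s1 * 2 / k" using s1 k by simp
  fix F :: "real ^ 'n \<Rightarrow> ennreal" assume "F \<in> borel_funs"
  note eq = *[OF this]
  show "(SI w. (LI r. ennreal (\<bar>r\<bar> ^ (CARD('n) - 1)) * F (r *\<^sub>R w))) = ennreal (s1 * 2 / k) * (LI x. F x)" (is "?X = _ * ?Y")
  proof (rule ennreal_mult_right_cancel[of _ "ennreal k"])
   have "?X * ennreal k = ennreal (s1 * 2) * ?Y" using eq by (simp add: mult.commute)
   also have "ennreal (s1 * 2) = ennreal (s1 * 2 / k) * ennreal k" using s1 k by (simp flip: ennreal_mult)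
   finally show "?X * ennreal k = ennreal (s1 * 2 / k) * ?Y * ennreal k" by (simp add: mult_ac)
  qed (use k in auto)
 qed
qed

end

text \<open>The integral over the hyperplane orthogonal to w is expressed as one over a strip of
  unit width around it. Only Lebesgue measure of the full space occurs, and no measure on
  hyperplanes has to be constructed.\<close>

lemma nn_integral_split_component:
 fixes w :: "'a::euclidean_space"
 assumes [measurable]: "\<Phi> \<in> borel_measurable (borel \<Otimes>\<^sub>M borel)" and w: "norm w = 1"
 shows "(LI z. \<Phi> (w \<bullet> z, z - (w \<bullet> z) *\<^sub>R w))
  = (LI z. indicator {0..1} (w \<bullet> z) * (LI r. \<Phi> (r, z - (w \<bullet> z) *\<^sub>R w)))"
proof -
 have ww: "w \<bullet> w = 1" using w by (simp add: norm_eq_1)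
 \<comment> \<open>The inserted indicator integrates to one in the free variable. Exchanging that
   variable with the component along w turns it into the strip condition.\<close>
 define F where "F = (\<lambda>q :: real \<times> 'a. indicator {0..1} (w \<bullet> snd q) * \<Phi> (fst q, snd q - (w \<bullet> snd q) *\<^sub>R w))"
 have [measurable]: "F \<in> borel_funs" unfolding F_def borel_prod[symmetric] by measurable
 have one: "(LI r. indicator {0..1::real} r) = 1" by simp
 have "(LI z. (LI r. F (w \<bullet> z, z - (w \<bullet> z) *\<^sub>R w + r *\<^sub>R w)))
  = (LI z. (LI r. indicator {0..1::real} r * \<Phi> (w \<bullet> z, z - (w \<bullet> z) *\<^sub>R w)))"
  by (intro nn_integral_cong) (simp add: F_def inner_diff_right inner_add_right ww)
 also have "... = (LI z. \<Phi> (w \<bullet> z, z - (w \<bullet> z) *\<^sub>R w))"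
 proof (rule nn_integral_cong)
  fix z
  have "(LI r. indicator {0..1::real} r * \<Phi> (w \<bullet> z, z - (w \<bullet> z) *\<^sub>R w)) = (LI r. indicator {0..1::real} r) * \<Phi> (w \<bullet> z, z - (w \<bullet> z) *\<^sub>R w)"
   by (rule nn_integral_multc) simp
  then show "(LI r. indicator {0..1::real} r * \<Phi> (w \<bullet> z, z - (w \<bullet> z) *\<^sub>R w)) = \<Phi> (w \<bullet> z, z - (w \<bullet> z) *\<^sub>R w)"
   by (simp only: one mult_1)
 qed
 finally have "(LI z. \<Phi> (w \<bullet> z, z - (w \<bullet> z) *\<^sub>R w)) = (LI z. (LI r. F (r, z)))"
  using nn_integral_exchange_component[OF \<open>F \<in> borel_funs\<close> w] by simp
 also have "... = (LI z. indicator {0..1} (w \<bullet> z) * (LI r. \<Phi> (r, z - (w \<bullet> z) *\<^sub>R w)))"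
  unfolding F_def fst_conv snd_conv by (intro nn_integral_cong nn_integral_cmult) measurable
 finally show ?thesis .
qed

definition perp :: "'a::euclidean_space \<Rightarrow> 'a \<Rightarrow> 'a" where
 "perp a y = y - ((a \<bullet> y) / (a \<bullet> a)) *\<^sub>R a"

lemma perp_scaleR: "r \<noteq> 0 \<Longrightarrow> norm w = 1 \<Longrightarrow> perp (r *\<^sub>R w) y = y - (w \<bullet> y) *\<^sub>R w"
 by (simp add: perp_def norm_eq_1 power2_eq_square field_simps)

lemma perp_measurable[measurable]:
 fixes f g :: "'b \<Rightarrow> 'a::euclidean_space"
 assumes [measurable]: "f \<in> borel_measurable M" "g \<in> borel_measurable M"
 shows "(\<lambda>x. perp (f x) (g x)) \<in> borel_measurable M"
 unfolding perp_def by measurable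

lemma nn_integral_strip:
 assumes "0 < \<rho>" "0 < \<epsilon>"
 shows "(LI r. indicator {r. \<bar>\<rho> * r\<bar> < \<epsilon>} r) = ennreal (2 * \<epsilon> / \<rho>)"
proof -
 have "{r. \<bar>\<rho> * r\<bar> < \<epsilon>} = {- \<epsilon> / \<rho> <..< \<epsilon> / \<rho>}"
  using assms by (auto simp: abs_less_iff field_simps)
 then show ?thesis using assms by (simp add: field_simps)
qed

text \<open>Compressing the component along a by \<epsilon> maps the fixed strip onto the thin one.
  Thin-strip integrals thereby live on a domain independent of \<epsilon>, where dominated
  convergence applies.\<close>

lemma nn_integral_squeeze:
 fixes a :: "'a::euclidean_space"
 assumes [measurable]: "K \<in> borel_funs" and a: "a \<noteq> 0" and e: "0 < \<epsilon>"
 shows "(LI y. indicator {r. \<bar>r\<bar> < 1} (a \<bullet> y) * K (perp a y + \<epsilon> *\<^sub>R (y - perp a y)))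
  = ennreal (1 / \<epsilon>) * (LI y. indicator {r. \<bar>r\<bar> < \<epsilon>} (a \<bullet> y) * K y)"
proof -
 define \<rho> w where "\<rho> = norm a" and "w = a /\<^sub>R norm a"
 have w: "norm w = 1" and aw: "a = \<rho> *\<^sub>R w" and rho: "\<rho> > 0" using a by (auto simp: \<rho>_def w_def)
 have p: "perp a y = y - (w \<bullet> y) *\<^sub>R w" for y unfolding aw using rho w by (intro perp_scaleR) auto
 let ?P = "\<lambda>z. z - (w \<bullet> z) *\<^sub>R w"
 let ?f = "\<lambda>z r. indicator {r. \<bar>r\<bar> < \<epsilon>} (\<rho> * r) * K (?P z + r *\<^sub>R w)"
 have "(LI y. indicator {r. \<bar>r\<bar> < 1} (a \<bullet> y) * K (perp a y + \<epsilon> *\<^sub>R (y - perp a y)))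
  = (LI z. indicator {r. \<bar>r\<bar> < 1} (\<rho> * (w \<bullet> z)) * K (?P z + (\<epsilon> * (w \<bullet> z)) *\<^sub>R w))"
  unfolding p by (simp add: aw)
 also have "... = (LI z. indicator {0..1} (w \<bullet> z) * (LI r. indicator {r. \<bar>r\<bar> < 1} (\<rho> * r) * K (?P z + (\<epsilon> * r) *\<^sub>R w)))"
  using nn_integral_split_component[OF _ w, of "\<lambda>q. indicator {r. \<bar>r\<bar> < 1} (\<rho> * fst q) * K (snd q + (\<epsilon> * fst q) *\<^sub>R w)"] by simp
 also have "... = (LI z. ennreal (1 / \<epsilon>) * (indicator {0..1} (w \<bullet> z) * (LI r. ?f z r)))"
 proof (rule nn_integral_cong)
  fix z
  have "(LI r. ?f z r) = ennreal \<epsilon> * (LI r. ?f z (\<epsilon> * r))"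
   using nn_integral_real_affine[of "?f z" \<epsilon> 0] e by simp
  also have "(LI r. ?f z (\<epsilon> * r)) = (LI r. indicator {r. \<bar>r\<bar> < 1} (\<rho> * r) * K (?P z + (\<epsilon> * r) *\<^sub>R w))"
  proof (rule nn_integral_cong)
   fix r :: real
   have "\<bar>\<rho> * (\<epsilon> * r)\<bar> < \<epsilon> \<longleftrightarrow> \<bar>\<rho> * r\<bar> < 1"
    using e mult_less_cancel_left_pos[OF e, of "\<bar>\<rho> * r\<bar>" 1] by (simp add: abs_mult mult_ac)
   then show "?f z (\<epsilon> * r) = indicator {r. \<bar>r\<bar> < 1} (\<rho> * r) * K (?P z + (\<epsilon> * r) *\<^sub>R w)"
    by (simp add: indicator_def)
  qed
  finally have sc: "(LI r. ?f z r) = ennreal \<epsilon> * (LI r. indicator {r. \<bar>r\<bar> < 1} (\<rho> * r) * K (?P z + (\<epsilon> * r) *\<^sub>R w))" .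
  have "ennreal (1 / \<epsilon>) * ennreal \<epsilon> = 1" using e by (simp flip: ennreal_mult)
  then have "(LI r. indicator {r. \<bar>r\<bar> < 1} (\<rho> * r) * K (?P z + (\<epsilon> * r) *\<^sub>R w)) = ennreal (1 / \<epsilon>) * (LI r. ?f z r)"
   unfolding sc by (simp only: mult.assoc[symmetric] mult_1)
  then show "indicator {0..1} (w \<bullet> z) * (LI r. indicator {r. \<bar>r\<bar> < 1} (\<rho> * r) * K (?P z + (\<epsilon> * r) *\<^sub>R w))
   = ennreal (1 / \<epsilon>) * (indicator {0..1} (w \<bullet> z) * (LI r. ?f z r))"
   by (simp only: mult_ac)
 qed
 also have "... = ennreal (1 / \<epsilon>) * (LI z. indicator {0..1} (w \<bullet> z) * (LI r. ?f z r))"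
  by (rule nn_integral_cmult) measurable
 also have "(LI z. indicator {0..1} (w \<bullet> z) * (LI r. ?f z r))
  = (LI y. indicator {r. \<bar>r\<bar> < \<epsilon>} (\<rho> * (w \<bullet> y)) * K (?P y + (w \<bullet> y) *\<^sub>R w))"
  using nn_integral_split_component[OF _ w, of "\<lambda>q. indicator {r. \<bar>r\<bar> < \<epsilon>} (\<rho> * fst q) * K (snd q + fst q *\<^sub>R w)"] by simp
 finally show ?thesis by (simp add: aw)
qed

text \<open>The exchange symmetry of orthogonal pairs arises from a limit that is available for
  continuous integrands. Open sets are reached by truncated multiples of the distance to the
  complement, which increase to the indicator.\<close>

lemma finite_measure_eqI_continuous:
 fixes M N :: "'a::metric_space measure"
 assumes sets: "sets M = sets borel" "sets N = sets borel" and fin: "emeasure M UNIV < top"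
  and eq: "\<And>F :: 'a \<Rightarrow> real. continuous_on UNIV F \<Longrightarrow> (\<And>x. 0 \<le> F x \<and> F x \<le> 1) \<Longrightarrow>
   (\<integral>\<^sup>+x. ennreal (F x) \<partial>M) = (\<integral>\<^sup>+x. ennreal (F x) \<partial>N)"
 shows "M = N"
proof (rule measure_eqI_generator_eq[where \<Omega>=UNIV and E="{U. open U}" and A="\<lambda>_::nat. UNIV"])
 have sp: "space M = UNIV" "space N = UNIV" using sets_eq_imp_space_eq[OF sets(1)] sets_eq_imp_space_eq[OF sets(2)] by simp_all
 show "emeasure M U = emeasure N U" if "U \<in> {U. open U}" for U
 \<comment> \<open>The full space is separate because \<open>infdist\<close> to the empty set is
   0.\<close>
 proof (cases "U = UNIV")
  case True
  then show ?thesis using eq[of "\<lambda>_. 1"] sp by simp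
 next
  case False
  have U: "open U" "closed (- U)" "- U \<noteq> {}" using that False by auto
  define F where "F n x = min 1 (real n * infdist x (- U))" for n x
  have F: "continuous_on UNIV (F n)" "0 \<le> F n x" "F n x \<le> 1" for n x
   unfolding F_def by (auto intro!: continuous_intros simp: infdist_nonneg)
  have inc: "incseq (\<lambda>n x. ennreal (F n x))"
   by (auto simp: incseq_def le_fun_def F_def intro!: ennreal_leI min.mono mult_right_mono infdist_nonneg)
  have sup: "(SUP n. ennreal (F n x)) = indicator U x" for x
  proof (cases "x \<in> U")
   case True
   then have "infdist x (- U) > 0"
    using U in_closed_iff_infdist_zero[OF U(2,3), of x] infdist_nonneg[of x "- U"] by force
   then obtain n :: nat where n: "real n * infdist x (- U) > 1" using reals_Archimedean3 by blast
   then have "F n x = 1" by (simp add: F_def)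
   then have "1 \<le> (SUP n. ennreal (F n x))" by (intro SUP_upper2[of n]) auto
   moreover have "(SUP n. ennreal (F n x)) \<le> 1" using F by (intro SUP_least) (simp add: ennreal_le_1)
   ultimately show ?thesis using True by (auto intro: antisym)
  next
   case False
   then have "F n x = 0" for n by (simp add: F_def infdist_zero)
   then show ?thesis using False by simp
  qed
  have *: "emeasure L U = (SUP n. \<integral>\<^sup>+x. ennreal (F n x) \<partial>L)" if L: "sets L = sets borel" for L
  proof -
   have "emeasure L U = (\<integral>\<^sup>+x. (SUP n. ennreal (F n x)) \<partial>L)" unfolding sup using U(1) L by simp
   also have "... = (SUP n. \<integral>\<^sup>+x. ennreal (F n x) \<partial>L)"
   proof (rule nn_integral_monotone_convergence_SUP[OF inc])
    show "(\<lambda>x. ennreal (F i x)) \<in> borel_measurable L" for i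
     using borel_measurable_continuous_onI[OF F(1)[of i]] L measurable_cong_sets[OF L refl] by (auto intro!: measurable_compose[OF _ measurable_ennreal])
   qed
   finally show ?thesis .
  qed
  show ?thesis unfolding *[OF sets(1)] *[OF sets(2)] using eq F by simp
 qed
next
 have sp: "space M = UNIV" using sets_eq_imp_space_eq[OF sets(1)] by simp
 show "sets M = sigma_sets UNIV {U. open U}" "sets N = sigma_sets UNIV {U. open U}"
  using sets by (simp_all add: borel_def)
 show "emeasure M UNIV \<noteq> \<infinity>" using fin by auto
qed (auto simp: Int_stable_def)

lemma power_le_exp:
 fixes x :: real
 assumes "0 \<le> x"
 shows "x ^ m \<le> fact m * exp x"
proof -
 have "x ^ m /\<^sub>R fact m \<le> (\<Sum>n. x ^ n /\<^sub>R fact n)"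
  using sum_le_suminf[OF summable_exp_generic[of x], of "{m}"] assms by simp
 then show ?thesis by (simp add: exp_def field_simps)
qed

text \<open>From (r - 2)^2 \<ge> 0 follows - r^2 / 2 \<le> 2 - 2 r; one of the two factors exp (- r)
  absorbs the power.\<close>

lemma power_gauss_le_exp:
 fixes r :: real
 assumes "0 \<le> r"
 shows "r ^ m * exp (- r\<^sup>2 / 2) \<le> fact m * exp 2 * exp (- r)"
proof -
 have "- r\<^sup>2 / 2 \<le> 2 - 2 * r" using zero_le_power2[of "r - 2"] by (simp add: power2_eq_square algebra_simps)
 then have "r ^ m * exp (- r\<^sup>2 / 2) \<le> (fact m * exp r) * exp (2 - 2 * r)"
  using assms power_le_exp[OF assms, of m] by (intro mult_mono) auto
 also have "(fact m * exp r) * exp (2 - 2 * r) = fact m * (exp (r + (2 - 2 * r)) :: real)"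
  by (simp only: exp_add mult.assoc)
 also have "r + (2 - 2 * r) = 2 + - r" by simp
 also have "fact m * exp (2 + - r) = fact m * exp 2 * (exp (- r) :: real)"
  by (simp only: exp_add mult.assoc)
 finally show ?thesis .
qed

lemma nn_integral_exp_half_line: "(LI r. ennreal (exp (- r)) * indicator {0..} r) = (1 :: ennreal)"
proof -
 have "((\<lambda>r::real. - exp (- r)) \<longlongrightarrow> - 0) at_top"
  by (intro tendsto_minus filterlim_compose[OF exp_at_bot filterlim_uminus_at_bot_at_top])
 moreover have "DERIV (\<lambda>r. - exp (- r)) x :> exp (- x)" for x :: real
  by (auto intro!: derivative_eq_intros)
 ultimately show ?thesis
  using nn_integral_FTC_atLeast[of "\<lambda>r. exp (- r)" 0 "\<lambda>r. - exp (- r)" 0] by simp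
qed

lemma gauss_moment_finite:
 "(\<integral>\<^sup>+x. ennreal (norm x ^ m * exp (- (norm x)\<^sup>2 / 2)) \<partial>(lborel :: 'a::euclidean_space measure)) < top"
proof -
 let ?k = "DIM('a) * measure lborel (ball (0::'a) 1)"
 let ?C = "?k * fact (DIM('a) - 1 + m) * exp 2"
 have "(\<integral>\<^sup>+x. ennreal (norm x ^ m * exp (- (norm x)\<^sup>2 / 2)) \<partial>(lborel :: 'a measure))
  = (LI r. ennreal (?k * r ^ (DIM('a) - 1)) * indicator {0..} r * ennreal (r ^ m * exp (- r\<^sup>2 / 2)))"
  by (rule nn_integral_lborel_norm[of "\<lambda>r. ennreal (r ^ m * exp (- r\<^sup>2 / 2))"]) measurable
 also have "... \<le> (LI r. ennreal ?C * (ennreal (exp (- r)) * indicator {0..} r))"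
 proof (rule nn_integral_mono)
  fix r :: real
  show "ennreal (?k * r ^ (DIM('a) - 1)) * indicator {0..} r * ennreal (r ^ m * exp (- r\<^sup>2 / 2))
   \<le> ennreal ?C * (ennreal (exp (- r)) * indicator {0..} r)"
  proof (cases "0 \<le> r")
   case True
   have "(?k * r ^ (DIM('a) - 1)) * (r ^ m * exp (- r\<^sup>2 / 2)) = ?k * (r ^ (DIM('a) - 1 + m) * exp (- r\<^sup>2 / 2))"
    by (simp only: power_add mult.assoc)
   also have "... \<le> ?k * (fact (DIM('a) - 1 + m) * exp 2 * exp (- r))"
    using power_gauss_le_exp[OF True] by (intro mult_left_mono) auto
   finally show ?thesis using True by (simp flip: ennreal_mult add: mult_ac)
  qed simp
 qed
 also have "... = ennreal ?C" by (subst nn_integral_cmult) (simp_all add: nn_integral_exp_half_line)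
 finally show ?thesis by (rule order.strict_trans1) simp
qed

lemma nn_integral_lborel_pair:
 fixes f :: "'a::euclidean_space \<times> 'b::euclidean_space \<Rightarrow> ennreal"
 assumes "f \<in> borel_funs"
 shows "(LI p. f p) = (LI a. (LI b. f (a, b)))"
proof -
 have "f \<in> borel_measurable (lborel \<Otimes>\<^sub>M lborel)" using assms by (simp add: borel_prod lborel_prod)
 then show ?thesis using lborel.nn_integral_fst[of f lborel] by (simp add: lborel_prod)
qed

definition gauss2 :: "'a::real_normed_vector \<times> 'a \<Rightarrow> real" where
 "gauss2 p = exp (- (norm (fst p))\<^sup>2 / 2 - (norm (snd p))\<^sup>2 / 2)"

lemma gauss2_measurable[measurable]: "gauss2 \<in> borel_measurable (borel :: ('a::euclidean_space \<times> 'a) measure)"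
 unfolding gauss2_def by measurable

lemma gauss2_swap: "gauss2 (prod.swap p) = gauss2 p"
 unfolding gauss2_def by (rule arg_cong[where f=exp]) simp

lemma gauss2_pos: "0 < gauss2 p" by (simp add: gauss2_def)

lemma gauss2_nonneg[simp]: "0 \<le> gauss2 p" by (simp add: gauss2_def)

lemma norm_perp_decomp:
 fixes w z :: "'a::real_inner"
 assumes "norm w = 1"
 shows "(norm ((w \<bullet> z) *\<^sub>R w))\<^sup>2 + (norm (z - (w \<bullet> z) *\<^sub>R w))\<^sup>2 = (norm z)\<^sup>2"
proof -
 have "w \<bullet> w = 1" using assms by (simp add: norm_eq_1)
 then show ?thesis unfolding power2_norm_eq_inner
  by (simp add: inner_diff_left inner_diff_right inner_commute power2_eq_square algebra_simps)
qed

lemma norm_perp_le: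
 fixes a y :: "'a::euclidean_space"
 shows "(norm (perp a y))\<^sup>2 \<le> (norm (perp a y + \<epsilon> *\<^sub>R (y - perp a y)))\<^sup>2"
proof -
 have "a \<bullet> perp a y = 0" by (cases "a = 0") (simp_all add: perp_def inner_diff_right)
 moreover have "y - perp a y = ((a \<bullet> y) / (a \<bullet> a)) *\<^sub>R a" by (simp add: perp_def)
 ultimately have o: "perp a y \<bullet> (y - perp a y) = 0" by (simp only: inner_scaleR_right inner_commute[of "perp a y" a])
 have "(norm (perp a y + \<epsilon> *\<^sub>R (y - perp a y)))\<^sup>2 = (norm (perp a y))\<^sup>2 + (norm (\<epsilon> *\<^sub>R (y - perp a y)))\<^sup>2"
  by (rule norm_add_Pythagorean) (simp add: orthogonal_def o)
 then show ?thesis by simp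
qed

context haar_sphere begin

definition orth_pair :: "'n vels \<Rightarrow> 'n vels" where
 "orth_pair p = ((fst p \<bullet> snd p) *\<^sub>R fst p, snd p - (fst p \<bullet> snd p) *\<^sub>R fst p)"

lemma orth_pair_measurable[measurable]: "orth_pair \<in> borel_funs"
 unfolding orth_pair_def by (intro borel_measurable_continuous_onI continuous_intros)

text \<open>Up to a constant this is integration over orthogonal pairs against delta (a . b) da db,
  the Carleman form of the collision integral. The variable z = a + b keeps it within Lebesgue
  measure.\<close>

definition orth_integral :: "('n vels \<Rightarrow> ennreal) \<Rightarrow> ennreal" where
 "orth_integral H = (SI w. (LI z. ennreal (jac w z) * H ((w \<bullet> z) *\<^sub>R w, z - (w \<bullet> z) *\<^sub>R w)))"

lemma orth_integral_dir:
 assumes [measurable]: "H \<in> borel_funs"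
 shows "orth_integral H = (\<integral>\<^sup>+p. ennreal (\<bar>fst p \<bullet> snd p\<bar> ^ (CARD('n) - 2)) * H (orth_pair p) \<partial>dir_measure)"
 unfolding orth_integral_def by (subst nn_integral_dir) (simp_all add: orth_pair_def)

text \<open>The strip |a . y| < 1 has thickness 2 / |a|, which supplies the factor 1 / |a| of delta
  (a . b); H is read at the projection and so is constant across the strip.\<close>

definition perp_integral :: "('n vels \<Rightarrow> ennreal) \<Rightarrow> ennreal" where
 "perp_integral H = (LI a. (LI y. indicator {r. \<bar>r\<bar> < 1} (a \<bullet> y) * H (a, perp a y)))"

text \<open>With a = r w the polar Jacobian is |r| ^ (d - 1) and the strip contributes 2 / |r|. What
  remains is the weight |r| ^ (d - 2) of \<open>orth_integral\<close>.\<close>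

lemma orth_integral_perp:
 "\<exists>c>0. \<forall>H \<in> borel_funs. orth_integral H = ennreal c * perp_integral H"
proof -
 obtain c where c: "c > 0" "\<And>F. F \<in> borel_funs \<Longrightarrow> (SI w. (LI r. ennreal (\<bar>r\<bar> ^ (CARD('n) - 1)) * F (r *\<^sub>R w)))
  = ennreal c * (LI x. F x)" using polar by blast
 have d: "\<bar>r\<bar> ^ (CARD('n) - 2) * \<bar>r\<bar> = \<bar>r\<bar> ^ (CARD('n) - 1)" for r :: real
 proof -
  have "CARD('n) - 1 = Suc (CARD('n) - 2)" using card2 by simp
  then show ?thesis by simp
 qed
 have "orth_integral H = ennreal (c / 2) * perp_integral H" if H[measurable]: "H \<in> borel_funs" for H
 proof -
  have [measurable]: "H \<in> borel_measurable (borel \<Otimes>\<^sub>M borel)" using H by (simp only: borel_prod)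
  \<comment> \<open>The factor 1 / 2 offsets the two sides of the strip, so that \<open>one\<close>
    below comes out as 1.\<close>
  define FF where "FF a = ennreal (1 / 2) * (LI y. indicator {r. \<bar>r\<bar> < 1} (a \<bullet> y) * H (a, perp a y))" for a
  have [measurable]: "FF \<in> borel_funs" unfolding FF_def by measurable
  have inner: "(LI z. ennreal (jac w z) * H ((w \<bullet> z) *\<^sub>R w, z - (w \<bullet> z) *\<^sub>R w))
   = (LI r. ennreal (\<bar>r\<bar> ^ (CARD('n) - 1)) * FF (r *\<^sub>R w))" if w: "norm w = 1" for w
  proof -
   let ?P = "\<lambda>z. z - (w \<bullet> z) *\<^sub>R w"
   let ?c = "\<lambda>z. indicator {0..1} (w \<bullet> z) :: ennreal"
   have "(LI z. ennreal (jac w z) * H ((w \<bullet> z) *\<^sub>R w, ?P z))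
    = (LI z. ?c z * (LI r. ennreal (\<bar>r\<bar> ^ (CARD('n) - 2)) * H (r *\<^sub>R w, ?P z)))"
    using nn_integral_split_component[OF _ w, of "\<lambda>q. ennreal (\<bar>fst q\<bar> ^ (CARD('n) - 2)) * H (fst q *\<^sub>R w, snd q)"] by simp
   also have "... = (LI z. (LI r. ?c z * (ennreal (\<bar>r\<bar> ^ (CARD('n) - 2)) * H (r *\<^sub>R w, ?P z))))"
    by (intro nn_integral_cong nn_integral_cmult[symmetric]) measurable
   also have "... = (LI r. (LI z. ?c z * (ennreal (\<bar>r\<bar> ^ (CARD('n) - 2)) * H (r *\<^sub>R w, ?P z))))"
    by (rule nn_integral_lborel_swap) measurable
   also have "... = (LI r. ennreal (\<bar>r\<bar> ^ (CARD('n) - 1)) * FF (r *\<^sub>R w))"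
   proof (rule nn_integral_cong_AE, rule AE_mp[OF AE_lborel_singleton[of 0]], rule AE_I2, rule impI)
    fix r :: real assume r: "r \<noteq> 0"
    have one: "(LI t. ennreal (\<bar>r\<bar> / 2) * indicator {t. \<bar>t\<bar> < 1} (r * t)) = 1"
    proof -
     have "(LI t. ennreal (\<bar>r\<bar> / 2) * indicator {t. \<bar>t\<bar> < 1} (r * t)) = (LI t. ennreal (\<bar>r\<bar> / 2) * indicator {t. \<bar>\<bar>r\<bar> * t\<bar> < 1} t)"
      by (intro nn_integral_cong) (simp add: indicator_def abs_mult)
     also have "... = ennreal (\<bar>r\<bar> / 2) * (LI t. indicator {t. \<bar>\<bar>r\<bar> * t\<bar> < 1} t)"
      by (rule nn_integral_cmult) measurable
     also have "... = ennreal (\<bar>r\<bar> / 2) * ennreal (2 * 1 / \<bar>r\<bar>)"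
      by (subst nn_integral_strip) (use r in auto)
     finally show ?thesis using r by (simp flip: ennreal_mult)
    qed
    have "(LI z. ennreal (\<bar>r\<bar> / 2) * indicator {t. \<bar>t\<bar> < 1} (r * (w \<bullet> z)) * H (r *\<^sub>R w, ?P z))
     = (LI z. ?c z * (LI t. ennreal (\<bar>r\<bar> / 2) * indicator {t. \<bar>t\<bar> < 1} (r * t) * H (r *\<^sub>R w, ?P z)))"
     using nn_integral_split_component[OF _ w, of "\<lambda>q. ennreal (\<bar>r\<bar> / 2) * indicator {t. \<bar>t\<bar> < 1} (r * fst q) * H (r *\<^sub>R w, snd q)"] by simp
    also have "... = (LI z. ?c z * H (r *\<^sub>R w, ?P z))"
    proof (rule nn_integral_cong)
     fix z
     have "(LI t. ennreal (\<bar>r\<bar> / 2) * indicator {t. \<bar>t\<bar> < 1} (r * t) * H (r *\<^sub>R w, ?P z))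
      = (LI t. ennreal (\<bar>r\<bar> / 2) * indicator {t. \<bar>t\<bar> < 1} (r * t)) * H (r *\<^sub>R w, ?P z)"
      by (rule nn_integral_multc) measurable
     then show "?c z * (LI t. ennreal (\<bar>r\<bar> / 2) * indicator {t. \<bar>t\<bar> < 1} (r * t) * H (r *\<^sub>R w, ?P z)) = ?c z * H (r *\<^sub>R w, ?P z)"
      by (simp only: one mult_1)
    qed
    finally have A: "(LI z. ?c z * H (r *\<^sub>R w, ?P z))
     = (LI z. ennreal (\<bar>r\<bar> / 2) * indicator {t. \<bar>t\<bar> < 1} (r * (w \<bullet> z)) * H (r *\<^sub>R w, ?P z))" by simp
    have "(LI z. ?c z * (ennreal (\<bar>r\<bar> ^ (CARD('n) - 2)) * H (r *\<^sub>R w, ?P z)))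
     = (LI z. ennreal (\<bar>r\<bar> ^ (CARD('n) - 2)) * (?c z * H (r *\<^sub>R w, ?P z)))"
     by (intro nn_integral_cong) (simp only: mult_ac)
    also have "... = ennreal (\<bar>r\<bar> ^ (CARD('n) - 2)) * (LI z. ?c z * H (r *\<^sub>R w, ?P z))"
     by (rule nn_integral_cmult) measurable
    also have "... = ennreal (\<bar>r\<bar> ^ (CARD('n) - 2)) * (LI z. ennreal (\<bar>r\<bar> / 2) * (indicator {t. \<bar>t\<bar> < 1} ((r *\<^sub>R w) \<bullet> z) * H (r *\<^sub>R w, perp (r *\<^sub>R w) z)))"
     unfolding A using r w by (simp add: perp_scaleR mult.assoc)
    also have "... = ennreal (\<bar>r\<bar> ^ (CARD('n) - 2)) * (ennreal (\<bar>r\<bar> / 2) * (LI z. indicator {t. \<bar>t\<bar> < 1} ((r *\<^sub>R w) \<bullet> z) * H (r *\<^sub>R w, perp (r *\<^sub>R w) z)))"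
     by (subst nn_integral_cmult) measurable
    also have "ennreal (\<bar>r\<bar> / 2) = ennreal \<bar>r\<bar> * ennreal (1 / 2)" by (subst ennreal_mult[symmetric]) simp_all
    finally show "(LI z. ?c z * (ennreal (\<bar>r\<bar> ^ (CARD('n) - 2)) * H (r *\<^sub>R w, ?P z))) = ennreal (\<bar>r\<bar> ^ (CARD('n) - 1)) * FF (r *\<^sub>R w)"
     unfolding FF_def d[symmetric] by (simp add: ennreal_mult mult.assoc)
   qed
   finally show ?thesis .
  qed
  have "orth_integral H = (SI w. (LI r. ennreal (\<bar>r\<bar> ^ (CARD('n) - 1)) * FF (r *\<^sub>R w)))"
   unfolding orth_integral_def using sphere_s by (intro nn_integral_cong_AE) (auto simp: inner)
  also have "... = ennreal c * (LI x. FF x)" by (rule c(2)) measurable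
  also have "(LI x. FF x) = ennreal (1 / 2) * perp_integral H"
   unfolding FF_def perp_integral_def by (rule nn_integral_cmult) measurable
  finally have "orth_integral H = ennreal c * (ennreal (1 / 2) * perp_integral H)" .
  moreover have "ennreal (c / 2) = ennreal c * ennreal (1 / 2)"
   using c(1) by (subst ennreal_mult[symmetric]) simp_all
  ultimately show ?thesis by (simp only: mult.assoc)
 qed
 then show ?thesis using c(1) by (intro exI[of _ "c / 2"]) auto
qed

lemma orth_integral_gauss_finite: "orth_integral (\<lambda>p. ennreal (gauss2 p)) < top"
proof -
 have "orth_integral (\<lambda>p. ennreal (gauss2 p)) \<le> (SI w. (LI (z :: real ^ 'n). ennreal (norm z ^ (CARD('n) - 2) * exp (- (norm z)\<^sup>2 / 2))))"
  unfolding orth_integral_def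
 proof (intro nn_integral_mono_AE, use sphere_s in eventually_elim, intro nn_integral_mono)
  fix w z :: "real ^ 'n" assume w: "norm w = 1"
  have "gauss2 ((w \<bullet> z) *\<^sub>R w, z - (w \<bullet> z) *\<^sub>R w) = exp (- (norm z)\<^sup>2 / 2)"
   unfolding gauss2_def using norm_perp_decomp[OF w, of z] by (simp add: field_simps)
  moreover have "\<bar>w \<bullet> z\<bar> \<le> norm z" using Cauchy_Schwarz_ineq2[of w z] w by simp
  ultimately show "ennreal (jac w z) * ennreal (gauss2 ((w \<bullet> z) *\<^sub>R w, z - (w \<bullet> z) *\<^sub>R w))
   \<le> ennreal (norm z ^ (CARD('n) - 2) * exp (- (norm z)\<^sup>2 / 2))"
   by (simp flip: ennreal_mult) (intro ennreal_leI mult_right_mono power_mono, auto)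
 qed
 also have "... = emeasure s UNIV * (\<integral>\<^sup>+z. ennreal (norm z ^ (CARD('n) - 2) * exp (- (norm z)\<^sup>2 / 2)) \<partial>(lborel :: (real ^ 'n) measure))"
  by (simp add: mult.commute)
 also have "... < top" using finite_s gauss_moment_finite[where 'a="real ^ 'n", of "CARD('n) - 2"]
  by (auto simp: ennreal_mult_less_top)
 finally show ?thesis .
qed

text \<open>For positive width the domain |a . y| < \<epsilon> is symmetric in a and y, which the
  limit is not in appearance; this is the access to the symmetry of delta (a . b). After squeezing,
  the integrand is dominated by the Gaussian at the projection, since the projection is never longer
  than the squeezed point.\<close>

lemma perp_integral_limit:
 assumes F: "continuous_on UNIV F" and F01: "\<And>p. 0 \<le> F p \<and> F p \<le> 1"
 shows "(\<lambda>n. ennreal (1 / (1 / Suc n)) * (LI a. (LI y. indicator {r. \<bar>r\<bar> < 1 / Suc n} (a \<bullet> y) * ennreal (F (a, y) * gauss2 (a, y)))))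
  \<longlonglongrightarrow> perp_integral (\<lambda>p. ennreal (F p * gauss2 p))"
proof -
 have [measurable]: "F \<in> borel_funs" by (rule borel_measurable_continuous_onI[OF F])
 define K where "K p = ennreal (F p * gauss2 p)" for p
 have K[measurable]: "K \<in> borel_funs" unfolding K_def by measurable
 have [measurable]: "K \<in> borel_measurable (borel \<Otimes>\<^sub>M borel)" using K by (simp only: borel_prod)
 define u where "u e p = indicator {r. \<bar>r\<bar> < 1} (fst p \<bullet> snd p) * K (fst p, perp (fst p) (snd p) + e *\<^sub>R (snd p - perp (fst p) (snd p)))" for e p
 have um[measurable]: "u e \<in> borel_funs" for e unfolding u_def by measurable
 let ?w = "\<lambda>p :: 'n vels. indicator {r. \<bar>r\<bar> < 1} (fst p \<bullet> snd p) * ennreal (gauss2 (fst p, perp (fst p) (snd p))) :: ennreal"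
 have "(\<lambda>n. (LI p. u (1 / Suc n) p)) \<longlonglongrightarrow> (LI p. u 0 p)"
 proof (rule nn_integral_dominated_convergence[where w="?w"])
  show "?w \<in> borel_measurable lborel" by measurable
  show "AE p in lborel. u (1 / Suc n) p \<le> ?w p" for n
  proof (rule AE_I2)
   fix p :: "'n vels"
   let ?q = "(fst p, perp (fst p) (snd p) + (1 / Suc n) *\<^sub>R (snd p - perp (fst p) (snd p)))"
   have "F ?q * gauss2 ?q \<le> 1 * gauss2 (fst p, perp (fst p) (snd p))"
   proof (rule mult_mono)
    show "gauss2 ?q \<le> gauss2 (fst p, perp (fst p) (snd p))"
     unfolding gauss2_def using norm_perp_le[of "fst p" "snd p" "1 / Suc n"] by simp
   qed (use F01 in \<open>auto simp: gauss2_def\<close>)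
   then show "u (1 / Suc n) p \<le> ?w p" unfolding u_def K_def by (intro mult_left_mono ennreal_leI) auto
  qed
  obtain c where c: "c > 0" "\<And>H. H \<in> borel_funs \<Longrightarrow> orth_integral H = ennreal c * perp_integral H"
   using orth_integral_perp by blast
  have "(LI p. ?w p) = perp_integral (\<lambda>p. ennreal (gauss2 p))"
   unfolding perp_integral_def by (subst nn_integral_lborel_pair) simp_all
  moreover have "ennreal c * perp_integral (\<lambda>p. ennreal (gauss2 p)) < top"
   using orth_integral_gauss_finite c(2)[of "\<lambda>p. ennreal (gauss2 p)"] by simp
  ultimately show "(LI p. ?w p) < \<infinity>"
   using c(1) by (auto simp: ennreal_mult_less_top)
  show "AE p in lborel. (\<lambda>n. u (1 / Suc n) p) \<longlonglongrightarrow> u 0 p"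
  proof (rule AE_I2)
   fix p :: "'n vels"
   have "(\<lambda>n. (fst p, perp (fst p) (snd p) + (1 / Suc n) *\<^sub>R (snd p - perp (fst p) (snd p)))) \<longlonglongrightarrow> (fst p, perp (fst p) (snd p) + 0 *\<^sub>R (snd p - perp (fst p) (snd p)))"
    by (intro tendsto_intros LIMSEQ_Suc[OF lim_1_over_n])
   moreover have "continuous_on UNIV (\<lambda>p. F p * gauss2 p)" unfolding gauss2_def by (intro continuous_intros F) simp_all
   ultimately have "(\<lambda>n. K (fst p, perp (fst p) (snd p) + (1 / Suc n) *\<^sub>R (snd p - perp (fst p) (snd p)))) \<longlonglongrightarrow> K (fst p, perp (fst p) (snd p) + 0 *\<^sub>R (snd p - perp (fst p) (snd p)))"
    unfolding K_def by (intro tendsto_ennrealI) (auto intro: continuous_on_tendsto_compose)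
   then show "(\<lambda>n. u (1 / Suc n) p) \<longlonglongrightarrow> u 0 p"
    unfolding u_def by (cases "\<bar>fst p \<bullet> snd p\<bar> < 1") simp_all
  qed
 qed measurable
 moreover have "(LI p. u 0 p) = perp_integral K"
  unfolding perp_integral_def by (subst nn_integral_lborel_pair) (simp_all add: u_def)
 moreover have "(LI p. u e p) = ennreal (1 / e) * (LI a. (LI y. indicator {r. \<bar>r\<bar> < e} (a \<bullet> y) * K (a, y)))" if e: "0 < e" for e
 proof -
  have "(LI p. u e p) = (LI a. (LI y. u e (a, y)))"
   by (rule nn_integral_lborel_pair) measurable
  also have "... = (LI a. ennreal (1 / e) * (LI y. indicator {r. \<bar>r\<bar> < e} (a \<bullet> y) * K (a, y)))"
  proof (rule nn_integral_cong_AE, rule AE_mp[OF AE_lborel_singleton[of 0]], rule AE_I2, rule impI)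
   fix a :: "real ^ 'n" assume a: "a \<noteq> 0"
   show "(LI y. u e (a, y)) = ennreal (1 / e) * (LI y. indicator {r. \<bar>r\<bar> < e} (a \<bullet> y) * K (a, y))"
    unfolding u_def fst_conv snd_conv by (rule nn_integral_squeeze[OF _ a e, of "\<lambda>y. K (a, y)"]) measurable
  qed
  also have "... = ennreal (1 / e) * (LI a. (LI y. indicator {r. \<bar>r\<bar> < e} (a \<bullet> y) * K (a, y)))"
   by (rule nn_integral_cmult) measurable
  finally show ?thesis .
 qed
 ultimately show ?thesis unfolding K_def[symmetric] by simp
qed

lemma perp_integral_swap:
 assumes F: "continuous_on UNIV F" and F01: "\<And>p. 0 \<le> F p \<and> F p \<le> 1"
 shows "perp_integral (\<lambda>p. ennreal (F (prod.swap p) * gauss2 p)) = perp_integral (\<lambda>p. ennreal (F p * gauss2 p))"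
proof (rule LIMSEQ_unique)
 have [measurable]: "F \<in> borel_funs" by (rule borel_measurable_continuous_onI[OF F])
 have [measurable]: "(\<lambda>p. F (fst p, snd p)) \<in> borel_measurable (borel \<Otimes>\<^sub>M borel)" by (simp add: borel_prod)
 let ?X = "\<lambda>F n. ennreal (1 / (1 / Suc n)) * (LI a. (LI y. indicator {r. \<bar>r\<bar> < 1 / Suc n} (a \<bullet> y) * ennreal (F (a, y) * gauss2 (a, y :: real ^ 'n))))"
 have "continuous_on UNIV (\<lambda>p. F (prod.swap p))"
  by (rule continuous_on_compose2[OF F]) (auto intro!: continuous_intros simp: prod.swap_def)
 then show "?X (\<lambda>p. F (prod.swap p)) \<longlonglongrightarrow> perp_integral (\<lambda>p. ennreal (F (prod.swap p) * gauss2 p))"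
  using F01 by (intro perp_integral_limit) auto
 have "?X (\<lambda>p. F (prod.swap p)) n = ?X F n" for n
 proof -
  have "(LI a. (LI y. indicator {r. \<bar>r\<bar> < 1 / Suc n} (a \<bullet> y) * ennreal (F (y, a) * gauss2 (a, y :: real ^ 'n))))
   = (LI y. (LI a. indicator {r. \<bar>r\<bar> < 1 / Suc n} (a \<bullet> y) * ennreal (F (y, a) * gauss2 (a, y :: real ^ 'n))))"
   by (rule nn_integral_lborel_swap) measurable
  also have "... = (LI y. (LI a. indicator {r. \<bar>r\<bar> < 1 / Suc n} (y \<bullet> a) * ennreal (F (y, a) * gauss2 (y, a :: real ^ 'n))))"
  proof (intro nn_integral_cong)
   fix y a :: "real ^ 'n"
   have "gauss2 (a, y) = gauss2 (y, a)" using gauss2_swap[of "(y, a)"] by simp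
   then show "indicator {r. \<bar>r\<bar> < 1 / Suc n} (a \<bullet> y) * ennreal (F (y, a) * gauss2 (a, y)) = indicator {r. \<bar>r\<bar> < 1 / Suc n} (y \<bullet> a) * ennreal (F (y, a) * gauss2 (y, a))"
    by (simp only: inner_commute[of a y])
  qed
  finally show ?thesis by simp
 qed
 then show "?X (\<lambda>p. F (prod.swap p)) \<longlonglongrightarrow> perp_integral (\<lambda>p. ennreal (F p * gauss2 p))"
  using perp_integral_limit[OF F F01] by simp
qed

text \<open>The Gaussian makes the measure finite, so that continuous test functions determine it.
  It is divided out again in \<open>orth_integral_swap\<close>.\<close>

definition orth_measure :: "('n vels) measure" where
 "orth_measure = distr (density dir_measure (\<lambda>p. ennreal (\<bar>fst p \<bullet> snd p\<bar> ^ (CARD('n) - 2) * gauss2 (orth_pair p)))) borel orth_pair"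

lemma sets_orth_measure[simp, measurable_cong]: "sets orth_measure = sets borel"
 by (simp add: orth_measure_def)

lemma nn_integral_orth_measure:
 assumes [measurable]: "H \<in> borel_funs"
 shows "(\<integral>\<^sup>+p. H p \<partial>orth_measure) = orth_integral (\<lambda>p. ennreal (gauss2 p) * H p)"
proof -
 have "(\<integral>\<^sup>+p. H p \<partial>orth_measure) = (\<integral>\<^sup>+p. ennreal (\<bar>fst p \<bullet> snd p\<bar> ^ (CARD('n) - 2) * gauss2 (orth_pair p)) * H (orth_pair p) \<partial>dir_measure)"
  unfolding orth_measure_def by (subst nn_integral_distr) (simp_all add: nn_integral_density)
 also have "... = (\<integral>\<^sup>+p. ennreal (\<bar>fst p \<bullet> snd p\<bar> ^ (CARD('n) - 2)) * (ennreal (gauss2 (orth_pair p)) * H (orth_pair p)) \<partial>dir_measure)"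
  by (intro nn_integral_cong) (simp add: ennreal_mult mult.assoc)
 also have "... = orth_integral (\<lambda>p. ennreal (gauss2 p) * H p)"
  by (subst orth_integral_dir) simp_all
 finally show ?thesis .
qed

lemma swap_measurable[measurable]: "prod.swap \<in> borel_measurable (borel :: ('a::topological_space \<times> 'b::topological_space) measure)"
 unfolding prod.swap_def by (intro borel_measurable_continuous_onI continuous_intros)

lemma distr_swap_orth_measure: "distr orth_measure borel prod.swap = orth_measure"
proof (rule finite_measure_eqI_continuous)
 have "emeasure (distr orth_measure borel prod.swap) UNIV = (\<integral>\<^sup>+p. 1 \<partial>orth_measure)"
  using sets_eq_imp_space_eq[OF sets_orth_measure] by (subst emeasure_distr) simp_all
 also have "... < top" using orth_integral_gauss_finite by (subst nn_integral_orth_measure) simp_all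
 finally show "emeasure (distr orth_measure borel prod.swap) UNIV < top" .
 obtain c where c: "c > 0" "\<And>H. H \<in> borel_funs \<Longrightarrow> orth_integral H = ennreal c * perp_integral H"
  using orth_integral_perp by blast
 fix F :: "'n vels \<Rightarrow> real"
 assume F: "continuous_on UNIV F" "\<And>x. 0 \<le> F x \<and> F x \<le> 1"
 have [measurable]: "F \<in> borel_funs" by (rule borel_measurable_continuous_onI[OF F(1)])
 have [measurable]: "(\<lambda>p. F (prod.swap p)) \<in> borel_funs"
  by (rule measurable_compose[OF swap_measurable]) simp
 have *: "(\<integral>\<^sup>+p. ennreal (f p) \<partial>orth_measure) = ennreal c * perp_integral (\<lambda>p. ennreal (f p * gauss2 p))"
  if [measurable]: "f \<in> borel_funs" and "\<And>p. 0 \<le> f p" for f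
 proof -
  have "ennreal (gauss2 p) * ennreal (f p) = ennreal (f p * gauss2 p)" for p
   using that(2)[of p] gauss2_pos[of p] by (subst mult.commute, subst ennreal_mult) simp_all
  then show ?thesis by (subst nn_integral_orth_measure) (simp_all add: c(2))
 qed
 have "(\<integral>\<^sup>+x. ennreal (F x) \<partial>distr orth_measure borel prod.swap) = (\<integral>\<^sup>+p. ennreal (F (prod.swap p)) \<partial>orth_measure)"
  by (subst nn_integral_distr) simp_all
 also have "... = (\<integral>\<^sup>+p. ennreal (F p) \<partial>orth_measure)"
  using F(2) by (simp add: * perp_integral_swap[OF F])
 finally show "(\<integral>\<^sup>+x. ennreal (F x) \<partial>distr orth_measure borel prod.swap) = (\<integral>\<^sup>+p. ennreal (F p) \<partial>orth_measure)" .
qed simp_all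

text \<open>Exchanging the legs a and b exchanges the two outgoing velocities of a collision. The
  symmetry is hidden in the definition, where a is parallel to w and b orthogonal to it.\<close>

lemma orth_integral_swap:
 assumes H[measurable]: "H \<in> borel_funs"
 shows "orth_integral (\<lambda>p. H (prod.swap p)) = orth_integral H"
proof -
 have [measurable]: "(\<lambda>p. H (prod.swap p)) \<in> borel_funs"
  by (rule measurable_compose[OF swap_measurable]) simp
 have g: "ennreal (gauss2 p) * (ennreal (1 / gauss2 p) * h) = h" for p :: "'n vels" and h
 proof -
  have "ennreal (gauss2 p) * ennreal (1 / gauss2 p) = 1"
   using gauss2_pos[of p] by (subst ennreal_mult[symmetric]) simp_all
  then show ?thesis by (simp only: mult.assoc[symmetric] mult_1)
 qed
 have "orth_integral (\<lambda>p. H (prod.swap p)) = (\<integral>\<^sup>+p. ennreal (1 / gauss2 p) * H (prod.swap p) \<partial>orth_measure)"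
  by (subst nn_integral_orth_measure) (simp_all add: g)
 also have "... = (\<integral>\<^sup>+p. ennreal (1 / gauss2 p) * H p \<partial>distr orth_measure borel prod.swap)"
  by (subst nn_integral_distr) (simp_all add: gauss2_swap)
 also have "... = orth_integral H"
  unfolding distr_swap_orth_measure by (subst nn_integral_orth_measure) (simp_all add: g)
 finally show ?thesis .
qed

end

section \<open>The Gaussian law of orthogonal collision legs\<close>

text \<open>Integrating a Gaussian against delta (a . b) da db over b leaves a Gaussian in a divided
  by |a|. The factor |a| removes this singularity and |b| does the same for the other leg. The
  factor |a| is also what allows a comparison with the collision rate.\<close>

definition wgt :: "'a::real_normed_vector \<times> 'a \<Rightarrow> real" where
 "wgt p = norm (fst p) * norm (snd p) * gauss2 p"

lemma wgt_nonneg[simp]: "0 \<le> wgt p" by (simp add: wgt_def)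

lemma wgt_swap: "wgt (prod.swap p) = wgt p" unfolding wgt_def gauss2_swap by simp

lemma wgt_measurable[measurable]: "wgt \<in> borel_measurable (borel :: ('a::euclidean_space \<times> 'a) measure)"
 unfolding wgt_def by measurable

context haar_sphere begin

text \<open>The integral of |b| exp (- |b|^2 / 2) over the hyperplane orthogonal to w, in strip
  form.\<close>

definition strip_const :: "real ^ 'n \<Rightarrow> ennreal" where
 "strip_const w = (LI z. indicator {0..1} (w \<bullet> z) * ennreal (norm (z - (w \<bullet> z) *\<^sub>R w) * exp (- (norm (z - (w \<bullet> z) *\<^sub>R w))\<^sup>2 / 2)))"

lemma strip_const_eq:
 assumes "norm w = norm w'"
 shows "strip_const w = strip_const w'"
proof -
 obtain A where A: "rotation_matrix A" "A *v w = w'" "orthogonal_transformation (\<lambda>z. A *v z)"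
  using rotation_to[OF assms] .
 have i: "w' \<bullet> (A *v z) = w \<bullet> z" for z using A(2,3) by (metis orthogonal_transformation_def)
 have n: "norm (A *v z - (w \<bullet> z) *\<^sub>R w') = norm (z - (w \<bullet> z) *\<^sub>R w)" for z
 proof -
  have "A *v z - (w \<bullet> z) *\<^sub>R w' = A *v (z - (w \<bullet> z) *\<^sub>R w)"
   by (simp add: A(2)[symmetric] matrix_vector_mult_diff_distrib matrix_vector_mult_scaleR)
  then show ?thesis using A(3) by (simp add: orthogonal_transformation_norm)
 qed
 have "strip_const w' = (LI z. indicator {0..1} (w' \<bullet> (A *v z)) * ennreal (norm (A *v z - (w' \<bullet> (A *v z)) *\<^sub>R w') * exp (- (norm (A *v z - (w' \<bullet> (A *v z)) *\<^sub>R w'))\<^sup>2 / 2)))"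
  unfolding strip_const_def
  by (rule nn_integral_lborel_orthogonal[OF A(3), symmetric, where F="\<lambda>z. indicator {0..1} (w' \<bullet> z) * ennreal (norm (z - (w' \<bullet> z) *\<^sub>R w') * exp (- (norm (z - (w' \<bullet> z) *\<^sub>R w'))\<^sup>2 / 2))"]) measurable
 then show ?thesis unfolding i n strip_const_def[symmetric] by simp
qed

lemma strip_const_finite:
 assumes w: "norm w = 1"
 shows "strip_const w < top"
proof -
 have "strip_const w \<le> (LI (z :: real ^ 'n). ennreal (exp (1/2)) * ennreal (norm z ^ 1 * exp (- (norm z)\<^sup>2 / 2)))"
  unfolding strip_const_def
 proof (rule nn_integral_mono)
  fix z :: "real ^ 'n"
  let ?b = "z - (w \<bullet> z) *\<^sub>R w"
  show "indicator {0..1} (w \<bullet> z) * ennreal (norm ?b * exp (- (norm ?b)\<^sup>2 / 2)) \<le> ennreal (exp (1/2)) * ennreal (norm z ^ 1 * exp (- (norm z)\<^sup>2 / 2))"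
  proof (cases "0 \<le> w \<bullet> z \<and> w \<bullet> z \<le> 1")
   case True
   have e: "(w \<bullet> z)\<^sup>2 + (norm ?b)\<^sup>2 = (norm z)\<^sup>2" using norm_perp_decomp[OF w, of z] w by simp
   have "(w \<bullet> z)\<^sup>2 \<le> 1" using True by (simp add: power_le_one)
   then have "- (norm ?b)\<^sup>2 / 2 \<le> 1 / 2 + - (norm z)\<^sup>2 / 2" using e by simp
   then have "exp (- (norm ?b)\<^sup>2 / 2) \<le> exp (1 / 2) * exp (- (norm z)\<^sup>2 / 2)" unfolding exp_add[symmetric] by simp
   moreover have "(norm ?b)\<^sup>2 \<le> (norm z)\<^sup>2" using e zero_le_power2[of "w \<bullet> z"] by linarith
   then have "norm ?b \<le> norm z" by (rule power2_le_imp_le) simp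
   ultimately have "norm ?b * exp (- (norm ?b)\<^sup>2 / 2) \<le> norm z * (exp (1 / 2) * exp (- (norm z)\<^sup>2 / 2))" by (intro mult_mono) auto
   then have "norm ?b * exp (- (norm ?b)\<^sup>2 / 2) \<le> exp (1 / 2) * (norm z ^ 1 * exp (- (norm z)\<^sup>2 / 2))" by (simp only: power_one_right mult_ac)
   then have "ennreal (norm ?b * exp (- (norm ?b)\<^sup>2 / 2)) \<le> ennreal (exp (1 / 2) * (norm z ^ 1 * exp (- (norm z)\<^sup>2 / 2)))" by (rule ennreal_leI)
   also have "... = ennreal (exp (1 / 2)) * ennreal (norm z ^ 1 * exp (- (norm z)\<^sup>2 / 2))" by (rule ennreal_mult) simp_all
   finally show ?thesis using True by simp
  qed simp
 qed
 also have "... = ennreal (exp (1/2)) * (LI (z :: real ^ 'n). ennreal (norm z ^ 1 * exp (- (norm z)\<^sup>2 / 2)))"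
  by (rule nn_integral_cmult) measurable
 also have "... < top" using gauss_moment_finite[where 'a="real ^ 'n", of 1] by (simp only: ennreal_mult_less_top) simp
 finally show ?thesis .
qed

text \<open>On a line the hyperplane would shrink to the origin and the constant to 0. From
  dimension two on there is a nonzero f orthogonal to w, and the integrand is positive in a
  neighbourhood of w / 2 + f.\<close>

lemma strip_const_pos:
 assumes w: "norm w = 1"
 shows "strip_const w \<noteq> 0"
proof
 assume "strip_const w = 0"
 then have "AE z in lborel. indicator {0..1} (w \<bullet> z) * ennreal (norm (z - (w \<bullet> z) *\<^sub>R w) * exp (- (norm (z - (w \<bullet> z) *\<^sub>R w))\<^sup>2 / 2)) = 0"
  unfolding strip_const_def by (subst (asm) nn_integral_0_iff_AE) measurable
 then have ae: "AE z in lborel. z \<notin> {z. 0 < w \<bullet> z \<and> w \<bullet> z < 1 \<and> z - (w \<bullet> z) *\<^sub>R w \<noteq> 0}" (is "AE z in lborel. z \<notin> ?U")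
  by eventually_elim (auto simp: ennreal_eq_0_iff mult_le_0_iff)
 have o: "open ?U"
  by (intro open_Collect_conj open_Collect_less open_Collect_neq continuous_intros)
 obtain f where f: "f \<noteq> 0" "orthogonal w f"
  using orthogonal_to_vector_exists[of w] card2 by auto
 have ww: "w \<bullet> w = 1" using w by (simp add: norm_eq_1)
 have "(1/2) *\<^sub>R w + f \<in> ?U" using f ww by (simp add: orthogonal_def inner_add_right)
 then obtain r where r: "r > 0" "ball ((1/2) *\<^sub>R w + f) r \<subseteq> ?U" using o open_contains_ball by blast
 have "emeasure lborel (ball ((1/2) *\<^sub>R w + f) r) \<le> emeasure lborel ?U" using r o by (intro emeasure_mono) auto
 moreover have "emeasure lborel ?U = 0" using ae o by (subst AE_iff_measurable[symmetric, where P="\<lambda>z. z \<notin> ?U"]) auto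
 ultimately show False using emeasure_lborel_ball_pos[OF r(1), of "(1/2) *\<^sub>R w + f"] by simp
qed

lemma orth_gauss_fst:
 "\<exists>I>0. \<forall>F \<in> borel_funs. orth_integral (\<lambda>p. ennreal (wgt p) * F (fst p)) = ennreal I * (LI a. ennreal (exp (- (norm a)\<^sup>2 / 2)) * F a)"
proof -
 obtain c where c: "c > 0" "\<And>F. F \<in> borel_funs \<Longrightarrow> (SI w. (LI r. ennreal (\<bar>r\<bar> ^ (CARD('n) - 1)) * F (r *\<^sub>R w)))
  = ennreal c * (LI x. F x)" using polar by blast
 obtain e :: "real ^ 'n" where e: "norm e = 1" using vector_choose_size[of 1] by auto
 define I where "I = enn2real (strip_const e)"
 have I: "strip_const e = ennreal I" "I > 0"
  using strip_const_finite[OF e] strip_const_pos[OF e]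
  by (auto simp: I_def enn2real_positive_iff less_top[symmetric] zero_less_iff_neq_zero)
 have d: "\<bar>r\<bar> ^ (CARD('n) - 2) * \<bar>r\<bar> = \<bar>r\<bar> ^ (CARD('n) - 1)" for r :: real
 proof -
  have "CARD('n) - 1 = Suc (CARD('n) - 2)" using card2 by simp
  then show ?thesis by simp
 qed
 have "orth_integral (\<lambda>p. ennreal (wgt p) * F (fst p)) = ennreal (I * c) * (LI a. ennreal (exp (- (norm a)\<^sup>2 / 2)) * F a)"
  if [measurable]: "F \<in> borel_funs" for F
 proof -
  let ?G = "\<lambda>a :: real ^ 'n. ennreal (exp (- (norm a)\<^sup>2 / 2)) * F a"
  have inner: "(LI z. ennreal (jac w z) * (ennreal (wgt ((w \<bullet> z) *\<^sub>R w, z - (w \<bullet> z) *\<^sub>R w)) * F ((w \<bullet> z) *\<^sub>R w)))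
   = ennreal I * (LI r. ennreal (\<bar>r\<bar> ^ (CARD('n) - 1)) * ?G (r *\<^sub>R w))" if w: "norm w = 1" for w
  proof -
   let ?P = "\<lambda>z. z - (w \<bullet> z) *\<^sub>R w"
   let ?h = "\<lambda>b :: real ^ 'n. ennreal (norm b * exp (- (norm b)\<^sup>2 / 2))"
   have prod: "ennreal (\<bar>r\<bar> ^ (CARD('n) - 2)) * (ennreal (wgt (r *\<^sub>R w, b)) * F (r *\<^sub>R w)) = ?h b * (ennreal (\<bar>r\<bar> ^ (CARD('n) - 1)) * ?G (r *\<^sub>R w))" for r b
   proof -
    have "\<bar>r\<bar> ^ (CARD('n) - 2) * wgt (r *\<^sub>R w, b) = (\<bar>r\<bar> ^ (CARD('n) - 2) * \<bar>r\<bar>) * (norm b * (exp (- (norm (r *\<^sub>R w))\<^sup>2 / 2) * exp (- (norm b)\<^sup>2 / 2)))"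
     unfolding exp_add[symmetric] using w by (simp add: wgt_def gauss2_def mult_ac)
    also have "... = (norm b * exp (- (norm b)\<^sup>2 / 2)) * (\<bar>r\<bar> ^ (CARD('n) - 1) * exp (- (norm (r *\<^sub>R w))\<^sup>2 / 2))"
     unfolding d by (simp only: mult_ac)
    finally have "ennreal (\<bar>r\<bar> ^ (CARD('n) - 2)) * ennreal (wgt (r *\<^sub>R w, b)) = ?h b * (ennreal (\<bar>r\<bar> ^ (CARD('n) - 1)) * ennreal (exp (- (norm (r *\<^sub>R w))\<^sup>2 / 2)))"
     by (simp only: ennreal_mult[symmetric] zero_le_power abs_ge_zero wgt_nonneg norm_ge_zero exp_ge_zero mult_nonneg_nonneg)
    then show ?thesis by (simp only: mult.assoc[symmetric])
   qed
   have "(LI z. ennreal (jac w z) * (ennreal (wgt ((w \<bullet> z) *\<^sub>R w, ?P z)) * F ((w \<bullet> z) *\<^sub>R w)))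
    = (LI z. ?h (?P z) * (ennreal (\<bar>w \<bullet> z\<bar> ^ (CARD('n) - 1)) * ?G ((w \<bullet> z) *\<^sub>R w)))"
    unfolding prod ..
   also have "... = (LI z. indicator {0..1} (w \<bullet> z) * (LI r. ?h (?P z) * (ennreal (\<bar>r\<bar> ^ (CARD('n) - 1)) * ?G (r *\<^sub>R w))))"
    using nn_integral_split_component[OF _ w, of "\<lambda>q. ?h (snd q) * (ennreal (\<bar>fst q\<bar> ^ (CARD('n) - 1)) * ?G (fst q *\<^sub>R w))"] by simp
   also have "... = (LI z. indicator {0..1} (w \<bullet> z) * ?h (?P z) * (LI r. ennreal (\<bar>r\<bar> ^ (CARD('n) - 1)) * ?G (r *\<^sub>R w)))"
    by (intro nn_integral_cong, subst nn_integral_cmult) (auto simp: mult.assoc)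
   also have "... = strip_const w * (LI r. ennreal (\<bar>r\<bar> ^ (CARD('n) - 1)) * ?G (r *\<^sub>R w))"
    unfolding strip_const_def by (rule nn_integral_multc) measurable
   also have "strip_const w = ennreal I" using strip_const_eq[of w e] w e I by simp
   finally show ?thesis .
  qed
  have "orth_integral (\<lambda>p. ennreal (wgt p) * F (fst p)) = (SI w. ennreal I * (LI r. ennreal (\<bar>r\<bar> ^ (CARD('n) - 1)) * ?G (r *\<^sub>R w)))"
   unfolding orth_integral_def using sphere_s by (intro nn_integral_cong_AE) (auto simp: inner)
  also have "... = ennreal I * (SI w. (LI r. ennreal (\<bar>r\<bar> ^ (CARD('n) - 1)) * ?G (r *\<^sub>R w)))"
   by (rule nn_integral_cmult) measurable
  also have "... = ennreal I * (ennreal c * (LI a. ?G a))"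
   by (subst c(2)) measurable
  finally show ?thesis using I c by (simp add: ennreal_mult mult.assoc)
 qed
 then show ?thesis using I c by (intro exI[of _ "I * c"]) auto
qed

text \<open>By Pythagoras the Gaussian depends on z = a + b alone. If t is the cosine of the angle
  between w and z, the other factors are |z| ^ d and |t| ^ (d - 1) * sqrt (1 - t^2); the average of
  the latter over w is the same for all z by rotation invariance.\<close>

lemma orth_gauss_sum:
 "\<exists>c\<ge>0. \<forall>F \<in> borel_funs. orth_integral (\<lambda>p. ennreal (wgt p) * F (fst p + snd p)) = (LI z. ennreal (c * norm z ^ CARD('n) * exp (- (norm z)\<^sup>2 / 2)) * F z)"
proof -
 obtain e :: "real ^ 'n" where e: "norm e = 1" using vector_choose_size[of 1] by auto
 define g where "g t = \<bar>t\<bar> ^ (CARD('n) - 1) * sqrt (1 - t\<^sup>2)" for t :: real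
 define c where "c = enn2real (SI w. ennreal (g (w \<bullet> e)))"
 have "(SI w. ennreal (g (w \<bullet> e))) \<le> (SI w. 1)"
 proof (intro nn_integral_mono_AE, use sphere_s in eventually_elim)
  fix w :: "real ^ 'n" assume "norm w = 1"
  then have "\<bar>w \<bullet> e\<bar> \<le> 1" using Cauchy_Schwarz_ineq2[of w e] e by simp
  then have "g (w \<bullet> e) \<le> 1 * 1" unfolding g_def by (intro mult_mono power_le_one) (auto simp: abs_square_le_1)
  then show "ennreal (g (w \<bullet> e)) \<le> 1" by simp
 qed
 also have "... < top" using finite_s by simp
 finally have c: "(SI w. ennreal (g (w \<bullet> e))) = ennreal c" by (simp add: c_def)
 have c0: "c \<ge> 0" by (simp add: c_def)
 have "orth_integral (\<lambda>p. ennreal (wgt p) * F (fst p + snd p)) = (LI z. ennreal (c * norm z ^ CARD('n) * exp (- (norm z)\<^sup>2 / 2)) * F z)"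
  if [measurable]: "F \<in> borel_funs" for F
 proof -
  have "orth_integral (\<lambda>p. ennreal (wgt p) * F (fst p + snd p))
   = (SI w. (LI z. ennreal (jac w z) * (ennreal (wgt ((w \<bullet> z) *\<^sub>R w, z - (w \<bullet> z) *\<^sub>R w)) * F z)))"
   unfolding orth_integral_def by simp
  also have "... = (LI z. (SI w. ennreal (jac w z) * (ennreal (wgt ((w \<bullet> z) *\<^sub>R w, z - (w \<bullet> z) *\<^sub>R w)) * F z)))"
   by (rule nn_integral_swap[OF s.sigma_finite_measure_axioms sigma_finite_lborel]) measurable
  also have "... = (LI z. ennreal (c * norm z ^ CARD('n) * exp (- (norm z)\<^sup>2 / 2)) * F z)"
  proof (rule nn_integral_cong_AE, rule AE_mp[OF AE_lborel_singleton[of 0]], rule AE_I2, rule impI)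
   fix z :: "real ^ 'n" assume z: "z \<noteq> 0"
   let ?k = "norm z ^ CARD('n) * exp (- (norm z)\<^sup>2 / 2)"
   have pt: "jac w z * wgt ((w \<bullet> z) *\<^sub>R w, z - (w \<bullet> z) *\<^sub>R w) = ?k * g (w \<bullet> (z /\<^sub>R norm z))" if w: "norm w = 1" for w
   proof -
    let ?t = "w \<bullet> (z /\<^sub>R norm z)"
    have t: "w \<bullet> z = norm z * ?t" using z by simp
    have b: "(w \<bullet> z)\<^sup>2 + (norm (z - (w \<bullet> z) *\<^sub>R w))\<^sup>2 = (norm z)\<^sup>2" using norm_perp_decomp[OF w, of z] w by simp
    then have "norm (z - (w \<bullet> z) *\<^sub>R w) = sqrt ((norm z)\<^sup>2 - (w \<bullet> z)\<^sup>2)" by (intro real_sqrt_unique[symmetric]) auto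
    also have "(norm z)\<^sup>2 - (w \<bullet> z)\<^sup>2 = (norm z)\<^sup>2 * (1 - ?t\<^sup>2)" unfolding t by (simp add: power_mult_distrib algebra_simps)
    finally have nb: "norm (z - (w \<bullet> z) *\<^sub>R w) = norm z * sqrt (1 - ?t\<^sup>2)" by (simp add: real_sqrt_mult)
    have ge: "gauss2 ((w \<bullet> z) *\<^sub>R w, z - (w \<bullet> z) *\<^sub>R w) = exp (- (norm z)\<^sup>2 / 2)"
     unfolding gauss2_def using norm_perp_decomp[OF w, of z] by (simp add: field_simps)
    obtain m where m: "CARD('n) = Suc (Suc m)" using card2 by (metis Suc_le_D numeral_2_eq_2 Suc_le_mono)
    have tz: "\<bar>w \<bullet> z\<bar> = norm z * \<bar>?t\<bar>" unfolding t abs_mult by simp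
    have "(norm z * \<bar>?t\<bar>) ^ m * (norm z * \<bar>?t\<bar> * (norm z * q)) = norm z ^ Suc (Suc m) * (\<bar>?t\<bar> ^ Suc m * q)" for q
     by (simp add: power_mult_distrib)
    then have "jac w z * (norm ((w \<bullet> z) *\<^sub>R w) * norm (z - (w \<bullet> z) *\<^sub>R w)) = norm z ^ CARD('n) * g ?t"
     unfolding nb g_def norm_scaleR w tz m mult_1_right by (simp only: diff_Suc_Suc diff_zero numeral_2_eq_2 One_nat_def)
    then show ?thesis unfolding wgt_def fst_conv snd_conv ge by (simp only: mult.assoc[symmetric]) (simp only: mult_ac)
   qed
   have "(SI w. ennreal (jac w z) * (ennreal (wgt ((w \<bullet> z) *\<^sub>R w, z - (w \<bullet> z) *\<^sub>R w)) * F z))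
    = (SI w. ennreal (g (w \<bullet> (z /\<^sub>R norm z))) * (ennreal ?k * F z))"
   proof (intro nn_integral_cong_AE, use sphere_s in eventually_elim)
    fix w :: "real ^ 'n" assume w: "norm w = 1"
    have "ennreal (jac w z) * ennreal (wgt ((w \<bullet> z) *\<^sub>R w, z - (w \<bullet> z) *\<^sub>R w)) = ennreal (?k * g (w \<bullet> (z /\<^sub>R norm z)))"
     unfolding pt[OF w, symmetric] by (rule ennreal_mult[symmetric]) simp_all
    also have "... = ennreal ?k * ennreal (g (w \<bullet> (z /\<^sub>R norm z)))" by (rule ennreal_mult') simp
    finally have "ennreal (jac w z) * ennreal (wgt ((w \<bullet> z) *\<^sub>R w, z - (w \<bullet> z) *\<^sub>R w)) * F z
     = ennreal ?k * ennreal (g (w \<bullet> (z /\<^sub>R norm z))) * F z" by (rule arg_cong)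
    then show "ennreal (jac w z) * (ennreal (wgt ((w \<bullet> z) *\<^sub>R w, z - (w \<bullet> z) *\<^sub>R w)) * F z)
     = ennreal (g (w \<bullet> (z /\<^sub>R norm z))) * (ennreal ?k * F z)" by (simp only: mult.assoc mult.left_commute)
   qed
   also have "... = (SI w. ennreal (g (w \<bullet> (z /\<^sub>R norm z)))) * (ennreal ?k * F z)"
    unfolding g_def by (rule nn_integral_multc) measurable
   also have "(SI w. ennreal (g (w \<bullet> (z /\<^sub>R norm z)))) = ennreal c"
    unfolding c[symmetric] g_def by (rule nn_integral_s_inner) (use z e in auto)
   also have "ennreal c * (ennreal ?k * F z) = ennreal (c * norm z ^ CARD('n) * exp (- (norm z)\<^sup>2 / 2)) * F z"
    using c0 by (simp add: ennreal_mult mult.assoc)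
   finally show "(SI w. ennreal (jac w z) * (ennreal (wgt ((w \<bullet> z) *\<^sub>R w, z - (w \<bullet> z) *\<^sub>R w)) * F z))
    = ennreal (c * norm z ^ CARD('n) * exp (- (norm z)\<^sup>2 / 2)) * F z" .
  qed
  finally show ?thesis .
 qed
 then show ?thesis using c0 by (intro exI[of _ c]) auto
qed

definition tau_mass :: real where
 "tau_mass = enn2real (orth_integral (\<lambda>p. ennreal (wgt p)))"

definition tau :: "('n vels) measure" where
 "tau = distr (density dir_measure (\<lambda>p. ennreal (\<bar>fst p \<bullet> snd p\<bar> ^ (CARD('n) - 2) * wgt (orth_pair p) / tau_mass))) borel orth_pair"

abbreviation (input) leg_integral_real :: "((real ^ 'n) \<times> (real ^ 'n) \<Rightarrow> real) \<Rightarrow> real" (binder "BT " 10) where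
 "leg_integral_real f \<equiv> integral\<^sup>L tau f"
abbreviation (input) leg_integral :: "((real ^ 'n) \<times> (real ^ 'n) \<Rightarrow> ennreal) \<Rightarrow> ennreal" (binder "TI " 10) where
 "leg_integral f \<equiv> nn_integral tau f"

lemma sets_tau[simp, measurable_cong]: "sets tau = sets borel" by (simp add: tau_def)

lemma space_tau[simp]: "space tau = UNIV" using sets_eq_imp_space_eq[OF sets_tau] by simp

definition gauss_const :: real where
 "gauss_const = enn2real (LE x. exp (- (norm (x :: real ^ 'n))\<^sup>2 / 2))"

lemma gauss_const: "(LE x. exp (- (norm (x :: real ^ 'n))\<^sup>2 / 2)) = ennreal gauss_const" "gauss_const > 0"
proof -
 let ?I = "(LE x. exp (- (norm (x :: real ^ 'n))\<^sup>2 / 2))"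
 have fin: "?I < top" using gauss_moment_finite[where 'a="real ^ 'n", of 0] by simp
 then show "?I = ennreal gauss_const" by (simp add: gauss_const_def)
 have "?I \<noteq> 0"
 proof
  assume "?I = 0"
  then have "AE x in lborel. ennreal (exp (- (norm (x :: real ^ 'n))\<^sup>2 / 2)) = 0"
   by (subst (asm) nn_integral_0_iff_AE) measurable
  then have "AE x in (lborel :: (real ^ 'n) measure). False" by eventually_elim (simp add: ennreal_eq_0_iff)
  then have "emeasure (lborel :: (real ^ 'n) measure) UNIV = 0" by (subst (asm) AE_iff_measurable[OF _ refl]) auto
  then show False by simp
 qed
 then show "gauss_const > 0" using fin unfolding gauss_const_def by (simp add: enn2real_positive_iff zero_less_iff_neq_zero)
qed

lemma tau_mass: "tau_mass > 0" "orth_integral (\<lambda>p. ennreal (wgt p)) = ennreal tau_mass"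
proof -
 obtain I where I: "I > 0" "\<And>F. F \<in> borel_funs \<Longrightarrow> orth_integral (\<lambda>p. ennreal (wgt p) * F (fst p)) = ennreal I * (LI a. ennreal (exp (- (norm a)\<^sup>2 / 2)) * F a)"
  using orth_gauss_fst by blast
 have *: "orth_integral (\<lambda>p. ennreal (wgt p)) = ennreal (I * gauss_const)"
  using I(2)[of "\<lambda>_. 1"] I(1) gauss_const by (simp add: ennreal_mult)
 then show "tau_mass > 0" using I(1) gauss_const(2) by (simp add: tau_mass_def)
 then show "orth_integral (\<lambda>p. ennreal (wgt p)) = ennreal tau_mass" using * I(1) gauss_const(2) by (simp add: tau_mass_def)
qed

lemma nn_integral_tau:
 assumes [measurable]: "H \<in> borel_funs"
 shows "orth_integral (\<lambda>p. ennreal (wgt p) * H p) = ennreal tau_mass * (TI p. H p)"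
proof -
 have "(TI p. H p) = (\<integral>\<^sup>+p. ennreal (\<bar>fst p \<bullet> snd p\<bar> ^ (CARD('n) - 2) * wgt (orth_pair p) / tau_mass) * H (orth_pair p) \<partial>dir_measure)"
  unfolding tau_def by (subst nn_integral_distr) (simp_all add: nn_integral_density)
 then have "ennreal tau_mass * (TI p. H p) = (\<integral>\<^sup>+p. ennreal tau_mass * (ennreal (\<bar>fst p \<bullet> snd p\<bar> ^ (CARD('n) - 2) * wgt (orth_pair p) / tau_mass) * H (orth_pair p)) \<partial>dir_measure)"
  by (simp add: nn_integral_cmult)
 also have "... = (\<integral>\<^sup>+p. ennreal (\<bar>fst p \<bullet> snd p\<bar> ^ (CARD('n) - 2)) * (ennreal (wgt (orth_pair p)) * H (orth_pair p)) \<partial>dir_measure)"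
 proof (rule nn_integral_cong)
  fix p :: "'n vels"
  have "ennreal tau_mass * ennreal (\<bar>fst p \<bullet> snd p\<bar> ^ (CARD('n) - 2) * wgt (orth_pair p) / tau_mass) = ennreal (\<bar>fst p \<bullet> snd p\<bar> ^ (CARD('n) - 2) * wgt (orth_pair p))"
   using tau_mass(1) by (subst ennreal_mult[symmetric]) simp_all
  also have "... = ennreal (\<bar>fst p \<bullet> snd p\<bar> ^ (CARD('n) - 2)) * ennreal (wgt (orth_pair p))" by (rule ennreal_mult) simp_all
  finally show "ennreal tau_mass * (ennreal (\<bar>fst p \<bullet> snd p\<bar> ^ (CARD('n) - 2) * wgt (orth_pair p) / tau_mass) * H (orth_pair p))
   = ennreal (\<bar>fst p \<bullet> snd p\<bar> ^ (CARD('n) - 2)) * (ennreal (wgt (orth_pair p)) * H (orth_pair p))"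
   by (simp only: mult.assoc[symmetric])
 qed
 also have "... = orth_integral (\<lambda>p. ennreal (wgt p) * H p)" by (subst orth_integral_dir) simp_all
 finally show ?thesis by simp
qed

lemma tau_eqI:
 assumes "ennreal tau_mass * a = ennreal tau_mass * b"
 shows "a = b"
 using assms tau_mass(1) by (intro ennreal_mult_right_cancel[of a "ennreal tau_mass" b]) (auto simp: mult.commute)

lemma prob_space_tau: "prob_space tau"
proof
 have "ennreal tau_mass * emeasure tau UNIV = ennreal tau_mass * 1"
  using nn_integral_tau[of "\<lambda>_. 1"] tau_mass(2) by simp
 then show "emeasure tau (space tau) = 1" by (simp add: tau_eqI)
qed

lemma tau_swap:
 assumes [measurable]: "H \<in> borel_funs"
 shows "(TI p. H (prod.swap p)) = (TI p. H p)"
proof (rule tau_eqI)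
 have [measurable]: "(\<lambda>p. H (prod.swap p)) \<in> borel_funs"
  by (rule measurable_compose[OF swap_measurable]) simp
 show "ennreal tau_mass * (TI p. H (prod.swap p)) = ennreal tau_mass * (TI p. H p)"
  using orth_integral_swap[of "\<lambda>p. ennreal (wgt p) * H p"]
  by (simp add: nn_integral_tau[symmetric] wgt_swap)
qed

text \<open>Reflecting z in the hyperplane orthogonal to w reverses the part along w and keeps the
  rest. Combined with a shift of v this is time reversal, see \<open>emb_reverse\<close>.\<close>

lemma tau_reflect:
 assumes [measurable]: "H \<in> borel_funs"
 shows "(TI p. H (- fst p, snd p)) = (TI p. H p)"
proof (rule tau_eqI)
 have "orth_integral (\<lambda>p. K (- fst p, snd p)) = orth_integral K" if [measurable]: "K \<in> borel_funs" for K
  unfolding orth_integral_def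
 proof (intro nn_integral_cong_AE, use sphere_s in eventually_elim)
  fix w :: "real ^ 'n" assume w: "norm w = 1"
  then have ww: "w \<bullet> w = 1" by (simp add: norm_eq_1)
  let ?f = "\<lambda>z. ennreal (jac w z) * K ((w \<bullet> z) *\<^sub>R w, z - (w \<bullet> z) *\<^sub>R w)"
  have "?f (z - (2 * (w \<bullet> z)) *\<^sub>R w) = ennreal (jac w z) * K (- ((w \<bullet> z) *\<^sub>R w), z - (w \<bullet> z) *\<^sub>R w)" for z
  proof -
   have i: "w \<bullet> (z - (2 * (w \<bullet> z)) *\<^sub>R w) = - (w \<bullet> z)" by (simp add: inner_diff_right ww)
   have e: "z - (2 * (w \<bullet> z)) *\<^sub>R w - (- (w \<bullet> z)) *\<^sub>R w = z - (w \<bullet> z) *\<^sub>R w"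
    unfolding mult_2 scaleR_left_distrib by simp
   show ?thesis unfolding i e by simp
  qed
  then show "(LI z. ennreal (jac w z) * K (- fst ((w \<bullet> z) *\<^sub>R w, z - (w \<bullet> z) *\<^sub>R w), snd ((w \<bullet> z) *\<^sub>R w, z - (w \<bullet> z) *\<^sub>R w))) = (LI z. ?f z)"
   using nn_integral_lborel_orthogonal[OF orthogonal_transformation_reflect[OF w], of ?f] by simp
 qed
 from this[of "\<lambda>p. ennreal (wgt p) * H p"]
 show "ennreal tau_mass * (TI p. H (- fst p, snd p)) = ennreal tau_mass * (TI p. H p)"
  by (simp add: nn_integral_tau[symmetric] wgt_def gauss2_def)
qed

definition alpha :: "real ^ 'n \<Rightarrow> real" where
 "alpha x = exp (- (norm x)\<^sup>2 / 2) / gauss_const"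

lemma tau_fst:
 assumes [measurable]: "F \<in> borel_funs"
 shows "(TI p. F (fst p)) = (LI x. ennreal (alpha x) * F x)"
proof (rule tau_eqI)
 obtain I where I: "I > 0" "\<And>F. F \<in> borel_funs \<Longrightarrow> orth_integral (\<lambda>p. ennreal (wgt p) * F (fst p)) = ennreal I * (LI a. ennreal (exp (- (norm a)\<^sup>2 / 2)) * F a)"
  using orth_gauss_fst by blast
 have "ennreal tau_mass = ennreal (I * gauss_const)"
  using I(2)[of "\<lambda>_. 1"] I(1) gauss_const tau_mass by (simp add: ennreal_mult)
 then have tm: "tau_mass = I * gauss_const" using I(1) gauss_const(2) tau_mass(1) by (simp add: ennreal_inj)
 have al: "ennreal (exp (- (norm x)\<^sup>2 / 2)) = ennreal gauss_const * ennreal (alpha x)" for x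
  using gauss_const(2) by (subst ennreal_mult[symmetric]) (simp_all add: alpha_def)
 have "ennreal tau_mass * (TI p. F (fst p)) = ennreal I * (LI a. ennreal gauss_const * (ennreal (alpha a) * F a))"
 proof -
  have "ennreal tau_mass * (TI p. F (fst p)) = ennreal I * (LI a. ennreal (exp (- (norm a)\<^sup>2 / 2)) * F a)"
   using I(2)[of F] nn_integral_tau[of "\<lambda>p. F (fst p)"] by simp
  then show ?thesis unfolding al mult.assoc .
 qed
 also have "(LI a. ennreal gauss_const * (ennreal (alpha a) * F a)) = ennreal gauss_const * (LI a. ennreal (alpha a) * F a)"
  unfolding alpha_def by (rule nn_integral_cmult) measurable
 finally show "ennreal tau_mass * (TI p. F (fst p)) = ennreal tau_mass * (LI x. ennreal (alpha x) * F x)"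
  using I(1) gauss_const(2) by (simp add: tm ennreal_mult mult.assoc)
qed

lemma tau_snd:
 assumes [measurable]: "F \<in> borel_funs"
 shows "(TI p. F (snd p)) = (LI x. ennreal (alpha x) * F x)"
 using tau_swap[of "\<lambda>p. F (fst p)"] by (simp add: tau_fst)

lemma tau_sum:
 "\<exists>c\<ge>0. \<forall>F \<in> borel_funs. (TI p. F (fst p + snd p)) = (LI z. ennreal (c * norm z ^ CARD('n) * exp (- (norm z)\<^sup>2 / 2)) * F z)"
proof -
 obtain c where c: "c \<ge> 0" "\<And>F. F \<in> borel_funs \<Longrightarrow> orth_integral (\<lambda>p. ennreal (wgt p) * F (fst p + snd p)) = (LI z. ennreal (c * norm z ^ CARD('n) * exp (- (norm z)\<^sup>2 / 2)) * F z)"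
  using orth_gauss_sum by blast
 have "(TI p. F (fst p + snd p)) = (LI z. ennreal (c / tau_mass * norm z ^ CARD('n) * exp (- (norm z)\<^sup>2 / 2)) * F z)"
  if [measurable]: "F \<in> borel_funs" for F
 proof (rule tau_eqI)
  have k: "ennreal (c * norm z ^ CARD('n) * exp (- (norm z)\<^sup>2 / 2)) = ennreal tau_mass * ennreal (c / tau_mass * norm z ^ CARD('n) * exp (- (norm z)\<^sup>2 / 2))" for z :: "real ^ 'n"
   using tau_mass(1) c(1) by (subst ennreal_mult[symmetric]) simp_all
  have "ennreal tau_mass * (TI p. F (fst p + snd p)) = (LI z. ennreal tau_mass * (ennreal (c / tau_mass * norm z ^ CARD('n) * exp (- (norm z)\<^sup>2 / 2)) * F z))"
  proof -
   have "ennreal tau_mass * (TI p. F (fst p + snd p)) = (LI z. ennreal (c * norm z ^ CARD('n) * exp (- (norm z)\<^sup>2 / 2)) * F z)"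
    using c(2)[of F] nn_integral_tau[of "\<lambda>p. F (fst p + snd p)"] by simp
   then show ?thesis unfolding k mult.assoc[of "_ :: ennreal"] .
  qed
  also have "... = ennreal tau_mass * (LI z. ennreal (c / tau_mass * norm z ^ CARD('n) * exp (- (norm z)\<^sup>2 / 2)) * F z)"
   by (rule nn_integral_cmult) measurable
  finally show "ennreal tau_mass * (TI p. F (fst p + snd p)) = ennreal tau_mass * (LI z. ennreal (c / tau_mass * norm z ^ CARD('n) * exp (- (norm z)\<^sup>2 / 2)) * F z)" .
 qed
 then show ?thesis using c(1) tau_mass(1) by (intro exI[of _ "c / tau_mass"]) auto
qed

end

section \<open>Collision measures\<close>

type_synonym 'n coll = "('n vels) \<times> ('n vels)"

definition swap_in :: "('a \<times> 'a) \<times> ('b \<times> 'b) \<Rightarrow> ('a \<times> 'a) \<times> ('b \<times> 'b)" where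
 "swap_in x = ((snd (fst x), fst (fst x)), snd x)"

definition swap_out :: "('a \<times> 'a) \<times> ('b \<times> 'b) \<Rightarrow> ('a \<times> 'a) \<times> ('b \<times> 'b)" where
 "swap_out x = (fst x, (snd (snd x), fst (snd x)))"

text \<open>For orthogonal legs this is a genuine collision with w parallel to the first leg: the
  incoming pair at v and v + R (a + b) exchanges its relative velocity along a. One incoming
  velocity and the two legs serve as coordinates on the set of collisions.\<close>

definition emb :: "real \<Rightarrow> 'a::real_vector \<Rightarrow> 'a \<times> 'a \<Rightarrow> ('a \<times> 'a) \<times> ('a \<times> 'a)" where
 "emb R v p = ((v, v + R *\<^sub>R (fst p + snd p)), (v + R *\<^sub>R fst p, v + R *\<^sub>R snd p))"

lemma emb_measurable[measurable]:
 fixes f :: "'b \<Rightarrow> real ^ 'n::finite" and g :: "'b \<Rightarrow> 'n vels"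
 assumes [measurable]: "f \<in> borel_measurable M" "g \<in> borel_measurable M"
 shows "(\<lambda>x. emb R (f x) (g x)) \<in> borel_measurable M"
 unfolding emb_def by measurable

lemma swap_in_measurable[measurable]: "swap_in \<in> borel_measurable (borel :: 'n::finite coll measure)"
 and swap_out_measurable[measurable]: "swap_out \<in> borel_measurable (borel :: 'n::finite coll measure)"
 unfolding swap_in_def swap_out_def by (intro borel_measurable_continuous_onI continuous_intros)+

context haar_sphere begin

text \<open>A single sigma-finite reference measure, dv du dw with weight |w . (u - v)| ^ (d - 2).
  The static measures and the typical collisions at a fixed time all have densities with respect to
  it, so that their rates can be compared pointwise.\<close>

definition coll_measure :: "'n coll measure" where
 "coll_measure = distr (density (lborel \<Otimes>\<^sub>M dir_measure) (\<lambda>q. ennreal (\<bar>fst (snd q) \<bullet> snd (snd q)\<bar> ^ (CARD('n) - 2))))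
  borel (\<lambda>q. emb 1 (fst q) (orth_pair (snd q)))"

abbreviation (input) coll_integral :: "('n coll \<Rightarrow> ennreal) \<Rightarrow> ennreal" (binder "CI " 10) where
 "coll_integral f \<equiv> nn_integral coll_measure f"
abbreviation (input) coll_integral_ennreal :: "('n coll \<Rightarrow> real) \<Rightarrow> ennreal" (binder "CE " 10) where
 "coll_integral_ennreal f \<equiv> nn_integral coll_measure (\<lambda>x. ennreal (f x))"
abbreviation (input) coll_integral_real :: "('n coll \<Rightarrow> real) \<Rightarrow> real" (binder "BC " 10) where
 "coll_integral_real f \<equiv> integral\<^sup>L coll_measure f"

lemma sets_coll_measure[simp, measurable_cong]: "sets coll_measure = sets borel" by (simp add: coll_measure_def)

lemma space_coll_measure[simp]: "space coll_measure = UNIV" using sets_eq_imp_space_eq[OF sets_coll_measure] by simp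

lemma nn_integral_coll_measure:
 assumes [measurable]: "H \<in> borel_funs"
 shows "(CI x. H x) = (LI v. orth_integral (\<lambda>q. H (emb 1 v q)))"
proof -
 have "(CI x. H x) = (\<integral>\<^sup>+q. ennreal (\<bar>fst (snd q) \<bullet> snd (snd q)\<bar> ^ (CARD('n) - 2)) * H (emb 1 (fst q) (orth_pair (snd q))) \<partial>(lborel \<Otimes>\<^sub>M dir_measure))"
  unfolding coll_measure_def by (subst nn_integral_distr) (simp_all add: nn_integral_density)
 also have "... = (LI v. \<integral>\<^sup>+p. ennreal (\<bar>fst p \<bullet> snd p\<bar> ^ (CARD('n) - 2)) * H (emb 1 v (orth_pair p)) \<partial>dir_measure)"
  by (subst sigma_finite_measure.nn_integral_fst[OF sigma_finite_dir, symmetric]) simp_all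
 also have "... = (LI v. orth_integral (\<lambda>q. H (emb 1 v q)))"
  by (intro nn_integral_cong, subst orth_integral_dir) simp_all
 finally show ?thesis .
qed

lemma nn_integral_coll_measure_post:
 assumes [measurable]: "H \<in> borel_funs"
 shows "(CI x. H x) =
  (LI v. (LI u. (SI w. ennreal (jac w (u - v)) * H ((v, u), post_collision v u w))))"
 unfolding nn_integral_coll_measure[OF assms]
proof (rule nn_integral_cong)
 fix v :: "real ^ 'n"
 have "orth_integral (\<lambda>q. H (emb 1 v q)) = (SI w. (LI z. ennreal (jac w z) * H ((v, v + z), (v + (w \<bullet> z) *\<^sub>R w, v + (z - (w \<bullet> z) *\<^sub>R w)))))"
  unfolding orth_integral_def by (simp add: emb_def)
 also have "... = (LI z. (SI w. ennreal (jac w z) * H ((v, v + z), (v + (w \<bullet> z) *\<^sub>R w, v + (z - (w \<bullet> z) *\<^sub>R w)))))"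
  by (rule nn_integral_swap[OF s.sigma_finite_measure_axioms sigma_finite_lborel]) measurable
 also have "... = (LI z. (SI w. ennreal (jac w (v + z - v)) * H ((v, v + z), post_collision v (v + z) w)))"
  by (simp add: post_collision_def add_diff_eq)
 also have "... = (LI u. (SI w. ennreal (jac w (u - v)) * H ((v, u), post_collision v u w)))"
  unfolding post_collision_def
  by (rule nn_integral_lborel_translate[of "\<lambda>u. (SI w. ennreal (jac w (u - v)) * H ((v, u), (v + (w \<bullet> (u - v)) *\<^sub>R w, u - (w \<bullet> (u - v)) *\<^sub>R w)))" v]) measurable
 finally show "orth_integral (\<lambda>q. H (emb 1 v q)) = (LI u. (SI w. ennreal (jac w (u - v)) * H ((v, u), post_collision v u w)))" .
qed

lemma sigma_finite_coll_measure: "sigma_finite_measure coll_measure"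
proof
 define A where "A n = {x :: 'n coll. norm (fst (fst x)) < real n \<and> norm (snd (fst x)) < real n}" for n
 have [measurable]: "A n \<in> sets borel" for n unfolding A_def by measurable
 have fin: "emeasure coll_measure (A n) < top" for n
 proof -
  let ?B = "ball (0 :: real ^ 'n) (real n)"
  have "emeasure coll_measure (A n) = (CI x. indicator (A n) x)" by simp
  also have "... = (LI v. (LI u. (SI w. ennreal (jac w (u - v)) * indicator (A n) ((v, u), post_collision v u w))))"
   by (rule nn_integral_coll_measure_post) measurable
  also have "... \<le> (LI v. (LI u. (SI w. indicator ?B v * (indicator ?B u * ennreal ((2 * real n) ^ (CARD('n) - 2))))))"
  proof (rule nn_integral_mono, rule nn_integral_mono, rule nn_integral_mono_AE, use sphere_s in eventually_elim)
   fix v u w :: "real ^ 'n" assume w: "norm w = 1"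
   show "ennreal (jac w (u - v)) * indicator (A n) ((v, u), post_collision v u w)
    \<le> indicator ?B v * (indicator ?B u * ennreal ((2 * real n) ^ (CARD('n) - 2)))"
   proof (cases "norm v < n \<and> norm u < n")
    case True
    have "\<bar>w \<bullet> (u - v)\<bar> \<le> norm (u - v)" using Cauchy_Schwarz_ineq2[of w "u - v"] w by simp
    also have "... \<le> 2 * real n" using norm_triangle_ineq4[of u v] True by simp
    finally have "jac w (u - v) \<le> (2 * real n) ^ (CARD('n) - 2)" by (rule power_mono) simp
    then show ?thesis using True by (simp add: A_def)
   qed (simp add: A_def)
  qed
  also have "... = emeasure lborel ?B * (emeasure lborel ?B * (ennreal ((2 * real n) ^ (CARD('n) - 2)) * emeasure s UNIV))"
  proof -
   define K where "K = ennreal ((2 * real n) ^ (CARD('n) - 2))"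
   define B where "B = ?B"
   have [measurable]: "B \<in> sets borel" by (simp add: B_def)
   show ?thesis unfolding K_def[symmetric] B_def[symmetric]
    by (simp add: nn_integral_cmult nn_integral_multc mult.assoc)
  qed
  also have "... < top" using finite_s emeasure_lborel_ball_finite[of "0 :: real ^ 'n" n] by (simp add: ennreal_mult_less_top)
  finally show ?thesis .
 qed
 have "(\<Union>n. A n) = UNIV"
 proof (intro set_eqI iffI UNIV_I)
  fix x :: "'n coll"
  obtain n :: nat where "max (norm (fst (fst x))) (norm (snd (fst x))) < n" using reals_Archimedean2 by blast
  then show "x \<in> (\<Union>n. A n)" by (auto simp: A_def)
 qed
 moreover have "emeasure coll_measure (A n) \<noteq> \<infinity>" for n using fin[of n] by auto
 ultimately show "\<exists>A. countable A \<and> A \<subseteq> sets coll_measure \<and> \<Union> A = space coll_measure \<and> (\<forall>a\<in>A. emeasure coll_measure a \<noteq> \<infinity>)"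
  by (intro exI[of _ "range A"]) auto
qed

text \<open>Density, relative to \<open>coll_measure\<close>, of the collisions whose first particle
  has Lebesgue measure and whose legs are R times a pair with law \<open>tau\<close>. The power 2 d
  - 2 is the homogeneity of delta (a . b) da db, here d from dz plus d - 2 from the weight.\<close>

definition evw :: "real \<Rightarrow> 'n coll \<Rightarrow> real" where
 "evw R x = wgt ((fst (snd x) - fst (fst x)) /\<^sub>R R, (snd (snd x) - fst (fst x)) /\<^sub>R R) / (tau_mass * R ^ (2 * CARD('n) - 2))"

lemma evw_measurable[measurable]: "evw R \<in> borel_funs"
 unfolding evw_def by measurable

lemma evw_nonneg[simp]: "0 \<le> R \<Longrightarrow> 0 \<le> evw R x"
 using tau_mass(1) by (simp add: evw_def)

lemma orth_integral_scale:
 assumes [measurable]: "K \<in> borel_funs" and R: "R > 0"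
 shows "orth_integral K = ennreal (R ^ (2 * CARD('n) - 2)) * orth_integral (\<lambda>q. K (R *\<^sub>R q))"
proof -
 have "orth_integral K = (SI w. ennreal (R ^ (2 * CARD('n) - 2)) * (LI z. ennreal (jac w z) * K (R *\<^sub>R ((w \<bullet> z) *\<^sub>R w, z - (w \<bullet> z) *\<^sub>R w))))"
  unfolding orth_integral_def
 proof (rule nn_integral_cong)
  fix w
  let ?f = "\<lambda>z. ennreal (jac w z) * K ((w \<bullet> z) *\<^sub>R w, z - (w \<bullet> z) *\<^sub>R w)"
  let ?g = "\<lambda>z. ennreal (jac w z) * K (R *\<^sub>R ((w \<bullet> z) *\<^sub>R w, z - (w \<bullet> z) *\<^sub>R w))"
  have "(LI z. ?f z) = ennreal (R ^ CARD('n)) * (LI z. ?f (R *\<^sub>R z))"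
   using nn_integral_lborel_scale[of ?f R] R by simp
  also have "(LI z. ?f (R *\<^sub>R z)) = (LI z. ennreal (R ^ (CARD('n) - 2)) * ?g z)"
   using R by (intro nn_integral_cong) (simp add: abs_mult power_mult_distrib ennreal_mult mult.assoc scaleR_diff_right)
  also have "... = ennreal (R ^ (CARD('n) - 2)) * (LI z. ?g z)"
   by (rule nn_integral_cmult) measurable
  also have "ennreal (R ^ CARD('n)) * (ennreal (R ^ (CARD('n) - 2)) * (LI z. ?g z)) = ennreal (R ^ (2 * CARD('n) - 2)) * (LI z. ?g z)"
  proof -
   have "CARD('n) + (CARD('n) - 2) = 2 * CARD('n) - 2" using card2 by simp
   then have "R ^ CARD('n) * R ^ (CARD('n) - 2) = R ^ (2 * CARD('n) - 2)" by (simp only: power_add[symmetric])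
   then have "ennreal (R ^ CARD('n)) * ennreal (R ^ (CARD('n) - 2)) = ennreal (R ^ (2 * CARD('n) - 2))"
    using R by (subst ennreal_mult[symmetric]) simp_all
   then show ?thesis by (simp only: mult.assoc[symmetric])
  qed
  finally show "(LI z. ?f z) = ennreal (R ^ (2 * CARD('n) - 2)) * (LI z. ?g z)" .
 qed
 also have "... = ennreal (R ^ (2 * CARD('n) - 2)) * orth_integral (\<lambda>q. K (R *\<^sub>R q))"
  unfolding orth_integral_def by (rule nn_integral_cmult) measurable
 finally show ?thesis .
qed

lemma nn_integral_evw:
 assumes [measurable]: "H \<in> borel_funs" and R: "R > 0"
 shows "(CI x. ennreal (evw R x) * H x) = (LI v. (TI p. H (emb R v p)))"
proof -
 have "(CI x. ennreal (evw R x) * H x) = (LI v. orth_integral (\<lambda>q. ennreal (evw R (emb 1 v q)) * H (emb 1 v q)))"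
  by (rule nn_integral_coll_measure) measurable
 also have "... = (LI v. (TI p. H (emb R v p)))"
 proof (rule nn_integral_cong)
  fix v
  let ?k = "R ^ (2 * CARD('n) - 2)"
  have k: "?k > 0" using R by simp
  have "orth_integral (\<lambda>q. ennreal (evw R (emb 1 v q)) * H (emb 1 v q)) = ennreal ?k * orth_integral (\<lambda>q. ennreal (evw R (emb 1 v (R *\<^sub>R q))) * H (emb 1 v (R *\<^sub>R q)))"
   by (rule orth_integral_scale[OF _ R, of "\<lambda>q. ennreal (evw R (emb 1 v q)) * H (emb 1 v q)"]) measurable
  also have "(\<lambda>q. ennreal (evw R (emb 1 v (R *\<^sub>R q))) * H (emb 1 v (R *\<^sub>R q))) = (\<lambda>q. ennreal (wgt q) * (ennreal (1 / (tau_mass * ?k)) * H (emb R v q)))"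
  proof
   fix q
   have "evw R (emb 1 v (R *\<^sub>R q)) = wgt q * (1 / (tau_mass * ?k))"
    using R by (simp add: evw_def emb_def)
   then have "ennreal (evw R (emb 1 v (R *\<^sub>R q))) = ennreal (wgt q) * ennreal (1 / (tau_mass * ?k))"
    using k tau_mass(1) by (simp only: ennreal_mult[OF wgt_nonneg]) (subst ennreal_mult, simp_all)
   moreover have "emb 1 v (R *\<^sub>R q) = emb R v q" by (simp add: emb_def scaleR_add_right)
   ultimately show "ennreal (evw R (emb 1 v (R *\<^sub>R q))) * H (emb 1 v (R *\<^sub>R q)) = ennreal (wgt q) * (ennreal (1 / (tau_mass * ?k)) * H (emb R v q))"
    by (simp only: mult.assoc)
  qed
  also have "orth_integral (\<lambda>q. ennreal (wgt q) * (ennreal (1 / (tau_mass * ?k)) * H (emb R v q))) = ennreal tau_mass * (TI q. ennreal (1 / (tau_mass * ?k)) * H (emb R v q))"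
   by (rule nn_integral_tau) measurable
  also have "(TI q. ennreal (1 / (tau_mass * ?k)) * H (emb R v q)) = ennreal (1 / (tau_mass * ?k)) * (TI q. H (emb R v q))"
   by (rule nn_integral_cmult) measurable
  also have "ennreal ?k * (ennreal tau_mass * (ennreal (1 / (tau_mass * ?k)) * (TI q. H (emb R v q)))) = (TI q. H (emb R v q))"
  proof -
   have "ennreal ?k * (ennreal tau_mass * ennreal (1 / (tau_mass * ?k))) = 1"
    using k R tau_mass(1) by (simp add: ennreal_mult[symmetric])
   then show ?thesis by (simp only: mult.assoc[symmetric] mult_1)
  qed
  finally show "orth_integral (\<lambda>q. ennreal (evw R (emb 1 v q)) * H (emb 1 v q)) = (TI p. H (emb R v p))" .
 qed
 finally show ?thesis .
qed

lemma sigma_finite_tau: "sigma_finite_measure tau"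
 using prob_space_tau by (simp add: prob_space_def finite_measure_def)

lemma emb_swap_out:
 assumes [measurable]: "H \<in> borel_funs"
 shows "(LI v. (TI p. H (swap_out (emb R v p)))) = (LI v. (TI p. H (emb R v p)))"
proof (rule nn_integral_cong)
 fix v
 have "swap_out (emb R v p) = emb R v (prod.swap p)" for p :: "'n vels"
  by (simp add: swap_out_def emb_def add.commute)
 then show "(TI p. H (swap_out (emb R v p))) = (TI p. H (emb R v p))"
  using tau_swap[of "\<lambda>p. H (emb R v p)"] by simp
qed

text \<open>Read backwards, the collision with legs (a, b) at v is the one with legs (- a, b) at v +
  R a. Translation invariance of dv and \<open>tau_reflect\<close> restore the original law.\<close>

lemma emb_reverse:
 assumes [measurable]: "H \<in> borel_funs"
 shows "(LI v. (TI p. H (prod.swap (emb R v p)))) = (LI v. (TI p. H (emb R v p)))"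
proof -
 have "prod.swap (emb R v p) = emb R (R *\<^sub>R fst p + v) (- fst p, snd p)" for v and p :: "'n vels"
  by (simp add: emb_def algebra_simps)
 then have "(LI v. (TI p. H (prod.swap (emb R v p)))) = (LI v. (TI p. H (emb R (R *\<^sub>R fst p + v) (- fst p, snd p))))"
  by simp
 also have "... = (TI p. (LI v. H (emb R (R *\<^sub>R fst p + v) (- fst p, snd p))))"
  by (rule nn_integral_swap[OF sigma_finite_lborel sigma_finite_tau]) measurable
 also have "... = (TI p. (LI v. H (emb R v (- fst p, snd p))))"
 proof (rule nn_integral_cong)
  fix p
  show "(LI v. H (emb R (R *\<^sub>R fst p + v) (- fst p, snd p))) = (LI v. H (emb R v (- fst p, snd p)))"
   by (rule nn_integral_lborel_translate[of "\<lambda>v. H (emb R v (- fst p, snd p))"]) measurable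
 qed
 also have "... = (LI v. (TI p. H (emb R v (- fst p, snd p))))"
  by (rule nn_integral_swap[OF sigma_finite_tau sigma_finite_lborel]) measurable
 also have "... = (LI v. (TI p. H (emb R v p)))"
 proof (rule nn_integral_cong)
  fix v
  show "(TI p. H (emb R v (- fst p, snd p))) = (TI p. H (emb R v p))"
   by (rule tau_reflect[of "\<lambda>p. H (emb R v p)"]) measurable
 qed
 finally show ?thesis .
qed

text \<open>Exchanging the incoming particles amounts to time reversal, exchange of the outgoing
  particles, and time reversal again.\<close>

lemma emb_swap_in:
 assumes H[measurable]: "H \<in> borel_funs"
 shows "(LI v. (TI p. H (swap_in (emb R v p)))) = (LI v. (TI p. H (emb R v p)))"
proof -
 have m: "(\<lambda>x. H (prod.swap x)) \<in> borel_funs"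
  by (rule measurable_compose[OF swap_measurable H])
 have m2: "(\<lambda>x. H (prod.swap (swap_out x))) \<in> borel_funs"
  by (rule measurable_compose[OF swap_out_measurable m])
 have "H (swap_in x) = H (prod.swap (swap_out (prod.swap x)))" for x :: "'n coll"
  by (simp add: swap_in_def swap_out_def prod.swap_def)
 then have "(LI v. (TI p. H (swap_in (emb R v p)))) = (LI v. (TI p. H (prod.swap (swap_out (prod.swap (emb R v p))))))"
  by simp
 also have "... = (LI v. (TI p. H (prod.swap (swap_out (emb R v p)))))"
  by (rule emb_reverse[OF m2])
 also have "... = (LI v. (TI p. H (prod.swap (emb R v p))))"
  by (rule emb_swap_out[OF m])
 also have "... = (LI v. (TI p. H (emb R v p)))"
  by (rule emb_reverse[OF H])
 finally show ?thesis .
qed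

end

section \<open>Smoothing by the Gaussian collision law\<close>

lemma ennreal_le_plusI: "a \<le> b + c \<Longrightarrow> 0 \<le> b \<Longrightarrow> 0 \<le> c \<Longrightarrow> ennreal a \<le> ennreal b + ennreal c"
 by (simp add: ennreal_leI flip: ennreal_plus)

lemma inverse_power_tail_finite:
 "(\<integral>\<^sup>+x. ennreal (1 / (1 + norm x) ^ (DIM('a) + 1)) \<partial>(lborel :: 'a::euclidean_space measure)) < top"
proof -
 let ?k = "DIM('a) * measure lborel (ball (0::'a) 1)"
 have "((\<lambda>r::real. - 1 / (1 + r)) \<longlongrightarrow> 0) at_top"
  by (intro tendsto_divide_0[OF tendsto_const] filterlim_at_top_imp_at_infinity filterlim_tendsto_add_at_top[OF tendsto_const] filterlim_ident)
 moreover have "DERIV (\<lambda>r. - 1 / (1 + r)) x :> 1 / (1 + x) ^ 2" if "0 \<le> x" for x :: real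
  using that by (auto intro!: derivative_eq_intros simp: power2_eq_square)
 ultimately have one: "(LI r. ennreal (1 / (1 + r) ^ 2) * indicator {0..} r) = 1"
  using nn_integral_FTC_atLeast[of "\<lambda>r. 1 / (1 + r) ^ 2" 0 "\<lambda>r. - 1 / (1 + r)" 0] by simp
 have "(\<integral>\<^sup>+x. ennreal (1 / (1 + norm x) ^ (DIM('a) + 1)) \<partial>(lborel :: 'a measure))
  = (LI r. ennreal (?k * r ^ (DIM('a) - 1)) * indicator {0..} r * ennreal (1 / (1 + r) ^ (DIM('a) + 1)))"
  by (rule nn_integral_lborel_norm[of "\<lambda>r. ennreal (1 / (1 + r) ^ (DIM('a) + 1))"]) measurable
 also have "... \<le> (LI r. ennreal ?k * (ennreal (1 / (1 + r) ^ 2) * indicator {0..} r))"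
 proof (rule nn_integral_mono)
  fix r :: real
  show "ennreal (?k * r ^ (DIM('a) - 1)) * indicator {0..} r * ennreal (1 / (1 + r) ^ (DIM('a) + 1))
   \<le> ennreal ?k * (ennreal (1 / (1 + r) ^ 2) * indicator {0..} r)"
  proof (cases "0 \<le> r")
   case True
   have "DIM('a) + 1 = (DIM('a) - 1) + 2" using DIM_positive[where 'a='a] by simp
   then have "(1 + r) ^ (DIM('a) + 1) = (1 + r) ^ (DIM('a) - 1) * (1 + r) ^ 2" by (simp only: power_add)
   moreover have "r ^ (DIM('a) - 1) / (1 + r) ^ (DIM('a) - 1) \<le> 1"
    using True by (simp add: power_mono divide_le_eq)
   then have "r ^ (DIM('a) - 1) / (1 + r) ^ (DIM('a) - 1) * (1 / (1 + r) ^ 2) \<le> 1 * (1 / (1 + r) ^ 2)"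
    by (rule mult_right_mono) simp
   ultimately have "r ^ (DIM('a) - 1) * (1 / (1 + r) ^ (DIM('a) + 1)) \<le> 1 / (1 + r) ^ 2" by simp
   then have "?k * (r ^ (DIM('a) - 1) * (1 / (1 + r) ^ (DIM('a) + 1))) \<le> ?k * (1 / (1 + r) ^ 2)"
    by (rule mult_left_mono) simp
   then have "?k * r ^ (DIM('a) - 1) * (1 / (1 + r) ^ (DIM('a) + 1)) \<le> ?k * (1 / (1 + r) ^ 2)" by (simp only: mult.assoc)
   then have le: "ennreal (?k * r ^ (DIM('a) - 1) * (1 / (1 + r) ^ (DIM('a) + 1))) \<le> ennreal (?k * (1 / (1 + r) ^ 2))" by (rule ennreal_leI)
   have e1: "ennreal (?k * r ^ (DIM('a) - 1) * (1 / (1 + r) ^ (DIM('a) + 1))) = ennreal (?k * r ^ (DIM('a) - 1)) * ennreal (1 / (1 + r) ^ (DIM('a) + 1))"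
    using True by (intro ennreal_mult) simp_all
   have e2: "ennreal (?k * (1 / (1 + r) ^ 2)) = ennreal ?k * ennreal (1 / (1 + r) ^ 2)" by (rule ennreal_mult) simp_all
   show ?thesis using True le unfolding e1 e2 by simp
  qed simp
 qed
 also have "... = ennreal ?k" by (subst nn_integral_cmult) (simp_all add: one)
 finally show ?thesis by (rule order.strict_trans1) simp
qed

lemma exp_minus_le_inverse_power:
 fixes r :: real assumes "0 \<le> r"
 shows "exp (- r) \<le> fact m * exp 1 / (1 + r) ^ m"
proof -
 have "(1 + r) ^ m \<le> fact m * exp (1 + r)" using assms by (intro power_le_exp) simp
 then have "(1 + r) ^ m * exp (- r) \<le> fact m * exp (1 + r) * exp (- r)" by (rule mult_right_mono) simp
 also have "... = fact m * exp 1" by (simp add: mult.assoc exp_add[symmetric])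
 finally show ?thesis using assms by (simp add: pos_le_divide_eq mult.commute)
qed

section \<open>Weighted translation estimates for Gaussian profiles\<close>

definition rgauss :: "nat \<Rightarrow> real \<Rightarrow> real" where
 "rgauss j r = r ^ j * exp (- r\<^sup>2 / 2)"

lemma rgauss_measurable[measurable]: "rgauss j \<in> borel_funs" unfolding rgauss_def by measurable

lemma rgauss_nonneg[simp]: "0 \<le> r \<Longrightarrow> 0 \<le> rgauss j r" by (simp add: rgauss_def)

lemma rgauss_bound: "0 \<le> r \<Longrightarrow> rgauss j r \<le> fact j * exp 2"
proof -
 assume r: "0 \<le> r"
 have "rgauss j r \<le> fact j * exp 2 * exp (- r)" unfolding rgauss_def by (rule power_gauss_le_exp[OF r])
 also have "... \<le> fact j * exp 2 * 1" using r by (intro mult_left_mono) auto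
 finally show ?thesis by simp
qed

text \<open>The decay is kept next to the increment so that the bound stays integrable against 1 +
  |x|. Increments are limited to one because the decay at an intermediate point must be moved to an
  end point, at the price of a factor exp 1.\<close>

lemma rgauss_lipschitz:
 "\<exists>C\<ge>0. \<forall>r r'. 0 \<le> r \<longrightarrow> 0 \<le> r' \<longrightarrow> \<bar>r - r'\<bar> \<le> 1 \<longrightarrow> \<bar>rgauss j r - rgauss j r'\<bar> \<le> C * \<bar>r - r'\<bar> * exp (- r)"
proof -
 define D where "D r = real j * r ^ (j - 1) * exp (- r\<^sup>2 / 2) - r ^ (j + 1) * exp (- r\<^sup>2 / 2)" for r :: real
 have der: "DERIV (rgauss j) r :> D r" for r
  unfolding rgauss_def D_def by (auto intro!: derivative_eq_intros simp: power2_eq_square)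
 define C0 :: real where "C0 = real j * (fact (j - 1) * exp 2) + fact (j + 1) * exp 2"
 have C0: "C0 \<ge> 0" by (simp add: C0_def)
 have Db: "\<bar>D r\<bar> \<le> C0 * exp (- r)" if "0 \<le> r" for r
 proof -
  have "\<bar>D r\<bar> \<le> real j * (r ^ (j - 1) * exp (- r\<^sup>2 / 2)) + r ^ (j + 1) * exp (- r\<^sup>2 / 2)"
   unfolding D_def using that by (intro order_trans[OF abs_triangle_ineq4]) (simp add: abs_mult)
  also have "... \<le> real j * (fact (j - 1) * exp 2 * exp (- r)) + fact (j + 1) * exp 2 * exp (- r)"
   by (intro add_mono mult_left_mono power_gauss_le_exp that) auto
  finally show ?thesis by (simp add: C0_def algebra_simps)
 qed
 have main: "\<bar>rgauss j r - rgauss j r'\<bar> \<le> C0 * exp 1 * (r' - r) * exp (- r') " if m: "0 \<le> r" "r < r'" "r' - r \<le> 1" for r r'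
 proof -
  obtain \<xi> where xi: "r < \<xi>" "\<xi> < r'" "rgauss j r' - rgauss j r = (r' - r) * D \<xi>"
   using MVT2[OF m(2), of "rgauss j" D] der by blast
  have "\<bar>D \<xi>\<bar> \<le> C0 * exp (- \<xi>)" using xi m by (intro Db) simp
  also have "... \<le> C0 * exp (1 - r')" using xi m C0 by (intro mult_left_mono) auto
  also have "exp (1 - r') = exp 1 * exp (- r')" by (simp add: exp_add[symmetric])
  finally have "(r' - r) * \<bar>D \<xi>\<bar> \<le> (r' - r) * (C0 * (exp 1 * exp (- r')))" using m by (intro mult_left_mono) auto
  moreover have "\<bar>rgauss j r - rgauss j r'\<bar> = (r' - r) * \<bar>D \<xi>\<bar>" using xi(3) m(2) by (subst abs_minus_commute) (simp add: abs_mult)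
  ultimately show ?thesis by (simp add: mult_ac)
 qed
 define C where "C = C0 * exp 1"
 have "\<bar>rgauss j r - rgauss j r'\<bar> \<le> C * \<bar>r - r'\<bar> * exp (- r)" if r: "0 \<le> r" "0 \<le> r'" "\<bar>r - r'\<bar> \<le> 1" for r r'
 proof (cases r r' rule: linorder_cases)
  case less
  have "\<bar>rgauss j r - rgauss j r'\<bar> \<le> C0 * exp 1 * (r' - r) * exp (- r')" using less r by (intro main) auto
  also have "... \<le> C0 * exp 1 * (r' - r) * exp (- r)" using less C0 by (intro mult_left_mono) auto
  finally show ?thesis using less by (simp add: C_def)
 next
  case greater
  have "\<bar>rgauss j r' - rgauss j r\<bar> \<le> C0 * exp 1 * (r - r') * exp (- r)" using greater r by (intro main) auto
  then show ?thesis using greater by (simp add: C_def abs_minus_commute)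
 qed simp
 then show ?thesis using C0 by (intro exI[of _ C]) (auto simp: C_def)
qed

text \<open>For |h| \<le> 1 the mean value bound is integrated. For larger h the two profiles are
  bounded separately by their moments, and |h| itself pays for the constants. The weight 1 + |x|
  lets the cascade control mass and first moment together.\<close>

lemma rgauss_translation:
 "\<exists>L\<ge>0. \<forall>h. (\<integral>\<^sup>+x. ennreal ((1 + norm x) * \<bar>rgauss j (norm (x - h)) - rgauss j (norm x)\<bar>) \<partial>(lborel :: 'a::euclidean_space measure)) \<le> ennreal (L * norm h)"
proof -
 obtain C where C: "C \<ge> 0" "\<And>r r'. 0 \<le> r \<Longrightarrow> 0 \<le> r' \<Longrightarrow> \<bar>r - r'\<bar> \<le> 1 \<Longrightarrow> \<bar>rgauss j r - rgauss j r'\<bar> \<le> C * \<bar>r - r'\<bar> * exp (- r)"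
  using rgauss_lipschitz[of j] by blast
 define T where "T = enn2real (\<integral>\<^sup>+x. ennreal (1 / (1 + norm x) ^ (DIM('a) + 1)) \<partial>(lborel :: 'a measure))"
 have T: "(\<integral>\<^sup>+x. ennreal (1 / (1 + norm x) ^ (DIM('a) + 1)) \<partial>(lborel :: 'a measure)) = ennreal T"
  using inverse_power_tail_finite[where 'a='a] by (simp add: T_def)
 have T0: "T \<ge> 0" by (simp add: T_def)
 define M where "M i = enn2real (\<integral>\<^sup>+x. ennreal (rgauss i (norm x)) \<partial>(lborel :: 'a measure))" for i
 have M: "(\<integral>\<^sup>+x. ennreal (rgauss i (norm x)) \<partial>(lborel :: 'a measure)) = ennreal (M i)" for i
  using gauss_moment_finite[where 'a='a, of i] by (simp add: M_def rgauss_def)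
 have M0: "M i \<ge> 0" for i by (simp add: M_def)
 define F :: real where "F = fact (DIM('a) + 2) * exp 1"
 define L where "L = C * F * T + 3 * (M j + M (j + 1))"
 have F0: "F \<ge> 0" by (simp add: F_def)
 have "(LE x. (1 + norm x) * \<bar>rgauss j (norm (x - h)) - rgauss j (norm x)\<bar>) \<le> ennreal (L * norm h)" for h :: 'a
 proof (cases "norm h \<le> 1")
  case True
  have pt: "(1 + norm x) * \<bar>rgauss j (norm (x - h)) - rgauss j (norm x)\<bar> \<le> (C * F * norm h) * (1 / (1 + norm x) ^ (DIM('a) + 1))" for x
  proof -
   have d: "\<bar>norm x - norm (x - h)\<bar> \<le> norm h" using norm_triangle_ineq3[of x "x - h"] by simp
   have "\<bar>rgauss j (norm x) - rgauss j (norm (x - h))\<bar> \<le> C * \<bar>norm x - norm (x - h)\<bar> * exp (- norm x)"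
    using d True by (intro C(2)) auto
   also have "... \<le> C * norm h * (fact (DIM('a) + 2) * exp 1 / (1 + norm x) ^ (DIM('a) + 2))"
    using d C(1) by (intro mult_mono exp_minus_le_inverse_power) auto
   finally have "(1 + norm x) * \<bar>rgauss j (norm x) - rgauss j (norm (x - h))\<bar> \<le> (1 + norm x) * (C * norm h * (F / (1 + norm x) ^ (DIM('a) + 2)))"
    unfolding F_def by (intro mult_left_mono) auto
   also have "... = (C * F * norm h) * ((1 + norm x) / (1 + norm x) ^ (DIM('a) + 2))" by simp
   also have "(1 + norm x) / (1 + norm x) ^ (DIM('a) + 2) = 1 / (1 + norm x) ^ (DIM('a) + 1)"
   proof -
    have "1 + norm x \<noteq> 0" using norm_ge_zero[of x] by linarith
    then show ?thesis by simp
   qed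
   finally show ?thesis by (simp add: abs_minus_commute)
  qed
  have "(LE x. (1 + norm x) * \<bar>rgauss j (norm (x - h)) - rgauss j (norm x)\<bar>)
   \<le> (\<integral>\<^sup>+x. ennreal (C * F * norm h) * ennreal (1 / (1 + norm x) ^ (DIM('a) + 1)) \<partial>(lborel :: 'a measure))"
  proof (rule nn_integral_mono)
   fix x :: 'a
   have "ennreal ((C * F * norm h) * (1 / (1 + norm x) ^ (DIM('a) + 1))) = ennreal (C * F * norm h) * ennreal (1 / (1 + norm x) ^ (DIM('a) + 1))"
    using C(1) F0 by (intro ennreal_mult) auto
   then show "ennreal ((1 + norm x) * \<bar>rgauss j (norm (x - h)) - rgauss j (norm x)\<bar>) \<le> ennreal (C * F * norm h) * ennreal (1 / (1 + norm x) ^ (DIM('a) + 1))"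
    using ennreal_leI[OF pt[of x]] by simp
  qed
  also have "... = ennreal (C * F * norm h) * ennreal T" unfolding T[symmetric] by (rule nn_integral_cmult) measurable
  also have "... = ennreal (C * F * norm h * T)" using C(1) F0 T0 by (intro ennreal_mult[symmetric]) auto
  also have "... \<le> ennreal (L * norm h)"
  proof (rule ennreal_leI)
   have "C * F * norm h * T = (C * F * T) * norm h" by simp
   also have "... \<le> L * norm h" using M0[of j] M0[of "j + 1"] by (intro mult_right_mono) (auto simp: L_def)
   finally show "C * F * norm h * T \<le> L * norm h" .
  qed
  finally show ?thesis .
 next
  case False
  have rs: "norm x * rgauss j (norm x) = rgauss (j + 1) (norm x)" for x :: 'a by (simp add: rgauss_def)
  have "(LE x. (1 + norm x) * \<bar>rgauss j (norm (x - h)) - rgauss j (norm x)\<bar>)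
   \<le> (LI x. ennreal ((1 + norm x) * rgauss j (norm (x - h))) + ennreal ((1 + norm x) * rgauss j (norm x)))"
  proof (rule nn_integral_mono)
   fix x :: 'a
   have "\<bar>rgauss j (norm (x - h)) - rgauss j (norm x)\<bar> \<le> rgauss j (norm (x - h)) + rgauss j (norm x)"
    using rgauss_nonneg[of "norm (x - h)" j] rgauss_nonneg[of "norm x" j] by (simp add: abs_le_iff)
   then have "(1 + norm x) * \<bar>rgauss j (norm (x - h)) - rgauss j (norm x)\<bar> \<le> (1 + norm x) * (rgauss j (norm (x - h)) + rgauss j (norm x))"
    by (intro mult_left_mono) auto
   then have "ennreal ((1 + norm x) * \<bar>rgauss j (norm (x - h)) - rgauss j (norm x)\<bar>) \<le> ennreal ((1 + norm x) * rgauss j (norm (x - h)) + (1 + norm x) * rgauss j (norm x))"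
    unfolding distrib_left by (rule ennreal_leI)
   also have "... = ennreal ((1 + norm x) * rgauss j (norm (x - h))) + ennreal ((1 + norm x) * rgauss j (norm x))"
    by (rule ennreal_plus) auto
   finally show "ennreal ((1 + norm x) * \<bar>rgauss j (norm (x - h)) - rgauss j (norm x)\<bar>) \<le> ennreal ((1 + norm x) * rgauss j (norm (x - h))) + ennreal ((1 + norm x) * rgauss j (norm x))" .
  qed
  also have "... = (LE x. (1 + norm x) * rgauss j (norm (x - h))) + (LI (x :: 'a). ennreal ((1 + norm x) * rgauss j (norm x)))"
   by (rule nn_integral_add) measurable
  also have "(LE x. (1 + norm x) * rgauss j (norm (x - h))) = (LE x. (1 + norm (h + x)) * rgauss j (norm x))"
   using nn_integral_lborel_translate[of "\<lambda>x. ennreal ((1 + norm x) * rgauss j (norm (x - h)))" h] by simp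
  also have "... \<le> (LI (x :: 'a). ennreal ((1 + norm h) * rgauss j (norm x)) + ennreal (rgauss (j + 1) (norm x)))"
  proof (rule nn_integral_mono)
   fix x :: 'a
   have "(1 + norm (h + x)) * rgauss j (norm x) \<le> (1 + norm h + norm x) * rgauss j (norm x)"
    using norm_triangle_ineq[of h x] by (intro mult_right_mono) auto
   also have "... = (1 + norm h) * rgauss j (norm x) + rgauss (j + 1) (norm x)" by (simp add: distrib_right rs)
   finally show "ennreal ((1 + norm (h + x)) * rgauss j (norm x)) \<le> ennreal ((1 + norm h) * rgauss j (norm x)) + ennreal (rgauss (j + 1) (norm x))"
    by (rule ennreal_le_plusI) simp_all
  qed
  also have "... = ennreal (1 + norm h) * ennreal (M j) + ennreal (M (j + 1))"
   unfolding M[symmetric] by (subst nn_integral_add) (simp_all add: ennreal_mult nn_integral_cmult)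
  also have "(LI (x :: 'a). ennreal ((1 + norm x) * rgauss j (norm x))) = ennreal (M j) + ennreal (M (j + 1))"
  proof -
   have "(LI (x :: 'a). ennreal ((1 + norm x) * rgauss j (norm x))) = (LI (x :: 'a). ennreal (rgauss j (norm x)) + ennreal (rgauss (j + 1) (norm x)))"
    by (intro nn_integral_cong, subst ennreal_plus[symmetric]) (auto simp: distrib_right rs)
   then show ?thesis unfolding M[symmetric] by (subst (asm) nn_integral_add) simp_all
  qed
  finally have "(LE x. (1 + norm x) * \<bar>rgauss j (norm (x - h)) - rgauss j (norm x)\<bar>)
   \<le> ennreal (1 + norm h) * ennreal (M j) + ennreal (M (j + 1)) + (ennreal (M j) + ennreal (M (j + 1)))"
   by (simp add: add_right_mono)
  also have "... = ennreal ((1 + norm h) * M j + M (j + 1) + (M j + M (j + 1)))"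
  proof -
   have "ennreal (1 + norm h) * ennreal (M j) = ennreal ((1 + norm h) * M j)" using M0 by (intro ennreal_mult[symmetric]) auto
   then show ?thesis
    by (simp only: ennreal_plus[symmetric] add_nonneg_nonneg mult_nonneg_nonneg M0 norm_ge_zero zero_le_one)
  qed
  also have "... \<le> ennreal (L * norm h)"
  proof (rule ennreal_leI)
   have h: "norm h \<ge> 1" using False by simp
   have "(1 + norm h) * M j \<le> (2 * norm h) * M j" using h M0 by (intro mult_right_mono) auto
   moreover have "M j \<le> norm h * M j" "2 * M (j + 1) \<le> 3 * norm h * M (j + 1)"
    using h M0[of j] M0[of "j + 1"] by (auto intro!: mult_right_mono simp: mult_le_cancel_right1)
   moreover have "0 \<le> C * F * T * norm h" using C(1) F0 T0 by simp
   ultimately show "(1 + norm h) * M j + M (j + 1) + (M j + M (j + 1)) \<le> L * norm h"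
    by (simp add: L_def algebra_simps)
  qed
  finally show ?thesis .
 qed
 moreover have "L \<ge> 0" using C(1) F0 T0 M0[of j] M0[of "j + 1"] by (simp add: L_def)
 ultimately show ?thesis by blast
qed

lemma integral_lborel_affine:
 fixes f :: "'a::euclidean_space \<Rightarrow> real"
 assumes [measurable]: "f \<in> borel_funs" and c: "c \<noteq> 0"
 shows "(BI x. f x) = \<bar>c\<bar> ^ DIM('a) * (BI x. f (t + c *\<^sub>R x))"
proof -
 have "(BI x. f x) = (\<integral>x. f x \<partial>density (distr lborel borel (\<lambda>x. t + c *\<^sub>R x)) (\<lambda>_. ennreal (\<bar>c\<bar> ^ DIM('a))))"
  by (subst lborel_affine[OF c, of t]) simp
 also have "... = (\<integral>x. \<bar>c\<bar> ^ DIM('a) *\<^sub>R f x \<partial>distr lborel borel (\<lambda>x. t + c *\<^sub>R x))"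
  by (rule integral_density) simp_all
 also have "... = (BI x. \<bar>c\<bar> ^ DIM('a) *\<^sub>R f (t + c *\<^sub>R x))"
  by (rule integral_distr) simp_all
 finally show ?thesis by simp
qed

section \<open>The signed kernel of one transport step\<close>

context haar_sphere begin

definition cU :: real where
 "cU = (SOME c. c \<ge> 0 \<and> (\<forall>F \<in> borel_funs. (TI p. F (fst p + snd p)) = (LI z. ennreal (c * norm z ^ CARD('n) * exp (- (norm z)\<^sup>2 / 2)) * F z)))"

definition sum_density :: "real ^ 'n \<Rightarrow> real" where
 "sum_density z = cU * rgauss CARD('n) (norm z)"

lemma cU: "cU \<ge> 0"
 and tau_sum_density: "F \<in> borel_funs \<Longrightarrow> (TI p. F (fst p + snd p)) = (LI z. ennreal (sum_density z) * F z)"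
proof -
 have "cU \<ge> 0 \<and> (\<forall>F \<in> borel_funs. (TI p. F (fst p + snd p)) = (LI z. ennreal (cU * norm z ^ CARD('n) * exp (- (norm z)\<^sup>2 / 2)) * F z))"
  unfolding cU_def by (rule someI_ex) (use tau_sum in blast)
 then show "cU \<ge> 0" "F \<in> borel_funs \<Longrightarrow> (TI p. F (fst p + snd p)) = (LI z. ennreal (sum_density z) * F z)"
  by (auto simp: sum_density_def rgauss_def mult.assoc)
qed

lemma alpha_rgauss: "alpha x = rgauss 0 (norm x) / gauss_const" by (simp add: alpha_def rgauss_def)

lemma alpha_measurable[measurable]: "alpha \<in> borel_funs" unfolding alpha_def by measurable
lemma sum_density_measurable[measurable]: "sum_density \<in> borel_funs" unfolding sum_density_def by measurable
lemma alpha_nonneg[simp]: "0 \<le> alpha x" using gauss_const(2) by (simp add: alpha_def)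
lemma sum_density_nonneg[simp]: "0 \<le> sum_density x" using cU by (simp add: sum_density_def)

text \<open>A particle at the origin is replaced by two outgoing particles, each leg with density
  \<open>alpha\<close>, at the expense of a partner with density \<open>sum_density\<close>. The
  total mass is 2 - 1 = 1, but the sign changes.\<close>

definition kap :: "real ^ 'n \<Rightarrow> real" where "kap x = 2 * alpha x - sum_density x"

lemma kap_measurable[measurable]: "kap \<in> borel_funs" unfolding kap_def by measurable

lemma distr_tau_fst: "distr tau borel fst = density lborel (\<lambda>x. ennreal (alpha x))"
 and distr_tau_snd: "distr tau borel snd = density lborel (\<lambda>x. ennreal (alpha x))"
 and distr_tau_sum: "distr tau borel (\<lambda>p. fst p + snd p) = density lborel (\<lambda>x. ennreal (sum_density x))"
proof -
 have aux: "distr tau borel f = density lborel (\<lambda>x. ennreal (k x))"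
  if [measurable]: "f \<in> borel_measurable tau" "k \<in> borel_funs"
   and eq: "\<And>F. F \<in> borel_funs \<Longrightarrow> (TI p. F (f p)) = (LI z. ennreal (k z) * F z)"
  for f and k :: "real ^ 'n \<Rightarrow> real"
 proof (rule measure_eqI)
  fix A assume "A \<in> sets (distr tau borel f)"
  then have [measurable]: "A \<in> sets borel" by simp
  have "emeasure (distr tau borel f) A = (TI p. indicator A (f p))"
   by (subst nn_integral_indicator[symmetric], simp, subst nn_integral_distr) simp_all
  also have "... = emeasure (density lborel (\<lambda>x. ennreal (k x))) A"
   by (subst eq) (simp_all add: emeasure_density)
  finally show "emeasure (distr tau borel f) A = emeasure (density lborel (\<lambda>x. ennreal (k x))) A" .
 qed simp
 show "distr tau borel fst = density lborel (\<lambda>x. ennreal (alpha x))" by (rule aux) (simp_all add: tau_fst)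
 show "distr tau borel snd = density lborel (\<lambda>x. ennreal (alpha x))" by (rule aux) (simp_all add: tau_snd)
 show "distr tau borel (\<lambda>p. fst p + snd p) = density lborel (\<lambda>x. ennreal (sum_density x))" by (rule aux) (simp_all add: tau_sum_density)
qed

sublocale tau: prob_space tau by (rule prob_space_tau)

lemma integrable_kap: "integrable lborel alpha" "integrable lborel sum_density" "integrable lborel kap"
proof -
 show 1: "integrable lborel alpha"
  using tau_fst[of "\<lambda>_. 1"] tau.emeasure_space_1 by (intro integrableI_nonneg) simp_all
 show 2: "integrable lborel sum_density"
  using tau_sum_density[of "\<lambda>_. 1"] tau.emeasure_space_1 by (intro integrableI_nonneg) simp_all
 show "integrable lborel kap" unfolding kap_def using 1 2 by simp
qed

lemma integrable_tau_bounded: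
 fixes \<psi> :: "'n vels \<Rightarrow> real" and B :: real
 assumes [measurable]: "\<psi> \<in> borel_funs" and "\<And>x. \<bar>\<psi> x\<bar> \<le> B"
 shows "integrable tau \<psi>"
 using assms(2) by (intro tau.integrable_const_bound[of _ B]) auto

lemma integral_kap:
 assumes [measurable]: "\<psi> \<in> borel_funs" and B: "\<And>x. \<bar>\<psi> x\<bar> \<le> B"
 shows "(BI y. \<psi> y * kap y) = (BT p. \<psi> (fst p) + \<psi> (snd p) - \<psi> (fst p + snd p))"
proof -
 have i: "integrable lborel (\<lambda>y. \<psi> y * k y)" if "integrable lborel k" for k :: "real ^ 'n \<Rightarrow> real"
 proof (rule Bochner_Integration.integrable_bound[of _ "\<lambda>y. B * \<bar>k y\<bar>"])
  show "integrable lborel (\<lambda>y. B * \<bar>k y\<bar>)" using that by simp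
  show "(\<lambda>y. \<psi> y * k y) \<in> borel_measurable lborel" using that by measurable
  have "\<bar>\<psi> y\<bar> * \<bar>k y\<bar> \<le> B * \<bar>k y\<bar>" for y by (intro mult_right_mono B) simp
  moreover have "0 \<le> B" using order_trans[OF abs_ge_zero B] .
  ultimately show "AE y in lborel. norm (\<psi> y * k y) \<le> norm (B * \<bar>k y\<bar>)"
   by (intro AE_I2) (simp add: abs_mult)
 qed
 have a: "(BT p. \<psi> (fst p)) = (BI y. \<psi> y * alpha y)"
 proof -
  have "(BT p. \<psi> (fst p)) = (\<integral>y. \<psi> y \<partial>distr tau borel fst)" by (rule integral_distr[symmetric]) simp_all
  then show ?thesis unfolding distr_tau_fst by (simp add: integral_density mult.commute)
 qed
 have b: "(BT p. \<psi> (snd p)) = (BI y. \<psi> y * alpha y)"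
 proof -
  have "(BT p. \<psi> (snd p)) = (\<integral>y. \<psi> y \<partial>distr tau borel snd)" by (rule integral_distr[symmetric]) simp_all
  then show ?thesis unfolding distr_tau_snd by (simp add: integral_density mult.commute)
 qed
 have c: "(BT p. \<psi> (fst p + snd p)) = (BI y. \<psi> y * sum_density y)"
 proof -
  have "(BT p. \<psi> (fst p + snd p)) = (\<integral>y. \<psi> y \<partial>distr tau borel (\<lambda>p. fst p + snd p))" by (rule integral_distr[symmetric]) simp_all
  then show ?thesis unfolding distr_tau_sum by (simp add: integral_density mult.commute)
 qed
 have t: "integrable tau (\<lambda>p. \<psi> (fst p))" "integrable tau (\<lambda>p. \<psi> (snd p))" "integrable tau (\<lambda>p. \<psi> (fst p + snd p))"
  using B by (auto intro!: integrable_tau_bounded[of _ B])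
 have "(BT p. \<psi> (fst p) + \<psi> (snd p) - \<psi> (fst p + snd p)) = (BI y. \<psi> y * alpha y) + (BI y. \<psi> y * alpha y) - (BI y. \<psi> y * sum_density y)"
  using t by (simp add: a b c)
 also have "... = (BI y. 2 * (\<psi> y * alpha y) - \<psi> y * sum_density y)"
  using i[OF integrable_kap(1)] i[OF integrable_kap(2)]
  by (subst Bochner_Integration.integral_diff) (simp_all add: integrable_mult_right)
 also have "(\<lambda>y. 2 * (\<psi> y * alpha y) - \<psi> y * sum_density y) = (\<lambda>y. \<psi> y * kap y)"
  by (simp add: kap_def algebra_simps)
 finally show ?thesis by simp
qed

lemma kap_bounded: "\<exists>C\<ge>0. \<forall>x. \<bar>kap x\<bar> \<le> C"
proof (intro exI conjI allI)
 let ?C = "2 * (fact 0 * exp 2 / gauss_const) + cU * (fact CARD('n) * exp 2)"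
 show "0 \<le> ?C" using cU gauss_const(2) by simp
 fix x :: "real ^ 'n"
 have "alpha x \<le> fact 0 * exp 2 / gauss_const" unfolding alpha_rgauss
  using gauss_const(2) by (intro divide_right_mono rgauss_bound) auto
 moreover have "sum_density x \<le> cU * (fact CARD('n) * exp 2)" unfolding sum_density_def
  using cU by (intro mult_left_mono rgauss_bound) auto
 ultimately show "\<bar>kap x\<bar> \<le> ?C" using alpha_nonneg[of x] sum_density_nonneg[of x] unfolding kap_def by linarith
qed

text \<open>The lower bound on L is obtained by adding one; it makes the later ratio of scales 2 * L
  at least 2.\<close>

lemma kap_translation:
 "\<exists>L\<ge>1. \<forall>h. (LE x. (1 + norm x) * \<bar>kap (x - h) - kap x\<bar>) \<le> ennreal (L * norm h)"
proof -
 obtain L0 where L0: "L0 \<ge> 0" "\<And>h :: real ^ 'n. (LE x. (1 + norm x) * \<bar>rgauss 0 (norm (x - h)) - rgauss 0 (norm x)\<bar>) \<le> ennreal (L0 * norm h)"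
  using rgauss_translation[where 'a="real ^ 'n", of 0] by blast
 obtain L1 where L1: "L1 \<ge> 0" "\<And>h :: real ^ 'n. (LE x. (1 + norm x) * \<bar>rgauss CARD('n) (norm (x - h)) - rgauss CARD('n) (norm x)\<bar>) \<le> ennreal (L1 * norm h)"
  using rgauss_translation[where 'a="real ^ 'n", of "CARD('n)"] by blast
 define p where "p = 2 / gauss_const"
 have p: "p \<ge> 0" using gauss_const(2) by (simp add: p_def)
 define L where "L = p * L0 + cU * L1 + 1"
 have "(LE x. (1 + norm x) * \<bar>kap (x - h) - kap x\<bar>) \<le> ennreal (L * norm h)" for h
 proof -
  let ?a = "\<lambda>j x. (1 + norm x) * \<bar>rgauss j (norm (x - h)) - rgauss j (norm x)\<bar>"
  have "(LE x. (1 + norm x) * \<bar>kap (x - h) - kap x\<bar>) \<le> (LI x. ennreal p * ennreal (?a 0 x) + ennreal cU * ennreal (?a CARD('n) x))"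
  proof (rule nn_integral_mono)
   fix x
   have "kap (x - h) - kap x = p * (rgauss 0 (norm (x - h)) - rgauss 0 (norm x)) - cU * (rgauss CARD('n) (norm (x - h)) - rgauss CARD('n) (norm x))"
    by (simp add: kap_def alpha_rgauss sum_density_def p_def algebra_simps diff_divide_distrib)
   then have "\<bar>kap (x - h) - kap x\<bar> \<le> p * \<bar>rgauss 0 (norm (x - h)) - rgauss 0 (norm x)\<bar> + cU * \<bar>rgauss CARD('n) (norm (x - h)) - rgauss CARD('n) (norm x)\<bar>"
    using abs_triangle_ineq4[of "p * (rgauss 0 (norm (x - h)) - rgauss 0 (norm x))" "cU * (rgauss CARD('n) (norm (x - h)) - rgauss CARD('n) (norm x))"] p cU
    by (simp add: abs_mult)
   then have "(1 + norm x) * \<bar>kap (x - h) - kap x\<bar> \<le> (1 + norm x) * (p * \<bar>rgauss 0 (norm (x - h)) - rgauss 0 (norm x)\<bar> + cU * \<bar>rgauss CARD('n) (norm (x - h)) - rgauss CARD('n) (norm x)\<bar>)"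
    by (intro mult_left_mono) auto
   also have "... = p * ?a 0 x + cU * ?a CARD('n) x" by (simp only: distrib_left mult.left_commute)
   finally have "ennreal ((1 + norm x) * \<bar>kap (x - h) - kap x\<bar>) \<le> ennreal (p * ?a 0 x + cU * ?a CARD('n) x)" by (rule ennreal_leI)
   also have "... = ennreal (p * ?a 0 x) + ennreal (cU * ?a CARD('n) x)" using p cU by (intro ennreal_plus) auto
   also have "... = ennreal p * ennreal (?a 0 x) + ennreal cU * ennreal (?a CARD('n) x)" using p cU by (simp add: ennreal_mult)
   finally show "ennreal ((1 + norm x) * \<bar>kap (x - h) - kap x\<bar>) \<le> ennreal p * ennreal (?a 0 x) + ennreal cU * ennreal (?a CARD('n) x)" .
  qed
  also have "... = ennreal p * (LE x. ?a 0 x) + ennreal cU * (LE x. ?a CARD('n) x)"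
   by (subst nn_integral_add) (simp_all add: nn_integral_cmult)
  also have "... \<le> ennreal p * ennreal (L0 * norm h) + ennreal cU * ennreal (L1 * norm h)"
   by (intro add_mono mult_left_mono L0(2) L1(2)) auto
  also have "... = ennreal (p * (L0 * norm h) + cU * (L1 * norm h))" using p cU L0(1) L1(1) by (simp add: ennreal_mult)
  also have "... \<le> ennreal (L * norm h)" by (intro ennreal_leI) (simp add: L_def algebra_simps)
  finally show ?thesis .
 qed
 moreover have "L \<ge> 1" using p cU L0(1) L1(1) by (simp add: L_def)
 ultimately show ?thesis by blast
qed

definition kapR :: "real \<Rightarrow> real ^ 'n \<Rightarrow> real" where "kapR R x = kap (x /\<^sub>R R) / R ^ CARD('n)"

lemma kapR_measurable[measurable]: "kapR R \<in> borel_funs" unfolding kapR_def by measurable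

definition Tconv :: "real \<Rightarrow> (real ^ 'n \<Rightarrow> real) \<Rightarrow> real ^ 'n \<Rightarrow> real" where
 "Tconv R g x = (BI v. g v * kapR R (x - v))"

lemma Tconv_measurable[measurable]:
 assumes [measurable]: "g \<in> borel_funs"
 shows "Tconv R g \<in> borel_funs"
 unfolding Tconv_def by measurable

lemma integral_kapR:
 assumes [measurable]: "\<phi> \<in> borel_funs" and R: "R > 0"
 shows "(BI x. \<phi> x * kapR R (x - v)) = (BI y. \<phi> (v + R *\<^sub>R y) * kap y)"
proof -
 have "(BI x. \<phi> x * kapR R (x - v)) = \<bar>R\<bar> ^ DIM(real ^ 'n) * (BI x. \<phi> (v + R *\<^sub>R x) * kapR R (v + R *\<^sub>R x - v))"
  by (rule integral_lborel_affine) (use R in auto)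
 also have "... = (BI x. R ^ CARD('n) * (\<phi> (v + R *\<^sub>R x) * kapR R (v + R *\<^sub>R x - v)))"
  using R by simp
 also have "... = (BI y. \<phi> (v + R *\<^sub>R y) * kap y)"
  using R by (intro Bochner_Integration.integral_cong) (auto simp: kapR_def)
 finally show ?thesis .
qed

lemma Tconv_integrable_pair:
 assumes g: "integrable lborel g" and [measurable]: "\<phi> \<in> borel_funs" and B: "\<And>x. \<bar>\<phi> x\<bar> \<le> B" and R: "R > 0"
 shows "integrable (lborel \<Otimes>\<^sub>M lborel) (\<lambda>(v, x). g v * (\<phi> x * kapR R (x - v)))"
proof (rule integrableI_bounded)
 have [measurable]: "g \<in> borel_funs" using g by auto
 show "(\<lambda>(v, x). g v * (\<phi> x * kapR R (x - v))) \<in> borel_measurable (lborel \<Otimes>\<^sub>M lborel)" by measurable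
 have B0: "B \<ge> 0" using B[of 0] by simp
 define M where "M = (LI y. ennreal \<bar>kap y\<bar>)"
 have M: "M < top" using integrable_kap(3) by (simp add: M_def integrable_iff_bounded)
 have sc: "(LI x. ennreal \<bar>kapR R (x - v)\<bar>) = M" for v
 proof -
  have "(LI x. ennreal \<bar>kapR R (x - v)\<bar>) = (LI x. ennreal \<bar>kapR R x\<bar>)"
   using nn_integral_lborel_translate[of "\<lambda>x. ennreal \<bar>kapR R x\<bar>" "- v"] by simp
  also have "... = ennreal (R ^ CARD('n)) * (LI x. ennreal \<bar>kapR R (R *\<^sub>R x)\<bar>)"
   using nn_integral_lborel_scale[of "\<lambda>x. ennreal \<bar>kapR R x\<bar>" R] R by simp
  also have "... = (LI x. ennreal (R ^ CARD('n)) * ennreal \<bar>kapR R (R *\<^sub>R x)\<bar>)"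
   by (rule nn_integral_cmult[symmetric]) measurable
  also have "... = M" unfolding M_def using R
   by (intro nn_integral_cong) (simp add: kapR_def abs_mult flip: ennreal_mult)
  finally show ?thesis .
 qed
 have "(\<integral>\<^sup>+q. ennreal (norm (case q of (v, x) \<Rightarrow> g v * (\<phi> x * kapR R (x - v)))) \<partial>(lborel \<Otimes>\<^sub>M lborel))
  = (LI v. (LE x. norm (g v * (\<phi> x * kapR R (x - v)))))"
  by (subst lborel.nn_integral_fst[symmetric]) simp_all
 also have "... \<le> (LI v. (LI x. (ennreal \<bar>g v\<bar> * ennreal B) * ennreal \<bar>kapR R (x - v)\<bar>))"
 proof (intro nn_integral_mono)
  fix v x
  have "norm (g v * (\<phi> x * kapR R (x - v))) \<le> \<bar>g v\<bar> * B * \<bar>kapR R (x - v)\<bar>"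
   using B[of x] by (simp add: abs_mult mult.assoc mult_left_mono mult_right_mono)
  then have "ennreal (norm (g v * (\<phi> x * kapR R (x - v)))) \<le> ennreal (\<bar>g v\<bar> * B * \<bar>kapR R (x - v)\<bar>)" by (rule ennreal_leI)
  then show "ennreal (norm (g v * (\<phi> x * kapR R (x - v)))) \<le> (ennreal \<bar>g v\<bar> * ennreal B) * ennreal \<bar>kapR R (x - v)\<bar>"
   using B0 by (simp add: ennreal_mult)
 qed
 also have "... = (LI v. ennreal \<bar>g v\<bar> * (ennreal B * M))"
  by (intro nn_integral_cong, subst nn_integral_cmult) (simp_all add: sc mult.assoc)
 also have "... = (LI v. ennreal \<bar>g v\<bar>) * (ennreal B * M)" by (rule nn_integral_multc) measurable
 also have "... < \<infinity>" using g M by (simp add: integrable_iff_bounded ennreal_mult_less_top)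
 finally show "(\<integral>\<^sup>+q. ennreal (norm (case q of (v, x) \<Rightarrow> g v * (\<phi> x * kapR R (x - v)))) \<partial>(lborel \<Otimes>\<^sub>M lborel)) < \<infinity>" .
qed

lemma Tconv_integrable:
 assumes g: "integrable lborel g" and R: "R > 0"
 shows "integrable lborel (Tconv R g)"
proof -
 have "integrable lborel (\<lambda>x. (BI v. (case (v, x) of (v, x) \<Rightarrow> g v * (1 * kapR R (x - v)))))"
  by (rule lborel_pair.integrable_snd) (use Tconv_integrable_pair[OF g, of "\<lambda>_. 1" 1 R] R in \<open>simp add: case_prod_beta\<close>)
 then show ?thesis by (simp add: Tconv_def[abs_def])
qed

text \<open>Dual form of a step: the test function sees every particle of g replaced by its two
  products minus the partner consumed. The step is thereby tied to the collision gradient in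
  \<open>cg_Tconv\<close>.\<close>

lemma Tconv_test:
 assumes g: "integrable lborel g" and [measurable]: "\<phi> \<in> borel_funs" and B: "\<And>x. \<bar>\<phi> x\<bar> \<le> B" and R: "R > 0"
 shows "(BI x. \<phi> x * Tconv R g x) = (BI v. g v * (BT p. \<phi> (v + R *\<^sub>R fst p) + \<phi> (v + R *\<^sub>R snd p) - \<phi> (v + R *\<^sub>R (fst p + snd p))))"
proof -
 have "(BI x. \<phi> x * Tconv R g x) = (BI x. (BI v. g v * (\<phi> x * kapR R (x - v))))"
  unfolding Tconv_def by (simp add: mult.left_commute flip: integral_mult_right_zero)
 also have "... = (BI v. (BI x. g v * (\<phi> x * kapR R (x - v))))"
  using lborel_pair.Fubini_integral[OF Tconv_integrable_pair[OF assms]] by simp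
 also have "... = (BI v. g v * (BI y. \<phi> (v + R *\<^sub>R y) * kap y))"
  by (simp add: integral_kapR[OF _ R])
 also have "... = (BI v. g v * (BT p. \<phi> (v + R *\<^sub>R fst p) + \<phi> (v + R *\<^sub>R snd p) - \<phi> (v + R *\<^sub>R (fst p + snd p))))"
  using integral_kap[of "\<lambda>y. \<phi> (_ + R *\<^sub>R y)" B] B by simp
 finally show ?thesis .
qed

lemma Tconv_bound:
 assumes g: "integrable lborel g" and R: "R > 0" and C: "\<And>x. \<bar>kap x\<bar> \<le> C"
 shows "\<bar>Tconv R g x\<bar> \<le> C / R ^ CARD('n) * (BI v. \<bar>g v\<bar>)"
proof -
 have [measurable]: "g \<in> borel_funs" using g by auto
 have k: "\<bar>kapR R y\<bar> \<le> C / R ^ CARD('n)" for y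
  using C R by (simp add: kapR_def abs_divide divide_right_mono)
 have pt: "norm (g v * kapR R (x - v)) \<le> C / R ^ CARD('n) * norm (g v)" for v
  using mult_right_mono[OF k[of "x - v"], of "\<bar>g v\<bar>"] by (simp add: abs_mult mult.commute)
 have ig: "integrable lborel (\<lambda>v. C / R ^ CARD('n) * norm (g v))" using g by simp
 have i: "integrable lborel (\<lambda>v. g v * kapR R (x - v))"
 proof (rule Bochner_Integration.integrable_bound[OF ig])
  show "AE v in lborel. norm (g v * kapR R (x - v)) \<le> norm (C / R ^ CARD('n) * norm (g v))"
   by (rule AE_I2, rule order_trans[OF pt]) (simp only: real_norm_def abs_ge_self)
 qed measurable
 have "norm (Tconv R g x) \<le> (BI v. norm (g v * kapR R (x - v)))"
  unfolding Tconv_def by (rule integral_norm_bound)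
 also have "... \<le> (BI v. C / R ^ CARD('n) * norm (g v))"
  by (rule integral_mono[OF integrable_norm[OF i] ig pt])
 finally show ?thesis by simp
qed

text \<open>Since g has mass zero, the untranslated kernel may be subtracted, and a translate by v
  differs from it by a multiple of |v| / R in the weighted norm. The first moment of g thus bounds
  both the mass and the rescaled first moment of the result, which is the source of the
  decay.\<close>

lemma Tconv_norm:
 assumes g: "integrable lborel g" and g0: "(BI v. g v) = 0" and R: "R > 0"
  and L: "L \<ge> 0" "\<And>h. (LE x. (1 + norm x) * \<bar>kap (x - h) - kap x\<bar>) \<le> ennreal (L * norm h)"
 shows "(LE x. \<bar>Tconv R g x\<bar> * (1 + norm x / R)) \<le> (LE v. L / R * (\<bar>g v\<bar> * norm v))"
proof -
 have [measurable]: "g \<in> borel_funs" using g by auto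
 obtain C where C: "C \<ge> 0" "\<And>x. \<bar>kap x\<bar> \<le> C" using kap_bounded by blast
 have k: "\<bar>kapR R y\<bar> \<le> C / R ^ CARD('n)" for y
  using C(2) R by (simp add: kapR_def abs_divide divide_right_mono)
 have ik: "integrable lborel (\<lambda>v. g v * kapR R (f v))" if [measurable]: "f \<in> borel_funs" for f
 proof (rule Bochner_Integration.integrable_bound[OF integrable_mult_right[of "C / R ^ CARD('n)" lborel "\<lambda>v. norm (g v)"]])
  have "\<bar>g v\<bar> * \<bar>kapR R (f v)\<bar> \<le> \<bar>g v\<bar> * (C / R ^ CARD('n))" for v by (intro mult_left_mono k) simp
  then show "AE v in lborel. norm (g v * kapR R (f v)) \<le> norm (C / R ^ CARD('n) * norm (g v))"
   using C(1) R by (intro AE_I2) (simp add: abs_mult mult.commute)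
 qed (use g in auto)
 have Tx: "ennreal \<bar>Tconv R g x\<bar> \<le> (LE v. \<bar>g v\<bar> * \<bar>kapR R (x - v) - kapR R x\<bar>)" for x
 proof -
  have "Tconv R g x = (BI v. g v * kapR R (x - v)) - (BI v. g v * kapR R x)"
   unfolding Tconv_def using g g0 by simp
  also have "... = (BI v. g v * kapR R (x - v) - g v * kapR R x)"
   by (rule Bochner_Integration.integral_diff[symmetric, OF ik[of "\<lambda>v. x - v"] ik[of "\<lambda>_. x"]]) simp_all
  finally have "ennreal (norm (Tconv R g x)) \<le> (LE v. norm (g v * kapR R (x - v) - g v * kapR R x))"
   using integral_norm_bound_ennreal[OF Bochner_Integration.integrable_diff[OF ik[of "\<lambda>v. x - v"] ik[of "\<lambda>_. x"]]] by simp
  then show ?thesis by (simp add: abs_mult flip: right_diff_distrib)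
 qed
 have inner: "(LE x. (1 + norm x / R) * \<bar>kapR R (x - v) - kapR R x\<bar>) \<le> ennreal (L / R * norm v)" for v
 proof -
  let ?f = "\<lambda>x. ennreal ((1 + norm x / R) * \<bar>kapR R (x - v) - kapR R x\<bar>)"
  have "(LI x. ?f x) = ennreal (R ^ CARD('n)) * (LI x. ?f (R *\<^sub>R x))"
   using nn_integral_lborel_scale[of ?f R] R by simp
  also have "... = (LI x. ennreal (R ^ CARD('n)) * ?f (R *\<^sub>R x))"
   by (rule nn_integral_cmult[symmetric]) measurable
  also have "... = (LE x. (1 + norm x) * \<bar>kap (x - v /\<^sub>R R) - kap x\<bar>)"
  proof (rule nn_integral_cong)
   fix x
   have "(R *\<^sub>R x - v) /\<^sub>R R = x - v /\<^sub>R R" using R by (simp add: scaleR_diff_right)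
   then have "R ^ CARD('n) * ((1 + norm (R *\<^sub>R x) / R) * \<bar>kapR R (R *\<^sub>R x - v) - kapR R (R *\<^sub>R x)\<bar>) = (1 + norm x) * \<bar>kap (x - v /\<^sub>R R) - kap x\<bar>"
    using R by (simp add: kapR_def abs_divide flip: diff_divide_distrib)
   then show "ennreal (R ^ CARD('n)) * ?f (R *\<^sub>R x) = ennreal ((1 + norm x) * \<bar>kap (x - v /\<^sub>R R) - kap x\<bar>)"
    using R by (subst ennreal_mult[symmetric]) simp_all
  qed
  also have "... \<le> ennreal (L * norm (v /\<^sub>R R))" by (rule L(2))
  finally show ?thesis using R by (simp add: field_simps)
 qed
 have "(LE x. \<bar>Tconv R g x\<bar> * (1 + norm x / R)) \<le> (LI x. (LI v. ennreal \<bar>g v\<bar> * ennreal ((1 + norm x / R) * \<bar>kapR R (x - v) - kapR R x\<bar>)))"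
 proof (rule nn_integral_mono)
  fix x :: "real ^ 'n"
  have "ennreal (\<bar>Tconv R g x\<bar> * (1 + norm x / R)) = ennreal (1 + norm x / R) * ennreal \<bar>Tconv R g x\<bar>"
   using R by (subst mult.commute, intro ennreal_mult) auto
  also have "... \<le> ennreal (1 + norm x / R) * (LE v. \<bar>g v\<bar> * \<bar>kapR R (x - v) - kapR R x\<bar>)"
   by (intro mult_left_mono Tx) simp
  also have "... = (LI v. ennreal (1 + norm x / R) * ennreal (\<bar>g v\<bar> * \<bar>kapR R (x - v) - kapR R x\<bar>))"
   by (rule nn_integral_cmult[symmetric]) measurable
  also have "... = (LI v. ennreal \<bar>g v\<bar> * ennreal ((1 + norm x / R) * \<bar>kapR R (x - v) - kapR R x\<bar>))"
  proof (rule nn_integral_cong)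
   fix v
   have "ennreal (1 + norm x / R) * ennreal (\<bar>g v\<bar> * \<bar>kapR R (x - v) - kapR R x\<bar>) = ennreal ((1 + norm x / R) * (\<bar>g v\<bar> * \<bar>kapR R (x - v) - kapR R x\<bar>))"
    using R by (intro ennreal_mult[symmetric]) auto
   also have "... = ennreal (\<bar>g v\<bar> * ((1 + norm x / R) * \<bar>kapR R (x - v) - kapR R x\<bar>))" by (simp only: mult.left_commute)
   also have "... = ennreal \<bar>g v\<bar> * ennreal ((1 + norm x / R) * \<bar>kapR R (x - v) - kapR R x\<bar>)"
    using R by (intro ennreal_mult) auto
   finally show "ennreal (1 + norm x / R) * ennreal (\<bar>g v\<bar> * \<bar>kapR R (x - v) - kapR R x\<bar>) = ennreal \<bar>g v\<bar> * ennreal ((1 + norm x / R) * \<bar>kapR R (x - v) - kapR R x\<bar>)" .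
  qed
  finally show "ennreal (\<bar>Tconv R g x\<bar> * (1 + norm x / R)) \<le> (LI v. ennreal \<bar>g v\<bar> * ennreal ((1 + norm x / R) * \<bar>kapR R (x - v) - kapR R x\<bar>))" .
 qed
 also have "... = (LI v. (LI x. ennreal \<bar>g v\<bar> * ennreal ((1 + norm x / R) * \<bar>kapR R (x - v) - kapR R x\<bar>)))"
  by (rule nn_integral_lborel_swap) measurable
 also have "... = (LI v. ennreal \<bar>g v\<bar> * (LE x. (1 + norm x / R) * \<bar>kapR R (x - v) - kapR R x\<bar>))"
  by (intro nn_integral_cong nn_integral_cmult) measurable
 also have "... \<le> (LI v. ennreal \<bar>g v\<bar> * ennreal (L / R * norm v))"
  by (intro nn_integral_mono mult_left_mono inner) simp
 also have "... = (LE v. L / R * (\<bar>g v\<bar> * norm v))"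
  using R L(1) by (intro nn_integral_cong) (simp add: mult.left_commute flip: ennreal_mult)
 finally show ?thesis .
qed

end

section \<open>Catalytic transport of densities\<close>

text \<open>Symmetrised over the incoming pair, as collision measures must be; the factor 1 / 2
  makes every particle count once.\<close>

definition Sin :: "('a \<Rightarrow> real) \<Rightarrow> ('a \<times> 'a) \<times> ('b \<times> 'b) \<Rightarrow> real" where
 "Sin g x = (g (fst (fst x)) + g (snd (fst x))) / 2"

definition Sout :: "('b \<Rightarrow> real) \<Rightarrow> ('a \<times> 'a) \<times> ('b \<times> 'b) \<Rightarrow> real" where
 "Sout g x = (g (fst (snd x)) + g (snd (snd x))) / 2"

text \<open>A majorant, up to constants, of - ln N at all four velocities of a collision. Including
  the outgoing pair makes it invariant under time reversal, and the leading 1 absorbs additive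
  constants.\<close>

definition Lw :: "'n::finite coll \<Rightarrow> real" where
 "Lw x = 1 + (ln (1 + norm (fst (fst x))) + ln (1 + norm (snd (fst x)))) + (ln (1 + norm (fst (snd x))) + ln (1 + norm (snd (snd x))))"

text \<open>Ratio of the hard sphere rate |w . (u - v)| to the weight |w . (u - v)| ^ (d - 2) in
  \<open>coll_measure\<close>. It is a quotient because the exponent 3 - d may be negative; when v'
  = v its value is 0 by the convention on division.\<close>

definition grate :: "'n::finite coll \<Rightarrow> real" where
 "grate x = norm (fst (snd x) - fst (fst x)) / norm (fst (snd x) - fst (fst x)) ^ (CARD('n) - 2)"

lemma Sin_measurable[measurable]:
 assumes [measurable]: "g \<in> borel_funs"
 shows "Sin g \<in> borel_measurable (borel :: 'n::finite coll measure)"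
 unfolding Sin_def by measurable

lemma Sout_measurable[measurable]:
 assumes [measurable]: "g \<in> borel_funs"
 shows "Sout g \<in> borel_measurable (borel :: 'n::finite coll measure)"
 unfolding Sout_def by measurable

lemma Lw_measurable[measurable]: "Lw \<in> borel_measurable (borel :: 'n::finite coll measure)"
 unfolding Lw_def by measurable

lemma grate_measurable[measurable]: "grate \<in> borel_measurable (borel :: 'n::finite coll measure)"
 unfolding grate_def by measurable

lemma Lw_ge_1: "1 \<le> Lw x"
proof -
 have "0 \<le> ln (1 + norm u)" for u :: "real ^ 'n" by (rule ln_ge_zero) simp
 then show ?thesis unfolding Lw_def by (simp add: add_nonneg_nonneg)
qed

lemma Sin_nonneg: "(\<And>v. 0 \<le> g v) \<Longrightarrow> 0 \<le> Sin g x" and Sout_nonneg: "(\<And>v. 0 \<le> g v) \<Longrightarrow> 0 \<le> Sout g x"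
 by (simp_all add: Sin_def Sout_def)

lemma Lw_swap: "Lw (swap_in x) = Lw x" "Lw (swap_out x) = Lw x" "Lw (prod.swap x) = Lw x"
 by (simp_all add: Lw_def swap_in_def swap_out_def)

lemma Sin_swap: "Sin g (swap_in x) = Sin g x" "Sin g (swap_out x) = Sin g x" "Sin g (prod.swap x) = Sout g x" "Sout g (prod.swap x) = Sin g x"
 "Sout g (swap_in x) = Sout g x" "Sout g (swap_out x) = Sout g x"
 by (simp_all add: Sin_def Sout_def swap_in_def swap_out_def add.commute)

lemma ln_norm_bound:
 fixes u :: "'a::real_normed_vector"
 assumes "R > 0" "norm u \<le> p + R * q" "0 \<le> p" "0 \<le> q"
 shows "ln (1 + norm u) \<le> ln (1 + R) + p / R + q"
proof -
 have "1 + norm u \<le> (1 + R) * (1 + (p / R + q))"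
 proof -
  have "(1 + R) * (1 + (p / R + q)) = 1 + R + (p / R + q) + (p + R * q)" using assms(1) by (simp add: field_simps)
  moreover have "0 \<le> p / R" using assms by simp
  ultimately show ?thesis using assms by linarith
 qed
 then have "ln (1 + norm u) \<le> ln ((1 + R) * (1 + (p / R + q)))" using assms by (subst ln_le_cancel_iff) (auto intro!: mult_pos_pos add_pos_nonneg)
 also have "... = ln (1 + R) + ln (1 + (p / R + q))" using assms by (intro ln_mult_pos) (auto intro!: add_pos_nonneg)
 also have "ln (1 + (p / R + q)) \<le> p / R + q" using assms by (intro ln_add_one_self_le_self) auto
 finally show ?thesis by simp
qed

context haar_sphere begin

text \<open>The first step already uses scale \<Lambda>, so the error after k steps has spread over
  lengths of order \<Lambda> ^ k and the next step acts on the following scale.\<close>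

primrec hseq :: "real \<Rightarrow> (real ^ 'n \<Rightarrow> real) \<Rightarrow> nat \<Rightarrow> real ^ 'n \<Rightarrow> real" where
 "hseq \<Lambda> f 0 = f"
| "hseq \<Lambda> f (Suc k) = Tconv (\<Lambda> ^ Suc k) (hseq \<Lambda> f k)"

text \<open>The weight 1 + |v| / \<Lambda> ^ k is adapted to the scale reached. By
  \<open>Tconv_norm\<close> a step at R = \<Lambda> ^ Suc k multiplies the norm by at most L *
  \<Lambda> ^ k / R, which is 1 / 2 for \<Lambda> = 2 * L. The pointwise bound uses only the mass of
  the previous error and the boundedness of the kernel.\<close>

lemma cascade:
 "\<exists>\<Lambda>\<ge>2. \<exists>C\<ge>0. \<forall>f E. integrable lborel f \<longrightarrow> (BI v. f v) = 0 \<longrightarrow> 0 \<le> E \<longrightarrow>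
  (LE v. \<bar>f v\<bar> * (1 + norm v)) \<le> ennreal E \<longrightarrow>
  (\<forall>k. integrable lborel (hseq \<Lambda> f k) \<and> (BI v. hseq \<Lambda> f k v) = 0 \<and>
   (LE v. \<bar>hseq \<Lambda> f k v\<bar> * (1 + norm v / \<Lambda> ^ k)) \<le> ennreal (E / 2 ^ k) \<and>
   (\<forall>x. \<bar>hseq \<Lambda> f (Suc k) x\<bar> \<le> C * E))"
proof -
 obtain L where L: "L \<ge> 1" "\<And>h. (LE x. (1 + norm x) * \<bar>kap (x - h) - kap x\<bar>) \<le> ennreal (L * norm h)"
  using kap_translation by blast
 obtain C where C: "C \<ge> 0" "\<And>x. \<bar>kap x\<bar> \<le> C" using kap_bounded by blast
 define \<Lambda> where "\<Lambda> = 2 * L"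
 have La: "\<Lambda> \<ge> 2" "\<Lambda> > 0" using L(1) by (auto simp: \<Lambda>_def)
 have main: "integrable lborel (hseq \<Lambda> f k) \<and> (BI v. hseq \<Lambda> f k v) = 0 \<and>
   (LE v. \<bar>hseq \<Lambda> f k v\<bar> * (1 + norm v / \<Lambda> ^ k)) \<le> ennreal (E / 2 ^ k)"
  if f: "integrable lborel f" "(BI v. f v) = 0" "0 \<le> E" "(LE v. \<bar>f v\<bar> * (1 + norm v)) \<le> ennreal E" for f E k
 proof (induction k)
  case 0
  then show ?case using f by simp
 next
  case (Suc k)
  define g where "g = hseq \<Lambda> f k"
  define R where "R = \<Lambda> ^ Suc k"
  have R: "R > 0" using La by (simp add: R_def)
  have g: "integrable lborel g" "(BI v. g v) = 0" "(LE v. \<bar>g v\<bar> * (1 + norm v / \<Lambda> ^ k)) \<le> ennreal (E / 2 ^ k)"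
   using Suc by (auto simp: g_def)
  have [measurable]: "g \<in> borel_funs" using g(1) by auto
  have h: "hseq \<Lambda> f (Suc k) = Tconv R g" by (simp add: g_def R_def)
  have "(BI x. Tconv R g x) = (BI v. g v * (BT p. 1 + 1 - 1))"
   using Tconv_test[OF g(1), of "\<lambda>_. 1" 1 R] R by simp
  also have "... = 0" using g(2) tau.prob_space by simp
  finally have z: "(BI x. Tconv R g x) = 0" .
  have "(LE x. \<bar>Tconv R g x\<bar> * (1 + norm x / R)) \<le> (LE v. L / R * (\<bar>g v\<bar> * norm v))"
   using L by (intro Tconv_norm[OF g(1,2) R]) auto
  also have "... \<le> (LI v. ennreal (1 / 2) * ennreal (\<bar>g v\<bar> * (1 + norm v / \<Lambda> ^ k)))"
  proof (rule nn_integral_mono)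
   fix v :: "real ^ 'n"
   have "L / R * (\<bar>g v\<bar> * norm v) = 1 / 2 * (\<bar>g v\<bar> * (norm v / \<Lambda> ^ k))"
    using L(1) by (simp add: R_def \<Lambda>_def field_simps)
   also have "... \<le> 1 / 2 * (\<bar>g v\<bar> * (1 + norm v / \<Lambda> ^ k))" by (intro mult_left_mono) auto
   finally have "ennreal (L / R * (\<bar>g v\<bar> * norm v)) \<le> ennreal (1 / 2 * (\<bar>g v\<bar> * (1 + norm v / \<Lambda> ^ k)))" by (rule ennreal_leI)
   also have "... = ennreal (1 / 2) * ennreal (\<bar>g v\<bar> * (1 + norm v / \<Lambda> ^ k))" using La by (intro ennreal_mult) auto
   finally show "ennreal (L / R * (\<bar>g v\<bar> * norm v)) \<le> ennreal (1 / 2) * ennreal (\<bar>g v\<bar> * (1 + norm v / \<Lambda> ^ k))" .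
  qed
  also have "... = ennreal (1 / 2) * (LE v. \<bar>g v\<bar> * (1 + norm v / \<Lambda> ^ k))"
   by (rule nn_integral_cmult) measurable
  also have "... \<le> ennreal (1 / 2) * ennreal (E / 2 ^ k)" by (intro mult_left_mono g(3)) simp
  also have "... = ennreal (1 / 2 * (E / 2 ^ k))" using f(3) by (intro ennreal_mult[symmetric]) auto
  also have "1 / 2 * (E / 2 ^ k) = E / 2 ^ Suc k" by simp
  finally show ?case unfolding h using Tconv_integrable[OF g(1) R] z by (simp add: R_def)
 qed
 have bound: "\<bar>hseq \<Lambda> f (Suc k) x\<bar> \<le> C * E"
  if f: "integrable lborel f" "(BI v. f v) = 0" "0 \<le> E" "(LE v. \<bar>f v\<bar> * (1 + norm v)) \<le> ennreal E" for f E k x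
 proof -
  define g where "g = hseq \<Lambda> f k"
  define R where "R = \<Lambda> ^ Suc k"
  have R: "R \<ge> 1" unfolding R_def using La by (intro one_le_power) simp
  have g: "integrable lborel g" "(LE v. \<bar>g v\<bar> * (1 + norm v / \<Lambda> ^ k)) \<le> ennreal (E / 2 ^ k)"
   using main[OF f, of k] by (auto simp: g_def)
  have "ennreal (BI v. \<bar>g v\<bar>) = (LI v. ennreal \<bar>g v\<bar>)" using g(1) by (intro nn_integral_eq_integral[symmetric]) auto
  also have "... \<le> (LE v. \<bar>g v\<bar> * (1 + norm v / \<Lambda> ^ k))"
   using La by (intro nn_integral_mono ennreal_leI) (simp add: mult_le_cancel_left1)
  also have "... \<le> ennreal (E / 2 ^ k)" by (rule g(2))
  also have "... \<le> ennreal E" using f(3) by (intro ennreal_leI) (simp add: field_simps mult_le_cancel_left1)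
  finally have gE: "(BI v. \<bar>g v\<bar>) \<le> E" using f(3) by (simp add: ennreal_le_iff)
  have "\<bar>Tconv R g x\<bar> \<le> C / R ^ CARD('n) * (BI v. \<bar>g v\<bar>)"
   using R C(2) by (intro Tconv_bound g(1)) auto
  also have "... \<le> C * E"
  proof (rule mult_mono)
   have "1 \<le> R ^ CARD('n)" using R by (rule one_le_power)
   then show "C / R ^ CARD('n) \<le> C" using C(1) by (simp add: divide_le_eq mult_le_cancel_left1)
  qed (use gE C f in auto)
  finally show ?thesis by (simp add: g_def R_def)
 qed
 show ?thesis using La(1) C(1) main bound by blast
qed

text \<open>For legs of lengths R A and R B the weight \<open>wgt\<close> contains the factor A that
  the rate has, and the Gaussian absorbs the power A ^ (d - 2) from the denominator of
  \<open>grate\<close>. The gain 1 / R is what makes the sum over scales converge pointwise.\<close>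

lemma evw_le_grate:
 "\<exists>C\<ge>0. \<forall>R x. 1 \<le> R \<longrightarrow> evw R x \<le> C / R * grate x"
proof -
 define d where "d = CARD('n) - 2"
 define C where "C = (fact d * exp 2) * (fact 1 * exp 2) / tau_mass"
 have C0: "C \<ge> 0" using tau_mass(1) by (simp add: C_def)
 have "evw R x \<le> C / R * grate x" if R: "1 \<le> R" for R x
 proof (cases "fst (snd x) - fst (fst x) = 0")
  case True
  then show ?thesis by (simp add: evw_def wgt_def grate_def)
 next
  case False
  define a b where "a = fst (snd x) - fst (fst x)" and "b = snd (snd x) - fst (fst x)"
  define A B where "A = norm a / R" and "B = norm b / R"
  have A: "A > 0" "B \<ge> 0" "norm a = R * A" using False R by (auto simp: A_def B_def a_def)
  have w: "wgt (a /\<^sub>R R, b /\<^sub>R R) = A * B * (exp (- A\<^sup>2 / 2) * exp (- B\<^sup>2 / 2))"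
  proof -
   have "norm (a /\<^sub>R R) = A" "norm (b /\<^sub>R R) = B" using R by (simp_all add: A_def B_def divide_inverse mult.commute)
   moreover have "- A\<^sup>2 / 2 - B\<^sup>2 / 2 = - A\<^sup>2 / 2 + (- B\<^sup>2 / 2)" by simp
   ultimately show ?thesis unfolding wgt_def gauss2_def fst_conv snd_conv by (simp only: exp_add)
  qed
  have "wgt (a /\<^sub>R R, b /\<^sub>R R) * (R * A) ^ d = (A ^ d * exp (- A\<^sup>2 / 2)) * (B ^ 1 * exp (- B\<^sup>2 / 2)) * (A * R ^ d)"
   unfolding w by (simp add: power_mult_distrib)
  also have "... \<le> (fact d * exp 2) * (fact 1 * exp 2) * (A * R ^ d)"
  proof -
   have "A ^ d * exp (- A\<^sup>2 / 2) \<le> fact d * exp 2" "B ^ 1 * exp (- B\<^sup>2 / 2) \<le> fact 1 * exp 2"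
    using A rgauss_bound[of A d] rgauss_bound[of B 1] unfolding rgauss_def by auto
   then show ?thesis using A R by (intro mult_right_mono mult_mono[of "A ^ d * exp (- A\<^sup>2 / 2)"]) auto
  qed
  finally have 1: "wgt (a /\<^sub>R R, b /\<^sub>R R) * (R * A) ^ d \<le> (C * tau_mass) * (A * R ^ d)" using tau_mass(1) by (simp add: C_def)
  have p: "2 * CARD('n) - 2 = Suc (Suc (d + d))" using card2 by (simp add: d_def)
  have pos: "(R * A) ^ d > 0" "tau_mass * R ^ (2 * CARD('n) - 2) > 0" using A R tau_mass(1) by auto
  have "evw R x = wgt (a /\<^sub>R R, b /\<^sub>R R) / (tau_mass * R ^ (2 * CARD('n) - 2))" by (simp add: evw_def a_def b_def)
  also have "... \<le> ((C * tau_mass) * (A * R ^ d) / (R * A) ^ d) / (tau_mass * R ^ (2 * CARD('n) - 2))"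
   using 1 pos by (intro divide_right_mono) (simp_all add: pos_le_divide_eq)
  also have "... = (C * A * R ^ d / (R * A) ^ d) / R ^ Suc (Suc (d + d))" using tau_mass(1) by (simp add: p)
  also have "... = (C * A / (R * A) ^ d) * (1 / (R * R * R ^ d))" using R by (simp add: power_add field_simps)
  also have "... \<le> (C * A / (R * A) ^ d) * 1"
  proof (rule mult_left_mono)
   have "1 \<le> R ^ d" using R by (rule one_le_power)
   moreover have "1 \<le> R * R" using mult_mono[OF R R] R by simp
   ultimately have "1 \<le> R * R * R ^ d" using mult_mono[of 1 "R * R" 1 "R ^ d"] R by simp
   then show "1 / (R * R * R ^ d) \<le> 1" by simp
  qed (use A C0 R in auto)
  also have "... = C / R * (norm a / norm a ^ d)" using R A by simp
  finally show ?thesis by (simp add: grate_def a_def d_def)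
 qed
 then show ?thesis using C0 by blast
qed

text \<open>The law of a collision at scale R is symmetric in the incoming pair. For symmetric H
  both halves of \<open>Sin g\<close> contribute equally, so g can be taken at the first particle
  while its partner remains a ghost.\<close>

lemma nn_integral_Sin:
 assumes [measurable]: "g \<in> borel_funs" "H \<in> borel_funs" and g0: "\<And>v. 0 \<le> g v"
  and sym: "\<And>x. H (swap_in x) = H x" and R: "R > 0"
 shows "(CI x. ennreal (evw R x * Sin g x) * H x) = (LI v. ennreal (g v) * (TI p. H (emb R v p)))"
proof -
 let ?A = "\<lambda>x :: 'n coll. ennreal (g (fst (fst x))) * H x"
 have [measurable]: "?A \<in> borel_funs" by measurable
 have spl: "ennreal (Sin g x) * H x = ennreal (1 / 2) * (?A x + ?A (swap_in x))" for x
 proof -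
  have "ennreal (Sin g x) = ennreal (1 / 2) * (ennreal (g (fst (fst x))) + ennreal (g (snd (fst x))))"
  proof -
   have "Sin g x = 1 / 2 * (g (fst (fst x)) + g (snd (fst x)))" by (simp add: Sin_def)
   then have "ennreal (Sin g x) = ennreal (1 / 2) * ennreal (g (fst (fst x)) + g (snd (fst x)))"
    using g0 by (simp only: ennreal_mult add_nonneg_nonneg zero_le_divide_1_iff zero_le_numeral)
   also have "ennreal (g (fst (fst x)) + g (snd (fst x))) = ennreal (g (fst (fst x))) + ennreal (g (snd (fst x)))"
    using g0 by (intro ennreal_plus) auto
   finally show ?thesis .
  qed
  moreover have "?A (swap_in x) = ennreal (g (snd (fst x))) * H x" by (simp only: sym) (simp add: swap_in_def)
  ultimately show ?thesis by (simp only: distrib_right mult.assoc)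
 qed
 have "(CI x. ennreal (evw R x * Sin g x) * H x) = (CI x. ennreal (evw R x) * (ennreal (Sin g x) * H x))"
  using R g0 by (intro nn_integral_cong) (simp add: ennreal_mult Sin_nonneg mult.assoc)
 also have "... = (LI v. (TI p. ennreal (Sin g (emb R v p)) * H (emb R v p)))"
  by (rule nn_integral_evw[OF _ R]) measurable
 also have "... = (LI v. (TI p. ennreal (1 / 2) * (?A (emb R v p) + ?A (swap_in (emb R v p)))))"
  unfolding spl ..
 also have "... = (LI v. ennreal (1 / 2) * ((TI p. ?A (emb R v p)) + (TI p. ?A (swap_in (emb R v p)))))"
  by (intro nn_integral_cong, subst nn_integral_cmult) (simp_all add: nn_integral_add)
 also have "... = ennreal (1 / 2) * ((LI v. (TI p. ?A (emb R v p))) + (LI v. (TI p. ?A (swap_in (emb R v p)))))"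
  by (subst nn_integral_cmult, measurable, subst nn_integral_add, measurable)
 also have "(LI v. (TI p. ?A (swap_in (emb R v p)))) = (LI v. (TI p. ?A (emb R v p)))"
  by (rule emb_swap_in) measurable
 also have "ennreal (1 / 2) * ((LI v. (TI p. ?A (emb R v p))) + (LI v. (TI p. ?A (emb R v p)))) = (LI v. (TI p. ?A (emb R v p)))"
 proof -
  have "ennreal (1 / 2) * (y + y) = y" for y :: ennreal
  proof -
   have "ennreal (1 / 2) * (y + y) = (ennreal (1 / 2) + ennreal (1 / 2)) * y" by (simp only: distrib_left distrib_right)
   also have "ennreal (1 / 2) + ennreal (1 / 2) = 1" by (subst ennreal_plus[symmetric]) auto
   finally show ?thesis by simp
  qed
  then show ?thesis .
 qed
 also have "... = (LI v. ennreal (g v) * (TI p. H (emb R v p)))"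
  by (intro nn_integral_cong) (simp add: emb_def nn_integral_cmult)
 finally show ?thesis .
qed

lemma nn_integral_Sout:
 assumes [measurable]: "g \<in> borel_funs" and H[measurable]: "H \<in> borel_funs" and g0: "\<And>v. 0 \<le> g v"
  and sym: "\<And>x. H (swap_out x) = H x" and R: "R > 0"
 shows "(CI x. ennreal (evw R x * Sout g x) * H x) = (LI v. ennreal (g v) * (TI p. H (prod.swap (emb R v p))))"
proof -
 have [measurable]: "(\<lambda>x. H (prod.swap x)) \<in> borel_funs" by (rule measurable_compose[OF swap_measurable H])
 have "(CI x. ennreal (evw R x * Sout g x) * H x) = (CI x. ennreal (evw R x) * (ennreal (Sout g x) * H x))"
  using R g0 by (intro nn_integral_cong) (simp add: ennreal_mult Sout_nonneg mult.assoc)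
 also have "... = (LI v. (TI p. ennreal (Sout g (emb R v p)) * H (emb R v p)))"
  by (rule nn_integral_evw[OF _ R]) measurable
 also have "... = (LI v. (TI p. ennreal (Sout g (prod.swap (emb R v p))) * H (prod.swap (emb R v p))))"
  by (rule emb_reverse[symmetric, of "\<lambda>x. ennreal (Sout g x) * H x"]) measurable
 also have "... = (LI v. (TI p. ennreal (Sin g (emb R v p)) * H (prod.swap (emb R v p))))"
  by (simp only: Sin_swap)
 also have "... = (CI x. ennreal (evw R x) * (ennreal (Sin g x) * H (prod.swap x)))"
  by (rule nn_integral_evw[OF _ R, symmetric]) measurable
 also have "... = (CI x. ennreal (evw R x * Sin g x) * H (prod.swap x))"
  using R g0 by (intro nn_integral_cong) (simp add: ennreal_mult Sin_nonneg mult.assoc)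
 also have "... = (LI v. ennreal (g v) * (TI p. H (prod.swap (emb R v p))))"
 proof (rule nn_integral_Sin[OF _ _ g0 _ R])
  show "H (prod.swap (swap_in x)) = H (prod.swap x)" for x
   using sym[of "prod.swap x"] by (simp add: swap_in_def swap_out_def prod.swap_def)
 qed measurable
 finally show ?thesis .
qed

text \<open>The scale enters only through ln (1 + R), which grows linearly along geometric scales,
  and v only through |v| / R, which the cascade norm measures. The legs contribute their Gaussian
  first moments.\<close>

lemma Lw_emb:
 "\<exists>c\<ge>0. \<forall>R\<ge>1. \<forall>v. (TI p. ennreal (Lw (emb R v p))) \<le> ennreal (c * (1 + ln (1 + R)) * (1 + norm v / R))"
proof -
 define M where "M = enn2real (TI p. ennreal (norm (fst p)))"
 have "(TI p. ennreal (norm (fst p))) = (LI x. ennreal (alpha x) * ennreal (norm x))"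
  by (rule tau_fst) measurable
 also have "... = (LI (x :: real ^ 'n). ennreal (1 / gauss_const) * ennreal (norm x ^ 1 * exp (- (norm x)\<^sup>2 / 2)))"
  using gauss_const(2) by (intro nn_integral_cong) (simp add: alpha_def mult.commute flip: ennreal_mult)
 also have "... = ennreal (1 / gauss_const) * (LI (x :: real ^ 'n). ennreal (norm x ^ 1 * exp (- (norm x)\<^sup>2 / 2)))"
  by (rule nn_integral_cmult) measurable
 also have "... < top" using gauss_moment_finite[where 'a="real ^ 'n", of 1] by (simp only: ennreal_mult_less_top) simp
 finally have M: "(TI p. ennreal (norm (fst p))) = ennreal M" by (simp add: M_def)
 have M2: "(TI p. ennreal (norm (snd p))) = ennreal M"
  unfolding M[symmetric] using tau_swap[of "\<lambda>p. ennreal (norm (fst p))"] by simp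
 have M0: "M \<ge> 0" by (simp add: M_def)
 have "(TI p. ennreal (Lw (emb R v p))) \<le> ennreal ((5 + 4 * M) * (1 + ln (1 + R)) * (1 + norm v / R))" if R: "R \<ge> 1" for R v
 proof -
  define K where "K = 1 + 4 * ln (1 + R) + 4 * (norm v / R)"
  have K0: "K \<ge> 0" using R by (simp add: K_def)
  have pt: "Lw (emb R v p) \<le> K + 2 * norm (fst p) + 2 * norm (snd p)" for p :: "'n vels"
  proof -
   have R0: "R > 0" using R by simp
   have 1: "ln (1 + norm v) \<le> ln (1 + R) + norm v / R + 0" by (rule ln_norm_bound[OF R0]) auto
   have "norm (v + R *\<^sub>R (fst p + snd p)) \<le> norm v + R * (norm (fst p) + norm (snd p))"
   proof -
    have "R * norm (fst p + snd p) \<le> R * (norm (fst p) + norm (snd p))" using R by (intro mult_left_mono norm_triangle_ineq) simp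
    moreover have "norm (R *\<^sub>R (fst p + snd p)) = R * norm (fst p + snd p)" using R by simp
    ultimately show ?thesis using norm_triangle_ineq[of v "R *\<^sub>R (fst p + snd p)"] by linarith
   qed
   then have 2: "ln (1 + norm (v + R *\<^sub>R (fst p + snd p))) \<le> ln (1 + R) + norm v / R + (norm (fst p) + norm (snd p))"
    by (rule ln_norm_bound[OF R0]) auto
   have n: "norm (v + R *\<^sub>R y) \<le> norm v + R * norm y" for y using norm_triangle_ineq[of v "R *\<^sub>R y"] R by simp
   have 3: "ln (1 + norm (v + R *\<^sub>R y)) \<le> ln (1 + R) + norm v / R + norm y" for y
    by (rule ln_norm_bound[OF R0 n]) auto
   show ?thesis unfolding Lw_def emb_def fst_conv snd_conv K_def using 1 2 3[of "fst p"] 3[of "snd p"] by linarith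
  qed
  have "(TI p. ennreal (Lw (emb R v p))) \<le> (TI p. ennreal K + (ennreal 2 * ennreal (norm (fst p)) + ennreal 2 * ennreal (norm (snd p))))"
  proof (rule nn_integral_mono)
   fix p :: "'n vels"
   have "ennreal (Lw (emb R v p)) \<le> ennreal K + ennreal (2 * norm (fst p) + 2 * norm (snd p))"
    by (rule ennreal_le_plusI) (use pt[of p] K0 in auto)
   then show "ennreal (Lw (emb R v p)) \<le> ennreal K + (ennreal 2 * ennreal (norm (fst p)) + ennreal 2 * ennreal (norm (snd p)))"
    by (simp add: ennreal_mult)
  qed
  also have "... = ennreal K + (ennreal 2 * ennreal M + ennreal 2 * ennreal M)"
   unfolding M[symmetric] M2[symmetric]
   by (subst nn_integral_add, measurable, subst nn_integral_add, measurable)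
    (simp add: nn_integral_cmult tau.emeasure_space_1[simplified] M M2)
  also have "... = ennreal (K + (2 * M + 2 * M))" using K0 M0
   by (simp only: ennreal_mult[symmetric] ennreal_plus[symmetric] add_nonneg_nonneg mult_nonneg_nonneg zero_le_numeral)
  also have "... \<le> ennreal ((5 + 4 * M) * (1 + ln (1 + R)) * (1 + norm v / R))"
  proof (rule ennreal_leI)
   define l w where "l = ln (1 + R)" and "w = norm v / R"
   have lw: "l \<ge> 0" "w \<ge> 0" using R by (auto simp: l_def w_def)
   have "0 \<le> l * w" "0 \<le> M * l" "0 \<le> M * w" "0 \<le> M * l * w" using lw M0 by auto
   then show "K + (2 * M + 2 * M) \<le> (5 + 4 * M) * (1 + ln (1 + R)) * (1 + norm v / R)"
    unfolding K_def l_def[symmetric] w_def[symmetric] using lw by (simp add: algebra_simps)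
  qed
  finally show ?thesis .
 qed
 then show ?thesis using M0 by (intro exI[of _ "5 + 4 * M"]) auto
qed

end

definition cg :: "(real ^ 'n::finite \<Rightarrow> real) \<Rightarrow> 'n coll \<Rightarrow> real" where
 "cg \<phi> x = collision_gradient \<phi> (fst x) (snd x)"

lemma cg_alt: "cg \<phi> x = \<phi> (fst (snd x)) + \<phi> (snd (snd x)) - \<phi> (fst (fst x)) - \<phi> (snd (fst x))"
 by (simp add: cg_def collision_gradient_def split: prod.splits)

lemma cg_measurable[measurable]:
 assumes [measurable]: "\<phi> \<in> borel_funs"
 shows "cg \<phi> \<in> borel_measurable (borel :: 'n::finite coll measure)"
 unfolding cg_alt[abs_def] by measurable

lemma cg_swap: "cg \<phi> (swap_in x) = cg \<phi> x" "cg \<phi> (swap_out x) = cg \<phi> x" "cg \<phi> (prod.swap x) = - cg \<phi> x"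
 by (simp_all add: cg_alt swap_in_def swap_out_def)

lemma cg_bound:
 assumes "\<And>v. \<bar>\<phi> v\<bar> \<le> B"
 shows "\<bar>cg \<phi> x\<bar> \<le> 4 * B"
 unfolding cg_alt using assms[of "fst (snd x)"] assms[of "snd (snd x)"] assms[of "fst (fst x)"] assms[of "snd (fst x)"] by linarith

lemma cg_emb: "cg \<phi> (emb R v p) = \<phi> (v + R *\<^sub>R fst p) + \<phi> (v + R *\<^sub>R snd p) - \<phi> (v + R *\<^sub>R (fst p + snd p)) - \<phi> v"
 by (simp add: cg_alt emb_def)

context haar_sphere begin

text \<open>The change of variables is known for nonnegative integrands. Adding the bound B makes
  \<psi> nonnegative, and the surplus is removed by the identity for the constant function.\<close>

lemma integral_of_nn_integral:
 fixes g :: "real ^ 'n \<Rightarrow> real" and D \<psi> :: "'n coll \<Rightarrow> real" and T :: "real ^ 'n \<Rightarrow> 'n vels \<Rightarrow> 'n coll" and B :: real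
 assumes [measurable]: "D \<in> borel_funs" "\<psi> \<in> borel_funs" "(\<lambda>q. T (fst q) (snd q)) \<in> borel_measurable (borel \<Otimes>\<^sub>M borel)"
  and D0: "\<And>x. 0 \<le> D x" and g: "integrable lborel g" "\<And>v. 0 \<le> g v" and B: "\<And>x. \<bar>\<psi> x\<bar> \<le> B"
  and eq: "(CI x. ennreal (D x) * ennreal (\<psi> x + B)) = (LI v. ennreal (g v) * (TI p. ennreal (\<psi> (T v p) + B)))"
  and eq1: "(CI x. ennreal (D x) * 1) = (LI v. ennreal (g v) * (TI p. 1))"
 shows "integrable coll_measure (\<lambda>x. D x * \<psi> x)"
  and "(BC x. D x * \<psi> x) = (BI v. g v * (BT p. \<psi> (T v p)))"
proof -
 have [measurable]: "g \<in> borel_funs" using g(1) by auto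
 have T2[measurable]: "T v \<in> borel_funs" for v
  using measurable_compose[of "\<lambda>p. (v, p)" borel "borel \<Otimes>\<^sub>M borel" "\<lambda>q. T (fst q) (snd q)" borel] by simp
 have eq1': "(CE x. D x) = (LE v. g v)"
  using eq1 tau.emeasure_space_1 by simp
 have gfin: "(LE v. g v) < \<infinity>"
  using g by (simp add: integrable_iff_bounded)
 have iD: "integrable coll_measure D"
  using eq1' gfin D0 by (intro integrableI_nonneg) auto
 have B0: "0 \<le> B" using order_trans[OF abs_ge_zero B] .
 show iDp: "integrable coll_measure (\<lambda>x. D x * \<psi> x)"
 proof (rule Bochner_Integration.integrable_bound[of _ "\<lambda>x. B * D x"])
  have "\<bar>\<psi> x\<bar> * D x \<le> B * D x" for x by (intro mult_right_mono B D0)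
  then show "AE x in coll_measure. norm (D x * \<psi> x) \<le> norm (B * D x)"
   using B0 D0 by (intro AE_I2) (simp add: abs_mult mult.commute)
 qed (use iD in auto)
 define G where "G v = (BT p. \<psi> (T v p))" for v
 have [measurable]: "G \<in> borel_funs" unfolding G_def by measurable
 have it: "integrable tau (\<lambda>p. \<psi> (T v p))" for v
  using B by (intro integrable_tau_bounded[of _ B]) auto
 have GB: "\<bar>G v\<bar> \<le> B" for v
 proof -
  have "\<bar>G v\<bar> \<le> (BT p. \<bar>\<psi> (T v p)\<bar>)" unfolding G_def by (rule integral_abs_bound)
  also have "... \<le> (BT p. B)" using it B by (intro integral_mono) auto
  finally show ?thesis using tau.prob_space by simp
 qed
 have inner: "(TI p. ennreal (\<psi> (T v p) + B)) = ennreal (G v + B)" for v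
 proof -
  have "0 \<le> \<psi> (T v p) + B" for p using B[of "T v p"] by linarith
  then have "(TI p. ennreal (\<psi> (T v p) + B)) = ennreal (BT p. \<psi> (T v p) + B)"
   using it by (intro nn_integral_eq_integral) auto
  also have "(BT p. \<psi> (T v p) + B) = G v + B" using it tau.prob_space by (simp add: G_def)
  finally show ?thesis .
 qed
 have pos1: "0 \<le> \<psi> x + B" for x using B[of x] by linarith
 have pos2: "0 \<le> G v + B" for v using GB[of v] by linarith
 have igG: "integrable lborel (\<lambda>v. g v * G v)"
 proof (rule Bochner_Integration.integrable_bound[of _ "\<lambda>v. B * g v"])
  have "\<bar>G v\<bar> * g v \<le> B * g v" for v by (intro mult_right_mono GB g)
  then show "AE v in lborel. norm (g v * G v) \<le> norm (B * g v)"
   using B0 g(2) by (intro AE_I2) (simp add: abs_mult mult.commute)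
 qed (use g in auto)
 have "(BC x. D x * (\<psi> x + B)) = enn2real (CE x. D x * (\<psi> x + B))"
  using D0 pos1 by (intro integral_eq_nn_integral) auto
 also have "(CE x. D x * (\<psi> x + B)) = (LE v. g v * (G v + B))"
  using eq D0 pos1 pos2 g(2) by (simp add: inner ennreal_mult)
 also have "enn2real (LE v. g v * (G v + B)) = (BI v. g v * (G v + B))"
  using g(2) pos2 by (intro integral_eq_nn_integral[symmetric]) auto
 finally have A: "(BC x. D x * (\<psi> x + B)) = (BI v. g v * (G v + B))" .
 have D1: "(BC x. D x) = (BI v. g v)"
  using eq1' D0 g(2) by (subst (1 2) integral_eq_nn_integral) auto
 have "(BC x. D x * (\<psi> x + B)) = (BC x. D x * \<psi> x) + (BC x. D x) * B"
  using iDp iD by (simp add: distrib_left)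
 moreover have "(BI v. g v * (G v + B)) = (BI v. g v * G v) + (BI v. g v) * B"
  using igG g(1) by (simp add: distrib_left)
 ultimately show "(BC x. D x * \<psi> x) = (BI v. g v * (BT p. \<psi> (T v p)))"
  using A D1 by (simp add: G_def)
qed

text \<open>A collision destroys the particle at v and its partner and creates two. Creation and
  loss of the partner make up \<open>Tconv\<close>; the loss of the particle at v is the remaining
  term.\<close>

lemma cg_Tconv:
 assumes g: "integrable lborel g" and [measurable]: "\<phi> \<in> borel_funs" and B: "\<And>v. \<bar>\<phi> v\<bar> \<le> B" and R: "R > 0"
 shows "(BI v. g v * (BT p. cg \<phi> (emb R v p))) = (BI x. \<phi> x * Tconv R g x) - (BI x. \<phi> x * g x)"
proof -
 have [measurable]: "g \<in> borel_funs" using g by auto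
 define G where "G v = (BT p. \<phi> (v + R *\<^sub>R fst p) + \<phi> (v + R *\<^sub>R snd p) - \<phi> (v + R *\<^sub>R (fst p + snd p)))" for v
 have [measurable]: "G \<in> borel_funs" unfolding G_def by measurable
 have it: "integrable tau (\<lambda>p. \<phi> (v + R *\<^sub>R fst p) + \<phi> (v + R *\<^sub>R snd p) - \<phi> (v + R *\<^sub>R (fst p + snd p)))" for v
 proof (rule integrable_tau_bounded[of _ "3 * B"])
  show "\<bar>\<phi> (v + R *\<^sub>R fst p) + \<phi> (v + R *\<^sub>R snd p) - \<phi> (v + R *\<^sub>R (fst p + snd p))\<bar> \<le> 3 * B" for p
   using B[of "v + R *\<^sub>R fst p"] B[of "v + R *\<^sub>R snd p"] B[of "v + R *\<^sub>R (fst p + snd p)"] by linarith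
 qed measurable
 have cgG: "(BT p. cg \<phi> (emb R v p)) = G v - \<phi> v" for v
  unfolding cg_emb G_def using it[of v] tau.prob_space by simp
 have GB: "\<bar>G v\<bar> \<le> 3 * B" for v
 proof -
  have "\<bar>G v\<bar> \<le> (BT p. \<bar>\<phi> (v + R *\<^sub>R fst p) + \<phi> (v + R *\<^sub>R snd p) - \<phi> (v + R *\<^sub>R (fst p + snd p))\<bar>)" unfolding G_def by (rule integral_abs_bound)
  also have "... \<le> (BT p. 3 * B)"
  proof (rule integral_mono)
   show "\<bar>\<phi> (v + R *\<^sub>R fst p) + \<phi> (v + R *\<^sub>R snd p) - \<phi> (v + R *\<^sub>R (fst p + snd p))\<bar> \<le> 3 * B" for p
    using B[of "v + R *\<^sub>R fst p"] B[of "v + R *\<^sub>R snd p"] B[of "v + R *\<^sub>R (fst p + snd p)"] by linarith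
  qed (use it in auto)
  finally show ?thesis using tau.prob_space by simp
 qed
 have i: "integrable lborel (\<lambda>v. g v * k v)" if [measurable]: "k \<in> borel_funs" and k: "\<And>v. \<bar>k v\<bar> \<le> b" for k b
 proof (rule Bochner_Integration.integrable_bound[of _ "\<lambda>v. b * \<bar>g v\<bar>"])
  have "\<bar>k v\<bar> * \<bar>g v\<bar> \<le> b * \<bar>g v\<bar>" for v by (intro mult_right_mono k) simp
  moreover have "0 \<le> b" using order_trans[OF abs_ge_zero k] .
  ultimately show "AE v in lborel. norm (g v * k v) \<le> norm (b * \<bar>g v\<bar>)"
   by (intro AE_I2) (simp add: abs_mult mult.commute)
 qed (use g in auto)
 have "(BI v. g v * (G v - \<phi> v)) = (BI v. g v * G v) - (BI v. g v * \<phi> v)"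
  using i[of G, OF _ GB] i[of \<phi>, OF _ B] by (simp add: right_diff_distrib)
 also have "(BI v. g v * G v) = (BI x. \<phi> x * Tconv R g x)"
  unfolding G_def by (rule Tconv_test[OF g _ B R, symmetric]) measurable
 finally show ?thesis unfolding cgG by (simp add: mult.commute)
qed

text \<open>Weighting by the incoming density replaces g by its smoothing. Weighting by the outgoing
  density runs the same collisions backward and reverses the sign, which is how the negative part of
  an error is transported by a nonnegative weight.\<close>

lemma Sin_balance:
 assumes g: "integrable lborel g" "\<And>v. 0 \<le> g v" and [measurable]: "\<phi> \<in> borel_funs" and B: "\<And>v. \<bar>\<phi> v\<bar> \<le> B" and R: "R > 0"
 shows "integrable coll_measure (\<lambda>x. evw R x * Sin g x * cg \<phi> x)"
  and "(BC x. evw R x * Sin g x * cg \<phi> x) = (BI x. \<phi> x * Tconv R g x) - (BI x. \<phi> x * g x)"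
  and "integrable coll_measure (\<lambda>x. evw R x * Sout g x * cg \<phi> x)"
  and "(BC x. evw R x * Sout g x * cg \<phi> x) = - ((BI x. \<phi> x * Tconv R g x) - (BI x. \<phi> x * g x))"
proof -
 have [measurable]: "g \<in> borel_funs" using g by auto
 have n: "0 \<le> evw R x * Sin g x" "0 \<le> evw R x * Sout g x" for x using g R by (simp_all add: Sin_nonneg Sout_nonneg)
 have c: "\<bar>cg \<phi> x\<bar> \<le> 4 * B" for x by (rule cg_bound[OF B])
 have [measurable]: "(\<lambda>q :: (real ^ 'n) \<times> ('n vels). prod.swap (emb R (fst q) (snd q))) \<in> borel_measurable (borel \<Otimes>\<^sub>M borel)"
  by (rule measurable_compose[OF _ swap_measurable]) measurable
 note in1 = integral_of_nn_integral[of "\<lambda>x. evw R x * Sin g x" "cg \<phi>" "emb R" g "4 * B"]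
 note out1 = integral_of_nn_integral[of "\<lambda>x. evw R x * Sout g x" "cg \<phi>" "\<lambda>v p. prod.swap (emb R v p)" g "4 * B"]
 have e1: "(CI x. ennreal (evw R x * Sin g x) * ennreal (cg \<phi> x + 4 * B)) = (LI v. ennreal (g v) * (TI p. ennreal (cg \<phi> (emb R v p) + 4 * B)))"
  by (rule nn_integral_Sin) (use g R in \<open>auto simp: cg_swap\<close>)
 have e2: "(CI x. ennreal (evw R x * Sin g x) * 1) = (LI v. ennreal (g v) * (TI p. 1))"
  by (rule nn_integral_Sin) (use g R in auto)
 have e3: "(CI x. ennreal (evw R x * Sout g x) * ennreal (cg \<phi> x + 4 * B)) = (LI v. ennreal (g v) * (TI p. ennreal (cg \<phi> (prod.swap (emb R v p)) + 4 * B)))"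
  by (rule nn_integral_Sout[of g "\<lambda>x. ennreal (cg \<phi> x + 4 * B)"]) (use g R in \<open>auto simp: cg_swap\<close>)
 have e4: "(CI x. ennreal (evw R x * Sout g x) * 1) = (LI v. ennreal (g v) * (TI p. 1))"
  by (rule nn_integral_Sout[of g "\<lambda>_. 1"]) (use g R in auto)
 show "integrable coll_measure (\<lambda>x. evw R x * Sin g x * cg \<phi> x)"
  by (rule in1(1)) (use n g c e1 e2 in simp_all)
 have "(BC x. evw R x * Sin g x * cg \<phi> x) = (BI v. g v * (BT p. cg \<phi> (emb R v p)))"
  by (rule in1(2)) (use n g c e1 e2 in simp_all)
 then show "(BC x. evw R x * Sin g x * cg \<phi> x) = (BI x. \<phi> x * Tconv R g x) - (BI x. \<phi> x * g x)"
  using cg_Tconv[OF g(1) _ B R] by simp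
 show "integrable coll_measure (\<lambda>x. evw R x * Sout g x * cg \<phi> x)"
  by (rule out1(1)) (use n g c e3 e4 in simp_all)
 have "(BC x. evw R x * Sout g x * cg \<phi> x) = (BI v. g v * (BT p. cg \<phi> (prod.swap (emb R v p))))"
  by (rule out1(2)) (use n g c e3 e4 in simp_all)
 also have "... = - (BI v. g v * (BT p. cg \<phi> (emb R v p)))"
  by (simp add: cg_swap)
 finally show "(BC x. evw R x * Sout g x * cg \<phi> x) = - ((BI x. \<phi> x * Tconv R g x) - (BI x. \<phi> x * g x))"
  using cg_Tconv[OF g(1) _ B R] by simp
qed

lemma evw_swap:
 assumes [measurable]: "H \<in> borel_funs" and R: "R > 0"
 shows "(CI x. ennreal (evw R x) * H (swap_in x)) = (CI x. ennreal (evw R x) * H x)"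
  and "(CI x. ennreal (evw R x) * H (swap_out x)) = (CI x. ennreal (evw R x) * H x)"
proof -
 have m: "(\<lambda>x. H (swap_in x)) \<in> borel_funs" "(\<lambda>x. H (swap_out x)) \<in> borel_funs"
  by (auto intro!: measurable_compose[OF swap_in_measurable] measurable_compose[OF swap_out_measurable])
 show "(CI x. ennreal (evw R x) * H (swap_in x)) = (CI x. ennreal (evw R x) * H x)"
  by (simp add: nn_integral_evw[OF m(1) R] nn_integral_evw[OF assms] emb_swap_in)
 show "(CI x. ennreal (evw R x) * H (swap_out x)) = (CI x. ennreal (evw R x) * H x)"
  by (simp add: nn_integral_evw[OF m(2) R] nn_integral_evw[OF assms] emb_swap_out)
qed

end

lemma integral_of_nn_integral_le:
 assumes [measurable]: "f \<in> borel_measurable M" and f: "\<And>x. 0 \<le> f x" and le: "(\<integral>\<^sup>+x. ennreal (f x) \<partial>M) \<le> ennreal c" and c: "0 \<le> c"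
 shows "integrable M f" "(\<integral>x. f x \<partial>M) \<le> c"
proof -
 show i: "integrable M f" using le f by (intro integrableI_nonneg) (auto intro: le_less_trans)
 have "ennreal (\<integral>x. f x \<partial>M) \<le> ennreal c" using le nn_integral_eq_integral[OF i] f by simp
 then show "(\<integral>x. f x \<partial>M) \<le> c" using c by (simp add: ennreal_le_iff)
qed

definition velocity_density :: "real \<Rightarrow> (real ^ 'n::finite \<Rightarrow> real) \<Rightarrow> bool" where
 "velocity_density e f \<longleftrightarrow> f \<in> borel_funs \<and> (\<forall>v. 0 \<le> f v) \<and> (LE v. f v) = 1 \<and>
  (LI v. ennreal (f v) * ennreal ((norm v)\<^sup>2 / 2)) \<le> ennreal e"

text \<open>The constants are those of 1 + r \<le> 3 / 2 + r^2 / 2, that is, of (r - 1)^2 \<ge>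
  0.\<close>

lemma velocity_density_moment:
 fixes f :: "real ^ 'n::finite \<Rightarrow> real"
 assumes "velocity_density e f" "0 \<le> e"
 shows "(LE v. f v * (1 + norm v)) \<le> ennreal (3 / 2 + e)"
proof -
 have [measurable]: "f \<in> borel_funs" and f: "\<And>v. 0 \<le> f v" "(LE v. f v) = 1"
   "(LI v. ennreal (f v) * ennreal ((norm v)\<^sup>2 / 2)) \<le> ennreal e"
  using assms by (auto simp: velocity_density_def)
 have "(LE v. f v * (1 + norm v)) \<le> (LI v. ennreal (3 / 2) * ennreal (f v) + ennreal (f v) * ennreal ((norm v)\<^sup>2 / 2))"
 proof (rule nn_integral_mono)
  fix v :: "real ^ 'n"
  have "1 + norm v \<le> 3 / 2 + (norm v)\<^sup>2 / 2" using zero_le_power2[of "norm v - 1"] by (simp add: power2_eq_square algebra_simps)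
  then have "f v * (1 + norm v) \<le> f v * (3 / 2 + (norm v)\<^sup>2 / 2)" using f(1) by (rule mult_left_mono)
  also have "... = 3 / 2 * f v + f v * ((norm v)\<^sup>2 / 2)" by (simp add: algebra_simps)
  finally have "ennreal (f v * (1 + norm v)) \<le> ennreal (3 / 2 * f v) + ennreal (f v * ((norm v)\<^sup>2 / 2))"
   by (rule ennreal_le_plusI) (use f in auto)
  then show "ennreal (f v * (1 + norm v)) \<le> ennreal (3 / 2) * ennreal (f v) + ennreal (f v) * ennreal ((norm v)\<^sup>2 / 2)"
   using f(1) by (simp only: ennreal_mult divide_nonneg_nonneg zero_le_power2 zero_le_numeral)
 qed
 also have "... = ennreal (3 / 2) + (LI v. ennreal (f v) * ennreal ((norm v)\<^sup>2 / 2))"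
  using f(2) by (subst nn_integral_add, measurable, subst nn_integral_cmult) simp_all
 also have "... \<le> ennreal (3 / 2) + ennreal e" by (intro add_left_mono f)
 also have "... = ennreal (3 / 2 + e)" using assms by (intro ennreal_plus[symmetric]) auto
 finally show ?thesis .
qed

lemma velocity_density_integral:
 assumes "velocity_density e f"
 shows "integrable lborel f" "(BI v. f v) = 1"
proof -
 have [measurable]: "f \<in> borel_funs" and f: "\<And>v. 0 \<le> f v" "(LE v. f v) = 1"
  using assms by (auto simp: velocity_density_def)
 show "integrable lborel f" using f by (intro integrableI_nonneg) auto
 show "(BI v. f v) = 1" using f by (subst integral_eq_nn_integral) auto
qed

text \<open>\<open>N_le\<close> keeps collisions weighted by N below a multiple of the rate,
  \<open>N_ln\<close> lets factors 1 / N be paid for by the moment of \<open>Lw\<close>, and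
  evenness gives N mean zero. The constants obtained here depend on N and e but not on the densities
  transported.\<close>

locale catalyst = haar_sphere s for s :: "(real ^ 'n::finite) measure" +
 fixes e nb cl :: real and N :: "real ^ 'n \<Rightarrow> real"
 assumes e0: "0 < e" and N_dens: "velocity_density e N" and N_pos: "\<And>v. 0 < N v" and N_le: "\<And>v. N v \<le> nb"
  and N_even: "\<And>v. N (- v) = N v" and cl0: "0 \<le> cl" and N_ln: "\<And>v. - ln (N v) \<le> cl * (1 + ln (1 + norm v))"
begin

lemma N_measurable[measurable]: "N \<in> borel_funs" using N_dens by (simp add: velocity_density_def)

lemma nb0: "0 \<le> nb" using N_pos[of 0] N_le[of 0] by linarith

text \<open>The weight consists of a part linear in f at one fixed scale and a remainder W. Only the
  first part can be unbounded; W is dominated by the rate with a constant uniform in f, as the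
  entropy estimate requires. Symmetry is asked of the weighted measure rather than pointwise,
  because the formula for \<open>evw\<close> is symmetric on collisions but not at arbitrary
  quadruples of velocities.\<close>

definition static_weight :: "real \<Rightarrow> real \<Rightarrow> (real ^ 'n \<Rightarrow> real) \<Rightarrow> ('n coll \<Rightarrow> real) \<Rightarrow> bool" where
 "static_weight R0 K f W \<longleftrightarrow> W \<in> borel_funs \<and> (\<forall>x. 0 \<le> W x) \<and> (\<forall>x. W x \<le> K * grate x) \<and>
  (\<forall>H \<in> borel_funs.
    (CI x. ennreal (evw R0 x * Sin f x + W x) * H (swap_in x)) = (CI x. ennreal (evw R0 x * Sin f x + W x) * H x) \<and>
    (CI x. ennreal (evw R0 x * Sin f x + W x) * H (swap_out x)) = (CI x. ennreal (evw R0 x * Sin f x + W x) * H x)) \<and>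
  (CE x. (evw R0 x * Sin f x + W x) * Lw x) \<le> ennreal K \<and>
  (\<forall>\<phi> \<in> borel_funs. \<forall>B. (\<forall>v. \<bar>\<phi> v\<bar> \<le> B) \<longrightarrow>
    (BC x. (evw R0 x * Sin f x + W x) * cg \<phi> x) = (BI v. \<phi> v * N v) - (BI v. \<phi> v * f v))"

text \<open>The contributions of the steps telescope to the limit of the errors minus the initial
  error f - N. The limit is zero since the mass of the k-th error is of order 2 ^ (- k).\<close>

theorem static_transport: "\<exists>R0\<ge>1. \<exists>K\<ge>0. \<forall>f. velocity_density e f \<longrightarrow> (\<exists>W. static_weight R0 K f W)"
proof -
 obtain \<Lambda> C where La: "2 \<le> \<Lambda>" and C0: "0 \<le> C" and casc: "\<And>f E. integrable lborel f \<Longrightarrow> (BI v. f v) = 0 \<Longrightarrow> 0 \<le> E \<Longrightarrow>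
  (LE v. \<bar>f v\<bar> * (1 + norm v)) \<le> ennreal E \<Longrightarrow>
  (\<forall>k. integrable lborel (hseq \<Lambda> f k) \<and> (BI v. hseq \<Lambda> f k v) = 0 \<and>
   (LE v. \<bar>hseq \<Lambda> f k v\<bar> * (1 + norm v / \<Lambda> ^ k)) \<le> ennreal (E / 2 ^ k) \<and>
   (\<forall>x. \<bar>hseq \<Lambda> f (Suc k) x\<bar> \<le> C * E))"
  using cascade by blast
 obtain ce where ce0: "0 \<le> ce" and ce: "\<And>R x. 1 \<le> R \<Longrightarrow> evw R x \<le> ce / R * grate x" using evw_le_grate by blast
 obtain c where c0: "0 \<le> c" and c: "\<And>R v. 1 \<le> R \<Longrightarrow> (TI p. ennreal (Lw (emb R v p))) \<le> ennreal (c * (1 + ln (1 + R)) * (1 + norm v / R))"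
  using Lw_emb by blast
 \<comment> \<open>Twice the moment bound 3 / 2 + e, once for f and once for N.\<close>
 define E where "E = 3 + 2 * e"
 have E0: "0 \<le> E" using e0 by (simp add: E_def)
 define l where "l = ln (1 + \<Lambda>)"
 have l0: "0 \<le> l" using La by (simp add: l_def)
 define R where "R k = \<Lambda> ^ Suc k" for k
 have R1: "1 \<le> R k" for k unfolding R_def using La by (intro one_le_power) simp
 have R0: "0 < R k" for k using R1[of k] by simp
 have R2: "2 ^ k \<le> R k" for k
 proof -
  have "(2::real) ^ k \<le> \<Lambda> ^ k" using La by (intro power_mono) auto
  also have "... \<le> \<Lambda> ^ Suc k" using La by (intro power_increasing) auto
  finally show ?thesis by (simp add: R_def)
 qed
 have gr0: "0 \<le> grate x" for x :: "'n coll" by (simp add: grate_def)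
 \<comment> \<open>Pointwise bound of the remainder: the reversed N part of the first step plus a
   geometric series of ratio 1 / 2. In K2, the bound of the moment of \<open>Lw\<close>, the factor
   8 is 2 times the sum 4 of the series of ratio 3 / 4.\<close>
 define K1 where "K1 = ce * nb + 4 * ce * C * E"
 define K2 where "K2 = 8 * (c * (1 + l) * E)"
 define K where "K = K1 + K2"
 have K12: "0 \<le> K1" "0 \<le> K2" using ce0 nb0 C0 E0 c0 l0 by (simp_all add: K1_def K2_def)
 show ?thesis
 proof (rule exI[of _ "R 0"], rule conjI[OF R1], rule exI[of _ K], intro conjI allI impI)
  show "0 \<le> K" using K12 by (simp add: K_def)
  fix f :: "real ^ 'n \<Rightarrow> real" assume f: "velocity_density e f"
  have fm[measurable]: "f \<in> borel_funs" and f0: "\<And>v. 0 \<le> f v" using f by (auto simp: velocity_density_def)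
  define h where "h = hseq \<Lambda> (\<lambda>v. f v - N v)"
  \<comment> \<open>At k = 0 the densities f and N themselves take the place of the positive and
    negative part of f - N. This keeps the leading term linear in f.\<close>
  define pp where "pp k = (if k = 0 then f else (\<lambda>v. max 0 (h k v)))" for k :: nat
  define mm where "mm k = (if k = 0 then N else (\<lambda>v. max 0 (- h k v)))" for k :: nat
  have fN: "(LE v. (f v + N v) * (1 + norm v)) \<le> ennreal E"
  proof -
   have "(LE v. (f v + N v) * (1 + norm v)) = (LI v. ennreal (f v * (1 + norm v)) + ennreal (N v * (1 + norm v)))"
    using f0 N_pos by (intro nn_integral_cong, subst ennreal_plus[symmetric]) (auto simp: distrib_right less_imp_le)
   also have "... = (LE v. f v * (1 + norm v)) + (LE v. N v * (1 + norm v))"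
    by (rule nn_integral_add) measurable
   also have "... \<le> ennreal (3 / 2 + e) + ennreal (3 / 2 + e)"
    using f N_dens e0 by (intro add_mono velocity_density_moment) auto
   also have "... = ennreal E" unfolding E_def using e0 by (subst ennreal_plus[symmetric]) auto
   finally show ?thesis .
  qed
  have hfacts: "integrable lborel (h k)" "(LE v. \<bar>h k v\<bar> * (1 + norm v / \<Lambda> ^ k)) \<le> ennreal (E / 2 ^ k)" "\<bar>h (Suc k) x\<bar> \<le> C * E" for k x
  proof -
   have "(LE v. \<bar>f v - N v\<bar> * (1 + norm v)) \<le> (LE v. (f v + N v) * (1 + norm v))"
   proof (rule nn_integral_mono)
    fix v :: "real ^ 'n"
    have "\<bar>f v - N v\<bar> \<le> f v + N v" using f0[of v] N_pos[of v] by linarith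
    then show "ennreal (\<bar>f v - N v\<bar> * (1 + norm v)) \<le> ennreal ((f v + N v) * (1 + norm v))"
     by (intro ennreal_leI mult_right_mono) auto
   qed
   then have "(LE v. \<bar>f v - N v\<bar> * (1 + norm v)) \<le> ennreal E" using fN by (rule order_trans)
   moreover have "integrable lborel (\<lambda>v. f v - N v)" "(BI v. f v - N v) = 0"
    using velocity_density_integral[OF f] velocity_density_integral[OF N_dens] by auto
   ultimately show "integrable lborel (h k)" "(LE v. \<bar>h k v\<bar> * (1 + norm v / \<Lambda> ^ k)) \<le> ennreal (E / 2 ^ k)" "\<bar>h (Suc k) x\<bar> \<le> C * E"
    using casc[of "\<lambda>v. f v - N v" E] E0 unfolding h_def by blast+
  qed
  have hm[measurable]: "h k \<in> borel_funs" for k using hfacts(1)[of k] by auto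
  have pm[measurable]: "pp k \<in> borel_funs" "mm k \<in> borel_funs" for k
   unfolding pp_def mm_def by auto
  have pm0: "0 \<le> pp k v" "0 \<le> mm k v" for k v using f0 N_pos by (auto simp: pp_def mm_def less_imp_le)
  have pmh: "pp k v - mm k v = h k v" for k v by (auto simp: pp_def mm_def h_def max_def)
  have pmsum: "(LE v. (pp k v + mm k v) * (1 + norm v / \<Lambda> ^ k)) \<le> ennreal (E / 2 ^ k)" for k
  proof (cases k)
   case 0
   then show ?thesis using fN by (simp add: pp_def mm_def)
  next
   case (Suc j)
   then have "pp k v + mm k v = \<bar>h k v\<bar>" for v by (auto simp: pp_def mm_def)
   then show ?thesis using hfacts(2)[of k] by simp
  qed
  have pmi: "integrable lborel (pp k)" "integrable lborel (mm k)" for k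
   using velocity_density_integral[OF f] velocity_density_integral[OF N_dens] hfacts(1)[of k] by (auto simp: pp_def mm_def)
  \<comment> \<open>Positive parts collide forward and negative parts backward; together they carry
    the error h k to h (Suc k).\<close>
  define Y where "Y k x = evw (R k) x * Sin (pp k) x + evw (R k) x * Sout (mm k) x" for k x
  have Ym[measurable]: "Y k \<in> borel_funs" for k unfolding Y_def by measurable
  have ev0: "0 \<le> evw (R k) x" for k x using R0[of k] by (simp add: less_imp_le)
  have Y0: "0 \<le> Y k x" for k x unfolding Y_def using pm0 ev0 by (simp add: Sin_nonneg Sout_nonneg)
  \<comment> \<open>After one smoothing both parts are bounded by C * E whatever f was, and the
    factor 1 / R of \<open>evw_le_grate\<close> yields summability.\<close>
  have YSuc: "Y (Suc k) x \<le> (2 * ce * C * E * grate x) * (1 / 2) ^ k" for k x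
  proof -
   have b: "pp (Suc k) v \<le> C * E" "mm (Suc k) v \<le> C * E" for v
    using hfacts(3)[of k v] C0 E0 by (auto simp: pp_def mm_def abs_le_iff)
   have "Sin (pp (Suc k)) x \<le> C * E" "Sout (mm (Suc k)) x \<le> C * E"
    using b[of "fst (fst x)"] b[of "snd (fst x)"] b[of "fst (snd x)"] b[of "snd (snd x)"] by (auto simp: Sin_def Sout_def)
   then have "Sin (pp (Suc k)) x + Sout (mm (Suc k)) x \<le> 2 * (C * E)" by linarith
   moreover have "evw (R (Suc k)) x \<le> ce * grate x * (1 / 2) ^ k"
   proof -
    have "2 ^ k \<le> R (Suc k)" using R2[of "Suc k"] by (rule order_trans[rotated]) simp
    then have "ce / R (Suc k) \<le> ce / 2 ^ k" using ce0 by (intro divide_left_mono) (auto intro!: mult_pos_pos R0)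
    then have "ce / R (Suc k) * grate x \<le> ce / 2 ^ k * grate x" by (intro mult_right_mono gr0)
    then have "evw (R (Suc k)) x \<le> ce / 2 ^ k * grate x" using ce[OF R1, of "Suc k" x] by (rule order_trans[rotated])
    moreover have "ce / 2 ^ k * grate x = ce * grate x * (1 / 2) ^ k" by (simp add: power_one_over)
    ultimately show ?thesis by simp
   qed
   ultimately have "evw (R (Suc k)) x * (Sin (pp (Suc k)) x + Sout (mm (Suc k)) x) \<le> (ce * grate x * (1 / 2) ^ k) * (2 * (C * E))"
    using ce0 gr0 pm0 by (intro mult_mono) (auto simp: Sin_nonneg Sout_nonneg)
   also have "... = (2 * ce * C * E * grate x) * (1 / 2) ^ k" by simp
   finally show ?thesis unfolding Y_def distrib_left .
  qed
  have geo: "summable (\<lambda>k. a * (1 / 2 :: real) ^ k)" "(\<Sum>k. a * (1 / 2 :: real) ^ k) = 2 * a" for a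
   using suminf_mult[of "\<lambda>k. (1 / 2 :: real) ^ k" a] suminf_geometric[of "1 / 2 :: real"] by (simp_all add: summable_mult summable_geometric)
  have sS: "summable (\<lambda>k. Y (Suc k) x)" for x
   by (rule summable_comparison_test'[OF geo(1)[of "2 * ce * C * E * grate x"], of 0]) (use YSuc Y0 in auto)
  have sY: "summable (\<lambda>k. Y k x)" for x by (rule iffD1[OF summable_Suc_iff[of "\<lambda>k. Y k x"]]) (rule sS)
  define YY where "YY x = (\<Sum>k. Y k x)" for x
  define W where "W x = YY x - evw (R 0) x * Sin f x" for x
  \<comment> \<open>The summand subtracted from YY is exactly the f part of step 0. Thus W is a sum
    of nonnegative terms, the N part of step 0 and all later steps.\<close>
  have Wsplit: "W x = evw (R 0) x * Sout N x + (\<Sum>k. Y (Suc k) x)" for x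
   unfolding W_def YY_def suminf_split_head[OF sY] using suminf_split_head[OF sY, of x] by (simp add: Y_def pp_def mm_def)
  have YYm[measurable]: "YY \<in> borel_funs" unfolding YY_def by measurable
  have YYW: "evw (R 0) x * Sin f x + W x = YY x" for x by (simp add: W_def)
  have YY0: "0 \<le> YY x" for x unfolding YY_def using Y0 sY by (intro suminf_nonneg) auto
  have YYenn: "ennreal (YY x) = (\<Sum>k. ennreal (Y k x))" for x
   unfolding YY_def by (rule suminf_ennreal2[symmetric]) (use Y0 sY in auto)
  have YYnn: "(CI x. ennreal (YY x) * H x) = (\<Sum>k. (CI x. ennreal (Y k x) * H x))"
   if [measurable]: "H \<in> borel_funs" for H
   unfolding YYenn by (subst nn_integral_suminf[symmetric]) (simp_all add: ennreal_suminf_multc)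
  have Yspl: "(CI x. ennreal (Y k x) * H x) = (CI x. ennreal (evw (R k) x) * (ennreal (Sin (pp k) x + Sout (mm k) x) * H x))" for k H
  proof (rule nn_integral_cong)
   fix x
   have "Y k x = evw (R k) x * (Sin (pp k) x + Sout (mm k) x)" by (simp add: Y_def distrib_left)
   then have "ennreal (Y k x) = ennreal (evw (R k) x) * ennreal (Sin (pp k) x + Sout (mm k) x)"
    using ev0 pm0 by (simp add: ennreal_mult Sin_nonneg Sout_nonneg)
   then show "ennreal (Y k x) * H x = ennreal (evw (R k) x) * (ennreal (Sin (pp k) x + Sout (mm k) x) * H x)" by (simp only: mult.assoc)
  qed
   have Yadd: "(CI x. ennreal (Y k x) * H x) = (LI v. ennreal (pp k v + mm k v) * (TI p. H (emb (R k) v p)))"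
    if [measurable]: "H \<in> borel_funs" and sym: "\<And>x. H (swap_in x) = H x" "\<And>x. H (swap_out x) = H x" "\<And>x. H (prod.swap x) = H x" for k H
   proof -
    have "(CI x. ennreal (Y k x) * H x) = (CI x. ennreal (evw (R k) x * Sin (pp k) x) * H x + ennreal (evw (R k) x * Sout (mm k) x) * H x)"
     unfolding Y_def using pm0 ev0 by (intro nn_integral_cong) (simp add: distrib_right Sin_nonneg Sout_nonneg)
    also have "... = (CI x. ennreal (evw (R k) x * Sin (pp k) x) * H x) + (CI x. ennreal (evw (R k) x * Sout (mm k) x) * H x)"
     by (rule nn_integral_add) measurable
    also have "... = (LI v. ennreal (pp k v) * (TI p. H (emb (R k) v p))) + (LI v. ennreal (mm k v) * (TI p. H (emb (R k) v p)))"
     using nn_integral_Sin[of "pp k" H "R k"] nn_integral_Sout[of "mm k" H "R k"] pm pm0 R0 sym that(1) by simp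
    also have "... = (LI v. ennreal (pp k v + mm k v) * (TI p. H (emb (R k) v p)))"
     using pm0 by (subst nn_integral_add[symmetric]) (simp_all add: distrib_right)
    finally show ?thesis .
   qed
  show "\<exists>W. static_weight (R 0) K f W"
   unfolding static_weight_def
  proof (intro exI[of _ W] conjI allI ballI impI, unfold YYW)
   show "W \<in> borel_funs" unfolding W_def by measurable
   show "0 \<le> W x" for x unfolding Wsplit using ev0 N_pos Y0 sS by (intro add_nonneg_nonneg mult_nonneg_nonneg suminf_nonneg Sout_nonneg) (auto simp: less_imp_le)
   show "W x \<le> K * grate x" for x
   proof -
    have "Sout N x \<le> nb" using N_le[of "fst (snd x)"] N_le[of "snd (snd x)"] by (simp add: Sout_def)
    moreover have "evw (R 0) x \<le> ce * grate x"
    proof -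
     have "ce / R 0 \<le> ce" using ce0 R1[of 0] by (simp add: divide_le_eq mult_le_cancel_left1)
     then have "ce / R 0 * grate x \<le> ce * grate x" by (intro mult_right_mono gr0)
     then show ?thesis using ce[OF R1, of 0 x] by linarith
    qed
    ultimately have "evw (R 0) x * Sout N x \<le> (ce * grate x) * nb"
     using ce0 gr0 N_pos by (intro mult_mono) (auto simp: Sout_nonneg less_imp_le)
    moreover have "(\<Sum>k. Y (Suc k) x) \<le> (\<Sum>k. (2 * ce * C * E * grate x) * (1 / 2) ^ k)"
     by (intro suminf_le YSuc sS geo(1))
    ultimately have "W x \<le> K1 * grate x" unfolding Wsplit geo(2) K1_def by (simp add: algebra_simps)
    also have "... \<le> K * grate x" using K12 by (intro mult_right_mono gr0) (simp add: K_def)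
    finally show ?thesis .
   qed
   fix H :: "'n coll \<Rightarrow> ennreal" assume Hm[measurable]: "H \<in> borel_funs"
   have m: "(\<lambda>x. H (swap_in x)) \<in> borel_funs" "(\<lambda>x. H (swap_out x)) \<in> borel_funs"
    by (auto intro!: measurable_compose[OF swap_in_measurable] measurable_compose[OF swap_out_measurable])
   have "(CI x. ennreal (Y k x) * H (swap_in x)) = (CI x. ennreal (Y k x) * H x)" for k
    unfolding Yspl using evw_swap(1)[of "\<lambda>x. ennreal (Sin (pp k) x + Sout (mm k) x) * H x" "R k"] R0[of k] by (simp add: Sin_swap)
   then show "(CI x. ennreal (YY x) * H (swap_in x)) = (CI x. ennreal (YY x) * H x)"
    unfolding YYnn[OF Hm] YYnn[OF m(1)] by simp
   have "(CI x. ennreal (Y k x) * H (swap_out x)) = (CI x. ennreal (Y k x) * H x)" for k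
    unfolding Yspl using evw_swap(2)[of "\<lambda>x. ennreal (Sin (pp k) x + Sout (mm k) x) * H x" "R k"] R0[of k] by (simp add: Sin_swap)
   then show "(CI x. ennreal (YY x) * H (swap_out x)) = (CI x. ennreal (YY x) * H x)"
    unfolding YYnn[OF Hm] YYnn[OF m(2)] by simp
  next
   have Lk: "(CI x. ennreal (Y k x) * ennreal (Lw x)) \<le> ennreal ((2 * (c * (1 + l) * E)) * (3 / 4) ^ k)" for k
   proof -
    let ?q = "c * (1 + ln (1 + R k))"
    have q0: "0 \<le> ?q" using c0 R1[of k] by simp
    have "(CI x. ennreal (Y k x) * ennreal (Lw x)) = (LI v. ennreal (pp k v + mm k v) * (TI p. ennreal (Lw (emb (R k) v p))))"
     by (rule Yadd) (simp_all add: Lw_swap)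
    also have "... \<le> (LI v. ennreal ?q * ennreal ((pp k v + mm k v) * (1 + norm v / \<Lambda> ^ k)))"
    proof (rule nn_integral_mono)
     fix v
     have "ennreal (pp k v + mm k v) * (TI p. ennreal (Lw (emb (R k) v p))) \<le> ennreal (pp k v + mm k v) * ennreal (?q * (1 + norm v / R k))"
      by (intro mult_left_mono c R1) simp
     also have "... = ennreal ((pp k v + mm k v) * (?q * (1 + norm v / R k)))"
      using pm0 q0 R0[of k] by (intro ennreal_mult[symmetric]) (auto simp: less_imp_le)
     also have "... \<le> ennreal (?q * ((pp k v + mm k v) * (1 + norm v / \<Lambda> ^ k)))"
     proof (rule ennreal_leI)
      have "\<Lambda> ^ k \<le> R k" unfolding R_def using La by (intro power_increasing) auto
      then have "norm v / R k \<le> norm v / \<Lambda> ^ k" using La by (intro divide_left_mono) (auto intro!: mult_pos_pos R0)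
      then have "(pp k v + mm k v) * (1 + norm v / R k) \<le> (pp k v + mm k v) * (1 + norm v / \<Lambda> ^ k)"
       using pm0 by (intro mult_left_mono) auto
      then have "?q * ((pp k v + mm k v) * (1 + norm v / R k)) \<le> ?q * ((pp k v + mm k v) * (1 + norm v / \<Lambda> ^ k))" using q0 by (rule mult_left_mono)
      then show "(pp k v + mm k v) * (?q * (1 + norm v / R k)) \<le> ?q * ((pp k v + mm k v) * (1 + norm v / \<Lambda> ^ k))" by (simp only: mult.left_commute)
     qed
     also have "... = ennreal ?q * ennreal ((pp k v + mm k v) * (1 + norm v / \<Lambda> ^ k))"
      using pm0 q0 La by (intro ennreal_mult) auto
     finally show "ennreal (pp k v + mm k v) * (TI p. ennreal (Lw (emb (R k) v p))) \<le> ennreal ?q * ennreal ((pp k v + mm k v) * (1 + norm v / \<Lambda> ^ k))" .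
    qed
    also have "... = ennreal ?q * (LE v. (pp k v + mm k v) * (1 + norm v / \<Lambda> ^ k))"
     by (rule nn_integral_cmult) measurable
    also have "... \<le> ennreal ?q * ennreal (E / 2 ^ k)" by (intro mult_left_mono pmsum) simp
    also have "... = ennreal (?q * (E / 2 ^ k))" using q0 E0 by (intro ennreal_mult[symmetric]) auto
    also have "... \<le> ennreal ((2 * (c * (1 + l) * E)) * (3 / 4) ^ k)"
    proof (rule ennreal_leI)
     \<comment> \<open>The logarithm of the scale is at most linear in k, and k + 2 \<le> 2 * (3 /
       2) ^ k. Against the decay 2 ^ (- k) of the error this leaves the ratio 3 / 4.\<close>
     have "1 + \<Lambda> ^ Suc n \<le> (1 + \<Lambda>) ^ Suc n" for n
     proof (induction n)
      case (Suc n)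
      have "1 + \<Lambda> ^ Suc (Suc n) \<le> (1 + \<Lambda>) * (1 + \<Lambda> ^ Suc n)" using La by (simp add: algebra_simps)
      also have "... \<le> (1 + \<Lambda>) * (1 + \<Lambda>) ^ Suc n" using Suc La by (intro mult_left_mono) auto
      finally show ?case by simp
     qed simp
     then have "ln (1 + R k) \<le> ln ((1 + \<Lambda>) ^ Suc k)" unfolding R_def using La by (subst ln_le_cancel_iff) (auto intro: add_pos_nonneg)
     also have "... = real (Suc k) * l" unfolding l_def using La by (subst ln_realpow) auto
     finally have "1 + ln (1 + R k) \<le> (1 + l) * (real k + 2)" using l0 by (simp add: algebra_simps)
     moreover have "(real k + 2) \<le> 2 * (3 / 2) ^ k"
     proof (induction k)
      case (Suc k)
      have "real (Suc k) + 2 \<le> 3 / 2 * (real k + 2)" by simp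
      also have "... \<le> 3 / 2 * (2 * (3 / 2) ^ k)" using Suc by (intro mult_left_mono) auto
      finally show ?case by simp
     qed simp
     then have "(1 + l) * (real k + 2) \<le> (1 + l) * (2 * (3 / 2) ^ k)" using l0 by (intro mult_left_mono) auto
     ultimately have "1 + ln (1 + R k) \<le> (1 + l) * (2 * (3 / 2) ^ k)" by linarith
     then have "?q * (E / 2 ^ k) \<le> (c * ((1 + l) * (2 * (3 / 2) ^ k))) * (E / 2 ^ k)"
      using c0 E0 by (intro mult_right_mono mult_left_mono) auto
     also have "... = (2 * (c * (1 + l) * E)) * ((3 / 2) ^ k * (1 / 2 ^ k))" by simp
     also have "(3 / 2) ^ k * (1 / 2 ^ k) = (3 / 4 :: real) ^ k" by (simp add: power_divide flip: power_mult_distrib)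
     finally show "?q * (E / 2 ^ k) \<le> (2 * (c * (1 + l) * E)) * (3 / 4) ^ k" .
    qed
    finally show ?thesis .
   qed
   have "(CE x. YY x * Lw x) = (CI x. ennreal (YY x) * ennreal (Lw x))"
    by (intro nn_integral_cong ennreal_mult YY0 order_trans[OF zero_le_one Lw_ge_1])
   also have "... = (\<Sum>k. (CI x. ennreal (Y k x) * ennreal (Lw x)))" by (rule YYnn) measurable
   also have "... \<le> (\<Sum>k. ennreal ((2 * (c * (1 + l) * E)) * (3 / 4) ^ k))" by (intro suminf_le Lk) auto
   also have "... = ennreal (\<Sum>k. (2 * (c * (1 + l) * E)) * (3 / 4) ^ k)"
    using c0 l0 E0 by (intro suminf_ennreal2) (auto intro!: summable_mult)
   also have "(\<Sum>k. (2 * (c * (1 + l) * E)) * (3 / 4 :: real) ^ k) = K2"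
    using suminf_mult[of "\<lambda>k. (3 / 4 :: real) ^ k" "2 * (c * (1 + l) * E)"] suminf_geometric[of "3 / 4 :: real"] by (simp add: summable_geometric K2_def)
   also have "ennreal K2 \<le> ennreal K" using K12 by (intro ennreal_leI) (simp add: K_def)
   finally show "(CE x. YY x * Lw x) \<le> ennreal K" .
  next
   fix \<phi> :: "real ^ 'n \<Rightarrow> real" and B :: real
   assume \<phi>m[measurable]: "\<phi> \<in> borel_funs" and "\<forall>v. \<bar>\<phi> v\<bar> \<le> B"
   then have B: "\<And>v. \<bar>\<phi> v\<bar> \<le> B" by simp
   have B0: "0 \<le> B" using order_trans[OF abs_ge_zero B] .
   have cgB: "\<bar>cg \<phi> x\<bar> \<le> 4 * B" for x by (rule cg_bound) (rule B)
   have i\<phi>: "integrable lborel (\<lambda>v. \<phi> v * g v)" if g: "integrable lborel g" for g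
   proof (rule Bochner_Integration.integrable_bound[of _ "\<lambda>v. B * \<bar>g v\<bar>"])
    have "\<bar>\<phi> v\<bar> * \<bar>g v\<bar> \<le> B * \<bar>g v\<bar>" for v by (intro mult_right_mono B) simp
    then show "AE v in lborel. norm (\<phi> v * g v) \<le> norm (B * \<bar>g v\<bar>)" using B0 by (intro AE_I2) (simp add: abs_mult)
   qed (use g in auto)
   have ik: "integrable coll_measure (\<lambda>x. Y k x * cg \<phi> x)" for k
    unfolding Y_def distrib_right using Sin_balance[OF pmi(1)[of k] pm0(1)[of k] \<phi>m B R0[of k]] Sin_balance[OF pmi(2)[of k] pm0(2)[of k] \<phi>m B R0[of k]] by auto
   have val: "(BC x. Y k x * cg \<phi> x) = (BI v. \<phi> v * h (Suc k) v) - (BI v. \<phi> v * h k v)" for k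
   proof -
    have "(BC x. Y k x * cg \<phi> x) = ((BI x. \<phi> x * Tconv (R k) (pp k) x) - (BI x. \<phi> x * pp k x)) - ((BI x. \<phi> x * Tconv (R k) (mm k) x) - (BI x. \<phi> x * mm k x))"
     unfolding Y_def distrib_right using Sin_balance[OF pmi(1)[of k] pm0(1)[of k] \<phi>m B R0[of k]] Sin_balance[OF pmi(2)[of k] pm0(2)[of k] \<phi>m B R0[of k]] by simp
    also have "... = (BI v. pp k v * (BT p. cg \<phi> (emb (R k) v p))) - (BI v. mm k v * (BT p. cg \<phi> (emb (R k) v p)))"
     using cg_Tconv[OF pmi(1)[of k] \<phi>m B R0[of k]] cg_Tconv[OF pmi(2)[of k] \<phi>m B R0[of k]] by simp
    also have "... = (BI v. h k v * (BT p. cg \<phi> (emb (R k) v p)))"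
    proof -
     define G where "G v = (BT p. cg \<phi> (emb (R k) v p))" for v
     have [measurable]: "G \<in> borel_funs" unfolding G_def by measurable
     have GB: "\<bar>G v\<bar> \<le> 4 * B" for v
     proof -
      have it: "integrable tau (\<lambda>p. cg \<phi> (emb (R k) v p))" using cgB by (intro integrable_tau_bounded[of _ "4 * B"]) auto
      have "\<bar>G v\<bar> \<le> (BT p. \<bar>cg \<phi> (emb (R k) v p)\<bar>)" unfolding G_def by (rule integral_abs_bound)
      also have "... \<le> (BT p. 4 * B)" using it cgB by (intro integral_mono) auto
      finally show ?thesis using tau.prob_space by simp
     qed
     have i: "integrable lborel (\<lambda>v. g v * G v)" if g: "integrable lborel g" for g
     proof (rule Bochner_Integration.integrable_bound[of _ "\<lambda>v. (4 * B) * \<bar>g v\<bar>"])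
      have "\<bar>G v\<bar> * \<bar>g v\<bar> \<le> (4 * B) * \<bar>g v\<bar>" for v by (intro mult_right_mono GB) simp
      then show "AE v in lborel. norm (g v * G v) \<le> norm ((4 * B) * \<bar>g v\<bar>)" using B0 by (intro AE_I2) (simp add: abs_mult mult.commute)
     qed (use g in auto)
     have "(BI v. pp k v * G v) - (BI v. mm k v * G v) = (BI v. pp k v * G v - mm k v * G v)"
      using i[OF pmi(1)] i[OF pmi(2)] by simp
     also have "... = (BI v. h k v * G v)" by (simp add: pmh flip: left_diff_distrib)
     finally show ?thesis by (simp add: G_def)
    qed
    also have "... = (BI x. \<phi> x * Tconv (R k) (h k) x) - (BI x. \<phi> x * h k x)"
     by (rule cg_Tconv[OF hfacts(1)[of k] \<phi>m B R0[of k]])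
    finally show ?thesis by (simp add: h_def R_def)
   qed
   have Yint: "integrable coll_measure (Y k)" "(BC x. Y k x) \<le> E / 2 ^ k" for k
   proof -
    have "(CI x. ennreal (Y k x) * 1) = (LI v. ennreal (pp k v + mm k v) * (TI p. 1))"
     by (rule Yadd) simp_all
    also have "... = (LE v. pp k v + mm k v)" using tau.emeasure_space_1 by simp
    also have "... \<le> (LE v. (pp k v + mm k v) * (1 + norm v / \<Lambda> ^ k))"
    proof (rule nn_integral_mono)
     fix v :: "real ^ 'n"
     have "(pp k v + mm k v) * 1 \<le> (pp k v + mm k v) * (1 + norm v / \<Lambda> ^ k)"
      using pm0 La by (intro mult_left_mono) auto
     then show "ennreal (pp k v + mm k v) \<le> ennreal ((pp k v + mm k v) * (1 + norm v / \<Lambda> ^ k))" by (intro ennreal_leI) simp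
    qed
    also have "... \<le> ennreal (E / 2 ^ k)" by (rule pmsum)
    finally have le: "(CE x. Y k x) \<le> ennreal (E / 2 ^ k)" by simp
    show "integrable coll_measure (Y k)" by (rule integral_of_nn_integral_le(1)[OF _ Y0 le]) (use E0 in auto)
    show "(BC x. Y k x) \<le> E / 2 ^ k" by (rule integral_of_nn_integral_le(2)[OF _ Y0 le]) (use E0 in auto)
   qed
   have sumg: "summable (\<lambda>k. c * (E / 2 ^ k))" for c
    using geo(1)[of "c * E"] by (simp add: power_one_over)
   have absle: "\<bar>Y k x * cg \<phi> x\<bar> \<le> (4 * B) * Y k x" for k x
    unfolding abs_mult using Y0 cgB[of x] by (simp add: mult.commute mult_left_mono)
   \<comment> \<open>Sum and integral may be exchanged because the terms are dominated by 4 * B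
     times Y k, whose integrals decay geometrically.\<close>
   have s1: "(\<lambda>k. (BC x. Y k x * cg \<phi> x)) sums (BC x. (\<Sum>k. Y k x * cg \<phi> x))"
   proof (rule sums_integral[OF ik])
    show "AE x in coll_measure. summable (\<lambda>k. norm (Y k x * cg \<phi> x))"
    proof (rule AE_I2)
     fix x :: "'n coll"
     show "summable (\<lambda>k. norm (Y k x * cg \<phi> x))"
      by (rule summable_comparison_test'[OF summable_mult[OF sY[of x], of "4 * B"], of 0]) (use absle in auto)
    qed
    show "summable (\<lambda>k. (BC x. norm (Y k x * cg \<phi> x)))"
    proof (rule summable_comparison_test'[OF sumg[of "4 * B"], of 0])
     fix k
     have "(BC x. \<bar>Y k x * cg \<phi> x\<bar>) \<le> (BC x. (4 * B) * Y k x)"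
      using ik Yint(1) absle by (intro integral_mono) auto
     also have "... \<le> (4 * B) * (E / 2 ^ k)" using mult_left_mono[OF Yint(2)[of k], of "4 * B"] B0 by simp
     finally show "norm (BC x. norm (Y k x * cg \<phi> x)) \<le> (4 * B) * (E / 2 ^ k)" by simp
    qed
   qed
   have "(\<Sum>k. Y k x * cg \<phi> x) = YY x * cg \<phi> x" for x
    unfolding YY_def by (rule suminf_mult2[symmetric]) (rule sY)
   then have s2: "(\<lambda>k. (BI v. \<phi> v * h (Suc k) v) - (BI v. \<phi> v * h k v)) sums (BC x. YY x * cg \<phi> x)"
    using s1 by (simp add: val)
   have "(\<lambda>k. (BI v. \<phi> v * h k v)) \<longlonglongrightarrow> 0"
   proof (rule Lim_null_comparison)
    show "(\<lambda>k. B * (E / 2 ^ k)) \<longlonglongrightarrow> 0" by (rule summable_LIMSEQ_zero[OF sumg])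
    have "norm (BI v. \<phi> v * h k v) \<le> B * (E / 2 ^ k)" for k
    proof -
     have "(LI v. ennreal \<bar>h k v\<bar>) \<le> (LE v. \<bar>h k v\<bar> * (1 + norm v / \<Lambda> ^ k))"
     proof (rule nn_integral_mono)
      fix v :: "real ^ 'n"
      have "\<bar>h k v\<bar> * 1 \<le> \<bar>h k v\<bar> * (1 + norm v / \<Lambda> ^ k)" using La by (intro mult_left_mono) auto
      then show "ennreal \<bar>h k v\<bar> \<le> ennreal (\<bar>h k v\<bar> * (1 + norm v / \<Lambda> ^ k))" by (intro ennreal_leI) simp
     qed
     also have "... \<le> ennreal (E / 2 ^ k)" by (rule hfacts(2))
     finally have "(BI v. \<bar>h k v\<bar>) \<le> E / 2 ^ k" using E0 by (intro integral_of_nn_integral_le(2)) auto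
     moreover have "norm (BI v. \<phi> v * h k v) \<le> (BI v. B * \<bar>h k v\<bar>)"
     proof -
      have "\<bar>(BI v. \<phi> v * h k v)\<bar> \<le> (BI v. \<bar>\<phi> v * h k v\<bar>)" by (rule integral_abs_bound)
      also have "... \<le> (BI v. B * \<bar>h k v\<bar>)"
      proof (rule integral_mono)
       show "\<bar>\<phi> v * h k v\<bar> \<le> B * \<bar>h k v\<bar>" for v unfolding abs_mult by (intro mult_right_mono B) simp
      qed (use integrable_abs[OF i\<phi>[OF hfacts(1)[of k]]] hfacts(1)[of k] in auto)
      finally show ?thesis by simp
     qed
     moreover have "(BI v. B * \<bar>h k v\<bar>) = B * (BI v. \<bar>h k v\<bar>)" by (rule integral_mult_right_zero)
     ultimately show ?thesis using mult_left_mono[OF _ B0, of "(BI v. \<bar>h k v\<bar>)" "E / 2 ^ k"] by linarith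
    qed
    then show "\<forall>\<^sub>F k in sequentially. norm (BI v. \<phi> v * h k v) \<le> B * (E / 2 ^ k)" by simp
   qed
   then have "(\<lambda>k. (BI v. \<phi> v * h (Suc k) v) - (BI v. \<phi> v * h k v)) sums (0 - (BI v. \<phi> v * h 0 v))"
    by (rule telescope_sums)
   then have "(BC x. YY x * cg \<phi> x) = - (BI v. \<phi> v * h 0 v)" using sums_unique2[OF s2] by (simp only: diff_0)
   also have "(BI v. \<phi> v * h 0 v) = (BI v. \<phi> v * f v - \<phi> v * N v)" by (simp add: h_def right_diff_distrib)
   also have "... = (BI v. \<phi> v * f v) - (BI v. \<phi> v * N v)"
    using velocity_density_integral(1)[OF f] velocity_density_integral(1)[OF N_dens] by (intro Bochner_Integration.integral_diff i\<phi>)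
   finally show "(BC x. YY x * cg \<phi> x) = (BI v. \<phi> v * N v) - (BI v. \<phi> v * f v)" by simp
  qed
 qed
qed

end

section \<open>Interpolating paths\<close>

text \<open>The three weights group the terms of (s + (1 - s)) ^ 4: the two with the highest powers
  of 1 - s, the middle one, and the two with the highest powers of s. Hence they sum to one and the
  derivatives of the outer two collapse to single monomials. These rates are at most 12 * s * (1 -
  s), which offsets the logarithmic singularities at both ends.\<close>

definition ramp_down :: "real \<Rightarrow> real" where "ramp_down s = (1 - s) ^ 3 * (1 + 3 * s)"
definition ramp_up :: "real \<Rightarrow> real" where "ramp_up s = s ^ 3 * (4 - 3 * s)"
definition bump :: "real \<Rightarrow> real" where "bump s = 6 * (s\<^sup>2 * (1 - s)\<^sup>2)"
definition ramp_rate :: "real \<Rightarrow> real" where "ramp_rate s = 12 * (s * (1 - s)\<^sup>2)"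

lemma ramp_sum: "ramp_down s + ramp_up s + bump s = 1"
 unfolding ramp_down_def ramp_up_def bump_def by (simp add: power2_eq_square power3_eq_cube algebra_simps)

lemma ramp_ends[simp]: "ramp_down 0 = 1" "ramp_down 1 = 0" "ramp_up 0 = 0" "ramp_up 1 = 1" "bump 0 = 0" "bump 1 = 0"
 by (simp_all add: ramp_down_def ramp_up_def bump_def)

lemma ramp_nonneg:
 assumes "0 \<le> s" "s \<le> 1"
 shows "0 \<le> ramp_down s" "0 \<le> ramp_up s" "0 \<le> bump s" "0 \<le> ramp_rate s" "0 \<le> ramp_rate (1 - s)"
 using assms by (simp_all add: ramp_down_def ramp_up_def bump_def ramp_rate_def)

lemma ramp_rate_le: "0 \<le> s \<Longrightarrow> s \<le> 1 \<Longrightarrow> ramp_rate s \<le> 12 * (s * (1 - s))"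
 unfolding ramp_rate_def power2_eq_square by (intro mult_left_mono) (auto simp: mult_left_le)

lemma ramp_rate_le_12:
 assumes "0 \<le> s" "s \<le> 1"
 shows "ramp_rate s \<le> 12"
proof -
 have "s * (1 - s)\<^sup>2 \<le> 1 * 1" using assms by (intro mult_mono) (auto simp: power_le_one)
 then show ?thesis by (simp add: ramp_rate_def)
qed

lemma DERIV_ramp_down: "(ramp_down has_real_derivative - ramp_rate s) (at s)"
 unfolding ramp_down_def[abs_def] ramp_rate_def
 by (rule derivative_eq_intros refl | simp)+ (simp add: power2_eq_square power3_eq_cube algebra_simps)

lemma DERIV_ramp_up: "(ramp_up has_real_derivative ramp_rate (1 - s)) (at s)"
 unfolding ramp_up_def[abs_def] ramp_rate_def
 by (rule derivative_eq_intros refl | simp)+ (simp add: power2_eq_square power3_eq_cube algebra_simps)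

lemma DERIV_bump: "(bump has_real_derivative ramp_rate s - ramp_rate (1 - s)) (at s)"
 unfolding bump_def[abs_def] ramp_rate_def
 by (rule derivative_eq_intros refl | simp)+ (simp add: power2_eq_square power3_eq_cube algebra_simps)

lemma continuous_on_ramps[continuous_intros]:
 "continuous_on A (\<lambda>t. ramp_down (t / T))" "continuous_on A (\<lambda>t. ramp_up (t / T))" "continuous_on A (\<lambda>t. bump (t / T))"
 "continuous_on A (\<lambda>t. ramp_rate (t / T))" "continuous_on A (\<lambda>t. ramp_rate (1 - t / T))"
 unfolding ramp_down_def ramp_up_def bump_def ramp_rate_def divide_inverse by (intro continuous_intros)+

lemma ramp_measurable[measurable]:
 "ramp_down \<in> borel_funs" "ramp_up \<in> borel_funs" "bump \<in> borel_funs" "ramp_rate \<in> borel_funs"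
 unfolding ramp_down_def[abs_def] ramp_up_def[abs_def] bump_def[abs_def] ramp_rate_def[abs_def] by measurable

lemma DERIV_rescale:
 assumes "(g has_real_derivative D) (at (t / T))"
 shows "((\<lambda>t. g (t / T)) has_real_derivative D / T) (at t)"
proof -
 have "((\<lambda>t. t / T) has_real_derivative 1 / T) (at t)" by (rule DERIV_cdivide[OF DERIV_ident])
 from DERIV_chain2[OF assms this] show ?thesis by simp
qed

text \<open>Each static measure is spent exactly once over the time interval, whatever T is; so the
  mass of the flow and the coefficient of the final entropy do not depend on T.\<close>

lemma nn_integral_ramp_rate:
 assumes T: "0 < T"
 shows "(LI t. ennreal (ramp_rate (t / T) / T) * indicator {0..T} t) = 1"
  and "(LI t. ennreal (ramp_rate (1 - t / T) / T) * indicator {0..T} t) = 1"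
proof -
 have s: "0 \<le> t / T" "t / T \<le> 1" if "0 \<le> t" "t \<le> T" for t using that T by auto
 have "(LI t. ennreal (ramp_rate (t / T) / T) * indicator {0..T} t) = ennreal (- ramp_down (T / T) - - ramp_down (0 / T))"
 proof (rule nn_integral_FTC_Icc)
  show "((\<lambda>t. - ramp_down (t / T)) has_real_derivative ramp_rate (t / T) / T) (at t)" for t
   using DERIV_minus[OF DERIV_rescale[OF DERIV_ramp_down]] by simp
 qed (use T s ramp_nonneg in auto)
 then show "(LI t. ennreal (ramp_rate (t / T) / T) * indicator {0..T} t) = 1" using T by simp
 have "(LI t. ennreal (ramp_rate (1 - t / T) / T) * indicator {0..T} t) = ennreal (ramp_up (T / T) - ramp_up (0 / T))"
 proof (rule nn_integral_FTC_Icc)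
  show "((\<lambda>t. ramp_up (t / T)) has_real_derivative ramp_rate (1 - t / T) / T) (at t)" for t
   by (rule DERIV_rescale[OF DERIV_ramp_up])
 qed (use T s ramp_nonneg in auto)
 then show "(LI t. ennreal (ramp_rate (1 - t / T) / T) * indicator {0..T} t) = 1" using T by simp
qed

lemma swap_in_swap: "swap_in (prod.swap x) = prod.swap (swap_out x)" "swap_out (prod.swap x) = prod.swap (swap_in x)"
 by (simp_all add: swap_in_def swap_out_def)

lemma post_collision_involution:
 assumes "norm w = 1"
 shows "post_collision (fst (post_collision v u w)) (snd (post_collision v u w)) w = (v, u)"
  and "w \<bullet> (snd (post_collision v u w) - fst (post_collision v u w)) = - (w \<bullet> (u - v))"
proof -
 have w: "w \<bullet> w = 1" using assms by (simp add: norm_eq_1)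
 define k where "k = w \<bullet> (u - v)"
 have p: "post_collision v u w = (v + k *\<^sub>R w, u - k *\<^sub>R w)" by (simp add: post_collision_def k_def)
 have "(u - k *\<^sub>R w) - (v + k *\<^sub>R w) = (u - v) - (k + k) *\<^sub>R w" by (simp only: scaleR_left_distrib) simp
 then have "w \<bullet> ((u - k *\<^sub>R w) - (v + k *\<^sub>R w)) = w \<bullet> (u - v) - (k + k) * (w \<bullet> w)"
  by (simp only: inner_diff_right[of w "u - v"] inner_scaleR_right)
 then have e: "w \<bullet> ((u - k *\<^sub>R w) - (v + k *\<^sub>R w)) = - k"
  unfolding w k_def[symmetric] by (rule trans) simp
 show "w \<bullet> (snd (post_collision v u w) - fst (post_collision v u w)) = - (w \<bullet> (u - v))"
  using e by (simp only: p fst_conv snd_conv k_def[symmetric])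
 show "post_collision (fst (post_collision v u w)) (snd (post_collision v u w)) w = (v, u)"
  unfolding p fst_conv snd_conv unfolding post_collision_def unfolding e by simp
qed

section \<open>Reversibility and symmetric collision weights\<close>

context haar_sphere begin

text \<open>For a fixed unit vector w the collision map is an involution that preserves Lebesgue
  measure and the modulus of w . (u - v). The average over w is moved to the outside so that this
  can be used for each w separately.\<close>

lemma nn_integral_coll_measure_swap:
 assumes [measurable]: "H \<in> borel_funs"
 shows "(CI x. H (prod.swap x)) = (CI x. H x)"
proof -
 have pm: "(\<lambda>p :: (real ^ 'n) \<times> 'n vels. H (snd p, post_collision (fst (snd p)) (snd (snd p)) (fst p))) \<in> borel_funs"
  "(\<lambda>p :: (real ^ 'n) \<times> 'n vels. H (post_collision (fst (snd p)) (snd (snd p)) (fst p), snd p)) \<in> borel_funs"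
  unfolding post_collision_def by measurable
 have ex: "(LI v. (LI u. (SI w. ennreal (jac w (u - v)) * G (w, v, u)))) =
   (SI w. (LI v. (LI u. ennreal (jac w (u - v)) * G (w, v, u))))"
  if [measurable]: "G \<in> borel_funs" for G :: "(real ^ 'n) \<times> 'n vels \<Rightarrow> ennreal"
 proof -
  have "(LI v. (LI u. (SI w. ennreal (jac w (u - v)) * G (w, v, u)))) =
    (LI v. (SI w. (LI u. ennreal (jac w (u - v)) * G (w, v, u))))"
   by (rule nn_integral_cong, rule nn_integral_swap[OF sigma_finite_lborel s.sigma_finite_measure_axioms]) measurable
  also have "... = (SI w. (LI v. (LI u. ennreal (jac w (u - v)) * G (w, v, u))))"
   by (rule nn_integral_swap[OF sigma_finite_lborel s.sigma_finite_measure_axioms]) measurable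
  finally show ?thesis .
 qed
 have Hs: "(\<lambda>x. H (prod.swap x)) \<in> borel_funs" by (rule measurable_compose[OF swap_measurable]) measurable
 have "(CI x. H (prod.swap x)) = (SI w. (LI v. (LI u. ennreal (jac w (u - v)) * H (post_collision v u w, (v, u)))))"
  using ex[OF pm(2)] by (subst nn_integral_coll_measure_post[OF Hs]) simp
 also have "... = (SI w. (LI v. (LI u. ennreal (jac w (u - v)) * H ((v, u), post_collision v u w))))"
 proof (rule nn_integral_cong_AE, rule AE_mp[OF sphere_s], rule AE_I2, rule impI)
  fix w :: "real ^ 'n" assume w: "norm w = 1"
  define F where "F q = ennreal (jac w (snd q - fst q)) * H (q, post_collision (fst q) (snd q) w)" for q
  have [measurable]: "F \<in> borel_funs" unfolding F_def post_collision_def by measurable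
  have "F (post_collision v u w) = ennreal (jac w (u - v)) * H (post_collision v u w, (v, u))" for v u
   by (simp add: F_def post_collision_involution[OF w])
  with nn_integral_post_collision[OF _ w, of F]
  show "(LI v. (LI u. ennreal (jac w (u - v)) * H (post_collision v u w, (v, u)))) =
    (LI v. (LI u. ennreal (jac w (u - v)) * H ((v, u), post_collision v u w)))"
   by (simp add: F_def)
 qed
 also have "... = (CI x. H x)"
  unfolding nn_integral_coll_measure_post[OF assms] using ex[OF pm(1)] by simp
 finally show ?thesis .
qed

lemma distr_coll_measure_swap: "distr coll_measure borel prod.swap = coll_measure"
proof (rule measure_eqI)
 fix A assume "A \<in> sets (distr coll_measure borel (prod.swap :: 'n coll \<Rightarrow> _))"
 then have A[measurable]: "A \<in> sets borel" by simp
 have "emeasure (distr coll_measure borel prod.swap) A = (\<integral>\<^sup>+x. indicator A x \<partial>distr coll_measure borel prod.swap)" by simp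
 also have "... = (CI x. indicator A (prod.swap x))"
  by (rule nn_integral_distr) (auto simp: measurable_cong_sets[OF sets_coll_measure refl] swap_measurable)
 also have "... = (CI x. indicator A x)" by (rule nn_integral_coll_measure_swap) measurable
 finally show "emeasure (distr coll_measure borel prod.swap) A = emeasure coll_measure A" by simp
qed simp

text \<open>In integral form for the reason given at \<open>static_weight\<close>. The form is
  stable under nonnegative combinations and under time reversal.\<close>

definition exchangeable :: "('n coll \<Rightarrow> real) \<Rightarrow> bool" where
 "exchangeable Y \<longleftrightarrow> Y \<in> borel_funs \<and> (\<forall>x. 0 \<le> Y x) \<and>
  (\<forall>H\<in>borel_funs.
   (CI x. ennreal (Y x) * H (swap_in x)) = (CI x. ennreal (Y x) * H x) \<and>
   (CI x. ennreal (Y x) * H (swap_out x)) = (CI x. ennreal (Y x) * H x))"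

lemma exchangeableD:
 assumes "exchangeable Y"
 shows "H \<in> borel_funs \<Longrightarrow> (CI x. ennreal (Y x) * H (swap_in x)) = (CI x. ennreal (Y x) * H x)"
  and "H \<in> borel_funs \<Longrightarrow> (CI x. ennreal (Y x) * H (swap_out x)) = (CI x. ennreal (Y x) * H x)"
  and "Y \<in> borel_funs" and "0 \<le> Y x"
 using assms unfolding exchangeable_def by blast+

lemma exchangeable_combination:
 assumes "exchangeable Y" "exchangeable Z" "0 \<le> a" "0 \<le> b"
 shows "exchangeable (\<lambda>x. a * Y x + b * Z x)"
proof -
 have [measurable]: "Y \<in> borel_funs" "Z \<in> borel_funs" and n: "\<And>x. 0 \<le> Y x" "\<And>x. 0 \<le> Z x"
  using assms by (auto simp: exchangeable_def)
 have e: "(CI x. ennreal (a * Y x + b * Z x) * H x) = ennreal a * (CI x. ennreal (Y x) * H x) + ennreal b * (CI x. ennreal (Z x) * H x)"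
  if [measurable]: "H \<in> borel_funs" for H
 proof -
  have "ennreal (a * Y x + b * Z x) = ennreal a * ennreal (Y x) + ennreal b * ennreal (Z x)" for x
   using n assms by (simp add: ennreal_mult ennreal_plus[symmetric])
  then have "(CI x. ennreal (a * Y x + b * Z x) * H x) = (CI x. ennreal a * (ennreal (Y x) * H x) + ennreal b * (ennreal (Z x) * H x))"
   by (simp only: distrib_right mult.assoc)
  also have "... = ennreal a * (CI x. ennreal (Y x) * H x) + ennreal b * (CI x. ennreal (Z x) * H x)"
   by (subst nn_integral_add, measurable, subst nn_integral_cmult, measurable, subst nn_integral_cmult, measurable)
  finally show ?thesis .
 qed
 have m: "(\<lambda>x. H (swap_in x)) \<in> borel_funs" "(\<lambda>x. H (swap_out x)) \<in> borel_funs" if "H \<in> borel_funs" for H :: "'n coll \<Rightarrow> ennreal"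
  using that by (auto intro: measurable_compose[OF swap_in_measurable] measurable_compose[OF swap_out_measurable])
 show ?thesis
  unfolding exchangeable_def
 proof (intro conjI allI ballI)
  show "0 \<le> a * Y x + b * Z x" for x using n assms by simp
  show "(\<lambda>x. a * Y x + b * Z x) \<in> borel_funs" by measurable
  fix H :: "'n coll \<Rightarrow> ennreal" assume H: "H \<in> borel_funs"
  show "(CI x. ennreal (a * Y x + b * Z x) * H (swap_in x)) = (CI x. ennreal (a * Y x + b * Z x) * H x)"
   unfolding e[OF H] e[OF m(1)[OF H]] using assms(1,2) H by (simp add: exchangeable_def)
  show "(CI x. ennreal (a * Y x + b * Z x) * H (swap_out x)) = (CI x. ennreal (a * Y x + b * Z x) * H x)"
   unfolding e[OF H] e[OF m(2)[OF H]] using assms(1,2) H by (simp add: exchangeable_def)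
 qed
qed

lemma exchangeable_swap:
 assumes "exchangeable Y"
 shows "exchangeable (\<lambda>x. Y (prod.swap x))"
proof -
 have Y[measurable]: "Y \<in> borel_funs" and n: "\<And>x. 0 \<le> Y x"
  using assms by (auto simp: exchangeable_def)
 have e: "(CI x. ennreal (Y (prod.swap x)) * H x) = (CI x. ennreal (Y x) * H (prod.swap x))"
  if H: "H \<in> borel_funs" for H
 proof -
  have "(\<lambda>x. ennreal (Y x) * H (prod.swap x)) \<in> borel_funs"
   using Y measurable_compose[OF swap_measurable H] by measurable
  from nn_integral_coll_measure_swap[OF this] show ?thesis by simp
 qed
 have m: "(\<lambda>x. H (swap_in x)) \<in> borel_funs" "(\<lambda>x. H (swap_out x)) \<in> borel_funs" "(\<lambda>x. H (prod.swap x)) \<in> borel_funs"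
  if "H \<in> borel_funs" for H :: "'n coll \<Rightarrow> ennreal"
  using that by (auto intro: measurable_compose[OF swap_in_measurable] measurable_compose[OF swap_out_measurable] measurable_compose[OF swap_measurable])
 show ?thesis
  unfolding exchangeable_def
 proof (intro conjI allI ballI)
  show "(\<lambda>x. Y (prod.swap x)) \<in> borel_funs" by (rule measurable_compose[OF swap_measurable Y])
  fix H :: "'n coll \<Rightarrow> ennreal" assume H: "H \<in> borel_funs"
  show "(CI x. ennreal (Y (prod.swap x)) * H (swap_in x)) = (CI x. ennreal (Y (prod.swap x)) * H x)"
   unfolding e[OF H] e[OF m(1)[OF H]] swap_in_swap by (rule exchangeableD(2)[OF assms m(3)[OF H]])
  show "(CI x. ennreal (Y (prod.swap x)) * H (swap_out x)) = (CI x. ennreal (Y (prod.swap x)) * H x)"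
   unfolding e[OF H] e[OF m(2)[OF H]] swap_in_swap by (rule exchangeableD(1)[OF assms m(3)[OF H]])
 qed (rule n)
qed

text \<open>The balance equation integrated over time. Testing with bounded Borel functions lets it
  be applied at each time to a section of a test function that has been cut off in time.\<close>

definition transports :: "(real ^ 'n \<Rightarrow> real) \<Rightarrow> (real ^ 'n \<Rightarrow> real) \<Rightarrow> ('n coll \<Rightarrow> real) \<Rightarrow> bool" where
 "transports f g Y \<longleftrightarrow> (\<forall>\<phi> \<in> borel_funs. \<forall>B. (\<forall>v. \<bar>\<phi> v\<bar> \<le> B) \<longrightarrow>
  (BC x. Y x * cg \<phi> x) = (BI v. \<phi> v * g v) - (BI v. \<phi> v * f v))"

lemma transportsD:
 assumes "transports f g Y" "\<phi> \<in> borel_funs" "\<And>v. \<bar>\<phi> v\<bar> \<le> B"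
 shows "(BC x. Y x * cg \<phi> x) = (BI v. \<phi> v * g v) - (BI v. \<phi> v * f v)"
 using assms unfolding transports_def by blast

lemma transports_swap:
 assumes "transports f g Y" and [measurable]: "Y \<in> borel_funs"
 shows "transports g f (\<lambda>x. Y (prod.swap x))"
 unfolding transports_def
proof (intro ballI allI impI)
 fix \<phi> :: "real ^ 'n \<Rightarrow> real" and B :: real
 assume [measurable]: "\<phi> \<in> borel_funs" and B: "\<forall>v. \<bar>\<phi> v\<bar> \<le> B"
 have "(BC x. Y x * cg \<phi> (prod.swap x)) = (\<integral>x. Y x * cg \<phi> (prod.swap x) \<partial>distr coll_measure borel prod.swap)"
  by (simp only: distr_coll_measure_swap)
 also have "... = (BC x. Y (prod.swap x) * cg \<phi> (prod.swap (prod.swap x)))"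
 proof (rule integral_distr)
  show "prod.swap \<in> measurable coll_measure borel" using swap_measurable by (simp add: measurable_cong_sets[OF sets_coll_measure refl])
  have "(\<lambda>x. cg \<phi> (prod.swap x)) \<in> borel_funs" by (rule measurable_compose[OF swap_measurable]) measurable
  then show "(\<lambda>x. Y x * cg \<phi> (prod.swap x)) \<in> borel_funs" by measurable
 qed
 finally have "(BC x. Y (prod.swap x) * cg \<phi> x) = - (BC x. Y x * cg \<phi> x)"
  by (simp add: cg_swap)
 then show "(BC x. Y (prod.swap x) * cg \<phi> x) = (BI v. \<phi> v * f v) - (BI v. \<phi> v * g v)"
  using transportsD[OF assms(1), of \<phi> B] B by simp
qed

lemma integrable_weight_cg:
 assumes Y: "integrable coll_measure Y" and [measurable]: "\<phi> \<in> borel_funs" and B: "\<And>v. \<bar>\<phi> v\<bar> \<le> B"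
 shows "integrable coll_measure (\<lambda>x. Y x * cg \<phi> x)"
proof (rule Bochner_Integration.integrable_bound[of _ "\<lambda>x. (4 * B) * \<bar>Y x\<bar>"])
 have cgB: "\<bar>cg \<phi> x\<bar> \<le> 4 * B" for x by (rule cg_bound) (rule B)
 have "0 \<le> B" using order_trans[OF abs_ge_zero B] .
 then show "AE x in coll_measure. norm (Y x * cg \<phi> x) \<le> norm ((4 * B) * \<bar>Y x\<bar>)"
  using mult_left_mono[OF cgB abs_ge_zero] by (intro AE_I2) (simp add: abs_mult mult.commute)
qed (use Y in auto)

lemma transports_add:
 assumes "transports f g Y" "transports h h Z" and i: "integrable coll_measure Y" "integrable coll_measure Z"
 shows "transports f g (\<lambda>x. Y x + c * Z x)"
 unfolding transports_def
proof (intro ballI allI impI)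
 fix \<phi> :: "real ^ 'n \<Rightarrow> real" and B :: real
 assume m: "\<phi> \<in> borel_funs" and B: "\<forall>v. \<bar>\<phi> v\<bar> \<le> B"
 have "(BC x. (Y x + c * Z x) * cg \<phi> x) = (BC x. Y x * cg \<phi> x + c * (Z x * cg \<phi> x))"
  by (simp add: distrib_right mult.assoc)
 also have "... = (BC x. Y x * cg \<phi> x) + (BC x. c * (Z x * cg \<phi> x))"
  using integrable_weight_cg[OF i(1) m] integrable_weight_cg[OF i(2) m] B by (intro Bochner_Integration.integral_add) auto
 finally show "(BC x. (Y x + c * Z x) * cg \<phi> x) = (BI v. \<phi> v * g v) - (BI v. \<phi> v * f v)"
  using transportsD[OF assms(1) m, of B] transportsD[OF assms(2) m, of B] B by simp
qed

section \<open>Collision measures with a density in time and velocities\<close>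

definition event_base :: "real \<Rightarrow> 'n event measure" where
 "event_base T = restrict_space (lborel \<Otimes>\<^sub>M coll_measure) ({0..T} \<times> UNIV)"

lemma sets_lborel_coll: "sets (lborel \<Otimes>\<^sub>M coll_measure) = sets (borel :: 'n event measure)"
proof -
 have "sets (lborel \<Otimes>\<^sub>M coll_measure) = sets ((borel :: real measure) \<Otimes>\<^sub>M (borel :: 'n coll measure))"
  by (rule sets_pair_measure_cong) simp_all
 also have "(borel :: real measure) \<Otimes>\<^sub>M (borel :: 'n coll measure) = borel" by (rule borel_prod)
 finally show ?thesis .
qed

lemma strip_sets: "({0..T :: real} \<times> UNIV) \<inter> space (lborel \<Otimes>\<^sub>M coll_measure) \<in> sets (lborel \<Otimes>\<^sub>M coll_measure)"
proof -
 have "{0..T} \<times> (UNIV :: 'n coll set) \<in> sets borel" by (intro borel_closed closed_Times) auto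
 then show ?thesis unfolding sets_lborel_coll using sets_eq_imp_space_eq[OF sets_lborel_coll] by simp
qed

lemma sets_event_base: "sets (event_base T) = sets (event_space T)"
 unfolding event_base_def event_space_def by (rule sets_restrict_space_cong) (rule sets_lborel_coll)

lemma space_event_base: "space (event_base T) = {0..T} \<times> UNIV"
 unfolding event_base_def space_restrict_space using sets_eq_imp_space_eq[OF sets_lborel_coll] by simp

lemma event_base_measurable: "F \<in> borel_funs \<Longrightarrow> F \<in> borel_measurable (event_base T)"
 unfolding event_base_def by (rule measurable_restrict_space1) (simp add: measurable_cong_sets[OF sets_lborel_coll refl])

lemma sets_event_space_borel:
 assumes "A \<in> sets (event_space T :: 'n event measure)"
 shows "A \<in> sets borel" "A \<subseteq> {0..T} \<times> UNIV"
proof -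
 have "{0..T} \<times> (UNIV :: 'n coll set) \<in> sets borel" by (intro borel_closed closed_Times) auto
 then show "A \<in> sets borel" "A \<subseteq> {0..T} \<times> UNIV" using assms unfolding event_space_def by (auto simp: sets_restrict_space_iff)
qed

lemma nn_integral_event_base:
 assumes [measurable]: "F \<in> borel_funs"
 shows "(\<integral>\<^sup>+y. F y \<partial>event_base T) = (LI t. (CI x. F (t, x)) * indicator {0..T} t)"
proof -
 interpret C: sigma_finite_measure coll_measure by (rule sigma_finite_coll_measure)
 have m: "(\<lambda>y. F y * indicator ({0..T} \<times> UNIV) y) \<in> borel_measurable (lborel \<Otimes>\<^sub>M coll_measure)"
 proof -
  have "{0..T} \<times> (UNIV :: 'n coll set) \<in> sets borel" by (intro borel_closed closed_Times) auto
  then show ?thesis unfolding measurable_cong_sets[OF sets_lborel_coll refl] by measurable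
 qed
 have "(\<integral>\<^sup>+y. F y \<partial>event_base T) = (\<integral>\<^sup>+y. F y * indicator ({0..T} \<times> UNIV) y \<partial>(lborel \<Otimes>\<^sub>M coll_measure))"
  unfolding event_base_def by (rule nn_integral_restrict_space[OF strip_sets])
 also have "... = (LI t. (CI x. F (t, x) * indicator ({0..T} \<times> UNIV) (t, x)))"
  by (rule C.nn_integral_fst[symmetric, OF m])
 also have "... = (LI t. (CI x. F (t, x) * indicator {0..T} t))"
  by (simp add: indicator_times)
 also have "... = (LI t. (CI x. F (t, x)) * indicator {0..T} t)"
  by (intro nn_integral_cong nn_integral_multc) measurable
 finally show ?thesis .
qed

lemma emeasure_density_event_base:
 assumes q[measurable]: "q \<in> borel_funs" and A: "A \<in> sets (event_space T)"
 shows "emeasure (density (event_base T) q) A = (LI t. (CI x. q (t, x) * indicator A (t, x)) * indicator {0..T} t)"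
proof -
 have [measurable]: "A \<in> sets borel" by (rule sets_event_space_borel[OF A])
 have "emeasure (density (event_base T) q) A = (\<integral>\<^sup>+y. q y * indicator A y \<partial>event_base T)"
  using A by (intro emeasure_density event_base_measurable q) (simp add: sets_event_base)
 also have "... = (LI t. (CI x. q (t, x) * indicator A (t, x)) * indicator {0..T} t)"
  by (rule nn_integral_event_base) measurable
 finally show ?thesis .
qed

lemma distr_density_event_base:
 assumes q[measurable]: "q \<in> borel_funs" and g: "g \<in> measurable borel borel"
  and inv: "\<And>t H. t \<in> {0..T} \<Longrightarrow> H \<in> borel_funs \<Longrightarrow> (CI x. q (t, x) * H (g x)) = (CI x. q (t, x) * H x)"
  and G: "\<And>t x. G (t, x) = (t, g x)"
 shows "distr (density (event_base T) q) (density (event_base T) q) G = density (event_base T) q"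
proof (rule measure_eqI)
 let ?Q = "density (event_base T) q"
 have sp: "space ?Q = {0..T} \<times> UNIV" and st: "sets ?Q = sets (event_space T)" by (simp_all add: space_event_base sets_event_base)
 have Gm: "G \<in> measurable borel borel"
 proof -
  have "G = (\<lambda>y. (fst y, g (snd y)))" using G by auto
  then show ?thesis using g by simp
 qed
 have GQ: "G \<in> measurable ?Q ?Q"
 proof -
  have "G \<in> measurable (restrict_space borel ({0..T} \<times> UNIV)) (restrict_space borel ({0..T} \<times> UNIV))"
   using G by (intro measurable_restrict_space3 Gm) auto
  then show ?thesis by (simp add: measurable_cong_sets[OF st st] event_space_def)
 qed
 fix A assume "A \<in> sets (distr ?Q ?Q G)"
 then have A: "A \<in> sets (event_space T)" by (simp add: sets_event_base)
 have Ab[measurable]: "A \<in> sets borel" by (rule sets_event_space_borel[OF A])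
 have A': "G -` A \<inter> space ?Q \<in> sets (event_space T)" using measurable_sets[OF GQ, of A] A st by simp
 have "emeasure (distr ?Q ?Q G) A = emeasure ?Q (G -` A \<inter> space ?Q)" using A st GQ by (intro emeasure_distr) auto
 also have "... = (LI t. (CI x. q (t, x) * indicator (G -` A \<inter> space ?Q) (t, x)) * indicator {0..T} t)"
  by (rule emeasure_density_event_base[OF q A'])
 also have "... = (LI t. (CI x. q (t, x) * indicator A (t, x)) * indicator {0..T} t)"
 proof (rule nn_integral_cong)
  fix t
  show "(CI x. q (t, x) * indicator (G -` A \<inter> space ?Q) (t, x)) * indicator {0..T} t = (CI x. q (t, x) * indicator A (t, x)) * indicator {0..T} t"
  proof (cases "t \<in> {0..T}")
   case True
   then have "indicator (G -` A \<inter> space ?Q) (t, x) = (indicator A (t, g x) :: ennreal)" for x using sp G by (simp add: indicator_def)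
   with inv[OF True, of "\<lambda>x. indicator A (t, x)"] show ?thesis by simp
  qed simp
 qed
 also have "... = emeasure ?Q A" by (rule emeasure_density_event_base[OF q A, symmetric])
 finally show "emeasure (distr ?Q ?Q G) A = emeasure ?Q A" .
qed simp

lemma density_event_base_collision_measure:
 assumes q[measurable]: "q \<in> borel_funs" and ex: "\<And>t. t \<in> {0..T} \<Longrightarrow> exchangeable (\<lambda>x. q (t, x))"
  and fin: "(\<integral>\<^sup>+y. ennreal (q y) \<partial>event_base T) < \<infinity>"
 shows "density (event_base T) q \<in> collision_measures T"
 unfolding collision_measures_def
proof (intro CollectI conjI)
 have m: "(\<lambda>y. ennreal (q y)) \<in> borel_funs" by measurable
 have "emeasure (density (event_base T) q) (space (density (event_base T) q)) = (\<integral>\<^sup>+y. ennreal (q y) \<partial>event_base T)"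
  unfolding space_density by (subst emeasure_density[OF event_base_measurable[OF m] sets.top]) (auto intro!: nn_integral_cong)
 then show "finite_measure (density (event_base T) q)" using fin by (intro finite_measureI) auto
 show "sets (density (event_base T) q) = sets (event_space T)" by (simp add: sets_event_base)
 show "distr (density (event_base T) q) (density (event_base T) q) (\<lambda>(t, (v, v\<^sub>s), p). (t, (v\<^sub>s, v), p)) = density (event_base T) q"
  by (rule distr_density_event_base[OF m swap_in_measurable]) (use ex in \<open>auto simp: exchangeable_def swap_in_def\<close>)
 show "distr (density (event_base T) q) (density (event_base T) q) (\<lambda>(t, p, (v', v\<^sub>s')). (t, p, (v\<^sub>s', v'))) = density (event_base T) q"
  by (rule distr_density_event_base[OF m swap_out_measurable]) (use ex in \<open>auto simp: exchangeable_def swap_out_def\<close>)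
qed

end

text \<open>A test function is controlled on [0, T] only. Extending it and its time derivative by
  zero gives bounded Borel functions on the whole space, as Fubini's theorem demands; regularity in
  time is retained within the closed interval.\<close>

lemma C1b_time_derivative:
 fixes \<phi> :: "real \<times> (real ^ 'n::finite) \<Rightarrow> real"
 assumes T: "0 < T" and \<phi>: "\<phi> \<in> C1b T"
 obtains B \<Phi> \<Psi> where "0 \<le> B" "\<Phi> \<in> borel_funs" "\<Psi> \<in> borel_funs"
  "\<And>p. \<bar>\<Phi> p\<bar> \<le> B" "\<And>p. \<bar>\<Psi> p\<bar> \<le> B" "\<And>t v. t \<notin> {0..T} \<Longrightarrow> \<Phi> (t, v) = 0" "\<And>t v. t \<notin> {0..T} \<Longrightarrow> \<Psi> (t, v) = 0"
  "\<And>t v. t \<in> {0..T} \<Longrightarrow> \<Phi> (t, v) = \<phi> (t, v)" "\<And>t v. t \<in> {0..T} \<Longrightarrow> time_deriv T \<phi> t v = \<Psi> (t, v)"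
  "\<And>t v. t \<in> {0..T} \<Longrightarrow> ((\<lambda>t. \<Phi> (t, v)) has_real_derivative \<Psi> (t, v)) (at t within {0..T})"
  "\<And>v. continuous_on {0..T} (\<lambda>t. \<Phi> (t, v))" "\<And>v. continuous_on {0..T} (\<lambda>t. \<Psi> (t, v))"
proof -
 let ?S = "{0..T} \<times> (UNIV :: (real ^ 'n) set)"
 obtain D where D: "\<And>p. p \<in> ?S \<Longrightarrow> (\<phi> has_derivative blinfun_apply (D p)) (at p within ?S)" and Dc: "continuous_on ?S D" and Db: "bounded (D ` ?S)"
  and pb: "bounded (\<phi> ` ?S)" using \<phi> unfolding C1b_def by auto
 obtain B1 where B1: "\<And>p. p \<in> ?S \<Longrightarrow> norm (\<phi> p) \<le> B1" using pb unfolding bounded_iff by auto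
 obtain B2 where B2: "\<And>p. p \<in> ?S \<Longrightarrow> norm (D p) \<le> B2" using Db unfolding bounded_iff by auto
 define B where "B = max 0 (max B1 B2)"
 define \<Phi> where "\<Phi> p = indicator ?S p *\<^sub>R \<phi> p" for p
 define \<Psi> where "\<Psi> p = indicator ?S p *\<^sub>R blinfun_apply (D p) (1, 0)" for p
 have S: "?S \<in> sets borel" by (intro borel_closed closed_Times) auto
 have \<phi>c: "continuous_on ?S \<phi>" by (rule has_derivative_continuous_on[OF D])
 have \<psi>c: "continuous_on ?S (\<lambda>p. blinfun_apply (D p) (1, 0))" by (rule bounded_linear.continuous_on[OF blinfun.bounded_linear_left Dc])
 have in_S: "(t, v) \<in> ?S \<longleftrightarrow> t \<in> {0..T}" for t and v :: "real ^ 'n" by simp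
 have e: "\<Phi> (t, v) = \<phi> (t, v)" "\<Psi> (t, v) = blinfun_apply (D (t, v)) (1, 0)" if "t \<in> {0..T}" for t v
  using that by (simp_all add: \<Phi>_def \<Psi>_def)
 have dv: "((\<lambda>t. \<phi> (t, v)) has_real_derivative \<Psi> (t, v)) (at t within {0..T})" if t: "t \<in> {0..T}" for t v
 proof -
  have "((\<lambda>t. (t, v)) has_vector_derivative (1, 0)) (at t within {0..T})" by (auto intro!: derivative_eq_intros)
  moreover have "(\<phi> has_derivative blinfun_apply (D (t, v))) (at (t, v) within (\<lambda>t. (t, v)) ` {0..T})"
   by (rule has_derivative_subset[OF D]) (use t in auto)
  ultimately have "((\<phi> \<circ> (\<lambda>t. (t, v))) has_vector_derivative blinfun_apply (D (t, v)) (1, 0)) (at t within {0..T})"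
   by (rule vector_derivative_diff_chain_within)
  then show ?thesis using e(2)[OF t] by (simp add: has_real_derivative_iff_has_vector_derivative o_def)
 qed
 have ct: "continuous_on {0..T} (\<lambda>t. (t, v))" for v :: "real ^ 'n" by (intro continuous_intros)
 show thesis
 proof (rule that[of B \<Phi> \<Psi>])
  show "0 \<le> B" by (simp add: B_def)
  show "\<Phi> \<in> borel_funs" unfolding \<Phi>_def by (rule borel_measurable_continuous_on_indicator[OF S \<phi>c])
  show "\<Psi> \<in> borel_funs" unfolding \<Psi>_def by (rule borel_measurable_continuous_on_indicator[OF S \<psi>c])
  show "\<bar>\<Phi> p\<bar> \<le> B" for p using B1[of p] by (auto simp: \<Phi>_def B_def indicator_def max_def)
  show "\<bar>\<Psi> p\<bar> \<le> B" for p
  proof (cases "p \<in> ?S")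
   case True
   have "norm (blinfun_apply (D p) (1, 0)) \<le> norm (D p) * norm ((1, 0) :: real \<times> (real ^ 'n))" by (rule norm_blinfun)
   also have "norm ((1, 0) :: real \<times> (real ^ 'n)) = 1" by (simp add: norm_Pair)
   finally show ?thesis using B2[OF True] True by (simp add: \<Psi>_def B_def)
  qed (simp add: \<Psi>_def B_def)
  show "\<Phi> (t, v) = 0" if "t \<notin> {0..T}" for t v using that by (simp add: \<Phi>_def)
  show "\<Psi> (t, v) = 0" if "t \<notin> {0..T}" for t v using that by (simp add: \<Psi>_def)
  show "\<Phi> (t, v) = \<phi> (t, v)" if "t \<in> {0..T}" for t v by (rule e(1)[OF that])
  show "time_deriv T \<phi> t v = \<Psi> (t, v)" if "t \<in> {0..T}" for t v
   unfolding time_deriv_def using dv[OF that] that T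
   by (intro vector_derivative_within_closed_interval) (auto simp: has_real_derivative_iff_has_vector_derivative)
  show "((\<lambda>t. \<Phi> (t, v)) has_real_derivative \<Psi> (t, v)) (at t within {0..T})" if "t \<in> {0..T}" for t v
   unfolding has_field_derivative_def
   by (rule has_derivative_transform[OF that _ dv[OF that, of v, unfolded has_field_derivative_def]]) (rule e(1))
  have "continuous_on {0..T} (\<lambda>t. \<phi> (t, v))" for v by (rule continuous_on_compose2[OF \<phi>c ct]) auto
  then show "continuous_on {0..T} (\<lambda>t. \<Phi> (t, v))" for v by (rule continuous_on_eq) (simp only: e(1))
  have "continuous_on {0..T} (\<lambda>t. blinfun_apply (D (t, v)) (1, 0))" for v by (rule continuous_on_compose2[OF \<psi>c ct]) auto
  then show "continuous_on {0..T} (\<lambda>t. \<Psi> (t, v))" for v by (rule continuous_on_eq) (simp only: e(2))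
 qed
qed

lemma continuous_path_cadlag:
 assumes T: "0 < T" and c: "continuous_map (top_of_set {0..T}) (weak_topology e) \<pi>" and v: "\<And>t. t \<in> {0..T} \<Longrightarrow> \<pi> t \<in> vel_distributions e"
 shows "\<pi> \<in> cadlag_paths e T"
proof -
 have lim: "limitin (weak_topology e) \<pi> (\<pi> t) F" if t: "t \<in> {0..T}" and F: "F \<le> nhds t" "eventually (\<lambda>r. r \<in> {0..T}) F" for t F
  unfolding limitin_def
 proof (intro conjI allI impI)
  show "\<pi> t \<in> topspace (weak_topology e)" using c t unfolding continuous_map_def by auto
  fix U assume U: "openin (weak_topology e) U \<and> \<pi> t \<in> U"
  then have "openin (top_of_set {0..T}) {r \<in> topspace (top_of_set {0..T}). \<pi> r \<in> U}" using c unfolding continuous_map_def by blast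
  then obtain V where V: "open V" "{r \<in> {0..T}. \<pi> r \<in> U} = {0..T} \<inter> V" unfolding openin_open by auto
  then have "t \<in> V" using t U by blast
  then have "eventually (\<lambda>r. r \<in> V) F" using V(1) F(1) by (blast intro: filter_leD eventually_nhds_in_open)
  with F(2) show "eventually (\<lambda>r. \<pi> r \<in> U) F" by eventually_elim (use V(2) in blast)
 qed
 show ?thesis
  unfolding cadlag_paths_def
 proof (intro CollectI conjI ballI)
  show "\<pi> t \<in> vel_distributions e" if "t \<in> {0..T}" for t by (rule v[OF that])
  show "limitin (weak_topology e) \<pi> (\<pi> t) (at_right t)" if t: "t \<in> {0..<T}" for t
  proof (rule lim)
   show "eventually (\<lambda>r. r \<in> {0..T}) (at_right t)" using t by (intro eventually_at_rightI[of t T]) auto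
  qed (use t in \<open>auto simp: at_within_def\<close>)
  show "\<exists>l. limitin (weak_topology e) \<pi> l (at_left t)" if t: "t \<in> {0<..T}" for t
  proof (rule exI[of _ "\<pi> t"], rule lim)
   show "eventually (\<lambda>r. r \<in> {0..T}) (at_left t)" using t by (intro eventually_at_leftI[of 0 t]) auto
  qed (use t in \<open>auto simp: at_within_def\<close>)
 qed
qed

section \<open>The interpolating path and its flow\<close>

locale transition = haar_sphere s for s :: "(real ^ 'n::finite) measure" +
 fixes e T :: real and f1 f2 N :: "real ^ 'n \<Rightarrow> real" and Y1 Y2 :: "'n coll \<Rightarrow> real"
 assumes e0: "0 < e" and T0: "0 < T"
  and dens: "velocity_density e f1" "velocity_density e f2" "velocity_density e N"
  and mean: "(BI v. f1 v *\<^sub>R v) = 0" "(BI v. f2 v *\<^sub>R v) = 0" "(BI v. N v *\<^sub>R v) = 0"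
  and exch: "exchangeable Y1" "exchangeable Y2"
  and Yint: "integrable coll_measure Y1" "integrable coll_measure Y2"
  and trans: "transports f1 N Y1" "transports N f2 Y2"
begin

definition interp :: "real \<Rightarrow> real ^ 'n \<Rightarrow> real" where
 "interp t v = ramp_down (t / T) * f1 v + ramp_up (t / T) * f2 v + bump (t / T) * N v"

text \<open>The time derivative of \<open>interp\<close>, regrouped as gains of the two transports:
  f1 is turned into N at the first rate and N into f2 at the second. In this form it matches
  \<open>flux\<close> term by term.\<close>

definition interp_rate :: "real \<Rightarrow> real ^ 'n \<Rightarrow> real" where
 "interp_rate t v = ramp_rate (t / T) / T * (N v - f1 v) + ramp_rate (1 - t / T) / T * (f2 v - N v)"

definition path :: "real \<Rightarrow> (real ^ 'n) measure" where "path t = density lborel (\<lambda>v. ennreal (interp t v))"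

definition flux :: "'n event \<Rightarrow> real" where
 "flux y = ramp_rate (fst y / T) / T * Y1 (snd y) + ramp_rate (1 - fst y / T) / T * Y2 (snd y)"

definition flow :: "'n event measure" where "flow = density (event_base T) (\<lambda>y. ennreal (flux y))"

lemma meas[measurable]: "f1 \<in> borel_funs" "f2 \<in> borel_funs" "N \<in> borel_funs"
  "Y1 \<in> borel_funs" "Y2 \<in> borel_funs"
 using dens exch by (auto simp: velocity_density_def exchangeable_def)

lemma nonneg: "0 \<le> f1 v" "0 \<le> f2 v" "0 \<le> N v" "0 \<le> Y1 x" "0 \<le> Y2 x"
 using dens exchangeableD(4)[OF exch(1)] exchangeableD(4)[OF exch(2)] by (auto simp: velocity_density_def)

lemma interp_measurable[measurable]: "(\<lambda>p. interp (fst p) (snd p)) \<in> borel_funs"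
 "(\<lambda>p. interp_rate (fst p) (snd p)) \<in> borel_funs" "flux \<in> borel_funs"
 "interp t \<in> borel_funs" "interp_rate t \<in> borel_funs"
 unfolding interp_def interp_rate_def flux_def by measurable

lemma scaled_time: "t \<in> {0..T} \<Longrightarrow> 0 \<le> t / T" "t \<in> {0..T} \<Longrightarrow> t / T \<le> 1"
 using T0 by auto

lemmas ramps = ramp_nonneg[OF scaled_time]

lemma interp_nonneg: "t \<in> {0..T} \<Longrightarrow> 0 \<le> interp t v"
 unfolding interp_def using ramps nonneg by (intro add_nonneg_nonneg mult_nonneg_nonneg) auto

lemma flux_nonneg: "t \<in> {0..T} \<Longrightarrow> 0 \<le> flux (t, x)"
 unfolding flux_def using ramps[of t] nonneg T0 by (intro add_nonneg_nonneg mult_nonneg_nonneg) auto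

lemma interp_ends: "interp 0 = f1" "interp T = f2"
 using T0 by (auto simp: interp_def)

lemma interp_le:
 assumes t: "t \<in> {0..T}"
 shows "interp t v \<le> f1 v + f2 v + N v"
proof -
 have "ramp_down (t / T) \<le> 1" "ramp_up (t / T) \<le> 1" "bump (t / T) \<le> 1" using ramps[OF t t] ramp_sum[of "t / T"] by linarith+
 then have "ramp_down (t / T) * f1 v + ramp_up (t / T) * f2 v + bump (t / T) * N v \<le> 1 * f1 v + 1 * f2 v + 1 * N v"
  by (intro add_mono mult_right_mono nonneg)
 then show ?thesis by (simp add: interp_def)
qed

lemma interp_rate_le:
 assumes t: "t \<in> {0..T}"
 shows "\<bar>interp_rate t v\<bar> \<le> 24 / T * (f1 v + f2 v + N v)"
proof -
 have r: "\<bar>r / T * x\<bar> \<le> 12 / T * y" if "0 \<le> r" "r \<le> 12" "\<bar>x\<bar> \<le> y" for r x y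
 proof -
  have "\<bar>r / T * x\<bar> = r / T * \<bar>x\<bar>" using that T0 by (simp add: abs_mult)
  also have "... \<le> 12 / T * y" using that T0 by (intro mult_mono divide_right_mono) auto
  finally show ?thesis .
 qed
 have "\<bar>ramp_rate (t / T) / T * (N v - f1 v)\<bar> \<le> 12 / T * (f1 v + f2 v + N v)"
  using ramps[OF t t] ramp_rate_le_12[OF scaled_time(1)[OF t] scaled_time(2)[OF t]] nonneg(1-3)[of v] by (intro r) (auto simp: abs_le_iff)
 moreover have "\<bar>ramp_rate (1 - t / T) / T * (f2 v - N v)\<bar> \<le> 12 / T * (f1 v + f2 v + N v)"
  using ramps[OF t t] ramp_rate_le_12[of "1 - t / T"] scaled_time[OF t] nonneg(1-3)[of v] by (intro r) (auto simp: abs_le_iff)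
 ultimately have "\<bar>ramp_rate (t / T) / T * (N v - f1 v) + ramp_rate (1 - t / T) / T * (f2 v - N v)\<bar> \<le> 12 / T * (f1 v + f2 v + N v) + 12 / T * (f1 v + f2 v + N v)"
  by (rule order_trans[OF abs_triangle_ineq add_mono])
 then show ?thesis by (simp add: interp_rate_def)
qed

lemma interp_integral:
 fixes g :: "real ^ 'n \<Rightarrow> 'b::{banach, second_countable_topology}"
 assumes "integrable lborel (\<lambda>v. f1 v *\<^sub>R g v)" "integrable lborel (\<lambda>v. f2 v *\<^sub>R g v)" "integrable lborel (\<lambda>v. N v *\<^sub>R g v)"
 shows "(BI v. interp t v *\<^sub>R g v) = ramp_down (t / T) *\<^sub>R (BI v. f1 v *\<^sub>R g v) + ramp_up (t / T) *\<^sub>R (BI v. f2 v *\<^sub>R g v) + bump (t / T) *\<^sub>R (BI v. N v *\<^sub>R g v)"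
proof -
 have "(BI v. interp t v *\<^sub>R g v) = (BI v. ramp_down (t / T) *\<^sub>R (f1 v *\<^sub>R g v) + ramp_up (t / T) *\<^sub>R (f2 v *\<^sub>R g v) + bump (t / T) *\<^sub>R (N v *\<^sub>R g v))"
  by (simp add: interp_def scaleR_add_left)
 also have "... = (BI v. ramp_down (t / T) *\<^sub>R (f1 v *\<^sub>R g v)) + (BI v. ramp_up (t / T) *\<^sub>R (f2 v *\<^sub>R g v)) + (BI v. bump (t / T) *\<^sub>R (N v *\<^sub>R g v))"
  using assms by (simp del: scaleR_scaleR)
 finally show ?thesis by (simp only: integral_scaleR_right)
qed

lemma path_integral:
 fixes g :: "real ^ 'n \<Rightarrow> 'b::{banach, second_countable_topology}"
 assumes t: "t \<in> {0..T}" and [measurable]: "g \<in> borel_funs"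
 shows "(\<integral>v. g v \<partial>path t) = (BI v. interp t v *\<^sub>R g v)"
 unfolding path_def using interp_nonneg[OF t] by (intro integral_density) auto

lemma bounded_test_integrable:
 fixes g h :: "real ^ 'n \<Rightarrow> real"
 assumes h: "integrable lborel h" and [measurable]: "g \<in> borel_funs" and B: "\<And>v. \<bar>g v\<bar> \<le> B"
 shows "integrable lborel (\<lambda>v. h v *\<^sub>R g v)"
proof (rule Bochner_Integration.integrable_bound[of _ "\<lambda>v. B * \<bar>h v\<bar>"])
 have "0 \<le> B" using order_trans[OF abs_ge_zero B] .
 moreover have "\<bar>h v\<bar> * \<bar>g v\<bar> \<le> B * \<bar>h v\<bar>" for v using mult_left_mono[OF B[of v] abs_ge_zero[of "h v"]] by (simp add: mult.commute)
 ultimately show "AE v in lborel. norm (h v *\<^sub>R g v) \<le> norm (B * \<bar>h v\<bar>)" by (intro AE_I2) (simp add: abs_mult)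
qed (use h in auto)

lemmas dens_int = velocity_density_integral(1)[OF dens(1)] velocity_density_integral(1)[OF dens(2)] velocity_density_integral(1)[OF dens(3)]

lemma interp_nn_integral:
 assumes t: "t \<in> {0..T}" and [measurable]: "H \<in> borel_funs"
 shows "(LI v. ennreal (interp t v) * H v) = ennreal (ramp_down (t / T)) * (LI v. ennreal (f1 v) * H v) +
  ennreal (ramp_up (t / T)) * (LI v. ennreal (f2 v) * H v) + ennreal (bump (t / T)) * (LI v. ennreal (N v) * H v)"
proof -
 note r = ramps[OF t t]
 have "ennreal (interp t v) = ennreal (ramp_down (t / T)) * ennreal (f1 v) + ennreal (ramp_up (t / T)) * ennreal (f2 v) + ennreal (bump (t / T)) * ennreal (N v)" for v
  unfolding interp_def using r nonneg by (simp add: ennreal_mult ennreal_plus)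
 then have "(LI v. ennreal (interp t v) * H v) = (LI v. ennreal (ramp_down (t / T)) * (ennreal (f1 v) * H v) + ennreal (ramp_up (t / T)) * (ennreal (f2 v) * H v) + ennreal (bump (t / T)) * (ennreal (N v) * H v))"
  by (simp only: distrib_right mult.assoc)
 also have "... = ennreal (ramp_down (t / T)) * (LI v. ennreal (f1 v) * H v) +
  ennreal (ramp_up (t / T)) * (LI v. ennreal (f2 v) * H v) + ennreal (bump (t / T)) * (LI v. ennreal (N v) * H v)"
  by (simp add: nn_integral_add nn_integral_cmult)
 finally show ?thesis .
qed

lemma ramp_average: "t \<in> {0..T} \<Longrightarrow> ennreal (ramp_down (t / T)) * c + ennreal (ramp_up (t / T)) * c + ennreal (bump (t / T)) * c = c"
 using ramps[of t] ramp_sum[of "t / T"] by (simp flip: distrib_right ennreal_plus)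

lemma interp_density:
 assumes t: "t \<in> {0..T}"
 shows "velocity_density e (interp t)"
proof -
 have d: "(LE v. f1 v) = 1" "(LE v. f2 v) = 1" "(LE v. N v) = 1"
  "(LI v. ennreal (f1 v) * ennreal ((norm v)\<^sup>2 / 2)) \<le> ennreal e"
  "(LI v. ennreal (f2 v) * ennreal ((norm v)\<^sup>2 / 2)) \<le> ennreal e"
  "(LI v. ennreal (N v) * ennreal ((norm v)\<^sup>2 / 2)) \<le> ennreal e"
  using dens by (auto simp: velocity_density_def)
 have "(LI v. ennreal (interp t v) * 1) = 1"
  using ramp_average[OF t, of 1] by (subst interp_nn_integral[OF t]) (simp_all add: d)
 moreover have "(LI v. ennreal (interp t v) * ennreal ((norm v)\<^sup>2 / 2)) \<le> ennreal (ramp_down (t / T)) * ennreal e + ennreal (ramp_up (t / T)) * ennreal e + ennreal (bump (t / T)) * ennreal e"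
  by (subst interp_nn_integral[OF t], measurable) (intro add_mono mult_left_mono d zero_le)
 ultimately show ?thesis using interp_nonneg[OF t] by (simp add: velocity_density_def ramp_average[OF t])
qed

lemma first_moment_integrable:
 fixes f :: "real ^ 'n \<Rightarrow> real"
 assumes f: "velocity_density e f"
 shows "integrable lborel (\<lambda>v. f v *\<^sub>R v)"
proof (rule Bochner_Integration.integrable_bound[of _ "\<lambda>v. f v * (1 + norm v)"])
 have [measurable]: "f \<in> borel_funs" and n: "\<And>v. 0 \<le> f v" using f by (auto simp: velocity_density_def)
 show "integrable lborel (\<lambda>v. f v * (1 + norm v))"
  by (rule integral_of_nn_integral_le(1)[OF _ _ velocity_density_moment[OF f]]) (use n e0 in auto)
 show "AE v in lborel. norm (f v *\<^sub>R v) \<le> norm (f v * (1 + norm v))"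
 proof (rule AE_I2)
  fix v :: "real ^ 'n"
  have "f v * norm v \<le> f v * (1 + norm v)" using n by (intro mult_left_mono) auto
  then show "norm (f v *\<^sub>R v) \<le> norm (f v * (1 + norm v))" using n[of v] by simp
 qed
qed (use f in \<open>auto simp: velocity_density_def\<close>)

lemma density_vel_distribution:
 fixes f :: "real ^ 'n \<Rightarrow> real"
 assumes f: "velocity_density e f" and m: "(BI v. f v *\<^sub>R v) = 0"
 shows "density lborel (\<lambda>v. ennreal (f v)) \<in> vel_distributions e"
 unfolding vel_distributions_def
proof (intro CollectI conjI)
 have [measurable]: "f \<in> borel_funs" and n: "\<And>v. 0 \<le> f v" and o: "(LE v. f v) = 1"
  and e: "(LI v. ennreal (f v) * ennreal ((norm v)\<^sup>2 / 2)) \<le> ennreal e"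
  using f by (auto simp: velocity_density_def)
 show "prob_space (density lborel (\<lambda>v. ennreal (f v)))" using o by (intro prob_spaceI) (simp add: emeasure_density)
 show "(\<integral>\<^sup>+v. ennreal ((norm v)\<^sup>2 / 2) \<partial>density lborel (\<lambda>v. ennreal (f v))) \<le> ennreal e" using e by (subst nn_integral_density) auto
 show "(\<integral>v. v \<partial>density lborel (\<lambda>v. ennreal (f v))) = 0" using n m by (subst integral_density) auto
qed simp

lemma path_vel: "t \<in> {0..T} \<Longrightarrow> path t \<in> vel_distributions e"
 unfolding path_def
proof (rule density_vel_distribution[OF interp_density])
 show "(BI v. interp t v *\<^sub>R v) = 0"
  by (subst interp_integral) (use first_moment_integrable dens mean in auto)
qed

text \<open>Against a bounded continuous test function the path is a combination of three fixed
  integrals with continuous coefficients, and such evaluations generate the weak topology.\<close>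

lemma path_continuous: "path \<in> continuous_paths e T"
 unfolding continuous_paths_def weak_topology_def continuous_on_generated_topo_iff
proof (intro CollectI conjI allI impI)
 show "path ` topspace (top_of_set {0..T}) \<subseteq> \<Union> {{\<pi> \<in> vel_distributions e. (\<integral>v. f v \<partial>\<pi>) \<in> U} | f U. continuous_on UNIV f \<and> bounded (range f) \<and> open (U :: real set)}"
 proof (rule subsetI, rule UnionI)
  show "{\<pi> \<in> vel_distributions e. (\<integral>v. 0 \<partial>\<pi>) \<in> (UNIV :: real set)} \<in> {{\<pi> \<in> vel_distributions e. (\<integral>v. f v \<partial>\<pi>) \<in> U} | f U. continuous_on UNIV f \<and> bounded (range f) \<and> open (U :: real set)}"
   by (intro CollectI exI[of _ "\<lambda>_ :: real ^ 'n. 0 :: real"] exI[of _ UNIV]) auto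
 qed (use path_vel in auto)
 fix W :: "(real ^ 'n) measure set" assume "W \<in> {{\<pi> \<in> vel_distributions e. (\<integral>v. f v \<partial>\<pi>) \<in> U} | f U. continuous_on UNIV f \<and> bounded (range f) \<and> open (U :: real set)}"
 then obtain g :: "real ^ 'n \<Rightarrow> real" and U where W: "W = {\<pi> \<in> vel_distributions e. (\<integral>v. g v \<partial>\<pi>) \<in> U}" and g: "continuous_on UNIV g" "bounded (range g)" and U: "open U" by auto
 obtain B where B: "\<And>v. \<bar>g v\<bar> \<le> B" using g(2) unfolding bounded_iff by auto
 have gm[measurable]: "g \<in> borel_funs" by (rule borel_measurable_continuous_onI[OF g(1)])
 define F where "F t = (BI v. interp t v *\<^sub>R g v)" for t
 have F: "F t = ramp_down (t / T) *\<^sub>R (BI v. f1 v *\<^sub>R g v) + ramp_up (t / T) *\<^sub>R (BI v. f2 v *\<^sub>R g v) + bump (t / T) *\<^sub>R (BI v. N v *\<^sub>R g v)" for t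
  unfolding F_def by (rule interp_integral) (rule bounded_test_integrable[OF _ gm B], rule dens_int)+
 have c: "continuous_on {0..T} F" unfolding F by (intro continuous_intros)
 have "path -` W \<inter> topspace (top_of_set {0..T}) = {0..T} \<inter> F -` U"
  using path_vel path_integral[OF _ gm] by (auto simp: W F_def)
 then show "openin (top_of_set {0..T}) (path -` W \<inter> topspace (top_of_set {0..T}))"
  using continuous_openin_preimage_gen[OF c U] by simp
qed

lemma nn_integral_flux:
 assumes [measurable]: "H \<in> borel_funs"
 shows "(\<integral>\<^sup>+y. ennreal (flux y) * H (snd y) \<partial>event_base T) = (CI x. ennreal (Y1 x) * H x) + (CI x. ennreal (Y2 x) * H x)"
proof -
 let ?I1 = "(CI x. ennreal (Y1 x) * H x)" and ?I2 = "(CI x. ennreal (Y2 x) * H x)"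
 have "(\<integral>\<^sup>+y. ennreal (flux y) * H (snd y) \<partial>event_base T) = (LI t. (CI x. ennreal (flux (t, x)) * H (snd (t, x))) * indicator {0..T} t)"
  by (rule nn_integral_event_base) measurable
 also have "... = (LI t. (ennreal (ramp_rate (t / T) / T) * indicator {0..T} t) * ?I1 + (ennreal (ramp_rate (1 - t / T) / T) * indicator {0..T} t) * ?I2)"
 proof (rule nn_integral_cong)
  fix t
  show "(CI x. ennreal (flux (t, x)) * H (snd (t, x))) * indicator {0..T} t = (ennreal (ramp_rate (t / T) / T) * indicator {0..T} t) * ?I1 + (ennreal (ramp_rate (1 - t / T) / T) * indicator {0..T} t) * ?I2"
  proof (cases "t \<in> {0..T}")
   case True
   have "ennreal (flux (t, x)) = ennreal (ramp_rate (t / T) / T) * ennreal (Y1 x) + ennreal (ramp_rate (1 - t / T) / T) * ennreal (Y2 x)" for x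
    unfolding flux_def fst_conv snd_conv using ramps[OF True True] nonneg T0 by (subst ennreal_plus) (auto simp: ennreal_mult[symmetric])
   then have "(CI x. ennreal (flux (t, x)) * H (snd (t, x))) = (CI x. ennreal (ramp_rate (t / T) / T) * (ennreal (Y1 x) * H x) + ennreal (ramp_rate (1 - t / T) / T) * (ennreal (Y2 x) * H x))"
    by (simp only: distrib_right mult.assoc snd_conv)
   also have "... = ennreal (ramp_rate (t / T) / T) * ?I1 + ennreal (ramp_rate (1 - t / T) / T) * ?I2"
    by (simp add: nn_integral_add nn_integral_cmult)
   finally show ?thesis using True by simp
  qed simp
 qed
 also have "... = (LI t. (ennreal (ramp_rate (t / T) / T) * indicator {0..T} t) * ?I1) + (LI t. (ennreal (ramp_rate (1 - t / T) / T) * indicator {0..T} t) * ?I2)"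
  by (rule nn_integral_add) measurable
 also have "... = ?I1 + ?I2"
  by (subst nn_integral_multc, measurable, subst nn_integral_multc, measurable) (simp add: nn_integral_ramp_rate[OF T0])
 finally show ?thesis .
qed

lemma flow_mass: "emeasure flow (space flow) = (CE x. Y1 x) + (CE x. Y2 x)"
proof -
 have m: "(\<lambda>y. ennreal (flux y)) \<in> borel_funs" by measurable
 have "emeasure flow (space flow) = (\<integral>\<^sup>+y. ennreal (flux y) * 1 \<partial>event_base T)"
  unfolding flow_def space_density by (subst emeasure_density[OF event_base_measurable[OF m] sets.top]) (auto intro!: nn_integral_cong)
 then show ?thesis using nn_integral_flux[of "\<lambda>_. 1"] by simp
qed

lemma Y_mass_finite: "(CE x. Y1 x) < \<infinity>" "(CE x. Y2 x) < \<infinity>"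
 using Yint nonneg by (simp_all add: nn_integral_eq_integral)

lemma flow_collision_measure: "flow \<in> collision_measures T"
 unfolding flow_def
proof (rule density_event_base_collision_measure)
 show "exchangeable (\<lambda>x. flux (t, x))" if "t \<in> {0..T}" for t
  unfolding flux_def fst_conv snd_conv using ramps[OF that that] T0 by (intro exchangeable_combination exch) auto
 show "(\<integral>\<^sup>+y. ennreal (flux y) \<partial>event_base T) < \<infinity>" using nn_integral_flux[of "\<lambda>_. 1"] Y_mass_finite by simp
qed measurable

text \<open>For each velocity the fundamental theorem of calculus applies to the test function times
  \<open>interp\<close>. After integration in v, the term in which the density is differentiated
  equals the contribution of the flow by the two transport identities.\<close>

lemma balance:
 assumes \<phi>: "\<phi> \<in> C1b T"
 shows "(\<integral>v. \<phi> (T, v) \<partial>path T) - (\<integral>v. \<phi> (0, v) \<partial>path 0) - (LINT t:{0..T}|lborel. (\<integral>v. time_deriv T \<phi> t v \<partial>path t))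
  - (\<integral>(t, p, p'). collision_gradient (\<lambda>v. \<phi> (t, v)) p p' \<partial>flow) = 0"
proof -
 obtain B \<Phi> \<Psi> where B0: "0 \<le> B" and \<Phi>m[measurable]: "\<Phi> \<in> borel_funs" and \<Psi>m[measurable]: "\<Psi> \<in> borel_funs"
  and \<Phi>B: "\<And>p. \<bar>\<Phi> p\<bar> \<le> B" and \<Psi>B: "\<And>p. \<bar>\<Psi> p\<bar> \<le> B"
  and out: "\<And>t v. t \<notin> {0..T} \<Longrightarrow> \<Phi> (t, v) = 0" "\<And>t v. t \<notin> {0..T} \<Longrightarrow> \<Psi> (t, v) = 0"
  and ins: "\<And>t v. t \<in> {0..T} \<Longrightarrow> \<Phi> (t, v) = \<phi> (t, v)" "\<And>t v. t \<in> {0..T} \<Longrightarrow> time_deriv T \<phi> t v = \<Psi> (t, v)"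
  and d\<Phi>: "\<And>t v. t \<in> {0..T} \<Longrightarrow> ((\<lambda>t. \<Phi> (t, v)) has_real_derivative \<Psi> (t, v)) (at t within {0..T})"
  and c: "\<And>v. continuous_on {0..T} (\<lambda>t. \<Phi> (t, v))" "\<And>v. continuous_on {0..T} (\<lambda>t. \<Psi> (t, v))"
  by (rule C1b_time_derivative[OF T0 \<phi>]) (rule that; assumption)
 interpret C: sigma_finite_measure coll_measure by (rule sigma_finite_coll_measure)
 interpret LC: pair_sigma_finite "lborel :: real measure" coll_measure by standard
 let ?g = "\<lambda>v. f1 v + f2 v + N v"
 have gi: "integrable lborel ?g" using dens_int by auto
 have g0: "0 \<le> ?g v" for v using nonneg(1-3)[of v] by simp
 \<comment> \<open>The end densities have no pointwise bound, so domination is by the integrable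
   function f1 + f2 + N, which does not depend on time.\<close>
 have pairI: "integrable (lborel \<Otimes>\<^sub>M lborel) (\<lambda>p. M (fst p) (snd p))"
  if M[measurable]: "(\<lambda>p. M (fst p) (snd p)) \<in> borel_funs" and le: "\<And>t v. t \<in> {0..T} \<Longrightarrow> \<bar>M t v\<bar> \<le> k * ?g v"
   and z: "\<And>t v. t \<notin> {0..T} \<Longrightarrow> M t v = 0" and k: "0 \<le> k" for M :: "real \<Rightarrow> real ^ 'n \<Rightarrow> real" and k
 proof (rule integrableI_bounded)
  show "(\<lambda>p. M (fst p) (snd p)) \<in> borel_measurable (lborel \<Otimes>\<^sub>M lborel)" using M by (simp add: lborel_prod)
  have "(\<integral>\<^sup>+p. ennreal (norm (M (fst p) (snd p))) \<partial>(lborel \<Otimes>\<^sub>M lborel)) = (LI t. (LE v. norm (M t v)))"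
   using M by (subst lborel.nn_integral_fst[symmetric]) (simp_all add: lborel_prod)
  also have "... \<le> (LI t. ennreal (BI v. k * ?g v) * indicator {0..T} t)"
  proof (rule nn_integral_mono)
   fix t :: real
   show "(LE v. norm (M t v)) \<le> ennreal (BI v. k * ?g v) * indicator {0..T} t"
   proof (cases "t \<in> {0..T}")
    case True
    have "(LE v. norm (M t v)) \<le> (LE v. k * ?g v)"
     using le[OF True] by (intro nn_integral_mono ennreal_leI) simp
    also have "... = ennreal (BI v. k * ?g v)" using gi g0 k by (intro nn_integral_eq_integral) auto
    finally show ?thesis using True by simp
   qed (simp add: z)
  qed
  also have "... = ennreal (BI v. k * ?g v) * ennreal T" using T0 by (subst nn_integral_cmult) auto
  also have "... < \<infinity>" by (simp add: ennreal_mult_less_top)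
  finally show "(\<integral>\<^sup>+p. ennreal (norm (M (fst p) (snd p))) \<partial>(lborel \<Otimes>\<^sub>M lborel)) < \<infinity>" .
 qed
 \<comment> \<open>M1 contains the derivative of the density and M2 that of the test function. Both
   vanish outside [0, T], so that integrals over the whole line can be used.\<close>
 define M1 where "M1 t v = \<Phi> (t, v) * interp_rate t v" for t v
 define M2 where "M2 t v = \<Psi> (t, v) * interp t v" for t v
 have [measurable]: "(\<lambda>p. M1 (fst p) (snd p)) \<in> borel_funs" "(\<lambda>p. M2 (fst p) (snd p)) \<in> borel_funs"
  unfolding M1_def M2_def by measurable
 have i1: "integrable (lborel \<Otimes>\<^sub>M lborel) (\<lambda>p. M1 (fst p) (snd p))"
 proof (rule pairI[of M1 "B * (24 / T)"])
  show "\<bar>M1 t v\<bar> \<le> B * (24 / T) * ?g v" if "t \<in> {0..T}" for t v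
   unfolding M1_def abs_mult mult.assoc by (intro mult_mono \<Phi>B interp_rate_le that B0) simp
 qed (use out B0 T0 in \<open>auto simp: M1_def\<close>)
 have i2: "integrable (lborel \<Otimes>\<^sub>M lborel) (\<lambda>p. M2 (fst p) (snd p))"
 proof (rule pairI[of M2 B])
  show "\<bar>M2 t v\<bar> \<le> B * ?g v" if "t \<in> {0..T}" for t v
   unfolding M2_def abs_mult using interp_le[OF that] interp_nonneg[OF that] by (intro mult_mono \<Psi>B B0) auto
 qed (use out B0 in \<open>auto simp: M2_def\<close>)
 have \<Phi>v: "(\<lambda>v. \<Phi> (t, v)) \<in> borel_funs" for t by measurable
 have T00: "0 \<in> {0..T}" "T \<in> {0..T}" using T0 by auto
 have ftc: "(BI t. M1 t v + M2 t v) = \<phi> (T, v) * f2 v - \<phi> (0, v) * f1 v" for v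
 proof -
  have "(BI t. indicator {0..T} t *\<^sub>R (M1 t v + M2 t v)) = \<Phi> (T, v) * interp T v - \<Phi> (0, v) * interp 0 v"
  proof (rule integral_FTC_Icc)
   fix t assume "0 \<le> t" "t \<le> T"
   then have t: "t \<in> {0..T}" by simp
   have "((\<lambda>t. interp t v) has_real_derivative (- ramp_rate (t / T) / T) * f1 v + (ramp_rate (1 - t / T) / T) * f2 v + ((ramp_rate (t / T) - ramp_rate (1 - t / T)) / T) * N v) (at t within {0..T})"
    unfolding interp_def by (intro DERIV_add DERIV_cmult_right DERIV_rescale[THEN DERIV_subset] DERIV_ramp_down DERIV_ramp_up DERIV_bump) auto
   also have "(- ramp_rate (t / T) / T) * f1 v + (ramp_rate (1 - t / T) / T) * f2 v + ((ramp_rate (t / T) - ramp_rate (1 - t / T)) / T) * N v = interp_rate t v"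
    unfolding interp_rate_def by (simp add: algebra_simps diff_divide_distrib)
   finally have "((\<lambda>t. interp t v) has_real_derivative interp_rate t v) (at t within {0..T})" .
   from DERIV_mult[OF d\<Phi>[OF t] this]
   show "((\<lambda>t. \<Phi> (t, v) * interp t v) has_vector_derivative M1 t v + M2 t v) (at t within {0..T})"
    by (simp add: has_real_derivative_iff_has_vector_derivative M1_def M2_def algebra_simps)
  next
   show "continuous_on {0..T} (\<lambda>t. M1 t v + M2 t v)"
    unfolding M1_def M2_def interp_def interp_rate_def using T0 by (intro continuous_intros c) auto
  qed (use T0 in simp)
  moreover have "indicator {0..T} t *\<^sub>R (M1 t v + M2 t v) = M1 t v + M2 t v" for t
   using out[of t v] by (cases "t \<in> {0..T}") (auto simp: M1_def M2_def)
  ultimately show ?thesis by (simp only: ins(1)[OF T00(1)] ins(1)[OF T00(2)] interp_ends)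
 qed
 have bd: "integrable lborel (\<lambda>v. h v *\<^sub>R \<Phi> (t, v))" if "integrable lborel h" for h t
  by (rule bounded_test_integrable[OF that _ \<Phi>B]) measurable
 have i12: "integrable (lborel \<Otimes>\<^sub>M lborel) (case_prod (\<lambda>t v. M1 t v + M2 t v))"
  using Bochner_Integration.integrable_add[OF i1 i2] by (simp only: case_prod_beta')
 have "(BI t. (BI v. M1 t v + M2 t v)) = (BI v. (BI t. M1 t v + M2 t v))"
  by (rule lborel_pair.Fubini_integral[symmetric, OF i12])
 also have "... = (BI v. f2 v *\<^sub>R \<Phi> (T, v) - f1 v *\<^sub>R \<Phi> (0, v))" by (simp add: ftc ins(1)[OF T00(1)] ins(1)[OF T00(2)] mult.commute)
 also have "... = (BI v. f2 v *\<^sub>R \<Phi> (T, v)) - (BI v. f1 v *\<^sub>R \<Phi> (0, v))"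
  by (rule Bochner_Integration.integral_diff) (rule bd dens_int)+
 also have "(BI v. f2 v *\<^sub>R \<Phi> (T, v)) = (\<integral>v. \<phi> (T, v) \<partial>path T)"
  using path_integral[OF T00(2) \<Phi>v[of T]] by (simp only: interp_ends ins(1)[OF T00(2)])
 also have "(BI v. f1 v *\<^sub>R \<Phi> (0, v)) = (\<integral>v. \<phi> (0, v) \<partial>path 0)"
  using path_integral[OF T00(1) \<Phi>v[of 0]] by (simp only: interp_ends ins(1)[OF T00(1)])
 finally have lhs: "(BI t. (BI v. M1 t v + M2 t v)) = (\<integral>v. \<phi> (T, v) \<partial>path T) - (\<integral>v. \<phi> (0, v) \<partial>path 0)" .
 have sl: "integrable lborel (M1 t)" "integrable lborel (M2 t)" for t
 proof -
  have gk: "integrable lborel (\<lambda>v. k * ?g v)" for k using gi by simp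
  have "AE v in lborel. norm (M1 t v) \<le> norm (B * (24 / T) * ?g v)"
  proof (rule AE_I2)
   fix v
   show "norm (M1 t v) \<le> norm (B * (24 / T) * ?g v)"
   proof (cases "t \<in> {0..T}")
    case True
    have "\<bar>M1 t v\<bar> \<le> B * (24 / T * ?g v)"
     unfolding M1_def abs_mult by (rule mult_mono[OF \<Phi>B interp_rate_le[OF True] B0 abs_ge_zero])
    then show ?thesis unfolding real_norm_def mult.assoc by (rule order_trans[OF _ abs_ge_self])
   qed (simp add: M1_def out)
  qed
  then show "integrable lborel (M1 t)" by (rule Bochner_Integration.integrable_bound[OF gk, rotated]) (unfold M1_def, measurable)
  have "AE v in lborel. norm (M2 t v) \<le> norm (B * ?g v)"
  proof (rule AE_I2)
   fix v
   have "t \<in> {0..T} \<Longrightarrow> \<bar>M2 t v\<bar> \<le> B * ?g v"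
    unfolding M2_def abs_mult using interp_le[of t v] interp_nonneg[of t v] by (intro mult_mono \<Psi>B B0) auto
   then show "norm (M2 t v) \<le> norm (B * ?g v)" using out(2)[of t v] by (cases "t \<in> {0..T}") (auto simp: M2_def)
  qed
  then show "integrable lborel (M2 t)" by (rule Bochner_Integration.integrable_bound[OF gk, rotated]) (unfold M2_def, measurable)
 qed
 have split: "(BI t. (BI v. M1 t v + M2 t v)) = (BI t. (BI v. M1 t v)) + (BI t. (BI v. M2 t v))"
  using lborel_pair.integrable_fst'[OF i1] lborel_pair.integrable_fst'[OF i2] by (simp add: Bochner_Integration.integral_add[OF sl])
 have time: "(LINT t:{0..T}|lborel. (\<integral>v. time_deriv T \<phi> t v \<partial>path t)) = (BI t. (BI v. M2 t v))"
  unfolding set_lebesgue_integral_def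
 proof (rule Bochner_Integration.integral_cong[OF refl])
  fix t :: real
  show "indicator {0..T} t *\<^sub>R (\<integral>v. time_deriv T \<phi> t v \<partial>path t) = (BI v. M2 t v)"
  proof (cases "t \<in> {0..T}")
   case True
   have "(\<integral>v. time_deriv T \<phi> t v \<partial>path t) = (\<integral>v. \<Psi> (t, v) \<partial>path t)" by (simp add: ins(2)[OF True])
   also have "... = (BI v. interp t v *\<^sub>R \<Psi> (t, v))" by (rule path_integral[OF True]) measurable
   finally show ?thesis using True by (simp add: M2_def mult.commute)
  qed (simp add: out M2_def)
 qed
 define h where "h y = cg (\<lambda>v. \<Phi> (fst y, v)) (snd y)" for y :: "'n event"
 have hm[measurable]: "h \<in> borel_funs" unfolding h_def cg_alt by measurable
 have hB: "\<bar>h y\<bar> \<le> 4 * B" for y unfolding h_def by (rule cg_bound) (rule \<Phi>B)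
 have h0: "h (t, x) = 0" if "t \<notin> {0..T}" for t x unfolding h_def cg_alt using that by (simp add: out)
 have iqh: "integrable (lborel \<Otimes>\<^sub>M coll_measure) (\<lambda>y. flux y * h y)"
 proof (rule integrableI_bounded)
  show "(\<lambda>y. flux y * h y) \<in> borel_measurable (lborel \<Otimes>\<^sub>M coll_measure)"
   unfolding measurable_cong_sets[OF sets_lborel_coll refl] by measurable
  have "(\<integral>\<^sup>+y. ennreal (norm (flux y * h y)) \<partial>(lborel \<Otimes>\<^sub>M coll_measure)) \<le> (\<integral>\<^sup>+y. (ennreal (flux y) * ennreal (4 * B)) * indicator ({0..T} \<times> UNIV) y \<partial>(lborel \<Otimes>\<^sub>M coll_measure))"
  proof (rule nn_integral_mono)
   fix y :: "'n event"
   obtain t x where y: "y = (t, x)" by (cases y)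
   show "ennreal (norm (flux y * h y)) \<le> (ennreal (flux y) * ennreal (4 * B)) * indicator ({0..T} \<times> UNIV) y"
   proof (cases "t \<in> {0..T}")
    case True
    have "norm (flux y * h y) \<le> flux y * (4 * B)" using hB[of y] flux_nonneg[OF True, of x] by (simp add: abs_mult y mult_left_mono)
    then have "ennreal (norm (flux y * h y)) \<le> ennreal (flux y * (4 * B))" by (rule ennreal_leI)
    also have "... = ennreal (flux y) * ennreal (4 * B)" using flux_nonneg[OF True, of x] B0 y by (intro ennreal_mult) auto
    finally show ?thesis using True y by simp
   qed (simp add: h0 y)
  qed
  also have "... = (\<integral>\<^sup>+y. ennreal (flux y) * ennreal (4 * B) \<partial>event_base T)"
   unfolding event_base_def by (rule nn_integral_restrict_space[OF strip_sets, symmetric])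
  also have "... < \<infinity>" using nn_integral_flux[of "\<lambda>_. ennreal (4 * B)"] Y_mass_finite by (simp add: nn_integral_multc ennreal_mult_less_top)
  finally show "(\<integral>\<^sup>+y. ennreal (norm (flux y * h y)) \<partial>(lborel \<Otimes>\<^sub>M coll_measure)) < \<infinity>" .
 qed
 have "(\<integral>(t, p, p'). collision_gradient (\<lambda>v. \<phi> (t, v)) p p' \<partial>flow) = (\<integral>y. h y \<partial>flow)"
 proof (rule Bochner_Integration.integral_cong[OF refl])
  fix y assume "y \<in> space flow"
  then have "fst y \<in> {0..T}" by (auto simp: flow_def space_event_base)
  then show "(case y of (t, p, p') \<Rightarrow> collision_gradient (\<lambda>v. \<phi> (t, v)) p p') = h y" by (simp add: h_def cg_def ins case_prod_beta)
 qed
 also have "... = (\<integral>y. flux y *\<^sub>R h y \<partial>event_base T)"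
  unfolding flow_def
 proof (rule integral_density)
  show "AE y in event_base T. 0 \<le> flux y" by (rule AE_I2) (use flux_nonneg in \<open>auto simp: space_event_base\<close>)
 qed (rule event_base_measurable, measurable)+
 also have "... = (\<integral>y. indicator ({0..T} \<times> UNIV) y *\<^sub>R (flux y *\<^sub>R h y) \<partial>(lborel \<Otimes>\<^sub>M coll_measure))"
  unfolding event_base_def by (rule integral_restrict_space[OF strip_sets])
 also have "... = (\<integral>y. flux y * h y \<partial>(lborel \<Otimes>\<^sub>M coll_measure))"
 proof (rule Bochner_Integration.integral_cong[OF refl])
  fix y :: "'n event"
  show "indicator ({0..T} \<times> UNIV) y *\<^sub>R (flux y *\<^sub>R h y) = flux y * h y"
   using h0[of "fst y" "snd y"] by (cases "fst y \<in> {0..T}") (auto simp: indicator_def mem_Times_iff)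
 qed
 also have "... = (BI t. (BC x. flux (t, x) * h (t, x)))" by (rule LC.integral_fst'[OF iqh, symmetric])
 also have "... = (BI t. (BI v. M1 t v))"
 proof (rule Bochner_Integration.integral_cong[OF refl])
  fix t :: real
  let ?p = "\<lambda>v. \<Phi> (t, v)"
  let ?a = "ramp_rate (t / T) / T" and ?b = "ramp_rate (1 - t / T) / T"
  have pm: "?p \<in> borel_funs" by measurable
  have "(BC x. flux (t, x) * h (t, x)) = (BC x. ?a * (Y1 x * cg ?p x) + ?b * (Y2 x * cg ?p x))"
   by (simp add: flux_def h_def distrib_right mult.assoc)
  also have "... = ?a * (BC x. Y1 x * cg ?p x) + ?b * (BC x. Y2 x * cg ?p x)"
   using integrable_weight_cg[OF Yint(1) pm \<Phi>B] integrable_weight_cg[OF Yint(2) pm \<Phi>B] by (subst Bochner_Integration.integral_add) auto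
  also have "... = ?a * ((BI v. N v *\<^sub>R ?p v) - (BI v. f1 v *\<^sub>R ?p v)) + ?b * ((BI v. f2 v *\<^sub>R ?p v) - (BI v. N v *\<^sub>R ?p v))"
   using transportsD[OF trans(1) pm \<Phi>B] transportsD[OF trans(2) pm \<Phi>B] by (simp add: mult.commute)
  also have "... = (BI v. ?a * (N v *\<^sub>R ?p v - f1 v *\<^sub>R ?p v) + ?b * (f2 v *\<^sub>R ?p v - N v *\<^sub>R ?p v))"
   using bd[OF dens_int(1), of t] bd[OF dens_int(2), of t] bd[OF dens_int(3), of t] by simp
  also have "... = (BI v. M1 t v)"
  proof (intro Bochner_Integration.integral_cong refl)
   fix v
   have alg: "a * (n * p - f * p) + b * (g * p - n * p) = p * (a * (n - f) + b * (g - n))" for a b n f g p :: real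
    by (simp add: algebra_simps)
   show "?a * (N v *\<^sub>R ?p v - f1 v *\<^sub>R ?p v) + ?b * (f2 v *\<^sub>R ?p v - N v *\<^sub>R ?p v) = M1 t v"
    unfolding M1_def interp_rate_def real_scaleR_def by (rule alg)
  qed
  finally show "(BC x. flux (t, x) * h (t, x)) = (BI v. M1 t v)" .
 qed
 finally show ?thesis using lhs split time by simp
qed

theorem path_flow_balanced: "(path, flow) \<in> balanced_pairs e T"
 unfolding balanced_pairs_def
proof (intro CollectI case_prodI conjI ballI)
 show "path \<in> cadlag_paths e T"
  using path_continuous path_vel by (intro continuous_path_cadlag[OF T0]) (auto simp: continuous_paths_def)
qed (use flow_collision_measure balance in auto)

end

section \<open>The cost of the path\<close>

text \<open>Write q / p as q / (2 a) times 2 a / p, and apply ln x \<le> x - 1 to the first factor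
  only. The 2 is chosen with \<open>log_sum_le\<close> in view, where the remainders q / 2 - a and q
  / 2 - b of the two parts cancel.\<close>

lemma mult_ln_le:
 fixes a c p q :: real
 assumes "0 \<le> a" "0 < p" "0 < q" "0 < a \<Longrightarrow> 0 < c" "a \<le> p * c"
 shows "a * ln (q / p) \<le> a * ln (2 * c) + (q / 2 - a)"
proof (cases "a = 0")
 case False
 then have a: "0 < a" and c: "0 < c" using assms by auto
 have "ln (q / (2 * a)) \<le> q / (2 * a) - 1" using assms a by (intro ln_le_minus_one) auto
 then have "a * ln (q / (2 * a)) \<le> a * (q / (2 * a) - 1)" using a by (intro mult_left_mono) auto
 also have "... = q / 2 - a" using a by (simp add: right_diff_distrib)
 finally have 1: "a * ln (q / (2 * a)) \<le> q / 2 - a" .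
 have "2 * a / p \<le> 2 * c" using assms(2,5) by (simp add: divide_le_eq mult.commute)
 then have "ln (2 * a / p) \<le> ln (2 * c)" using a c assms(2) by (subst ln_le_cancel_iff) auto
 then have 2: "a * ln (2 * a / p) \<le> a * ln (2 * c)" using a by (intro mult_left_mono) auto
 have "q / p = (q / (2 * a)) * (2 * a / p)" using a by simp
 then have "ln (q / p) = ln (q / (2 * a)) + ln (2 * a / p)" using a assms by (simp only: ln_mult_pos divide_pos_pos mult_pos_pos zero_less_numeral)
 then have "a * ln (q / p) = a * ln (q / (2 * a)) + a * ln (2 * a / p)" by (simp only: distrib_left)
 then show ?thesis using 1 2 by linarith
qed (use assms in simp)

text \<open>The common factor u stays in front of the whole sum, whereas w, later the average of f2
  over the outgoing pair, enters only through b * ln w with coefficient one. No error proportional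
  to the mass is left.\<close>

lemma log_sum_le:
 fixes a b p u w :: real
 assumes "0 \<le> a" "0 \<le> b" "0 < a + b" "0 < p" "0 < u" "0 \<le> w" "a \<le> p * u" "b \<le> p * (u * w)"
 shows "(a + b) * ln ((a + b) / p) \<le> (a + b) * ln (2 * u) + b * ln w"
proof -
 define q where "q = a + b"
 have q: "0 < q" using assms by (simp add: q_def)
 have 1: "a * ln (q / p) \<le> a * ln (2 * u) + (q / 2 - a)" using assms q by (intro mult_ln_le) auto
 have w: "0 < w" if "0 < b"
 proof (rule ccontr)
  assume "\<not> 0 < w"
  then have "w = 0" using assms by simp
  then show False using assms(8) that by simp
 qed
 have 2: "b * ln (q / p) \<le> b * ln (2 * (u * w)) + (q / 2 - b)" using assms q w by (intro mult_ln_le) auto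
 have 3: "b * ln (2 * (u * w)) = b * ln (2 * u) + b * ln w"
 proof (cases "b = 0")
  case False
  then have "0 < w" using w assms by simp
  then show ?thesis using assms ln_mult_pos[of "2 * u" w] by (simp add: mult.assoc distrib_left)
 qed simp
 have q4: "q * z = a * z + b * z" for z by (simp add: q_def distrib_right)
 have "a * ln (q / p) + b * ln (q / p) \<le> (a * ln (2 * u) + (q / 2 - a)) + ((b * ln (2 * u) + b * ln w) + (q / 2 - b))"
  using add_mono[OF 1 2] unfolding 3 .
 also have "... = (a * ln (2 * u) + b * ln (2 * u)) + b * ln w"
 proof -
  have "(X + c) + ((Y + Z) + c') = (X + Y) + Z" if "c + c' = 0" for X Y Z c c' :: real using that by linarith
  moreover have "(q / 2 - a) + (q / 2 - b) = 0" using q_def by linarith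
  ultimately show ?thesis .
 qed
 finally have "q * ln (q / p) \<le> q * ln (2 * u) + b * ln w" unfolding q4 .
 then show ?thesis by (simp only: q_def)
qed

lemma mult_ln_midpoint_convex:
 fixes x y :: real
 assumes "0 \<le> x" "0 \<le> y"
 shows "(x + y) / 2 * ln ((x + y) / 2) \<le> (x * ln x + y * ln y) / 2"
proof (cases "x + y = 0")
 case True
 then show ?thesis using assms by (simp add: add_nonneg_eq_0_iff)
next
 case False
 define m where "m = (x + y) / 2"
 have m: "0 < m" using False assms by (simp add: m_def)
 have "z * ln m \<le> z * ln z + m - z" if z: "0 \<le> z" for z
 proof (cases "z = 0")
  case False
  then have z: "0 < z" using z by simp
  have "ln (m / z) \<le> m / z - 1" using m z by (intro ln_le_minus_one) auto
  then have "z * ln (m / z) \<le> z * (m / z - 1)" using z by (intro mult_left_mono) auto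
  then show ?thesis using z m by (simp add: ln_div algebra_simps)
 qed (use m in simp)
 from add_mono[OF this[OF assms(1)] this[OF assms(2)]]
 have "x * ln m + y * ln m \<le> (x * ln x + m - x) + (y * ln y + m - y)" .
 also have "... = x * ln x + y * ln y" by (simp add: m_def field_simps)
 finally have *: "x * ln m + y * ln m \<le> x * ln x + y * ln y" .
 have "m * ln m = (x * ln m + y * ln m) / 2" unfolding distrib_right[symmetric] by (simp add: m_def)
 also have "... \<le> (x * ln x + y * ln y) / 2" using * by (rule divide_right_mono) simp
 finally show ?thesis by (simp only: m_def)
qed

lemma mult_ln_ratio_ge:
 fixes p q :: real
 assumes "0 \<le> q" "0 < p"
 shows "q - p \<le> q * ln (q / p)"
proof (cases "q = 0")
 case False
 then have q: "0 < q" using assms by simp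
 have "ln (p / q) \<le> p / q - 1" using assms q by (intro ln_le_minus_one) auto
 then have "q * ln (p / q) \<le> q * (p / q - 1)" using q by (intro mult_left_mono) auto
 then show ?thesis using q assms by (simp add: ln_div algebra_simps)
qed (use assms in simp)

text \<open>\<open>E1\<close> and \<open>E2\<close> multiply the possibly unbounded f1 and f2;
  \<open>Z1\<close> and \<open>Z2\<close> collect what is dominated by the rate irrespective of
  them. \<open>E2_marginal\<close> expresses that \<open>E2\<close> gives the outgoing particles
  Lebesgue measure, from which the entropy of f2 is recovered.\<close>

locale controlled_transition = transition s e T f1 f2 N Y1 Y2
 for s :: "(real ^ 'n::finite) measure" and e T f1 f2 N Y1 Y2 +
 fixes nb cl k :: real and E1 E2 Z1 Z2 :: "'n coll \<Rightarrow> real"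
 assumes N_pos: "\<And>v. 0 < N v" and N_le: "\<And>v. N v \<le> nb" and cl0: "0 \<le> cl" and N_ln: "\<And>v. - ln (N v) \<le> cl * (1 + ln (1 + norm v))"
  and k1: "1 \<le> k"
  and EZ_meas[measurable]: "E1 \<in> borel_funs" "E2 \<in> borel_funs" "Z1 \<in> borel_funs" "Z2 \<in> borel_funs"
  and EZ_nonneg: "\<And>x. 0 \<le> E1 x" "\<And>x. 0 \<le> E2 x" "\<And>x. 0 \<le> Z1 x" "\<And>x. 0 \<le> Z2 x"
  and EZ_le: "\<And>x. E1 x \<le> k * grate x" "\<And>x. E2 x \<le> k * grate x" "\<And>x. Z1 x \<le> k * grate x" "\<And>x. Z2 x \<le> k * grate x"
  and Y1_eq: "\<And>x. Y1 x = E1 x * Sin f1 x + Z1 x" and Y2_eq: "\<And>x. Y2 x = E2 x * Sout f2 x + Z2 x"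
  and E2_marginal: "\<And>g. g \<in> borel_funs \<Longrightarrow> (\<And>v. 0 \<le> g v) \<Longrightarrow> (CE x. E2 x * Sout g x) = (LE v. g v)"
begin

text \<open>Density of the typical collisions relative to \<open>event_base\<close>; 1 / 4 is the 1
  / 2 of their definition times the 1 / 2 of the cross section.\<close>

definition typical :: "'n event \<Rightarrow> real" where
 "typical y = interp (fst y) (fst (fst (snd y))) * interp (fst y) (snd (fst (snd y))) * grate (snd y) / 4"

text \<open>The first summand is spent on the part of the flux linear in f1, the second on the two
  remainders; see \<open>PD\<close> in \<open>density_ratio_bounds\<close>.\<close>

definition D :: real where "D = 8 * (k * nb) + 3 * k"

text \<open>The 3 compensates \<tau> * (3 / \<tau>), which stems from - ln (\<tau> ^ 3), and 2 * cl
  the values of N at the two incoming velocities.\<close>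

definition A :: real where "A = \<bar>ln (2 * D)\<bar> + 3 + 2 * cl"

lemma grate_nonneg: "0 \<le> grate x" for x :: "'n coll" by (simp add: grate_def)

lemma interp_lower:
 assumes t: "t \<in> {0..T}"
 shows "ramp_down (t / T) * f1 v \<le> interp t v" "bump (t / T) * N v \<le> interp t v"
 using ramps[OF t t] nonneg(1-3)[of v] by (simp_all add: interp_def)

lemma flux_decomposition:
 "flux (t, x) = (ramp_rate (t / T) / T * (E1 x * Sin f1 x) + ramp_rate (t / T) / T * Z1 x + ramp_rate (1 - t / T) / T * Z2 x) + ramp_rate (1 - t / T) / T * (E2 x * Sout f2 x)"
 by (simp add: flux_def Y1_eq Y2_eq distrib_left)

lemma flux_nonzeroD:
 assumes "flux (t, x) \<noteq> 0" "t \<in> {0..T}"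
 shows "0 < t / T" "t / T < 1" "0 < grate x"
proof -
 have "t / T \<noteq> 0" using assms(1) by (auto simp: flux_def ramp_rate_def)
 then show "0 < t / T" using scaled_time(1)[OF assms(2)] by linarith
 have "t / T \<noteq> 1" using assms(1) by (auto simp: flux_def ramp_rate_def)
 then show "t / T < 1" using scaled_time(2)[OF assms(2)] by linarith
 have "grate x \<noteq> 0"
 proof
  assume "grate x = 0"
  then have "E1 x = 0" "E2 x = 0" "Z1 x = 0" "Z2 x = 0" using EZ_le[of x] EZ_nonneg[of x] by auto
  then show False using assms(1) by (simp add: flux_def Y1_eq Y2_eq)
 qed
 then show "0 < grate x" using grate_nonneg[of x] by linarith
qed

lemma typical_nonneg: "t \<in> {0..T} \<Longrightarrow> 0 \<le> typical (t, x)"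
 unfolding typical_def using interp_nonneg[of t] grate_nonneg by simp

lemma typical_pos:
 assumes "flux (t, x) \<noteq> 0" "t \<in> {0..T}"
 shows "0 < typical (t, x)"
proof -
 note f = flux_nonzeroD[OF assms]
 have "0 < bump (t / T)" unfolding bump_def using f by (intro mult_pos_pos zero_less_power) auto
 then have "0 < interp t v" for v
  by (rule less_le_trans[OF mult_pos_pos[OF _ N_pos] interp_lower(2)[OF assms(2)]])
 then show ?thesis unfolding typical_def fst_conv snd_conv using f(3) by (intro divide_pos_pos mult_pos_pos) auto
qed

lemma typical_measurable[measurable]: "typical \<in> borel_funs"
 unfolding typical_def interp_def grate_def by measurable

text \<open>The reference rate is bounded below by dropping terms of the interpolation: both
  particles are taken from the reservoir for the remainders and for the prefactor of f2; one from f1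
  and one from the reservoir for the part linear in f1, which then cancels. All losses are collected
  in u, which contains neither f1 nor f2.\<close>

lemma density_ratio_bounds:
 assumes fl: "flux (t, x) \<noteq> 0" and t: "t \<in> {0..T}"
 defines "\<tau> \<equiv> t / T * (1 - t / T)"
 defines "u \<equiv> D / (\<tau> ^ 3 * T * (N (fst (fst x)) * N (snd (fst x))))"
 shows "ramp_rate (t / T) / T * (E1 x * Sin f1 x) + ramp_rate (t / T) / T * Z1 x + ramp_rate (1 - t / T) / T * Z2 x \<le> typical (t, x) * u"
  and "ramp_rate (1 - t / T) / T * (E2 x * Sout f2 x) \<le> typical (t, x) * (u * Sout f2 x)"
  and "0 < u"
proof -
 define \<theta> where "\<theta> = t / T"
 define g where "g = grate x"
 define F where "F = interp t (fst (fst x))"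
 define G where "G = interp t (snd (fst x))"
 define a where "a = N (fst (fst x))"
 define b where "b = N (snd (fst x))"
 define l where "l = ramp_rate \<theta> / T"
 define l' where "l' = ramp_rate (1 - \<theta>) / T"
 have th: "0 < \<theta>" "\<theta> < 1" and g: "0 < g" using flux_nonzeroD[OF fl t] by (simp_all add: \<theta>_def g_def)
 have tau: "\<tau> = \<theta> * (1 - \<theta>)" by (simp add: \<tau>_def \<theta>_def)
 have tp: "0 < \<tau>" unfolding tau using th by simp
 have ab: "0 < a" "0 < b" "a \<le> nb" "b \<le> nb" using N_pos N_le by (simp_all add: a_def b_def)
 have nb: "0 < nb" using ab by linarith
 have k: "0 < k" using k1 by simp
 have D: "0 < D" unfolding D_def using nb k by (simp add: add_nonneg_pos)
 have l0: "0 \<le> l" "0 \<le> l'" using ramps[OF t t] T0 by (simp_all add: l_def l'_def \<theta>_def)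
 have lb: "l \<le> 12 * \<tau> / T" "l' \<le> 12 * \<tau> / T"
  using ramp_rate_le[of \<theta>] ramp_rate_le[of "1 - \<theta>"] th T0 unfolding l_def l'_def tau by (auto intro!: divide_right_mono simp: mult.commute)
 have u: "u = D / (\<tau> ^ 3 * T * (a * b))" by (simp add: u_def a_def b_def)
 show u0: "0 < u" unfolding u using D tp T0 ab by simp
 have ty: "typical (t, x) = F * G * g / 4" by (simp add: typical_def F_def G_def g_def)
 have bt: "bump (t / T) = 6 * \<tau>\<^sup>2" unfolding tau power_mult_distrib by (simp only: bump_def \<theta>_def)
 have Fb1: "6 * \<tau>\<^sup>2 * a \<le> F" using interp_lower(2)[OF t, of "fst (fst x)"] unfolding bt F_def a_def .
 have Fb2: "6 * \<tau>\<^sup>2 * b \<le> G" using interp_lower(2)[OF t, of "snd (fst x)"] unfolding bt G_def b_def .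
 note Fb = Fb1 Fb2
 have down: "(1 - \<theta>) ^ 3 \<le> ramp_down \<theta>" unfolding ramp_down_def using th by (simp add: mult_le_cancel_left1)
 have Ff: "(1 - \<theta>) ^ 3 * f1 (fst (fst x)) \<le> F" "(1 - \<theta>) ^ 3 * f1 (snd (fst x)) \<le> G"
  using interp_lower(1)[OF t, of "fst (fst x)"] interp_lower(1)[OF t, of "snd (fst x)"]
   mult_right_mono[OF down nonneg(1), of "fst (fst x)"] mult_right_mono[OF down nonneg(1), of "snd (fst x)"]
  by (simp_all add: F_def G_def \<theta>_def)
 have pu: "typical (t, x) * u = (F * G) * (g * D / (4 * (\<tau> ^ 3 * T * (a * b))))" by (simp add: ty u)
 have coef: "0 < g * D / (4 * (\<tau> ^ 3 * T * (a * b)))" using g D tp T0 ab by simp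
 \<comment> \<open>Two reservoir particles: the constant is 6 * 6 / 4 = 9, and \<tau> ^ 4 / \<tau> ^
   3 leaves the one power of \<tau> that the rates contain.\<close>
 have low1: "9 * (\<tau> * (D * g)) / T \<le> typical (t, x) * u"
 proof -
  have "(6 * \<tau>\<^sup>2 * a) * (6 * \<tau>\<^sup>2 * b) \<le> F * G" using Fb ab tp by (intro mult_mono) (auto intro: order_trans[OF _ Fb(1)])
  then have "((6 * \<tau>\<^sup>2 * a) * (6 * \<tau>\<^sup>2 * b)) * (g * D / (4 * (\<tau> ^ 3 * T * (a * b)))) \<le> typical (t, x) * u"
   unfolding pu using coef by (intro mult_right_mono) auto
  moreover have "((6 * \<tau>\<^sup>2 * a) * (6 * \<tau>\<^sup>2 * b)) * (g * D / (4 * (\<tau> ^ 3 * T * (a * b)))) = 9 * (\<tau> * (D * g)) / T"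
   using tp ab T0 by (simp add: field_simps power2_eq_square power3_eq_cube)
  ultimately show ?thesis by simp
 qed
 \<comment> \<open>One particle from f1 and one from the reservoir. Surplus powers of \<theta> are
   given up to arrive at the rate l = 12 * \<theta> * (1 - \<theta>)^2 / T, and 12 / 8 = 3 / 2
   accounts for the 8. The value of N left in the denominator is replaced by its bound nb.\<close>
 have low2: "D * g * l * z / (8 * nb) \<le> typical (t, x) * u"
  if FG: "((1 - \<theta>) ^ 3 * z) * (6 * \<tau>\<^sup>2 * c) \<le> F * G" and c: "c = a \<and> c' = b \<or> c = b \<and> c' = a" and z: "0 \<le> z" for z c c'
 proof -
  have cc: "a * b = c * c'" "0 < c" "0 < c'" "c' \<le> nb" using c ab by auto
  have "((1 - \<theta>) ^ 3 * z) * (6 * \<tau>\<^sup>2 * c) * (g * D / (4 * (\<tau> ^ 3 * T * (a * b)))) \<le> typical (t, x) * u"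
   unfolding pu using coef FG by (intro mult_right_mono) auto
  moreover have "((1 - \<theta>) ^ 3 * z) * (6 * \<tau>\<^sup>2 * c) * (g * D / (4 * (\<tau> ^ 3 * T * (a * b)))) = (3 / 2) * ((1 - \<theta>) ^ 3 / \<tau>) * (z * g * D) / (T * c')"
   unfolding cc(1) using tp cc T0 by (simp add: field_simps power2_eq_square power3_eq_cube)
  moreover have "(3 / 2) * (\<theta> * (1 - \<theta>)\<^sup>2) * (z * g * D) / (T * nb) \<le> (3 / 2) * ((1 - \<theta>) ^ 3 / \<tau>) * (z * g * D) / (T * c')"
  proof (rule frac_le)
   have "(1 - \<theta>) ^ 3 / \<tau> = (1 - \<theta>)\<^sup>2 / \<theta>" unfolding tau using th by (simp add: field_simps power2_eq_square power3_eq_cube)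
   moreover have "\<theta> * (1 - \<theta>)\<^sup>2 \<le> (1 - \<theta>)\<^sup>2 / \<theta>"
   proof -
    have "\<theta> * (1 - \<theta>)\<^sup>2 * \<theta> \<le> 1 * (1 - \<theta>)\<^sup>2 * 1" using th by (intro mult_mono) auto
    then show ?thesis using th by (simp add: pos_le_divide_eq)
   qed
   ultimately have "\<theta> * (1 - \<theta>)\<^sup>2 \<le> (1 - \<theta>) ^ 3 / \<tau>" by simp
   then show "(3 / 2) * (\<theta> * (1 - \<theta>)\<^sup>2) * (z * g * D) \<le> (3 / 2) * ((1 - \<theta>) ^ 3 / \<tau>) * (z * g * D)"
    using z g D by (intro mult_right_mono mult_left_mono) auto
   show "0 \<le> (3 / 2) * ((1 - \<theta>) ^ 3 / \<tau>) * (z * g * D)" using z g D th tp by simp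
  qed (use T0 cc in auto)
  moreover have "(3 / 2) * (\<theta> * (1 - \<theta>)\<^sup>2) * (z * g * D) / (T * nb) = D * g * l * z / (8 * nb)"
   unfolding l_def ramp_rate_def using T0 nb by (simp add: field_simps)
  ultimately show ?thesis by linarith
 qed
 have S1: "D * g * l * Sin f1 x / (8 * nb) \<le> typical (t, x) * u"
 proof -
  have h1: "D * g * l * f1 (fst (fst x)) / (8 * nb) \<le> typical (t, x) * u"
  proof (rule low2[of _ b a])
   show "((1 - \<theta>) ^ 3 * f1 (fst (fst x))) * (6 * \<tau>\<^sup>2 * b) \<le> F * G"
    using Ff Fb ab th nonneg(1)[of "fst (fst x)"] by (intro mult_mono) (auto intro: order_trans[OF _ Ff(1)])
  qed (use nonneg in auto)
  have h2: "D * g * l * f1 (snd (fst x)) / (8 * nb) \<le> typical (t, x) * u"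
  proof (rule low2[of _ a b])
   have "(6 * \<tau>\<^sup>2 * a) * ((1 - \<theta>) ^ 3 * f1 (snd (fst x))) \<le> F * G"
    using Ff Fb ab th nonneg(1)[of "snd (fst x)"] by (intro mult_mono) (auto intro: order_trans[OF _ Fb(1)])
   then show "((1 - \<theta>) ^ 3 * f1 (snd (fst x))) * (6 * \<tau>\<^sup>2 * a) \<le> F * G" by (simp only: mult.commute)
  qed (use nonneg in auto)
  have h3: "D * g * l * Sin f1 x / (8 * nb) = (D * g * l * f1 (fst (fst x)) / (8 * nb) + D * g * l * f1 (snd (fst x)) / (8 * nb)) / 2"
   by (simp add: Sin_def add_divide_distrib distrib_left)
  have "(y + z) / 2 \<le> w" if "y \<le> w" "z \<le> w" for y z w :: real
   using add_mono[OF that] by (simp add: pos_divide_le_eq)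
  from this[OF h1 h2] show ?thesis unfolding h3 .
 qed
 define P where "P = typical (t, x) * u"
 have P0: "0 \<le> P" unfolding P_def using u0 typical_nonneg[OF t, of x] by simp
 have kg: "k * (\<tau> * g) / T \<le> P / (9 * D) * k"
 proof -
  have "\<tau> * g / T \<le> P / (9 * D)" using low1 D T0 by (simp add: P_def field_simps)
  then have "\<tau> * g / T * k \<le> P / (9 * D) * k" using k by (intro mult_right_mono) auto
  then show ?thesis by (simp add: mult.commute)
 qed
 have lk: "l * (k * g) \<le> (4 / 3) * (P * k / D)" "l' * (k * g) \<le> (4 / 3) * (P * k / D)"
 proof -
  have "m * (k * g) \<le> (4 / 3) * (P * k / D)" if "m \<le> 12 * \<tau> / T" for m
  proof -
   have "m * (k * g) \<le> 12 * \<tau> / T * (k * g)" using that k g by (intro mult_right_mono) auto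
   also have "... = 12 * (k * (\<tau> * g) / T)" by simp
   also have "... \<le> 12 * (P / (9 * D) * k)" using kg by (intro mult_left_mono) auto
   also have "... = (4 / 3) * (P * k / D)" by simp
   finally show ?thesis .
  qed
  then show "l * (k * g) \<le> (4 / 3) * (P * k / D)" "l' * (k * g) \<le> (4 / 3) * (P * k / D)" using lb by auto
 qed
 have Z: "l * Z1 x \<le> l * (k * g)" "l' * Z2 x \<le> l' * (k * g)" "l' * E2 x \<le> l' * (k * g)" "l * E1 x \<le> l * (k * g)"
  using EZ_le[of x] l0 by (auto simp: g_def intro: mult_left_mono)
 have Sin0: "0 \<le> Sin f1 x" "0 \<le> Sout f2 x" using nonneg by (simp_all add: Sin_nonneg Sout_nonneg)
 have E: "l * (E1 x * Sin f1 x) \<le> 8 * nb * (P * k / D)"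
 proof -
  have "l * (E1 x * Sin f1 x) = (l * E1 x) * Sin f1 x" by simp
  also have "... \<le> (l * (k * g)) * Sin f1 x" using Z(4) Sin0 by (intro mult_right_mono)
  also have "... = (D * g * l * Sin f1 x / (8 * nb)) * (8 * nb * k / D)" using D nb by simp
  also have "... \<le> P * (8 * nb * k / D)" unfolding P_def using S1 nb k D by (intro mult_right_mono) auto
  finally show ?thesis by (simp add: mult_ac)
 qed
 \<comment> \<open>This identity fixes D. The two remainders use 2 * (4 / 3) of the 3
   available.\<close>
 have PD: "8 * nb * (P * k / D) + 3 * (P * k / D) = P"
 proof -
  have "8 * nb * (P * k / D) + 3 * (P * k / D) = P * (8 * (k * nb) + 3 * k) / D" by (simp add: add_divide_distrib algebra_simps)
  then show ?thesis using D by (simp add: D_def[symmetric])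
 qed
 have Pk: "0 \<le> P * k / D" using P0 k D by simp
 have "l * (E1 x * Sin f1 x) + l * Z1 x + l' * Z2 x \<le> P" using E Z lk PD Pk by linarith
 then show "ramp_rate (t / T) / T * (E1 x * Sin f1 x) + ramp_rate (t / T) / T * Z1 x + ramp_rate (1 - t / T) / T * Z2 x \<le> typical (t, x) * u"
  by (simp only: P_def l_def l'_def \<theta>_def)
 have "l' * E2 x \<le> P"
 proof -
  have "0 \<le> 8 * nb * (P * k / D)" using Pk nb by (intro mult_nonneg_nonneg) auto
  then show ?thesis using Z(3) lk(2) PD Pk by linarith
 qed
 then have "(l' * E2 x) * Sout f2 x \<le> P * Sout f2 x" using Sin0 by (intro mult_right_mono)
 then show "ramp_rate (1 - t / T) / T * (E2 x * Sout f2 x) \<le> typical (t, x) * (u * Sout f2 x)"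
  by (simp add: P_def l'_def \<theta>_def mult.assoc)
qed

abbreviation L :: "real ^ 'n \<Rightarrow> real" where "L v \<equiv> f2 v * ln (f2 v)"

lemma flux_le: "t \<in> {0..T} \<Longrightarrow> flux (t, x) \<le> 12 * (t / T * (1 - t / T)) / T * (Y1 x + Y2 x)"
proof -
 assume t: "t \<in> {0..T}"
 have r1: "ramp_rate (t / T) \<le> 12 * (t / T * (1 - t / T))" by (rule ramp_rate_le[OF scaled_time(1)[OF t] scaled_time(2)[OF t]])
 have r2: "ramp_rate (1 - t / T) \<le> 12 * (t / T * (1 - t / T))" using ramp_rate_le[of "1 - t / T"] scaled_time[OF t] by (simp add: mult.commute)
 have "ramp_rate (t / T) / T \<le> 12 * (t / T * (1 - t / T)) / T" "ramp_rate (1 - t / T) / T \<le> 12 * (t / T * (1 - t / T)) / T"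
  using divide_right_mono[OF r1, of T] divide_right_mono[OF r2, of T] T0 by simp_all
 then have "ramp_rate (t / T) / T * Y1 x + ramp_rate (1 - t / T) / T * Y2 x \<le> 12 * (t / T * (1 - t / T)) / T * Y1 x + 12 * (t / T * (1 - t / T)) / T * Y2 x"
  by (intro add_mono mult_right_mono nonneg)
 then show ?thesis by (simp add: flux_def distrib_left)
qed

text \<open>The logarithm of 2 * u is at most a multiple of \<open>Lw\<close> plus 3 / \<tau>, while
  the flux is at most a multiple of \<tau>: the singularity at the ends of the time interval
  cancels. Of the end densities only the entropy density of f2 at the outgoing velocities survives
  separately.\<close>

lemma entropy_production_le:
 assumes t: "t \<in> {0..T}"
 shows "flux (t, x) * ln (flux (t, x) / typical (t, x)) \<le>
  12 / T * (A + \<bar>ln T\<bar>) * ((Y1 x + Y2 x) * Lw x) + ramp_rate (1 - t / T) / T * (E2 x * Sout L x)"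
proof -
 have A0: "0 \<le> A" using cl0 by (simp add: A_def)
 have Y0: "0 \<le> Y1 x + Y2 x" using nonneg by simp
 have Lw0: "0 \<le> Lw x" using Lw_ge_1[of x] by linarith
 have R0: "0 \<le> 12 / T * (A + \<bar>ln T\<bar>) * ((Y1 x + Y2 x) * Lw x)" using A0 Y0 Lw0 T0 by simp
 have S0: "0 \<le> Sin f1 x" "0 \<le> Sout f2 x" using nonneg by (simp_all add: Sin_nonneg Sout_nonneg)
 note r = ramps[OF t t]
 define la where "la = ramp_rate (t / T) / T * (E1 x * Sin f1 x) + ramp_rate (t / T) / T * Z1 x + ramp_rate (1 - t / T) / T * Z2 x"
 define lb where "lb = ramp_rate (1 - t / T) / T * (E2 x * Sout f2 x)"
 have q: "flux (t, x) = la + lb" unfolding la_def lb_def by (rule flux_decomposition)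
 have ab0: "0 \<le> la" "0 \<le> lb" unfolding la_def lb_def using r EZ_nonneg[of x] S0 T0 by simp_all
 \<comment> \<open>\<open>Sout f2\<close> is an average over the outgoing pair; convexity of x ln x
   moves the average outside the logarithm, where \<open>E2_marginal\<close> can evaluate
   it.\<close>
 have conv: "Sout f2 x * ln (Sout f2 x) \<le> Sout L x" unfolding Sout_def using nonneg by (intro mult_ln_midpoint_convex) auto
 have lbL: "lb * ln (Sout f2 x) \<le> ramp_rate (1 - t / T) / T * (E2 x * Sout L x)"
 proof -
  have "lb * ln (Sout f2 x) = ramp_rate (1 - t / T) / T * (E2 x * (Sout f2 x * ln (Sout f2 x)))" by (simp add: lb_def)
  also have "... \<le> ramp_rate (1 - t / T) / T * (E2 x * Sout L x)" using r EZ_nonneg[of x] T0 conv by (intro mult_left_mono) auto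
  finally show ?thesis .
 qed
 show ?thesis
 proof (cases "flux (t, x) = 0")
  \<comment> \<open>Without flux the right-hand side still contains the entropy term, of unclear
    sign. It is nonnegative by \<open>lbL\<close>, whose left side vanishes with lb.\<close>
  case True
  then have "lb = 0" using q ab0 by linarith
  then have "0 \<le> ramp_rate (1 - t / T) / T * (E2 x * Sout L x)" using lbL by simp
  then show ?thesis using True R0 by simp
 next
  case False
  define \<tau> where "\<tau> = t / T * (1 - t / T)"
  define u where "u = D / (\<tau> ^ 3 * T * (N (fst (fst x)) * N (snd (fst x))))"
  note b = density_ratio_bounds[OF False t, folded \<tau>_def, folded u_def, folded la_def lb_def]
  note nz = flux_nonzeroD[OF False t]
  have tp: "0 < \<tau>" unfolding \<tau>_def using nz by (intro mult_pos_pos) auto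
  have "t / T * (1 - t / T) \<le> 1 * 1" using nz by (intro mult_mono) auto
  then have tp1: "\<tau> \<le> 1" unfolding \<tau>_def by simp
  note tp = tp tp1
  have D0: "0 < D" unfolding D_def using N_pos[of 0] N_le[of 0] k1 by (simp add: add_nonneg_pos)
  have pos: "0 < flux (t, x)" using False flux_nonneg[OF t, of x] by linarith
  have main: "(la + lb) * ln ((la + lb) / typical (t, x)) \<le> (la + lb) * ln (2 * u) + lb * ln (Sout f2 x)"
   by (rule log_sum_le) (use ab0 pos q b typical_pos[OF False t] S0 in auto)
  have lnu: "ln (2 * u) \<le> (A - 3 + \<bar>ln T\<bar>) * Lw x + 3 / \<tau>"
  proof -
   have "ln (2 * u) = ln (2 * D) - (ln (\<tau> ^ 3) + ln T + (ln (N (fst (fst x))) + ln (N (snd (fst x)))))"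
   proof -
    define Na where "Na = N (fst (fst x))"
    define Nb where "Nb = N (snd (fst x))"
    have NN: "0 < Na" "0 < Nb" by (simp_all add: Na_def Nb_def N_pos)
    have "0 < \<tau> ^ 3 * T * (Na * Nb)" using tp T0 NN by simp
    moreover have "0 < 2 * D" using D0 by simp
    ultimately have "ln (2 * D / (\<tau> ^ 3 * T * (Na * Nb))) = ln (2 * D) - ln (\<tau> ^ 3 * T * (Na * Nb))" using tp T0 NN by (simp add: ln_div)
    also have "ln (\<tau> ^ 3 * T * (Na * Nb)) = ln (\<tau> ^ 3 * T) + ln (Na * Nb)" using tp T0 NN by (intro ln_mult_pos) auto
    also have "ln (\<tau> ^ 3 * T) = ln (\<tau> ^ 3) + ln T" using tp T0 by (intro ln_mult_pos) auto
    also have "ln (Na * Nb) = ln Na + ln Nb" using NN by (intro ln_mult_pos) auto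
    finally show ?thesis unfolding u_def times_divide_eq_right Na_def Nb_def .
   qed
   moreover have "ln (\<tau> ^ 3) = 3 * ln \<tau>" using tp by (simp add: ln_realpow)
   moreover have "- ln \<tau> \<le> 1 / \<tau>" using ln_le_minus_one[of "1 / \<tau>"] tp by (simp add: ln_div)
   moreover have "- ln (N (fst (fst x))) \<le> cl * Lw x" "- ln (N (snd (fst x))) \<le> cl * Lw x"
   proof -
    have n: "0 \<le> ln (1 + norm v)" for v :: "real ^ 'n" by (rule ln_ge_zero) simp
    have "1 + ln (1 + norm (fst (fst x))) \<le> Lw x" "1 + ln (1 + norm (snd (fst x))) \<le> Lw x"
     unfolding Lw_def using n[of "fst (fst x)"] n[of "snd (fst x)"] n[of "fst (snd x)"] n[of "snd (snd x)"] by linarith+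
    then show "- ln (N (fst (fst x))) \<le> cl * Lw x" "- ln (N (snd (fst x))) \<le> cl * Lw x"
     using cl0 by (auto intro!: order_trans[OF N_ln] mult_left_mono)
   qed
   moreover have "ln (2 * D) \<le> \<bar>ln (2 * D)\<bar> * Lw x" "- ln T \<le> \<bar>ln T\<bar> * Lw x"
    using mult_left_mono[OF Lw_ge_1[of x] abs_ge_zero[of "ln (2 * D)"]] mult_left_mono[OF Lw_ge_1[of x] abs_ge_zero[of "ln T"]] by linarith+
   moreover have "(A - 3 + \<bar>ln T\<bar>) * Lw x = \<bar>ln (2 * D)\<bar> * Lw x + 2 * (cl * Lw x) + \<bar>ln T\<bar> * Lw x" by (simp add: A_def algebra_simps)
   moreover have "3 / \<tau> = 3 * (1 / \<tau>)" by simp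
   ultimately show ?thesis by linarith
  qed
  have "flux (t, x) * ln (2 * u) \<le> flux (t, x) * ((A - 3 + \<bar>ln T\<bar>) * Lw x + 3 / \<tau>)" using lnu pos by (intro mult_left_mono) auto
  also have "... \<le> (12 * \<tau> / T * (Y1 x + Y2 x)) * ((A - 3 + \<bar>ln T\<bar>) * Lw x + 3 / \<tau>)"
  proof (rule mult_right_mono)
   show "flux (t, x) \<le> 12 * \<tau> / T * (Y1 x + Y2 x)" using flux_le[OF t, of x] by (simp only: \<tau>_def)
   have "0 \<le> A - 3 + \<bar>ln T\<bar>" using cl0 by (simp add: A_def)
   then show "0 \<le> (A - 3 + \<bar>ln T\<bar>) * Lw x + 3 / \<tau>" using Lw0 tp by simp
  qed
  also have "... = 12 / T * (Y1 x + Y2 x) * (\<tau> * ((A - 3 + \<bar>ln T\<bar>) * Lw x) + 3)" using tp T0 by (simp add: field_simps)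
  also have "... \<le> 12 / T * (Y1 x + Y2 x) * ((A + \<bar>ln T\<bar>) * Lw x)"
  proof (rule mult_left_mono)
   have "0 \<le> (A - 3 + \<bar>ln T\<bar>) * Lw x" using cl0 Lw0 by (simp add: A_def)
   then have "\<tau> * ((A - 3 + \<bar>ln T\<bar>) * Lw x) \<le> 1 * ((A - 3 + \<bar>ln T\<bar>) * Lw x)" using tp by (intro mult_right_mono) auto
   moreover have "(A + \<bar>ln T\<bar>) * Lw x = (A - 3 + \<bar>ln T\<bar>) * Lw x + 3 * Lw x" by (simp add: algebra_simps)
   ultimately show "\<tau> * ((A - 3 + \<bar>ln T\<bar>) * Lw x) + 3 \<le> (A + \<bar>ln T\<bar>) * Lw x" using Lw_ge_1[of x] by linarith
  qed (use Y0 T0 in simp)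
  also have "... = 12 / T * (A + \<bar>ln T\<bar>) * ((Y1 x + Y2 x) * Lw x)" by (simp only: ac_simps)
  finally have "flux (t, x) * ln (2 * u) \<le> 12 / T * (A + \<bar>ln T\<bar>) * ((Y1 x + Y2 x) * Lw x)" .
  then show ?thesis using main lbL unfolding q by linarith
 qed
qed

end

section \<open>Integrated cost against the typical collisions\<close>

context controlled_transition begin

text \<open>Here the entropy of the final state acquires the coefficient exactly one: the rate has
  integral one in time and \<open>E2\<close> has Lebesgue outgoing marginal.\<close>

lemma nn_integral_E2_flux:
 assumes [measurable]: "g \<in> borel_funs" and g: "\<And>v. 0 \<le> g v"
 shows "(\<integral>\<^sup>+y. ennreal (ramp_rate (1 - fst y / T) / T * (E2 (snd y) * Sout g (snd y))) \<partial>event_base T) = (LE v. g v)"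
proof -
 let ?I = "(LE v. g v)"
 have "(\<integral>\<^sup>+y. ennreal (ramp_rate (1 - fst y / T) / T * (E2 (snd y) * Sout g (snd y))) \<partial>event_base T) =
   (LI t. (CE x. ramp_rate (1 - fst (t, x) / T) / T * (E2 (snd (t, x)) * Sout g (snd (t, x)))) * indicator {0..T} t)"
  by (rule nn_integral_event_base) measurable
 also have "... = (LI t. (ennreal (ramp_rate (1 - t / T) / T) * indicator {0..T} t) * ?I)"
 proof (rule nn_integral_cong)
  fix t :: real
  show "(CE x. ramp_rate (1 - fst (t, x) / T) / T * (E2 (snd (t, x)) * Sout g (snd (t, x)))) * indicator {0..T} t = (ennreal (ramp_rate (1 - t / T) / T) * indicator {0..T} t) * ?I"
  proof (cases "t \<in> {0..T}")
   case True
   have r: "0 \<le> ramp_rate (1 - t / T) / T" using ramps[OF True True] T0 by simp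
   have "ennreal (ramp_rate (1 - t / T) / T * (E2 x * Sout g x)) = ennreal (ramp_rate (1 - t / T) / T) * ennreal (E2 x * Sout g x)" for x
    using r EZ_nonneg(2)[of x] g by (intro ennreal_mult) (auto simp: Sout_nonneg)
   then have "(CE x. ramp_rate (1 - fst (t, x) / T) / T * (E2 (snd (t, x)) * Sout g (snd (t, x)))) = (CI x. ennreal (ramp_rate (1 - t / T) / T) * ennreal (E2 x * Sout g x))"
    by simp
   also have "... = ennreal (ramp_rate (1 - t / T) / T) * (CE x. E2 x * Sout g x)" by (rule nn_integral_cmult) measurable
   also have "(CE x. E2 x * Sout g x) = ?I" by (rule E2_marginal) (use g in auto)
   finally show ?thesis using True by simp
  qed simp
 qed
 also have "... = (LI t. ennreal (ramp_rate (1 - t / T) / T) * indicator {0..T} t) * ?I" by (rule nn_integral_multc) measurable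
 finally show ?thesis using nn_integral_ramp_rate(2)[OF T0] by simp
qed

text \<open>The weight of \<open>coll_measure\<close> cancels the denominator of
  \<open>grate\<close> and leaves the hard sphere rate. If w . (u - v) = 0, both sides are
  0.\<close>

lemma nn_integral_typical:
 assumes [measurable]: "H \<in> borel_funs"
 shows "(\<integral>\<^sup>+y. ennreal (typical y) * H y \<partial>event_base T) = (LI t. (LI v. ennreal (interp t v) * (LI u. ennreal (interp t u) *
  (SI w. ennreal (\<bar>w \<bullet> (u - v)\<bar> / 4) * H (t, ((v, u), post_collision v u w))))) * indicator {0..T} t)"
proof -
 have "(\<integral>\<^sup>+y. ennreal (typical y) * H y \<partial>event_base T) = (LI t. (CI x. ennreal (typical (t, x)) * H (t, x)) * indicator {0..T} t)"
  by (rule nn_integral_event_base) measurable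
 also have "... = (LI t. (LI v. ennreal (interp t v) * (LI u. ennreal (interp t u) *
  (SI w. ennreal (\<bar>w \<bullet> (u - v)\<bar> / 4) * H (t, ((v, u), post_collision v u w))))) * indicator {0..T} t)"
 proof (rule nn_integral_cong)
  fix t :: real
  show "(CI x. ennreal (typical (t, x)) * H (t, x)) * indicator {0..T} t = (LI v. ennreal (interp t v) * (LI u. ennreal (interp t u) *
  (SI w. ennreal (\<bar>w \<bullet> (u - v)\<bar> / 4) * H (t, ((v, u), post_collision v u w))))) * indicator {0..T} t"
  proof (cases "t \<in> {0..T}")
   case True
   note i0 = interp_nonneg[OF True]
   have [measurable]: "(\<lambda>p. post_collision (fst p) (fst (snd p)) (snd (snd p))) \<in> measurable borel (borel :: ('n vels) measure)"
    unfolding post_collision_def by measurable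
   have "(CI x. ennreal (typical (t, x)) * H (t, x)) = (LI v. (LI u. (SI w. ennreal (jac w (u - v)) *
     (ennreal (typical (t, ((v, u), post_collision v u w))) * H (t, ((v, u), post_collision v u w))))))"
    by (rule nn_integral_coll_measure_post) measurable
   also have "... = (LI v. (LI u. ennreal (interp t v) * (ennreal (interp t u) * (SI w. ennreal (\<bar>w \<bullet> (u - v)\<bar> / 4) * H (t, ((v, u), post_collision v u w))))))"
   proof (intro nn_integral_cong)
    fix v u :: "real ^ 'n"
    let ?h = "\<lambda>w. H (t, ((v, u), post_collision v u w))"
    have "(SI w. ennreal (jac w (u - v)) * (ennreal (typical (t, ((v, u), post_collision v u w))) * ?h w)) =
      (SI w. ennreal (interp t v * interp t u) * (ennreal (\<bar>w \<bullet> (u - v)\<bar> / 4) * ?h w))"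
    proof (rule nn_integral_cong_AE, rule AE_mp[OF sphere_s], rule AE_I2, rule impI)
     fix w :: "real ^ 'n" assume w: "norm w = 1"
     define c where "c = \<bar>w \<bullet> (u - v)\<bar>"
     have g: "grate ((v, u), post_collision v u w) = c / c ^ (CARD('n) - 2)"
      by (simp add: grate_def post_collision_def w c_def)
     have "c ^ (CARD('n) - 2) * typical (t, ((v, u), post_collision v u w)) = (interp t v * interp t u) * (c / 4)"
      unfolding typical_def fst_conv snd_conv g by (cases "c = 0") simp_all
     moreover have "0 \<le> c" "0 \<le> typical (t, ((v, u), post_collision v u w))" using typical_nonneg[OF True] by (simp_all add: c_def)
     moreover have "0 \<le> interp t v * interp t u" using i0 by simp
     ultimately have "ennreal (c ^ (CARD('n) - 2)) * ennreal (typical (t, ((v, u), post_collision v u w))) = ennreal (interp t v * interp t u) * ennreal (c / 4)"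
      by (subst (1 2) ennreal_mult[symmetric]) auto
     then show "ennreal (jac w (u - v)) * (ennreal (typical (t, ((v, u), post_collision v u w))) * ?h w) = ennreal (interp t v * interp t u) * (ennreal (\<bar>w \<bullet> (u - v)\<bar> / 4) * ?h w)"
      by (simp only: c_def mult.assoc[symmetric])
    qed
    also have "... = ennreal (interp t v * interp t u) * (SI w. ennreal (\<bar>w \<bullet> (u - v)\<bar> / 4) * ?h w)"
     by (rule nn_integral_cmult) (unfold post_collision_def, measurable)
    also have "... = ennreal (interp t v) * (ennreal (interp t u) * (SI w. ennreal (\<bar>w \<bullet> (u - v)\<bar> / 4) * ?h w))"
     using i0 by (simp only: ennreal_mult mult.assoc)
    finally show "(SI w. ennreal (jac w (u - v)) * (ennreal (typical (t, ((v, u), post_collision v u w))) * ?h w)) =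
      ennreal (interp t v) * (ennreal (interp t u) * (SI w. ennreal (\<bar>w \<bullet> (u - v)\<bar> / 4) * ?h w))" .
   qed
   also have "... = (LI v. ennreal (interp t v) * (LI u. ennreal (interp t u) * (SI w. ennreal (\<bar>w \<bullet> (u - v)\<bar> / 4) * H (t, ((v, u), post_collision v u w)))))"
    by (rule nn_integral_cong, rule nn_integral_cmult) (unfold post_collision_def, measurable)
   finally show ?thesis by simp
  qed simp
 qed
 finally show ?thesis .
qed

definition kS :: real where "kS = measure s UNIV * (3 / 2 + e)\<^sup>2"

text \<open>The estimate |u - v| \<le> (1 + |u|) (1 + |v|) separates the two particles, so the
  moment bound is applied once to each.\<close>

lemma typical_mass: "(\<integral>\<^sup>+y. ennreal (typical y) \<partial>event_base T) \<le> ennreal (T * kS)"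
proof -
 let ?m = "3 / 2 + e"
 have m0: "0 \<le> ?m" using e0 by simp
 have S: "emeasure s UNIV = ennreal (measure s UNIV)" by (rule s.emeasure_eq_measure)
 have "(\<integral>\<^sup>+y. ennreal (typical y) * 1 \<partial>event_base T) = (LI t. (LI v. ennreal (interp t v) * (LI u. ennreal (interp t u) *
  (SI w. ennreal (\<bar>w \<bullet> (u - v)\<bar> / 4) * 1))) * indicator {0..T} t)"
  by (rule nn_integral_typical) measurable
 also have "... \<le> (LI t. ennreal kS * indicator {0..T} t)"
 proof (rule nn_integral_mono)
  fix t :: real
  show "(LI v. ennreal (interp t v) * (LI u. ennreal (interp t u) * (SI w. ennreal (\<bar>w \<bullet> (u - v)\<bar> / 4) * 1))) * indicator {0..T} t \<le> ennreal kS * indicator {0..T} t"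
  proof (cases "t \<in> {0..T}")
   case True
   note i0 = interp_nonneg[OF True]
   note mom = velocity_density_moment[OF interp_density[OF True] less_imp_le[OF e0]]
   have w: "(SI w. ennreal (\<bar>w \<bullet> (u - v)\<bar> / 4) * 1) \<le> ennreal ((1 + norm u) * ((1 + norm v) * measure s UNIV))" for u v :: "real ^ 'n"
   proof -
    have "(SI w. ennreal (\<bar>w \<bullet> (u - v)\<bar> / 4) * 1) \<le> (SI w. ennreal ((1 + norm u) * (1 + norm v)))"
    proof (rule nn_integral_mono_AE, rule AE_mp[OF sphere_s], rule AE_I2, rule impI)
     fix w :: "real ^ 'n" assume "norm w = 1"
     then have "\<bar>w \<bullet> (u - v)\<bar> \<le> norm (u - v)" using Cauchy_Schwarz_ineq2[of w "u - v"] by simp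
     also have "... \<le> norm u + norm v" by (rule norm_triangle_ineq4)
     also have "... \<le> (1 + norm u) * (1 + norm v)" by (simp add: distrib_left distrib_right)
     finally have "\<bar>w \<bullet> (u - v)\<bar> / 4 \<le> (1 + norm u) * (1 + norm v)" using abs_ge_zero[of "w \<bullet> (u - v)"] by linarith
     then show "ennreal (\<bar>w \<bullet> (u - v)\<bar> / 4) * 1 \<le> ennreal ((1 + norm u) * (1 + norm v))" by (simp add: ennreal_leI)
    qed
    also have "... = ennreal ((1 + norm u) * (1 + norm v)) * ennreal (measure s UNIV)" by (simp add: S)
    also have "... = ennreal (((1 + norm u) * (1 + norm v)) * measure s UNIV)" by (rule ennreal_mult[symmetric]) auto
    finally show ?thesis by (simp only: mult.assoc)
   qed
   have u: "(LI u. ennreal (interp t u) * (SI w. ennreal (\<bar>w \<bullet> (u - v)\<bar> / 4) * 1)) \<le> ennreal (?m * ((1 + norm v) * measure s UNIV))" for v :: "real ^ 'n"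
   proof -
    have "(LI u. ennreal (interp t u) * (SI w. ennreal (\<bar>w \<bullet> (u - v)\<bar> / 4) * 1)) \<le> (LI u. ennreal (interp t u * (1 + norm u)) * ennreal ((1 + norm v) * measure s UNIV))"
    proof (rule nn_integral_mono)
     fix u :: "real ^ 'n"
     have "ennreal (interp t u) * (SI w. ennreal (\<bar>w \<bullet> (u - v)\<bar> / 4) * 1) \<le> ennreal (interp t u) * ennreal ((1 + norm u) * ((1 + norm v) * measure s UNIV))"
      by (rule mult_left_mono[OF w]) simp
     also have "... = ennreal (interp t u * ((1 + norm u) * ((1 + norm v) * measure s UNIV)))" by (rule ennreal_mult[symmetric]) (use i0 in auto)
     also have "... = ennreal ((interp t u * (1 + norm u)) * ((1 + norm v) * measure s UNIV))" by (simp only: mult.assoc)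
     also have "... = ennreal (interp t u * (1 + norm u)) * ennreal ((1 + norm v) * measure s UNIV)" by (rule ennreal_mult) (use i0 in auto)
     finally show "ennreal (interp t u) * (SI w. ennreal (\<bar>w \<bullet> (u - v)\<bar> / 4) * 1) \<le> ennreal (interp t u * (1 + norm u)) * ennreal ((1 + norm v) * measure s UNIV)" .
    qed
    also have "... = (LE u. interp t u * (1 + norm u)) * ennreal ((1 + norm v) * measure s UNIV)" by (rule nn_integral_multc) measurable
    also have "... \<le> ennreal ?m * ennreal ((1 + norm v) * measure s UNIV)" by (rule mult_right_mono[OF mom]) simp
    also have "... = ennreal (?m * ((1 + norm v) * measure s UNIV))" by (rule ennreal_mult[symmetric]) (use m0 in auto)
    finally show ?thesis .
   qed
   have "(LI v. ennreal (interp t v) * (LI u. ennreal (interp t u) * (SI w. ennreal (\<bar>w \<bullet> (u - v)\<bar> / 4) * 1))) \<le> (LI v. ennreal (interp t v * (1 + norm v)) * ennreal (?m * measure s UNIV))"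
   proof (rule nn_integral_mono)
    fix v :: "real ^ 'n"
    have "ennreal (interp t v) * (LI u. ennreal (interp t u) * (SI w. ennreal (\<bar>w \<bullet> (u - v)\<bar> / 4) * 1)) \<le> ennreal (interp t v) * ennreal (?m * ((1 + norm v) * measure s UNIV))"
     by (rule mult_left_mono[OF u]) simp
    also have "... = ennreal (interp t v * (?m * ((1 + norm v) * measure s UNIV)))" by (rule ennreal_mult[symmetric]) (use i0 m0 in auto)
    also have "interp t v * (?m * ((1 + norm v) * measure s UNIV)) = (interp t v * (1 + norm v)) * (?m * measure s UNIV)" by (simp only: mult.assoc mult.left_commute)
    also have "ennreal ... = ennreal (interp t v * (1 + norm v)) * ennreal (?m * measure s UNIV)" by (rule ennreal_mult) (use i0 m0 in auto)
    finally show "ennreal (interp t v) * (LI u. ennreal (interp t u) * (SI w. ennreal (\<bar>w \<bullet> (u - v)\<bar> / 4) * 1)) \<le> ennreal (interp t v * (1 + norm v)) * ennreal (?m * measure s UNIV)" .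
   qed
   also have "... = (LE v. interp t v * (1 + norm v)) * ennreal (?m * measure s UNIV)" by (rule nn_integral_multc) measurable
   also have "... \<le> ennreal ?m * ennreal (?m * measure s UNIV)" by (rule mult_right_mono[OF mom]) simp
   also have "... = ennreal (?m * (?m * measure s UNIV))" by (rule ennreal_mult[symmetric]) (use m0 in auto)
   also have "?m * (?m * measure s UNIV) = kS" by (simp add: kS_def power2_eq_square)
   finally show ?thesis using True by simp
  qed simp
 qed
 also have "... = ennreal kS * ennreal T" using T0 by (subst nn_integral_cmult) auto
 also have "... = ennreal (kS * T)" using T0 by (intro ennreal_mult[symmetric]) (simp_all add: kS_def)
 finally show ?thesis by (simp add: mult.commute)
qed

text \<open>Agreement with an existing measure on the measurable sets suffices, since
  \<open>measure_of\<close> applied to the values of a measure returns that measure. Countable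
  additivity of the iterated integral comes along with it.\<close>

lemma typical_collisions_eq:
 assumes \<sigma>: "sets \<sigma> = sets (restrict_space borel (sphere 0 1))" and s: "s = distr \<sigma> borel (\<lambda>w. w)"
 shows "typical_collisions \<sigma> T path = density (event_base T) (\<lambda>y. ennreal (typical y))"
proof -
 let ?Q = "density (event_base T) (\<lambda>y. ennreal (typical y))"
 let ?\<mu> = "\<lambda>A. \<integral>\<^sup>+t\<in>{0..T}. (\<integral>\<^sup>+v. (\<integral>\<^sup>+v\<^sub>s. emeasure (collision_kernel \<sigma> v v\<^sub>s) {p'. (t, (v, v\<^sub>s), p') \<in> A} / 2 \<partial>path t) \<partial>path t) \<partial>lborel"
 have id\<sigma>: "(\<lambda>w. w) \<in> measurable \<sigma> borel"
  unfolding measurable_cong_sets[OF \<sigma> refl] by (rule measurable_restrict_space1) simp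
 have toS: "(\<integral>\<^sup>+w. h w \<partial>\<sigma>) = (SI w. h w)" if "h \<in> borel_funs" for h
  unfolding s by (rule nn_integral_distr[symmetric, OF id\<sigma>]) (use that in simp)
 have eq: "?\<mu> A = emeasure ?Q A" if A: "A \<in> sets (event_space T)" for A
 proof -
  have Ab[measurable]: "A \<in> sets borel" by (rule sets_event_space_borel[OF A])
  have tm: "(\<lambda>y. ennreal (typical y)) \<in> borel_funs" by measurable
  have ker: "emeasure (collision_kernel \<sigma> v u) {p'. (t, (v, u), p') \<in> A} / 2 = (SI w. ennreal (\<bar>w \<bullet> (u - v)\<bar> / 4) * indicator A (t, ((v, u), post_collision v u w)))"
   for t and v u :: "real ^ 'n"
  proof -
   let ?B = "{p'. (t, (v, u), p') \<in> A}"
   have "(\<lambda>p' :: 'n vels. (t, (v, u), p')) -` A \<inter> space borel \<in> sets borel" by (rule measurable_sets[OF _ Ab]) measurable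
   moreover have "(\<lambda>p' :: 'n vels. (t, (v, u), p')) -` A \<inter> space borel = ?B" by auto
   ultimately have B[measurable]: "?B \<in> sets borel" by simp
   have pm: "post_collision v u \<in> measurable borel borel" unfolding post_collision_def[abs_def] by measurable
   have cm: "(\<lambda>w. ennreal (cross_section (v - u) w)) \<in> borel_funs" unfolding cross_section_def by measurable
   have pm\<sigma>: "post_collision v u \<in> measurable \<sigma> borel" and cm\<sigma>: "(\<lambda>w. ennreal (cross_section (v - u) w)) \<in> borel_measurable \<sigma>"
    using measurable_compose[OF id\<sigma> pm] measurable_compose[OF id\<sigma> cm] by simp_all
   have "emeasure (collision_kernel \<sigma> v u) ?B = (\<integral>\<^sup>+p. indicator ?B p \<partial>collision_kernel \<sigma> v u)"
    using B by (intro nn_integral_indicator[symmetric]) (simp add: collision_kernel_def)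
   also have "... = (\<integral>\<^sup>+w. indicator ?B (post_collision v u w) \<partial>density \<sigma> (\<lambda>w. ennreal (cross_section (v - u) w)))"
    unfolding collision_kernel_def by (rule nn_integral_distr) (use pm\<sigma> in simp_all)
   also have "... = (\<integral>\<^sup>+w. ennreal (cross_section (v - u) w) * indicator ?B (post_collision v u w) \<partial>\<sigma>)"
    by (rule nn_integral_density[OF cm\<sigma> measurable_compose[OF pm\<sigma>]]) measurable
   also have "... = (SI w. ennreal (cross_section (v - u) w) * indicator ?B (post_collision v u w))"
   proof (rule toS)
    have "(\<lambda>w. indicator ?B (post_collision v u w) :: ennreal) \<in> borel_funs" by (rule measurable_compose[OF pm]) measurable
    with cm show "(\<lambda>w. ennreal (cross_section (v - u) w) * indicator ?B (post_collision v u w)) \<in> borel_funs" by measurable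
   qed
   finally have "emeasure (collision_kernel \<sigma> v u) ?B / 2 = (SI w. ennreal (cross_section (v - u) w) * indicator ?B (post_collision v u w)) * inverse 2"
    by (simp add: divide_ennreal_def)
   also have "... = (SI w. ennreal (cross_section (v - u) w) * indicator ?B (post_collision v u w) * inverse 2)"
   proof (rule nn_integral_multc[symmetric])
    have "(\<lambda>w. indicator ?B (post_collision v u w) :: ennreal) \<in> borel_measurable s" by (rule measurable_compose[of _ _ borel]) (use pm in \<open>simp_all add: measurable_cong_sets[OF sets_s refl]\<close>)
    moreover have "(\<lambda>w. ennreal (cross_section (v - u) w)) \<in> borel_measurable s" using cm by (simp add: measurable_cong_sets[OF sets_s refl])
    ultimately show "(\<lambda>w. ennreal (cross_section (v - u) w) * indicator ?B (post_collision v u w)) \<in> borel_measurable s" by measurable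
   qed
   also have "... = (SI w. ennreal (\<bar>w \<bullet> (u - v)\<bar> / 4) * indicator A (t, ((v, u), post_collision v u w)))"
   proof (rule nn_integral_cong)
    fix w :: "real ^ 'n"
    have "(v - u) \<bullet> w = - (w \<bullet> (u - v))" by (simp add: inner_diff_left inner_diff_right inner_commute)
    then have c: "cross_section (v - u) w = \<bar>w \<bullet> (u - v)\<bar> / 2" by (simp add: cross_section_def)
    have h: "inverse 2 = ennreal (1 / 2)" using inverse_ennreal[of 2] by (simp add: inverse_eq_divide)
    have "ennreal (cross_section (v - u) w) * inverse 2 = ennreal (\<bar>w \<bullet> (u - v)\<bar> / 2 * (1 / 2))"
     unfolding c h by (rule ennreal_mult[symmetric]) auto
    then have h1: "ennreal (cross_section (v - u) w) * inverse 2 = ennreal (\<bar>w \<bullet> (u - v)\<bar> / 4)" by simp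
    have h2: "indicator ?B (post_collision v u w) = (indicator A (t, ((v, u), post_collision v u w)) :: ennreal)" by (simp add: indicator_def)
    have "ennreal (cross_section (v - u) w) * i * inverse 2 = (ennreal (cross_section (v - u) w) * inverse 2) * i" for i
     by (simp only: ac_simps)
    then show "ennreal (cross_section (v - u) w) * indicator ?B (post_collision v u w) * inverse 2 = ennreal (\<bar>w \<bullet> (u - v)\<bar> / 4) * indicator A (t, ((v, u), post_collision v u w))"
     by (simp only: h1 h2)
   qed
   finally show ?thesis .
  qed
  have "?\<mu> A = (LI t. (LI v. ennreal (interp t v) * (LI u. ennreal (interp t u) *
   (SI w. ennreal (\<bar>w \<bullet> (u - v)\<bar> / 4) * indicator A (t, ((v, u), post_collision v u w))))) * indicator {0..T} t)"
  proof (rule nn_integral_cong)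
   fix t :: real
   define K where "K p = (SI w. ennreal (\<bar>w \<bullet> (snd p - fst p)\<bar> / 4) * indicator A (t, (p, post_collision (fst p) (snd p) w)))" for p
   have [measurable]: "K \<in> borel_funs" unfolding K_def post_collision_def by measurable
   have i: "(\<lambda>v. ennreal (interp t v)) \<in> borel_measurable lborel" by measurable
   have "(\<integral>\<^sup>+v. (\<integral>\<^sup>+u. K (v, u) \<partial>path t) \<partial>path t) = (\<integral>\<^sup>+v. (LI u. ennreal (interp t u) * K (v, u)) \<partial>path t)"
    unfolding path_def by (rule nn_integral_cong, rule nn_integral_density[OF i]) measurable
   also have "... = (LI v. ennreal (interp t v) * (LI u. ennreal (interp t u) * K (v, u)))"
    unfolding path_def by (rule nn_integral_density[OF i]) measurable
   finally show "(\<integral>\<^sup>+v. (\<integral>\<^sup>+v\<^sub>s. emeasure (collision_kernel \<sigma> v v\<^sub>s) {p'. (t, (v, v\<^sub>s), p') \<in> A} / 2 \<partial>path t) \<partial>path t) * indicator {0..T} t =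
    (LI v. ennreal (interp t v) * (LI u. ennreal (interp t u) * (SI w. ennreal (\<bar>w \<bullet> (u - v)\<bar> / 4) * indicator A (t, ((v, u), post_collision v u w))))) * indicator {0..T} t"
    by (simp only: ker K_def fst_conv snd_conv)
  qed
  also have "... = (\<integral>\<^sup>+y. ennreal (typical y) * indicator A y \<partial>event_base T)" by (rule nn_integral_typical[symmetric]) measurable
  also have "... = emeasure ?Q A" using A by (intro emeasure_density[symmetric] event_base_measurable tm) (simp add: sets_event_base)
  finally show ?thesis .
 qed
 have "typical_collisions \<sigma> T path = measure_of (space (event_space T)) (sets (event_space T)) (emeasure ?Q)"
  unfolding typical_collisions_def
 proof (rule measure_of_eq)
  show "sets (event_space T :: 'n event measure) \<subseteq> Pow (space (event_space T))" by (rule sets.space_closed)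
  fix A assume "A \<in> sigma_sets (space (event_space T)) (sets (event_space T :: 'n event measure))"
  then have "A \<in> sets (event_space T)" by (simp only: sets.sigma_sets_eq)
  then show "?\<mu> A = emeasure ?Q A" by (rule eq)
 qed
 also have "... = measure_of (space ?Q) (sets ?Q) (emeasure ?Q)"
  using sets_eq_imp_space_eq[OF sets_event_base] by (simp add: sets_event_base)
 also have "... = ?Q" by (rule measure_of_of_measure)
 finally show ?thesis .
qed

text \<open>All terms live in \<open>ennreal\<close>, so the negative part of f2 ln f2 is added on
  the left instead of being subtracted on the right. The pointwise bound is rearranged in the same
  way before it is integrated.\<close>

theorem rate_function_le:
 assumes \<sigma>: "sets \<sigma> = sets (restrict_space borel (sphere 0 1))" and s: "s = distr \<sigma> borel (\<lambda>w. w)"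
  and M: "(CE x. (Y1 x + Y2 x) * Lw x) \<le> ennreal M" "0 \<le> M"
 shows "rate_function \<sigma> e T path flow + (LE v. - L v) \<le> ennreal (12 * (A + \<bar>ln T\<bar>) * M + T * kS) + (LE v. L v)"
proof -
 let ?EB = "event_base T"
 define P where "P = density ?EB (\<lambda>y. ennreal (typical y))"
 \<comment> \<open>Where the typical density is 0 the flux is 0 too, and so is the quotient by
   convention; hence r is a density of the flow with respect to P everywhere on the strip.\<close>
 define r where "r y = flux y / typical y" for y
 have [measurable]: "r \<in> borel_funs" unfolding r_def by measurable
 have spP: "space P = {0..T} \<times> UNIV" by (simp add: P_def space_event_base)
 have tm: "(\<lambda>y. ennreal (typical y)) \<in> borel_measurable ?EB" by (rule event_base_measurable) measurable
 have rm: "(\<lambda>y. ennreal (r y)) \<in> borel_measurable ?EB" by (rule event_base_measurable) measurable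
 have fm: "(\<lambda>y. ennreal (flux y)) \<in> borel_measurable ?EB" by (rule event_base_measurable) measurable
 have rmP: "(\<lambda>y. ennreal (r y)) \<in> borel_measurable P" unfolding P_def using rm by simp
 have r0: "0 \<le> r y" "0 \<le> typical y" "0 \<le> flux y" and tr: "typical y * r y = flux y" and z: "flux y \<noteq> 0 \<Longrightarrow> 0 < typical y" if y: "y \<in> {0..T} \<times> UNIV" for y
 proof -
  obtain t x where tx: "y = (t, x)" "t \<in> {0..T}" using y by auto
  show t0: "0 \<le> typical y" "0 \<le> flux y" using typical_nonneg[OF tx(2)] flux_nonneg[OF tx(2)] tx(1) by simp_all
  then show "0 \<le> r y" by (simp add: r_def)
  show z: "flux y \<noteq> 0 \<Longrightarrow> 0 < typical y" using typical_pos[OF _ tx(2)] tx(1) by simp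
  show "typical y * r y = flux y" using z by (cases "flux y = 0") (auto simp: r_def)
 qed
 have flow_eq: "flow = density P (\<lambda>y. ennreal (r y))"
 proof -
  have "density P (\<lambda>y. ennreal (r y)) = density ?EB (\<lambda>y. ennreal (typical y) * ennreal (r y))"
   unfolding P_def by (rule density_density_eq[OF tm rm])
  also have "... = density ?EB (\<lambda>y. ennreal (flux y))"
  proof (rule density_cong)
   show "AE y in ?EB. ennreal (typical y) * ennreal (r y) = ennreal (flux y)"
    by (rule AE_I2) (use r0 tr in \<open>simp add: space_event_base ennreal_mult[symmetric]\<close>)
  qed (use tm rm fm in auto)
  finally show ?thesis by (simp add: flow_def)
 qed
 have "emeasure P (space P) = (\<integral>\<^sup>+y. ennreal (typical y) \<partial>?EB)"
  unfolding P_def space_density by (subst emeasure_density[OF tm sets.top]) (auto intro!: nn_integral_cong)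
 also have "... < \<infinity>" using typical_mass by (rule le_less_trans) simp
 finally interpret P: finite_measure P by (intro finite_measureI) simp
 have RN: "AE y in P. ennreal (r y) = RN_deriv P flow y" by (rule P.RN_deriv_unique[OF rmP flow_eq[symmetric]])
 have ac: "absolutely_continuous P flow" unfolding flow_eq by (rule absolutely_continuousI_density[OF rmP])
 have "rate_function \<sigma> e T path flow = (\<integral>\<^sup>+y. ennreal (enn2real (RN_deriv P flow y) * ln (enn2real (RN_deriv P flow y)) - (enn2real (RN_deriv P flow y) - 1)) \<partial>P)"
  unfolding rate_function_def Let_def typical_collisions_eq[OF \<sigma> s] P_def[symmetric] using ac path_continuous by simp
 also have "... = (\<integral>\<^sup>+y. ennreal (r y * ln (r y) - (r y - 1)) \<partial>P)"
 proof (rule nn_integral_cong_AE, rule AE_mp[OF RN], rule AE_I2, rule impI)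
  fix y assume y: "y \<in> space P" and e: "ennreal (r y) = RN_deriv P flow y"
  have "enn2real (RN_deriv P flow y) = r y" unfolding e[symmetric] using r0(1)[of y] y spP by simp
  then show "ennreal (enn2real (RN_deriv P flow y) * ln (enn2real (RN_deriv P flow y)) - (enn2real (RN_deriv P flow y) - 1)) = ennreal (r y * ln (r y) - (r y - 1))" by simp
 qed
 also have "... = (\<integral>\<^sup>+y. ennreal (typical y) * ennreal (r y * ln (r y) - (r y - 1)) \<partial>?EB)"
  unfolding P_def by (rule nn_integral_density[OF tm event_base_measurable]) measurable
 finally have J: "rate_function \<sigma> e T path flow = (\<integral>\<^sup>+y. ennreal (typical y) * ennreal (r y * ln (r y) - (r y - 1)) \<partial>?EB)" .
 define Lp where "Lp v = max 0 (L v)" for v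
 define Ln where "Ln v = max 0 (- L v)" for v
 have [measurable]: "Lp \<in> borel_funs" "Ln \<in> borel_funs" unfolding Lp_def Ln_def by measurable
 have Lpn0: "0 \<le> Lp v" "0 \<le> Ln v" for v by (simp_all add: Lp_def Ln_def)
 have Lpn: "Sout L x = Sout Lp x - Sout Ln x" for x :: "'n coll"
 proof -
  have "L v = Lp v - Ln v" for v by (simp add: Lp_def Ln_def max_def)
  then show ?thesis unfolding Sout_def by (simp only: add_divide_distrib diff_divide_distrib)
 qed
 define w where "w g y = ramp_rate (1 - fst y / T) / T * (E2 (snd y) * Sout g (snd y))" for g and y :: "'n event"
 define G where "G y = 12 / T * (A + \<bar>ln T\<bar>) * ((Y1 (snd y) + Y2 (snd y)) * Lw (snd y))" for y :: "'n event"
 have wm: "w Lp \<in> borel_funs" "w Ln \<in> borel_funs" "G \<in> borel_funs" unfolding w_def G_def by measurable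
 have A0: "0 \<le> A" using cl0 by (simp add: A_def)
 have G0: "0 \<le> G y" for y
 proof -
  have "0 \<le> Y1 (snd y) + Y2 (snd y)" "0 \<le> Lw (snd y)" using nonneg Lw_ge_1[of "snd y"] by (simp, linarith)
  then show ?thesis unfolding G_def using A0 T0 by simp
 qed
 have wI: "(\<integral>\<^sup>+y. ennreal (w g y) \<partial>?EB) = (LE v. g v)" if "g \<in> borel_funs" "\<And>v. 0 \<le> g v" for g
  unfolding w_def by (rule nn_integral_E2_flux[OF that])
 have em: "(\<lambda>y. ennreal (w Lp y)) \<in> borel_measurable ?EB" "(\<lambda>y. ennreal (w Ln y)) \<in> borel_measurable ?EB" "(\<lambda>y. ennreal (G y)) \<in> borel_measurable ?EB"
  by (rule event_base_measurable, use wm in measurable)+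
 have jm: "(\<lambda>y. ennreal (typical y) * ennreal (r y * ln (r y) - (r y - 1))) \<in> borel_measurable ?EB" by (rule event_base_measurable) measurable
 have "rate_function \<sigma> e T path flow + (LE v. Ln v) = (\<integral>\<^sup>+y. ennreal (typical y) * ennreal (r y * ln (r y) - (r y - 1)) + ennreal (w Ln y) \<partial>?EB)"
  unfolding J using wI[of Ln] Lpn0 by (subst nn_integral_add[OF jm em(2)]) simp
 also have "... \<le> (\<integral>\<^sup>+y. (ennreal (G y) + ennreal (typical y)) + ennreal (w Lp y) \<partial>?EB)"
 proof (rule nn_integral_mono)
  fix y assume "y \<in> space ?EB"
  then have y: "y \<in> {0..T} \<times> UNIV" by (simp add: space_event_base)
  then obtain t x where tx: "y = (t, x)" "t \<in> {0..T}" by auto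
  have w0: "0 \<le> w g y" if "\<And>v. 0 \<le> g v" for g
   unfolding w_def tx fst_conv snd_conv using ramps[OF tx(2) tx(2)] EZ_nonneg(2)[of x] T0 that by (simp add: Sout_nonneg)
  have wd: "w L y = w Lp y - w Ln y" unfolding w_def Lpn by (simp add: right_diff_distrib)
  define j where "j = typical y * (r y * ln (r y) - (r y - 1))"
  have j: "j = flux y * ln (flux y / typical y) - flux y + typical y"
  proof -
   have "j = (typical y * r y) * ln (r y) - typical y * r y + typical y" by (simp add: j_def algebra_simps)
   then show ?thesis unfolding tr[OF y] by (simp add: r_def)
  qed
  have "j \<le> G y + typical y + w L y"
   using entropy_production_le[OF tx(2), of x] r0(3)[OF y] unfolding j G_def w_def tx fst_conv snd_conv by linarith
  then have main: "j + w Ln y \<le> G y + typical y + w Lp y" using wd by linarith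
  have j0: "0 \<le> j"
  proof (cases "flux y = 0")
   case True
   then show ?thesis using j r0(2)[OF y] by simp
  next
   case False
   then show ?thesis using mult_ln_ratio_ge[OF r0(3)[OF y] z[OF y False]] unfolding j by linarith
  qed
  have "ennreal (typical y) * ennreal (r y * ln (r y) - (r y - 1)) = ennreal j"
  proof (cases "typical y = 0")
   case False
   then have "0 < typical y" using r0(2)[OF y] by simp
   then have "0 \<le> r y * ln (r y) - (r y - 1)" using j0 unfolding j_def by (simp add: zero_le_mult_iff)
   then show ?thesis unfolding j_def using r0(2)[OF y] by (intro ennreal_mult[symmetric])
  qed (simp add: j_def)
  then have "ennreal (typical y) * ennreal (r y * ln (r y) - (r y - 1)) + ennreal (w Ln y) = ennreal (j + w Ln y)"
   using j0 w0[OF Lpn0(2)] by (simp add: ennreal_plus)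
  also have "... \<le> ennreal (G y + typical y + w Lp y)" by (rule ennreal_leI[OF main])
  also have "... = (ennreal (G y) + ennreal (typical y)) + ennreal (w Lp y)"
   using G0[of y] r0(2)[OF y] w0[OF Lpn0(1)] by (simp add: ennreal_plus)
  finally show "ennreal (typical y) * ennreal (r y * ln (r y) - (r y - 1)) + ennreal (w Ln y) \<le> (ennreal (G y) + ennreal (typical y)) + ennreal (w Lp y)" .
 qed
 also have "... = ((\<integral>\<^sup>+y. ennreal (G y) \<partial>?EB) + (\<integral>\<^sup>+y. ennreal (typical y) \<partial>?EB)) + (LE v. Lp v)"
  using wI[of Lp] Lpn0 em tm by (simp add: nn_integral_add)
 also have "... \<le> (ennreal (12 * (A + \<bar>ln T\<bar>) * M) + ennreal (T * kS)) + (LE v. Lp v)"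
 proof (intro add_mono typical_mass order_refl)
  \<comment> \<open>The bound G is constant in time, so the length of the interval cancels the
    factor 1 / T, and in this term T survives only through |ln T|.\<close>
  define c where "c = 12 / T * (A + \<bar>ln T\<bar>)"
  have c0: "0 \<le> c" using A0 T0 by (simp add: c_def)
  have "(\<integral>\<^sup>+y. ennreal (G y) \<partial>?EB) = (LI t. (CE x. G (t, x)) * indicator {0..T} t)"
   by (rule nn_integral_event_base) (use wm in measurable)
  also have "... \<le> (LI t. ennreal (c * M) * indicator {0..T} t)"
  proof (intro nn_integral_mono mult_right_mono)
   fix t :: real
   have "ennreal (G (t, x)) = ennreal c * ennreal ((Y1 x + Y2 x) * Lw x)" for x
    unfolding G_def snd_conv c_def[symmetric] by (rule ennreal_mult[OF c0]) (intro mult_nonneg_nonneg add_nonneg_nonneg nonneg order_trans[OF zero_le_one Lw_ge_1])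
   then have "(CE x. G (t, x)) = ennreal c * (CE x. (Y1 x + Y2 x) * Lw x)"
    by (simp add: nn_integral_cmult)
   also have "... \<le> ennreal c * ennreal M" by (intro mult_left_mono M) simp
   finally show "(CE x. G (t, x)) \<le> ennreal (c * M)" using c0 M(2) by (simp add: ennreal_mult)
  qed simp
  also have "... = ennreal (c * M) * ennreal T" using T0 by (subst nn_integral_cmult) auto
  also have "... = ennreal (c * M * T)" using c0 M(2) T0 by (intro ennreal_mult[symmetric]) auto
  also have "c * M * T = 12 * (A + \<bar>ln T\<bar>) * M" using T0 by (simp add: c_def)
  finally show "(\<integral>\<^sup>+y. ennreal (G y) \<partial>?EB) \<le> ennreal (12 * (A + \<bar>ln T\<bar>) * M)" .
 qed
 also have "ennreal (12 * (A + \<bar>ln T\<bar>) * M) + ennreal (T * kS) = ennreal (12 * (A + \<bar>ln T\<bar>) * M + T * kS)"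
  using A0 M(2) T0 by (intro ennreal_plus[symmetric]) (simp_all add: kS_def)
 finally show ?thesis by (simp add: Lp_def Ln_def ennreal_max_0)
qed

end

section \<open>Existence of controlled paths\<close>

text \<open>The exponent d + 3 leaves a tail of order d + 1, still integrable, after multiplication
  by (1 + |v|)^2; a contraction then brings the energy below e. A Maxwellian would make - ln N
  quadratic, beyond the reach of the logarithmic moment of \<open>Lw\<close>.\<close>

lemma power_law_density:
 fixes e :: real
 assumes e: "0 < e"
 obtains N :: "real ^ 'n::finite \<Rightarrow> real" and nb cl :: real where "velocity_density e N" "\<And>v. 0 < N v" "\<And>v. N v \<le> nb" "\<And>v. N (- v) = N v"
  "0 \<le> cl" "\<And>v. - ln (N v) \<le> cl * (1 + ln (1 + norm v))"
proof -
 define d where "d = CARD('n)"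
 define p where "p v = 1 / (1 + norm v) ^ (d + 3)" for v :: "real ^ 'n"
 have [measurable]: "p \<in> borel_funs" unfolding p_def by measurable
 have n1: "1 \<le> 1 + norm v" for v :: "real ^ 'n" by simp
 have p0: "0 < p v" for v unfolding p_def by (intro divide_pos_pos zero_less_power) (auto intro: add_pos_nonneg)
 have p1: "p v \<le> 1" for v
 proof -
  have "1 \<le> (1 + norm v) ^ (d + 3)" by (rule one_le_power[OF n1])
  then show ?thesis unfolding p_def by (subst divide_le_eq_1_pos) linarith+
 qed
 have tail: "(\<integral>\<^sup>+v. ennreal (1 / (1 + norm v) ^ (d + 1)) \<partial>(lborel :: (real ^ 'n) measure)) < top"
  using inverse_power_tail_finite[where 'a="real ^ 'n"] by (simp add: d_def)
 have ple: "p v * (1 + norm v)\<^sup>2 = 1 / (1 + norm v) ^ (d + 1)" for v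
 proof -
  have d3: "d + 3 = (d + 1) + 2" by simp
  have "(1 + norm v) ^ (d + 3) = (1 + norm v) ^ (d + 1) * (1 + norm v)\<^sup>2" unfolding d3 by (rule power_add)
  moreover have "(1 + norm v)\<^sup>2 \<noteq> 0" by (rule power_not_zero) (use norm_ge_zero[of v] in linarith)
  ultimately show ?thesis by (simp add: p_def)
 qed
 have le0: "p v \<le> 1 / (1 + norm v) ^ (d + 1)" for v
 proof -
  have "p v * 1 \<le> p v * (1 + norm v)\<^sup>2" using n1[of v] p0[of v] by (intro mult_left_mono one_le_power) auto
  then show ?thesis by (simp add: ple)
 qed
 have le2: "p v * ((norm v)\<^sup>2 / 2) \<le> 1 / (1 + norm v) ^ (d + 1)" for v
 proof -
  have "(norm v)\<^sup>2 \<le> (1 + norm v)\<^sup>2" by (rule power_mono) auto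
  then have "(norm v)\<^sup>2 / 2 \<le> (1 + norm v)\<^sup>2" using zero_le_power2[of "norm v"] by linarith
  then have "p v * ((norm v)\<^sup>2 / 2) \<le> p v * (1 + norm v)\<^sup>2" using p0[of v] by (intro mult_left_mono) auto
  then show ?thesis by (simp add: ple)
 qed
 have f0: "(LE v. p v) < top" by (rule le_less_trans[OF nn_integral_mono tail]) (rule ennreal_leI[OF le0])
 have f2: "(LE v. p v * ((norm v)\<^sup>2 / 2)) < top" by (rule le_less_trans[OF nn_integral_mono tail]) (rule ennreal_leI[OF le2])
 define i0 where "i0 = enn2real (LE v. p v)"
 define i2 where "i2 = enn2real (LE v. p v * ((norm v)\<^sup>2 / 2))"
 have i0: "(LE v. p v) = ennreal i0" using f0 by (simp add: i0_def)
 have i2: "(LE v. p v * ((norm v)\<^sup>2 / 2)) = ennreal i2" "0 \<le> i2" using f2 by (simp_all add: i2_def)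
 have i0p: "0 < i0"
 proof (rule ccontr)
  assume "\<not> 0 < i0"
  then have "(LE v. p v) = 0" using i0 by (simp add: ennreal_neg)
  then have "AE v in lborel. ennreal (p v) = 0" by (subst (asm) nn_integral_0_iff_AE) auto
  moreover have "ennreal (p v) \<noteq> 0" for v using p0[of v] by (simp add: ennreal_eq_0_iff not_le)
  ultimately have "AE v in (lborel :: (real ^ 'n) measure). False" by simp
  then have "emeasure (lborel :: (real ^ 'n) measure) UNIV = 0" by (simp add: AE_iff_measurable[of UNIV])
  then show False by simp
 qed
 \<comment> \<open>Contraction by l multiplies the energy i2 / i0 of the unit profile by l^2, which
   is at most l. The + 1 keeps the denominator positive.\<close>
 define l where "l = min 1 (e * i0 / (i2 + 1))"
 have l: "0 < l" "l \<le> 1" using e i0p i2(2) by (auto simp: l_def)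
 have lE: "l\<^sup>2 * i2 \<le> e * i0"
 proof -
  have "l\<^sup>2 \<le> l" using l by (simp add: power2_eq_square mult_left_le)
  also have "l \<le> e * i0 / (i2 + 1)" by (simp add: l_def)
  finally have "l\<^sup>2 * i2 \<le> e * i0 / (i2 + 1) * i2" using i2(2) by (intro mult_right_mono)
  also have "... = e * i0 * (i2 / (i2 + 1))" by simp
  also have "... \<le> e * i0 * 1" using e i0p i2(2) by (intro mult_left_mono) auto
  finally show ?thesis by simp
 qed
 define c where "c = 1 / (l ^ d * i0)"
 have c0: "0 < c" using l i0p by (simp add: c_def)
 define N where "N v = c * p (v /\<^sub>R l)" for v
 have Nm[measurable]: "N \<in> borel_funs" unfolding N_def by measurable
 have N0: "0 < N v" for v unfolding N_def using c0 p0 by simp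
 have dim: "\<bar>l\<bar> ^ DIM(real ^ 'n) = l ^ d" using l by (simp add: d_def)
 have Nl: "N (l *\<^sub>R v) = c * p v" for v using l by (simp add: N_def)
 show thesis
 proof (rule that[of N c "\<bar>ln c\<bar> + (real d + 3) * (1 + \<bar>ln l\<bar>)"])
  show "velocity_density e N"
   unfolding velocity_density_def
  proof (intro conjI allI)
   have "(LE v. N v) = ennreal (l ^ d) * (LE v. N (l *\<^sub>R v))"
    using nn_integral_lborel_scale[of "\<lambda>v. ennreal (N v)" l] l unfolding dim by simp
   also have "(LE v. N (l *\<^sub>R v)) = (LI v. ennreal c * ennreal (p v))"
    unfolding Nl using c0 p0 by (intro nn_integral_cong ennreal_mult) (auto simp: less_imp_le)
   also have "... = ennreal c * ennreal i0" by (subst nn_integral_cmult) (simp_all add: i0)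
   also have "ennreal (l ^ d) * (ennreal c * ennreal i0) = ennreal (l ^ d * (c * i0))"
    using c0 i0p l by (simp add: ennreal_mult)
   also have "l ^ d * (c * i0) = 1" using l i0p by (simp add: c_def)
   finally show "(LE v. N v) = 1" by simp
   have "(LI v. ennreal (N v) * ennreal ((norm v)\<^sup>2 / 2)) = ennreal (l ^ d) * (LI v. ennreal (N (l *\<^sub>R v)) * ennreal ((norm (l *\<^sub>R v))\<^sup>2 / 2))"
    using nn_integral_lborel_scale[of "\<lambda>v. ennreal (N v) * ennreal ((norm v)\<^sup>2 / 2)" l] l unfolding dim by simp
   also have "(LI v. ennreal (N (l *\<^sub>R v)) * ennreal ((norm (l *\<^sub>R v))\<^sup>2 / 2)) = (LI v. ennreal (c * l\<^sup>2) * ennreal (p v * ((norm v)\<^sup>2 / 2)))"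
   proof (rule nn_integral_cong)
    fix v :: "real ^ 'n"
    have "ennreal (N (l *\<^sub>R v)) * ennreal ((norm (l *\<^sub>R v))\<^sup>2 / 2) = ennreal (c * p v * ((norm (l *\<^sub>R v))\<^sup>2 / 2))"
     unfolding Nl using c0 p0[of v] by (intro ennreal_mult[symmetric]) auto
    also have "c * p v * ((norm (l *\<^sub>R v))\<^sup>2 / 2) = (c * l\<^sup>2) * (p v * ((norm v)\<^sup>2 / 2))" by (simp add: power_mult_distrib)
    also have "ennreal ... = ennreal (c * l\<^sup>2) * ennreal (p v * ((norm v)\<^sup>2 / 2))" using c0 p0[of v] by (intro ennreal_mult) auto
    finally show "ennreal (N (l *\<^sub>R v)) * ennreal ((norm (l *\<^sub>R v))\<^sup>2 / 2) = ennreal (c * l\<^sup>2) * ennreal (p v * ((norm v)\<^sup>2 / 2))" .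
   qed
   also have "... = ennreal (c * l\<^sup>2) * (LE v. p v * ((norm v)\<^sup>2 / 2))" by (rule nn_integral_cmult) measurable
   also have "(LE v. p v * ((norm v)\<^sup>2 / 2)) = ennreal i2" by (rule i2(1))
   also have "ennreal (l ^ d) * (ennreal (c * l\<^sup>2) * ennreal i2) = ennreal (l ^ d * ((c * l\<^sup>2) * i2))"
    using c0 i2(2) l by (simp add: ennreal_mult)
   also have "l ^ d * ((c * l\<^sup>2) * i2) = l\<^sup>2 * i2 / i0" using l i0p by (simp add: c_def)
   also have "ennreal (l\<^sup>2 * i2 / i0) \<le> ennreal e" using lE i0p by (intro ennreal_leI) (simp add: pos_divide_le_eq)
   finally show "(LI v. ennreal (N v) * ennreal ((norm v)\<^sup>2 / 2)) \<le> ennreal e" .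
  qed (use N0 in \<open>auto simp: less_imp_le\<close>)
  show "0 < N v" for v by (rule N0)
  show "N v \<le> c" for v unfolding N_def using mult_left_mono[OF p1, of c] c0 by simp
  show "N (- v) = N v" for v by (simp add: N_def p_def)
  show "0 \<le> \<bar>ln c\<bar> + (real d + 3) * (1 + \<bar>ln l\<bar>)" by simp
  show "- ln (N v) \<le> (\<bar>ln c\<bar> + (real d + 3) * (1 + \<bar>ln l\<bar>)) * (1 + ln (1 + norm v))" for v
  proof -
   define z where "z = ln (1 + norm v)"
   have z0: "0 \<le> z" unfolding z_def by (rule ln_ge_zero) simp
   define D where "D = real d + 3"
   have pos: "0 < 1 + norm (v /\<^sub>R l)" by (simp add: add_pos_nonneg)
   have "ln (N v) = ln c - D * ln (1 + norm (v /\<^sub>R l))"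
    unfolding N_def p_def using c0 pos by (simp add: ln_div ln_mult_pos ln_realpow D_def)
   moreover have "ln (1 + norm (v /\<^sub>R l)) \<le> z + \<bar>ln l\<bar>"
   proof -
    have "1 + norm (v /\<^sub>R l) \<le> (1 + norm v) / l" using l by (simp add: field_simps)
    then have "ln (1 + norm (v /\<^sub>R l)) \<le> ln ((1 + norm v) / l)" using pos by (simp add: ln_mono)
    also have "... = z - ln l"
    proof -
     have "0 < 1 + norm v" using norm_ge_zero[of v] by linarith
     then show ?thesis unfolding z_def using l by (simp add: ln_div)
    qed
    finally show ?thesis by linarith
   qed
   then have "D * ln (1 + norm (v /\<^sub>R l)) \<le> D * (z + \<bar>ln l\<bar>)" by (intro mult_left_mono) (simp_all add: D_def)
   moreover have "D * (z + \<bar>ln l\<bar>) \<le> D * ((1 + \<bar>ln l\<bar>) * (1 + z))"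
    using z0 by (intro mult_left_mono) (simp_all add: D_def distrib_left distrib_right)
   moreover have "- ln c \<le> \<bar>ln c\<bar> * (1 + z)"
   proof -
    have "\<bar>ln c\<bar> * 1 \<le> \<bar>ln c\<bar> * (1 + z)" using z0 by (intro mult_left_mono) auto
    then show ?thesis by linarith
   qed
   ultimately have "- ln (N v) \<le> \<bar>ln c\<bar> * (1 + z) + D * ((1 + \<bar>ln l\<bar>) * (1 + z))" by linarith
   also have "... = (\<bar>ln c\<bar> + D * (1 + \<bar>ln l\<bar>)) * (1 + z)" by (simp add: distrib_right)
   finally show ?thesis by (simp only: z_def D_def)
  qed
 qed
qed

context catalyst begin

lemma N_mean: "(BI v. N v *\<^sub>R v) = 0"
proof (cases "integrable lborel (\<lambda>v. N v *\<^sub>R v)")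
 case True
 show ?thesis
 proof (rule euclidean_eqI)
  fix b :: "real ^ 'n"
  have m: "(\<lambda>v. N v * (v \<bullet> b)) \<in> borel_funs" by measurable
  have "(BI v. N v * (v \<bullet> b)) = \<bar>-1\<bar> ^ DIM(real ^ 'n) * (BI v. N (0 + (-1) *\<^sub>R v) * ((0 + (-1) *\<^sub>R v) \<bullet> b))"
   by (rule integral_lborel_affine[OF m]) simp
  then have "(BI v. N v * (v \<bullet> b)) = - (BI v. N v * (v \<bullet> b))" by (simp add: N_even)
  then have "(BI v. (N v *\<^sub>R v) \<bullet> b) = 0" by simp
  then show "(BI v. N v *\<^sub>R v) \<bullet> b = 0 \<bullet> b" using True by (simp only: integral_inner_left inner_zero_left)
 qed
qed (simp add: not_integrable_integral_eq)

text \<open>From f ln (f / N) \<ge> f - N and the at most linear growth of - ln N, the negative part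
  of f ln f is bounded by the first moment of f. Finiteness of \<open>rel_entropy\<close> then
  passes to the positive part, and the subtraction in its definition becomes one of real
  numbers.\<close>

lemma finite_entropy_density:
 fixes \<pi> :: "(real ^ 'n) measure"
 assumes \<pi>: "\<pi> \<in> vel_distributions e" and H: "rel_entropy e \<pi> < \<infinity>"
 obtains f :: "real ^ 'n \<Rightarrow> real" where "velocity_density e f" "density lborel (\<lambda>v. ennreal (f v)) = \<pi>" "(BI v. f v *\<^sub>R v) = 0"
  "(LE v. f v * ln (f v)) < \<infinity>" "(LE v. - (f v * ln (f v))) < \<infinity>"
  "rel_entropy e \<pi> = enn2ereal (LE v. f v * ln (f v)) - enn2ereal (LE v. - (f v * ln (f v)))
   + ereal (real CARD('n) / 2 * (ln (4 * pi * e / real CARD('n)) + 1))"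
proof -
 interpret P: prob_space \<pi> using \<pi> by (simp add: vel_distributions_def)
 have sets: "sets \<pi> = sets lborel" and en: "(\<integral>\<^sup>+v. ennreal ((norm v)\<^sup>2 / 2) \<partial>\<pi>) \<le> ennreal e" and mean: "(\<integral>v. v \<partial>\<pi>) = 0"
  using \<pi> by (auto simp: vel_distributions_def)
 have ac: "absolutely_continuous lborel \<pi>" using H by (auto simp: rel_entropy_def split: if_splits)
 define f where "f v = enn2real (RN_deriv lborel \<pi> v)" for v
 have fm[measurable]: "f \<in> borel_funs" unfolding f_def by (simp add: borel_measurable_RN_deriv[of lborel \<pi>, simplified])
 have f0: "0 \<le> f v" for v by (simp add: f_def)
 have fin: "AE v in lborel. RN_deriv lborel \<pi> v \<noteq> \<infinity>" by (rule sigma_finite_measure.RN_deriv_finite[OF sigma_finite_lborel P.sigma_finite_measure_axioms ac sets])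
 have d: "density lborel (\<lambda>v. ennreal (f v)) = \<pi>"
 proof -
  have "density lborel (\<lambda>v. ennreal (f v)) = density lborel (RN_deriv lborel \<pi>)"
  proof (rule density_cong)
   show "AE v in lborel. ennreal (f v) = RN_deriv lborel \<pi> v" using fin by eventually_elim (simp add: f_def less_top)
  qed auto
  then show ?thesis using sigma_finite_measure.density_RN_deriv[OF sigma_finite_lborel ac sets] by simp
 qed
 have vd: "velocity_density e f"
  unfolding velocity_density_def
 proof (intro conjI allI)
  have "(LE v. f v) = emeasure (density lborel (\<lambda>v. ennreal (f v))) UNIV" by (simp add: emeasure_density)
  also have "... = 1" unfolding d using P.emeasure_space_1 sets_eq_imp_space_eq[OF sets] by simp
  finally show "(LE v. f v) = 1" .
  show "(LI v. ennreal (f v) * ennreal ((norm v)\<^sup>2 / 2)) \<le> ennreal e"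
   using en unfolding d[symmetric] by (subst (asm) nn_integral_density) auto
 qed (use f0 in auto)
 have mf: "(BI v. f v *\<^sub>R v) = 0"
  using mean unfolding d[symmetric] by (subst (asm) integral_density) (use f0 in auto)
 let ?P = "(LE v. f v * ln (f v))" and ?Q = "(LE v. - (f v * ln (f v)))"
 have Q: "?Q < \<infinity>"
 proof -
  have "?Q \<le> (LI v. ennreal cl * ennreal (f v * (1 + norm v)) + ennreal (N v))"
  proof (rule nn_integral_mono)
   fix v :: "real ^ 'n"
   have "- (f v * ln (f v)) \<le> cl * (f v * (1 + norm v)) + N v"
   proof (cases "f v = 0")
    case True
    then show ?thesis using N_pos[of v] by (simp add: less_imp_le)
   next
    case False
    then have fp: "0 < f v" using f0[of v] by linarith
    have "f v - N v \<le> f v * ln (f v / N v)" by (rule mult_ln_ratio_ge[OF f0 N_pos])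
    also have "... = f v * ln (f v) + f v * (- ln (N v))" using fp N_pos[of v] by (simp add: ln_div right_diff_distrib)
    also have "f v * (- ln (N v)) \<le> f v * (cl * (1 + norm v))"
    proof (rule mult_left_mono[OF _ f0])
     have "ln (1 + norm v) \<le> norm v" using ln_le_minus_one[of "1 + norm v"] by (simp add: add_pos_nonneg)
     then have "cl * (1 + ln (1 + norm v)) \<le> cl * (1 + norm v)" using cl0 by (intro mult_left_mono) auto
     then show "- ln (N v) \<le> cl * (1 + norm v)" using N_ln[of v] by linarith
    qed
    finally have "f v - N v \<le> f v * ln (f v) + f v * (cl * (1 + norm v))" by simp
    moreover have "f v * (cl * (1 + norm v)) = cl * (f v * (1 + norm v))" by simp
    ultimately show ?thesis using f0[of v] by linarith
   qed
   then have "ennreal (- (f v * ln (f v))) \<le> ennreal (cl * (f v * (1 + norm v))) + ennreal (N v)"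
    by (rule ennreal_le_plusI) (use cl0 f0 N_pos[of v] in auto)
   also have "ennreal (cl * (f v * (1 + norm v))) = ennreal cl * ennreal (f v * (1 + norm v))" using cl0 f0 by (intro ennreal_mult) auto
   finally show "ennreal (- (f v * ln (f v))) \<le> ennreal cl * ennreal (f v * (1 + norm v)) + ennreal (N v)" .
  qed
  also have "... = ennreal cl * (LE v. f v * (1 + norm v)) + (LE v. N v)"
   by (subst nn_integral_add, measurable, subst nn_integral_cmult, measurable)
  also have "... \<le> ennreal cl * ennreal (3 / 2 + e) + 1"
   using N_dens velocity_density_moment[OF vd] e0 by (intro add_mono mult_left_mono) (auto simp: velocity_density_def)
  also have "... < \<infinity>" by (simp add: ennreal_mult_less_top)
  finally show ?thesis .
 qed
 have re: "rel_entropy e \<pi> = enn2ereal ?P - enn2ereal ?Q + ereal (real CARD('n) / 2 * (ln (4 * pi * e / real CARD('n)) + 1))"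
  unfolding rel_entropy_def Let_def using ac by (simp add: f_def)
 have P: "?P < \<infinity>"
 proof (rule ccontr)
  assume "\<not> ?P < \<infinity>"
  then have P: "?P = top" by (simp add: less_top[symmetric])
  obtain q where q: "?Q = ennreal q" "0 \<le> q" using Q by (cases ?Q) auto
  show False using H unfolding re P q(1) using q(2) by (simp add: enn2ereal_ennreal)
 qed
 show thesis by (rule that[OF vd d mf P Q re])
qed

lemma static_weightD:
 assumes f: "velocity_density e f" and R: "1 \<le> R0" and st: "static_weight R0 K f W"
 shows "W \<in> borel_funs" "0 \<le> W x" "W x \<le> K * grate x" "exchangeable (\<lambda>x. evw R0 x * Sin f x + W x)"
  "(CE x. (evw R0 x * Sin f x + W x) * Lw x) \<le> ennreal K" "transports f N (\<lambda>x. evw R0 x * Sin f x + W x)"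
proof -
 have [measurable]: "f \<in> borel_funs" and f0: "\<And>v. 0 \<le> f v" using f by (auto simp: velocity_density_def)
 note c1 = st[unfolded static_weight_def, THEN conjunct1] and r1 = st[unfolded static_weight_def, THEN conjunct2]
 note c2 = r1[THEN conjunct1] and r2 = r1[THEN conjunct2]
 note c3 = r2[THEN conjunct1] and r3 = r2[THEN conjunct2]
 note c4 = r3[THEN conjunct1] and r4 = r3[THEN conjunct2]
 note c5 = r4[THEN conjunct1] and c6 = r4[THEN conjunct2]
 show Wm[measurable]: "W \<in> borel_funs" by (rule c1)
 show "0 \<le> W x" by (rule c2[rule_format])
 show "W x \<le> K * grate x" by (rule c3[rule_format])
 show "(CE x. (evw R0 x * Sin f x + W x) * Lw x) \<le> ennreal K" by (rule c5)
 have m: "(\<lambda>x. evw R0 x * Sin f x + W x) \<in> borel_funs" by measurable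
 have n: "\<forall>x. 0 \<le> evw R0 x * Sin f x + W x" using c2 f0 R by (simp add: Sin_nonneg)
 show "exchangeable (\<lambda>x. evw R0 x * Sin f x + W x)" unfolding exchangeable_def by (intro conjI m n c4)
 show "transports f N (\<lambda>x. evw R0 x * Sin f x + W x)" unfolding transports_def by (rule c6)
qed

text \<open>For the fixed e the coefficients a and b are functions of \<kappa> alone, and T appears
  only in 1 + |ln T| and as a linear factor. This is the origin of the local boundedness of the
  final constant in T.\<close>

theorem controlled_path:
 assumes \<sigma>: "sets \<sigma> = sets (restrict_space borel (sphere 0 1))" and s_eq: "s = distr \<sigma> borel (\<lambda>w. w)"
 shows "\<exists>C1\<ge>0. \<exists>a b. (\<forall>\<kappa>\<ge>0. 0 \<le> a \<kappa> \<and> 0 \<le> (b \<kappa> :: real)) \<and> (\<forall>T>0. \<forall>\<kappa>\<ge>C1. \<forall>f1 f2. velocity_density e f1 \<and> velocity_density e f2 \<and>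
  (BI v. f1 v *\<^sub>R v) = 0 \<and> (BI v. f2 v *\<^sub>R v) = 0 \<longrightarrow>
  (\<exists>\<pi> Q. (\<pi>, Q) \<in> balanced_pairs e T \<and> \<pi> 0 = density lborel (\<lambda>v. ennreal (f1 v)) \<and> \<pi> T = density lborel (\<lambda>v. ennreal (f2 v)) \<and> measure Q (space Q) = \<kappa> \<and>
   rate_function \<sigma> e T \<pi> Q + (LE v. - (f2 v * ln (f2 v))) \<le>
    ennreal (a \<kappa> * (1 + \<bar>ln T\<bar>) + b \<kappa> * T) + (LE v. f2 v * ln (f2 v))))"
proof -
 obtain R0 K where R: "1 \<le> R0" and K: "0 \<le> K" and st: "\<And>f. velocity_density e f \<Longrightarrow> \<exists>W. static_weight R0 K f W"
  using static_transport by blast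
 obtain C where C: "0 \<le> C" and evC: "\<And>R x. 1 \<le> R \<Longrightarrow> evw R x \<le> C / R * grate x" using evw_le_grate by blast
 have gr0: "0 \<le> grate x" for x :: "'n coll" by (simp add: grate_def)
 have ev: "evw R0 x \<le> C * grate x" for x
 proof -
  have "C / R0 \<le> C" using C R by (simp add: divide_le_eq mult_le_cancel_left1)
  then have "C / R0 * grate x \<le> C * grate x" using gr0 by (rule mult_right_mono)
  then show ?thesis using evC[OF R, of x] by linarith
 qed
 \<comment> \<open>Room for all four densities at once: C for \<open>evw\<close>, K for the static
   remainder and \<kappa> * (C * nb + K) for the waste, whose amount is at most \<kappa>; the 1
   meets the locale assumption on k.\<close>
 define k where "k \<kappa> = 1 + C + K + \<kappa> * (C * nb + K)" for \<kappa>
 define A where "A \<kappa> = \<bar>ln (2 * (8 * (k \<kappa> * nb) + 3 * k \<kappa>))\<bar> + 3 + 2 * cl" for \<kappa>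
 define a where "a \<kappa> = 12 * A \<kappa> * ((2 + \<kappa>) * K)" for \<kappa>
 define b where "b \<kappa> = measure s UNIV * (3 / 2 + e)\<^sup>2" for \<kappa> :: real
 have A3: "3 \<le> A \<kappa>" for \<kappa> using cl0 by (simp add: A_def)
 have main: "\<exists>\<pi> Q. (\<pi>, Q) \<in> balanced_pairs e T \<and> \<pi> 0 = density lborel (\<lambda>v. ennreal (f1 v)) \<and> \<pi> T = density lborel (\<lambda>v. ennreal (f2 v)) \<and> measure Q (space Q) = \<kappa> \<and>
   rate_function \<sigma> e T \<pi> Q + (LE v. - (f2 v * ln (f2 v))) \<le>
    ennreal (a \<kappa> * (1 + \<bar>ln T\<bar>) + b \<kappa> * T) + (LE v. f2 v * ln (f2 v))"
  if T: "0 < T" and \<kappa>: "2 * K \<le> \<kappa>" and f1: "velocity_density e f1" and f2: "velocity_density e f2"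
   and mean: "(BI v. f1 v *\<^sub>R v) = 0" "(BI v. f2 v *\<^sub>R v) = 0" for T \<kappa> f1 f2
 proof -
  have k0: "0 \<le> \<kappa>" using \<kappa> K by simp
  have [measurable]: "f1 \<in> borel_funs" "f2 \<in> borel_funs" and f0: "\<And>v. 0 \<le> f1 v" "\<And>v. 0 \<le> f2 v"
   using f1 f2 by (auto simp: velocity_density_def)
  have N0: "0 \<le> N v" for v using N_pos[of v] by simp
  from st[OF f1] obtain W1 where s1: "static_weight R0 K f1 W1" ..
  from st[OF f2] obtain W2 where s2: "static_weight R0 K f2 W2" ..
  from st[OF N_dens] obtain W0 where s0: "static_weight R0 K N W0" ..
  note W1 = static_weightD[OF f1 R s1] and W2 = static_weightD[OF f2 R s2] and W0 = static_weightD[OF N_dens R s0]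
  have [measurable]: "W1 \<in> borel_funs" "W2 \<in> borel_funs" "W0 \<in> borel_funs" by fact+
  define U1 where "U1 x = evw R0 x * Sin f1 x + W1 x" for x
  define V2 where "V2 x = evw R0 x * Sin f2 x + W2 x" for x
  define U0 where "U0 x = evw R0 x * Sin N x + W0 x" for x
  define U2 where "U2 x = V2 (prod.swap x)" for x
  have ex: "exchangeable U1" "exchangeable V2" "exchangeable U0" using W1(4) W2(4) W0(4) by (simp_all add: U1_def[abs_def] V2_def[abs_def] U0_def[abs_def])
  have tr: "transports f1 N U1" "transports f2 N V2" "transports N N U0" using W1(6) W2(6) W0(6) by (simp_all add: U1_def[abs_def] V2_def[abs_def] U0_def[abs_def])
  have exU2: "exchangeable U2" unfolding U2_def[abs_def] by (rule exchangeable_swap[OF ex(2)])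
  have Um[measurable]: "U1 \<in> borel_funs" "V2 \<in> borel_funs" "U0 \<in> borel_funs" "U2 \<in> borel_funs"
   using exchangeableD(3) ex exU2 by auto
  have trU2: "transports N f2 U2" unfolding U2_def[abs_def] by (rule transports_swap[OF tr(2) Um(2)])
  have U0n: "0 \<le> U1 x" "0 \<le> V2 x" "0 \<le> U0 x" "0 \<le> U2 x" for x using exchangeableD(4) ex exU2 by auto
  have LI: "(CE x. U1 x * Lw x) \<le> ennreal K" "(CE x. V2 x * Lw x) \<le> ennreal K" "(CE x. U0 x * Lw x) \<le> ennreal K"
   using W1(5) W2(5) W0(5) by (simp_all add: U1_def V2_def U0_def)
  have LI2: "(CE x. U2 x * Lw x) \<le> ennreal K"
  proof -
   have "(CE x. V2 (prod.swap x) * Lw (prod.swap x)) = (CE x. V2 x * Lw x)"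
    by (rule nn_integral_coll_measure_swap) measurable
   then show ?thesis using LI(2) by (simp add: U2_def Lw_swap)
  qed
  have mass: "integrable coll_measure U \<and> (BC x. U x) \<le> K \<and> 0 \<le> (BC x. U x)"
   if [measurable]: "U \<in> borel_funs" and "\<And>x. 0 \<le> U x" "(CE x. U x * Lw x) \<le> ennreal K" for U
  proof -
   have le: "(CE x. U x) \<le> ennreal K"
   proof (rule order_trans[OF nn_integral_mono that(3)])
    fix x
    have "U x * 1 \<le> U x * Lw x" by (intro mult_left_mono Lw_ge_1 that(2))
    then show "ennreal (U x) \<le> ennreal (U x * Lw x)" by (intro ennreal_leI) simp
   qed
   have m: "U \<in> borel_measurable coll_measure" by measurable
   show ?thesis using integral_of_nn_integral_le[OF m that(2) le K] that(2) by (simp add: integral_nonneg_AE)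
  qed
  note m1 = mass[OF Um(1) U0n(1) LI(1)] and m2 = mass[OF Um(4) U0n(4) LI2] and m0 = mass[OF Um(3) U0n(3) LI(3)]
  define \<mu>1 where "\<mu>1 = (BC x. U1 x)"
  define \<mu>2 where "\<mu>2 = (BC x. U2 x)"
  define \<mu>0 where "\<mu>0 = (BC x. U0 x)"
  \<comment> \<open>The first step alone collides every particle of N once, so a unit of waste has
    mass at least one. This bounds its amount by \<kappa>.\<close>
  have mu0: "1 \<le> \<mu>0"
  proof -
   have "(CI x. ennreal (evw R0 x * Sin N x) * 1) = (LI v. ennreal (N v) * (TI p. 1))"
    by (rule nn_integral_Sin) (use N0 R in auto)
   also have "... = 1" using N_dens tau.emeasure_space_1 by (simp add: velocity_density_def)
   finally have "1 = (CE x. evw R0 x * Sin N x)" by simp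
   also have "... \<le> (CE x. U0 x)" using W0(2) by (intro nn_integral_mono ennreal_leI) (simp add: U0_def)
   also have "... = ennreal \<mu>0" unfolding \<mu>0_def using m0 U0n by (intro nn_integral_eq_integral) auto
   finally have "ennreal 1 \<le> ennreal \<mu>0" by simp
   moreover have "0 \<le> \<mu>0" using m0 by (simp add: \<mu>0_def)
   ultimately show ?thesis by (simp only: ennreal_le_iff)
  qed
  \<comment> \<open>Solves \<mu>1 + \<mu>2 + 2 * \<theta> * \<mu>0 = \<kappa>: the same amount of
    waste is added to both transports. Since each of \<mu>1 and \<mu>2 is at most K, \<kappa> \<ge>
    2 * K makes it nonnegative.\<close>
  define \<theta> where "\<theta> = (\<kappa> - \<mu>1 - \<mu>2) / (2 * \<mu>0)"
  have mus: "\<mu>1 \<le> K" "\<mu>2 \<le> K" "0 \<le> \<mu>1" "0 \<le> \<mu>2" using m1 m2 by (simp_all add: \<mu>1_def \<mu>2_def)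
  have th0: "0 \<le> \<theta>" unfolding \<theta>_def using mus \<kappa> mu0 by simp
  have th1: "2 * \<theta> \<le> \<kappa>"
  proof -
   have "2 * \<theta> * \<mu>0 = \<kappa> - \<mu>1 - \<mu>2" using mu0 by (simp add: \<theta>_def)
   moreover have "2 * \<theta> * 1 \<le> 2 * \<theta> * \<mu>0" using th0 mu0 by (intro mult_left_mono) auto
   ultimately show ?thesis using mus by linarith
  qed
  define Y1 where "Y1 x = U1 x + \<theta> * U0 x" for x
  define Y2 where "Y2 x = U2 x + \<theta> * U0 x" for x
  have Ym[measurable]: "Y1 \<in> borel_funs" "Y2 \<in> borel_funs" unfolding Y1_def Y2_def by measurable
  have gsw: "grate (prod.swap x) = grate x" for x :: "'n coll" by (simp add: grate_def norm_minus_commute)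
  have U0g: "U0 x \<le> (C * nb + K) * grate x" for x
  proof -
   have "Sin N x \<le> nb" using N_le[of "fst (fst x)"] N_le[of "snd (fst x)"] by (simp add: Sin_def)
   then have "evw R0 x * Sin N x \<le> (C * grate x) * nb" using ev[of x] gr0 C N0 by (intro mult_mono) (auto simp: Sin_nonneg)
   then show ?thesis using W0(3)[of x] by (simp add: U0_def algebra_simps)
  qed
  have CK: "0 \<le> C * nb + K" using C K nb0 by simp
  have thU: "\<theta> * U0 x \<le> \<kappa> * (C * nb + K) * grate x" for x
  proof -
   have "\<theta> * U0 x \<le> \<kappa> * ((C * nb + K) * grate x)" using th0 th1 k0 U0g U0n by (intro mult_mono) auto
   then show ?thesis by (simp only: mult.assoc)
  qed
  have kg: "k \<kappa> * grate x = grate x + C * grate x + K * grate x + \<kappa> * (C * nb + K) * grate x" for x :: "'n coll" by (simp add: k_def distrib_right)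
  have g3: "0 \<le> C * grate x" "0 \<le> K * grate x" "0 \<le> \<kappa> * (C * nb + K) * grate x" for x :: "'n coll" using C K k0 CK gr0 by simp_all
  have evs[measurable]: "(\<lambda>x. evw R0 (prod.swap x)) \<in> borel_funs" by (rule measurable_compose[OF swap_measurable]) measurable
  have W2s[measurable]: "(\<lambda>x. W2 (prod.swap x)) \<in> borel_funs" by (rule measurable_compose[OF swap_measurable]) measurable
  interpret ct: controlled_transition s e T f1 f2 N Y1 Y2 nb cl "k \<kappa>" "evw R0" "\<lambda>x. evw R0 (prod.swap x)" "\<lambda>x. W1 x + \<theta> * U0 x" "\<lambda>x. W2 (prod.swap x) + \<theta> * U0 x"
  proof unfold_locales
   show "0 < T" "0 < e" "velocity_density e f1" "velocity_density e f2" "velocity_density e N" by (fact T, fact e0, fact f1, fact f2, fact N_dens)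
   show "(BI v. f1 v *\<^sub>R v) = 0" "(BI v. f2 v *\<^sub>R v) = 0" "(BI v. N v *\<^sub>R v) = 0" by (fact mean(1), fact mean(2), fact N_mean)
   show "exchangeable Y1" using exchangeable_combination[OF ex(1) ex(3) zero_le_one th0] by (simp add: Y1_def[abs_def])
   show "exchangeable Y2" using exchangeable_combination[OF exU2 ex(3) zero_le_one th0] by (simp add: Y2_def[abs_def])
   show "integrable coll_measure Y1" "integrable coll_measure Y2" unfolding Y1_def[abs_def] Y2_def[abs_def] using m1 m2 m0 by auto
   show "transports f1 N Y1" unfolding Y1_def[abs_def] using m1 m0 by (intro transports_add[OF tr(1) tr(3)]) auto
   show "transports N f2 Y2" unfolding Y2_def[abs_def] using m2 m0 by (intro transports_add[OF trU2 tr(3)]) auto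
   show "0 < N v" "N v \<le> nb" "- ln (N v) \<le> cl * (1 + ln (1 + norm v))" for v by (rule N_pos, rule N_le, rule N_ln)
   show "0 \<le> cl" by (rule cl0)
   show "1 \<le> k \<kappa>" unfolding k_def using C K k0 CK by simp
   show "evw R0 \<in> borel_funs" "(\<lambda>x. evw R0 (prod.swap x)) \<in> borel_funs" by measurable
   show "(\<lambda>x. W1 x + \<theta> * U0 x) \<in> borel_funs" "(\<lambda>x. W2 (prod.swap x) + \<theta> * U0 x) \<in> borel_funs" by measurable
   show "0 \<le> evw R0 x" "0 \<le> evw R0 (prod.swap x)" "0 \<le> W1 x + \<theta> * U0 x" "0 \<le> W2 (prod.swap x) + \<theta> * U0 x" for x
    using R W1(2)[of x] W2(2)[of "prod.swap x"] th0 U0n(3)[of x] by simp_all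
   show "evw R0 x \<le> k \<kappa> * grate x" "evw R0 (prod.swap x) \<le> k \<kappa> * grate x" for x
    using ev[of x] ev[of "prod.swap x"] g3[of x] gr0[of x] unfolding kg gsw by linarith+
   show "W1 x + \<theta> * U0 x \<le> k \<kappa> * grate x" "W2 (prod.swap x) + \<theta> * U0 x \<le> k \<kappa> * grate x" for x
    using W1(3)[of x] W2(3)[of "prod.swap x"] thU[of x] g3[of x] gr0[of x] unfolding kg gsw by linarith+
   show "Y1 x = evw R0 x * Sin f1 x + (W1 x + \<theta> * U0 x)" for x by (simp add: Y1_def U1_def)
   show "Y2 x = evw R0 (prod.swap x) * Sout f2 x + (W2 (prod.swap x) + \<theta> * U0 x)" for x by (simp add: Y2_def U2_def V2_def Sin_swap)
   fix g :: "real ^ 'n \<Rightarrow> real" assume gm[measurable]: "g \<in> borel_funs" and g: "\<And>v. 0 \<le> g v"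
   have "(CE x. evw R0 (prod.swap x) * Sin g (prod.swap x)) = (CI x. ennreal (evw R0 x * Sin g x) * 1)"
    using nn_integral_coll_measure_swap[of "\<lambda>x. ennreal (evw R0 x * Sin g x)"] by simp
   also have "... = (LI v. ennreal (g v) * (TI p. 1))" by (rule nn_integral_Sin) (use g R in auto)
   finally show "(CE x. evw R0 (prod.swap x) * Sout g x) = (LE v. g v)"
    using tau.emeasure_space_1 by (simp add: Sin_swap)
  qed
  have YL: "(CE x. (Y1 x + Y2 x) * Lw x) \<le> ennreal ((2 + \<kappa>) * K)"
  proof -
   have "(CE x. (Y1 x + Y2 x) * Lw x) = (CI x. (ennreal (U1 x * Lw x) + ennreal (U2 x * Lw x)) + ennreal (2 * \<theta>) * ennreal (U0 x * Lw x))"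
   proof (rule nn_integral_cong)
    fix x :: "'n coll"
    have L0: "0 \<le> Lw x" using Lw_ge_1[of x] by linarith
    have n: "0 \<le> U1 x * Lw x" "0 \<le> U2 x * Lw x" "0 \<le> U0 x * Lw x" "0 \<le> (2 * \<theta>) * (U0 x * Lw x)" using U0n L0 th0 by simp_all
    have "(Y1 x + Y2 x) * Lw x = (U1 x * Lw x + U2 x * Lw x) + (2 * \<theta>) * (U0 x * Lw x)" by (simp add: Y1_def Y2_def algebra_simps)
    then have "ennreal ((Y1 x + Y2 x) * Lw x) = (ennreal (U1 x * Lw x) + ennreal (U2 x * Lw x)) + ennreal ((2 * \<theta>) * (U0 x * Lw x))"
     using n by (simp only: ennreal_plus add_nonneg_nonneg)
    also have "ennreal ((2 * \<theta>) * (U0 x * Lw x)) = ennreal (2 * \<theta>) * ennreal (U0 x * Lw x)" using n th0 by (intro ennreal_mult) auto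
    finally show "ennreal ((Y1 x + Y2 x) * Lw x) = (ennreal (U1 x * Lw x) + ennreal (U2 x * Lw x)) + ennreal (2 * \<theta>) * ennreal (U0 x * Lw x)" .
   qed
   also have "... = ((CE x. U1 x * Lw x) + (CE x. U2 x * Lw x)) + ennreal (2 * \<theta>) * (CE x. U0 x * Lw x)"
    by (simp add: nn_integral_add nn_integral_cmult)
   also have "... \<le> (ennreal K + ennreal K) + ennreal \<kappa> * ennreal K"
    using th1 by (intro add_mono mult_mono LI LI2 ennreal_leI) auto
   also have "... = ennreal ((K + K) + \<kappa> * K)" using K k0 by (simp only: ennreal_plus ennreal_mult add_nonneg_nonneg mult_nonneg_nonneg)
   also have "(K + K) + \<kappa> * K = (2 + \<kappa>) * K" by (simp add: algebra_simps)
   finally show ?thesis .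
  qed
  have cost: "rate_function \<sigma> e T ct.path ct.flow + (LE v. - (f2 v * ln (f2 v))) \<le> ennreal (12 * (ct.A + \<bar>ln T\<bar>) * ((2 + \<kappa>) * K) + T * ct.kS) + (LE v. f2 v * ln (f2 v))"
   by (rule ct.rate_function_le[OF \<sigma> s_eq YL]) (use K k0 in simp)
  have "12 * (ct.A + \<bar>ln T\<bar>) * ((2 + \<kappa>) * K) + T * ct.kS \<le> a \<kappa> * (1 + \<bar>ln T\<bar>) + b \<kappa> * T"
  proof -
   have cA: "ct.A = A \<kappa>" by (simp add: ct.A_def A_def ct.D_def)
   have "A \<kappa> + \<bar>ln T\<bar> \<le> A \<kappa> * (1 + \<bar>ln T\<bar>)"
    using A3[of \<kappa>] mult_right_mono[of 1 "A \<kappa>" "\<bar>ln T\<bar>"] by (simp add: distrib_left)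
   then have h1: "12 * (A \<kappa> + \<bar>ln T\<bar>) * ((2 + \<kappa>) * K) \<le> 12 * (A \<kappa> * (1 + \<bar>ln T\<bar>)) * ((2 + \<kappa>) * K)"
    using K k0 by (intro mult_right_mono mult_left_mono) auto
   have h2: "12 * (A \<kappa> * (1 + \<bar>ln T\<bar>)) * ((2 + \<kappa>) * K) = a \<kappa> * (1 + \<bar>ln T\<bar>)" by (simp add: a_def)
   have h3: "T * ct.kS = b \<kappa> * T" by (simp add: ct.kS_def b_def)
   show ?thesis unfolding cA h3 using h1 unfolding h2 by (rule add_right_mono)
  qed
  then have cost': "rate_function \<sigma> e T ct.path ct.flow + (LE v. - (f2 v * ln (f2 v))) \<le> ennreal (a \<kappa> * (1 + \<bar>ln T\<bar>) + b \<kappa> * T) + (LE v. f2 v * ln (f2 v))"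
   by (intro order_trans[OF cost] add_right_mono ennreal_leI)
  have tot: "measure ct.flow (space ct.flow) = \<kappa>"
  proof -
   have Y0: "0 \<le> Y1 x" "0 \<le> Y2 x" for x unfolding Y1_def Y2_def using U0n th0 by simp_all
   have "(BC x. Y1 x) = \<mu>1 + \<theta> * \<mu>0" "(BC x. Y2 x) = \<mu>2 + \<theta> * \<mu>0"
    unfolding Y1_def Y2_def \<mu>1_def \<mu>2_def \<mu>0_def using m1 m2 m0 by simp_all
   then have "emeasure ct.flow (space ct.flow) = ennreal (\<mu>1 + \<theta> * \<mu>0) + ennreal (\<mu>2 + \<theta> * \<mu>0)"
    unfolding ct.flow_mass using ct.Yint Y0 by (simp add: nn_integral_eq_integral)
   also have "... = ennreal ((\<mu>1 + \<theta> * \<mu>0) + (\<mu>2 + \<theta> * \<mu>0))" using mus th0 mu0 by (intro ennreal_plus[symmetric]) auto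
   also have "(\<mu>1 + \<theta> * \<mu>0) + (\<mu>2 + \<theta> * \<mu>0) = \<kappa>" using mu0 by (simp add: \<theta>_def field_simps)
   finally show ?thesis using k0 by (simp add: measure_def)
  qed
  have "ct.path 0 = density lborel (\<lambda>v. ennreal (f1 v))" "ct.path T = density lborel (\<lambda>v. ennreal (f2 v))"
   by (simp_all add: ct.path_def ct.interp_ends)
  then show ?thesis using ct.path_flow_balanced tot cost' by (intro exI[of _ ct.path] exI[of _ ct.flow] conjI)
 qed
 show ?thesis
 proof (rule exI[of _ "2 * K"], rule conjI, rule mult_nonneg_nonneg[OF zero_le_numeral K], rule exI[of _ a], rule exI[of _ b], intro conjI allI impI)
  show "0 \<le> a \<kappa>" "0 \<le> b \<kappa>" if "0 \<le> \<kappa>" for \<kappa> using that A3[of \<kappa>] K by (simp_all add: a_def b_def)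
 qed (rule main; blast)
qed

end

lemma sphere_haar_haar_sphere:
 fixes \<sigma> :: "(real ^ 'n::finite) measure"
 assumes card: "2 \<le> CARD('n)" and \<sigma>: "sphere_haar \<sigma>"
 shows "haar_sphere (distr \<sigma> borel (\<lambda>w. w))"
proof -
 have sets: "sets \<sigma> = sets (restrict_space borel (sphere 0 1))" and fin: "finite_measure \<sigma>" and nz: "emeasure \<sigma> (space \<sigma>) \<noteq> 0"
  and rot: "\<And>A :: real ^ 'n ^ 'n. rotation_matrix A \<Longrightarrow> distr \<sigma> \<sigma> (\<lambda>w. A *v w) = \<sigma>"
  using \<sigma> by (auto simp: sphere_haar_def)
 interpret finite_measure \<sigma> by (rule fin)
 have sp: "space \<sigma> = sphere 0 1" using sets_eq_imp_space_eq[OF sets] by (simp add: space_restrict_space)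
 have id: "(\<lambda>w. w) \<in> measurable \<sigma> borel" unfolding measurable_cong_sets[OF sets refl] by (rule measurable_restrict_space1) simp
 have mass: "emeasure (distr \<sigma> borel (\<lambda>w. w)) UNIV = emeasure \<sigma> (space \<sigma>)" by (subst emeasure_distr[OF id]) auto
 show ?thesis
 proof (rule haar_sphere.intro)
  show "2 \<le> CARD('n)" by (rule card)
  show "emeasure (distr \<sigma> borel (\<lambda>w. w)) UNIV < \<infinity>" unfolding mass by (simp add: less_top[symmetric])
  show "emeasure (distr \<sigma> borel (\<lambda>w. w)) UNIV \<noteq> 0" unfolding mass by (rule nz)
  show "AE w in distr \<sigma> borel (\<lambda>w. w). norm w = 1"
   by (subst AE_distr_iff[OF id]) (auto simp: sp)
  fix A :: "real ^ 'n ^ 'n" assume A: "rotation_matrix A"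
  have mA: "(\<lambda>w. A *v w) \<in> measurable borel borel" by (intro borel_measurable_continuous_onI linear_continuous_on) (simp add: matrix_vector_mul_bounded_linear)
  have orth: "orthogonal_matrix A" using A by (simp add: rotation_matrix_def)
  have mS: "(\<lambda>w. A *v w) \<in> measurable \<sigma> \<sigma>"
   unfolding measurable_cong_sets[OF sets sets]
  proof (rule measurable_restrict_space3[OF mA])
   show "(\<lambda>w. A *v w) \<in> sphere 0 1 \<rightarrow> sphere 0 1"
    using orth orthogonal_transformation_matrix[of "\<lambda>w. A *v w"] by (auto simp: orthogonal_transformation)
  qed
  have "distr (distr \<sigma> borel (\<lambda>w. w)) borel (\<lambda>w. A *v w) = distr \<sigma> borel ((\<lambda>w. A *v w) \<circ> (\<lambda>w. w))" by (rule distr_distr[OF mA id])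
  also have "... = distr \<sigma> borel ((\<lambda>w. w) \<circ> (\<lambda>w. A *v w))" by (simp add: o_def)
  also have "... = distr (distr \<sigma> \<sigma> (\<lambda>w. A *v w)) borel (\<lambda>w. w)" by (rule distr_distr[OF id mS, symmetric])
  finally show "distr (distr \<sigma> borel (\<lambda>w. w)) borel (\<lambda>w. A *v w) = distr \<sigma> borel (\<lambda>w. w)" by (simp only: rot[OF A])
 qed simp
qed

theorem theorem4p1:
 fixes \<sigma> :: "(real ^ 'n::finite) measure"
 assumes "CARD('n) \<ge> 2" and "sphere_haar \<sigma>"
 shows "\<exists>(C\<^sub>1 :: real \<Rightarrow> real) (F\<^sub>1 :: real \<Rightarrow> real \<Rightarrow> real \<Rightarrow> real).
  (\<forall>e\<ge>0. \<forall>T\<ge>0. \<forall>\<kappa>\<ge>0. F\<^sub>1 e T \<kappa> \<ge> 0) \<and>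
  (\<forall>e>0. \<forall>T>0. \<forall>\<pi>\<^sub>1 \<in> vel_distributions e. \<forall>\<pi>\<^sub>2 \<in> vel_distributions e. \<forall>\<kappa> \<ge> C\<^sub>1 e.
   rel_entropy e \<pi>\<^sub>1 < \<infinity> \<and> rel_entropy e \<pi>\<^sub>2 < \<infinity> \<longrightarrow>
   (\<exists>(\<pi> :: real \<Rightarrow> (real ^ 'n) measure, Q) \<in> balanced_pairs e T.
     \<pi> 0 = \<pi>\<^sub>1 \<and> \<pi> T = \<pi>\<^sub>2 \<and>
     enn2ereal (rate_function \<sigma> e T \<pi> Q) \<le> ereal (F\<^sub>1 e T \<kappa>) + rel_entropy e \<pi>\<^sub>2 \<and>
     measure Q (space Q) = \<kappa>)) \<and>
  (\<forall>e\<ge>0. \<forall>\<kappa>\<ge>0. \<forall>T\<^sub>0 T\<^sub>1. 0 < T\<^sub>0 \<and> T\<^sub>0 < T\<^sub>1 \<longrightarrow>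
   bdd_above ((\<lambda>T. F\<^sub>1 e T \<kappa>) ` {T\<^sub>0..T\<^sub>1}))"
proof -
 have \<sigma>: "sets \<sigma> = sets (restrict_space borel (sphere 0 1))" using assms(2) by (simp add: sphere_haar_def)
 define s where "s = distr \<sigma> borel (\<lambda>w. w)"
 interpret haar_sphere s unfolding s_def by (rule sphere_haar_haar_sphere[OF assms])
 \<comment> \<open>The constant by which \<open>rel_entropy\<close> exceeds the integral of f ln f;
   it is subtracted from the bound in order to express it by the relative entropy.\<close>
 define c where "c e = real CARD('n) / 2 * (ln (4 * pi * e / real CARD('n)) + 1)" for e
 \<comment> \<open>Everything to be selected for one value of e. The constants exist for each e > 0
   separately and become functions of e by choice.\<close>
 define good where "good e C1 a b \<longleftrightarrow> 0 \<le> C1 \<and> (\<forall>\<kappa>\<ge>0. 0 \<le> a \<kappa> \<and> 0 \<le> b \<kappa>) \<and>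
  (\<forall>T>0. \<forall>\<kappa>\<ge>C1. \<forall>\<pi>1 \<in> vel_distributions e. \<forall>\<pi>2 \<in> vel_distributions e. rel_entropy e \<pi>1 < \<infinity> \<longrightarrow> rel_entropy e \<pi>2 < \<infinity> \<longrightarrow>
   (\<exists>(\<pi> :: real \<Rightarrow> (real ^ 'n) measure) Q. (\<pi>, Q) \<in> balanced_pairs e T \<and> \<pi> 0 = \<pi>1 \<and> \<pi> T = \<pi>2 \<and> measure Q (space Q) = \<kappa> \<and>
    enn2ereal (rate_function \<sigma> e T \<pi> Q) \<le> ereal (a \<kappa> * (1 + \<bar>ln T\<bar>) + b \<kappa> * T - c e) + rel_entropy e \<pi>2))"
  for e C1 :: real and a b :: "real \<Rightarrow> real"
 have "\<exists>C1 a b. good e C1 a b" if e: "0 < e" for e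
 proof -
  obtain N :: "real ^ 'n \<Rightarrow> real" and nb cl where N: "velocity_density e N" "\<And>v. 0 < N v" "\<And>v. N v \<le> nb" "\<And>v. N (- v) = N v"
   "0 \<le> cl" "\<And>v. - ln (N v) \<le> cl * (1 + ln (1 + norm v))" using power_law_density[OF e] by blast
  interpret catalyst s e nb cl N by unfold_locales (use e N in auto)
  obtain C1 a b where C1: "0 \<le> C1" and ab: "\<forall>\<kappa>\<ge>0. 0 \<le> a \<kappa> \<and> 0 \<le> (b \<kappa> :: real)" and cp: "\<forall>T>0. \<forall>\<kappa>\<ge>C1. \<forall>f1 f2. velocity_density e f1 \<and> velocity_density e f2 \<and>
  (BI v. f1 v *\<^sub>R v) = 0 \<and> (BI v. f2 v *\<^sub>R v) = 0 \<longrightarrow>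
  (\<exists>\<pi> Q. (\<pi>, Q) \<in> balanced_pairs e T \<and> \<pi> 0 = density lborel (\<lambda>v. ennreal (f1 v)) \<and> \<pi> T = density lborel (\<lambda>v. ennreal (f2 v)) \<and> measure Q (space Q) = \<kappa> \<and>
   rate_function \<sigma> e T \<pi> Q + (LE v. - (f2 v * ln (f2 v))) \<le>
    ennreal (a \<kappa> * (1 + \<bar>ln T\<bar>) + b \<kappa> * T) + (LE v. f2 v * ln (f2 v)))"
   using controlled_path[OF \<sigma> s_def] by (elim exE conjE) (rule that)
  have "good e C1 a b"
   unfolding good_def
  proof (intro conjI C1 ab allI impI ballI)
   fix T \<kappa> :: real and \<pi>1 \<pi>2 :: "(real ^ 'n) measure"
   assume T: "0 < T" and \<kappa>: "C1 \<le> \<kappa>" and p1: "\<pi>1 \<in> vel_distributions e" "rel_entropy e \<pi>1 < \<infinity>" and p2: "\<pi>2 \<in> vel_distributions e" "rel_entropy e \<pi>2 < \<infinity>"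
   obtain f1 where f1: "velocity_density e f1" "density lborel (\<lambda>v. ennreal (f1 v)) = \<pi>1" "(BI v. f1 v *\<^sub>R v) = 0"
    by (rule finite_entropy_density[OF p1]) (rule that; assumption)
   obtain f2 where f2: "velocity_density e f2" "density lborel (\<lambda>v. ennreal (f2 v)) = \<pi>2" "(BI v. f2 v *\<^sub>R v) = 0"
    and Pf: "(LE v. f2 v * ln (f2 v)) < \<infinity>" and Qf: "(LE v. - (f2 v * ln (f2 v))) < \<infinity>"
    and re: "rel_entropy e \<pi>2 = enn2ereal (LE v. f2 v * ln (f2 v)) - enn2ereal (LE v. - (f2 v * ln (f2 v)))
     + ereal (real CARD('n) / 2 * (ln (4 * pi * e / real CARD('n)) + 1))"
    by (rule finite_entropy_density[OF p2]) (rule that; assumption)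
   from cp[rule_format, OF T \<kappa>, of f1 f2] f1 f2 obtain \<pi> Q where pq: "(\<pi>, Q) \<in> balanced_pairs e T" "\<pi> 0 = \<pi>1" "\<pi> T = \<pi>2" "measure Q (space Q) = \<kappa>"
    and le: "rate_function \<sigma> e T \<pi> Q + (LE v. - (f2 v * ln (f2 v))) \<le>
    ennreal (a \<kappa> * (1 + \<bar>ln T\<bar>) + b \<kappa> * T) + (LE v. f2 v * ln (f2 v))" by auto
   define B where "B = a \<kappa> * (1 + \<bar>ln T\<bar>) + b \<kappa> * T"
   have B0: "0 \<le> B" unfolding B_def using ab \<kappa> C1 T by simp
   obtain x where x: "(LE v. f2 v * ln (f2 v)) = ennreal x" "0 \<le> x" using Pf by (cases "(LE v. f2 v * ln (f2 v))") auto
   obtain y where y: "(LE v. - (f2 v * ln (f2 v))) = ennreal y" "0 \<le> y" using Qf by (cases "(LE v. - (f2 v * ln (f2 v)))") auto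
   have le': "rate_function \<sigma> e T \<pi> Q + ennreal y \<le> ennreal (B + x)" using le B0 x y by (simp add: B_def)
   have "rate_function \<sigma> e T \<pi> Q \<le> rate_function \<sigma> e T \<pi> Q + ennreal y" by simp
   also have "... < top" using le' by (rule le_less_trans) simp
   finally obtain r where r: "rate_function \<sigma> e T \<pi> Q = ennreal r" "0 \<le> r" by (cases "rate_function \<sigma> e T \<pi> Q") auto
   \<comment> \<open>All terms are finite by now, so the inequality descends to the reals, where the
     negative part can be moved to the right.\<close>
   have "r + y \<le> B + x" using le' r y B0 x by (simp flip: ennreal_plus)
   then have "enn2ereal (rate_function \<sigma> e T \<pi> Q) \<le> ereal (B - c e) + rel_entropy e \<pi>2"
    unfolding re x y r c_def using r(2) x(2) y(2) by (simp add: enn2ereal_ennreal)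
   then show "\<exists>\<pi> Q. (\<pi>, Q) \<in> balanced_pairs e T \<and> \<pi> 0 = \<pi>1 \<and> \<pi> T = \<pi>2 \<and> measure Q (space Q) = \<kappa> \<and>
    enn2ereal (rate_function \<sigma> e T \<pi> Q) \<le> ereal (a \<kappa> * (1 + \<bar>ln T\<bar>) + b \<kappa> * T - c e) + rel_entropy e \<pi>2"
    using pq unfolding B_def by blast
  qed
  then show ?thesis by blast
 qed
 then have "\<forall>e. \<exists>C1 a b. 0 < e \<longrightarrow> good e C1 a b" by blast
 then obtain C1 a b where g: "\<And>e. 0 < e \<Longrightarrow> good e (C1 e) (a e) (b e)" by metis
 \<comment> \<open>The maximum ensures nonnegativity, as c e can be large for large e. For e or
   \<kappa> outside the relevant range the value 0 is a default.\<close>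
 define F where "F e T \<kappa> = (if 0 < e \<and> 0 \<le> \<kappa> then max 0 (a e \<kappa> * (1 + \<bar>ln T\<bar>) + b e \<kappa> * T - c e) else 0)" for e T \<kappa>
 show ?thesis
 proof (rule exI[of _ C1], rule exI[of _ F], intro conjI allI impI ballI)
  show "0 \<le> F e T \<kappa>" for e T \<kappa> by (simp add: F_def)
 next
  fix e T \<kappa> :: real and \<pi>1 \<pi>2 :: "(real ^ 'n) measure"
  assume e: "0 < e" and T: "0 < T" and p: "\<pi>1 \<in> vel_distributions e" "\<pi>2 \<in> vel_distributions e" and \<kappa>: "C1 e \<le> \<kappa>"
   and H: "rel_entropy e \<pi>1 < \<infinity> \<and> rel_entropy e \<pi>2 < \<infinity>"
  have gg: "0 \<le> C1 e" using g[OF e] by (simp add: good_def)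
  obtain \<pi> Q where pq: "(\<pi>, Q) \<in> balanced_pairs e T" "\<pi> 0 = \<pi>1" "\<pi> T = \<pi>2" "measure Q (space Q) = \<kappa>"
   "enn2ereal (rate_function \<sigma> e T \<pi> Q) \<le> ereal (a e \<kappa> * (1 + \<bar>ln T\<bar>) + b e \<kappa> * T - c e) + rel_entropy e \<pi>2"
   using g[OF e] T \<kappa> p H unfolding good_def by blast
  have "ereal (a e \<kappa> * (1 + \<bar>ln T\<bar>) + b e \<kappa> * T - c e) \<le> ereal (F e T \<kappa>)" using e gg \<kappa> by (simp add: F_def)
  then have "enn2ereal (rate_function \<sigma> e T \<pi> Q) \<le> ereal (F e T \<kappa>) + rel_entropy e \<pi>2"
   using pq(5) by (meson add_right_mono order_trans)
  then show "\<exists>(\<pi>, Q) \<in> balanced_pairs e T. \<pi> 0 = \<pi>1 \<and> \<pi> T = \<pi>2 \<and> enn2ereal (rate_function \<sigma> e T \<pi> Q) \<le> ereal (F e T \<kappa>) + rel_entropy e \<pi>2 \<and> measure Q (space Q) = \<kappa>"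
   using pq by (intro bexI[of _ "(\<pi>, Q)"]) auto
 next
  fix e \<kappa> T0 T1 :: real assume e: "0 \<le> e" and \<kappa>: "0 \<le> \<kappa>" and T: "0 < T0 \<and> T0 < T1"
  show "bdd_above ((\<lambda>T. F e T \<kappa>) ` {T0..T1})"
  proof (cases "0 < e")
   case True
   have ab: "0 \<le> a e \<kappa>" "0 \<le> b e \<kappa>" using g[OF True] \<kappa> by (auto simp: good_def)
   show ?thesis
   proof (rule bdd_aboveI2)
    fix t assume t: "t \<in> {T0..T1}"
    have "ln T0 \<le> ln t" "ln t \<le> ln T1" using t T by (auto simp: ln_mono)
    then have "\<bar>ln t\<bar> \<le> \<bar>ln T0\<bar> + \<bar>ln T1\<bar>" by linarith
    then have "a e \<kappa> * (1 + \<bar>ln t\<bar>) \<le> a e \<kappa> * (1 + (\<bar>ln T0\<bar> + \<bar>ln T1\<bar>))" using ab by (intro mult_left_mono) auto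
    moreover have "b e \<kappa> * t \<le> b e \<kappa> * T1" using ab t by (intro mult_left_mono) auto
    ultimately show "F e t \<kappa> \<le> max 0 (a e \<kappa> * (1 + (\<bar>ln T0\<bar> + \<bar>ln T1\<bar>)) + b e \<kappa> * T1 - c e)"
     by (auto simp: F_def)
   qed
  qed (auto simp: F_def intro!: bdd_aboveI2[of _ _ 0])
 qed
qed

end
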